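(* Let $\mathcal{A}$ be a locally finite connected cochain DG algebra over a field $k$, with $\mathfrak{m}=\mathcal{A}^{\ge 1}$, and let $M$ be a compact (left) DG $\mathcal{A}$-module. Then $$R\Gamma_{\mathfrak{m}}(M)'\;\cong\; R\mathrm{Hom}_{\mathcal{A}}\big(M,\,R\Gamma_{\mathfrak{m}}(\mathcal{A})'\big)$$ in $\mathscr{D}(\mathcal{A}^{op})$.
   Context: $k$ is the base field. A connected cochain DG algebra is a DG $k$-algebra $\mathcal{A}=\bigoplus_{i\ge 0}\mathcal{A}^i$ with $\mathcal{A}^0=k$ and differential of degree $+1$; it is locally finite if $\dim_k\mathcal{A}^i<\infty$ for all $i$. $\mathcal{A}^{op}$ is the opposite DG algebra and $\mathcal{A}^e=\mathcal{A}\otimes\mathcal{A}^{op}$ the enveloping one. $\mathscr{D}(\mathcal{B})$ is the derived category of left DG $\mathcal{B}$-modules. A DG module is compact if $\mathrm{Hom}_{\mathscr{D}(\mathcal{A})}(M,-)$ commutes with arbitrary direct sums (equivalently, $M$ has a semi-free resolution with a finite semi-basis). Torsion functor: $\Gamma_{\mathfrak{m}}(M)=\{m\in M\mid \mathcal{A}^{\ge n}m=0\text{ for some }n\ge1\}=\varinjlim_{n\ge1}\mathrm{Hom}_{\mathcal{A}}(\mathcal{A}/\mathcal{A}^{\ge n},M)$, a DG submodule of $M$. $R\Gamma_{\mathfrak{m}}$ is its right derived functor, i.e. $R\Gamma_{\mathfrak{m}}(M)=\Gamma_{\mathfrak{m}}(I)$ for a semi-injective resolution $M\to I$. $R\Gamma_{\mathfrak{m}}(\mathcal{A})$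 is regarded as an object of $\mathscr{D}(\mathcal{A}^e)$ by using a semi-injective resolution $I$ of $\mathcal{A}$ over $\mathcal{A}^e$ (which is semi-injective also over $\mathcal{A}$) and applying the left torsion functor $\Gamma_{\mathfrak{m}}$. Matlis dual: for a graded $k$-space $V$, $V'=\bigoplus_{i\in\mathbb{Z}}\mathrm{Hom}_k(V^i,k)$, with $(V')^{-i}=\mathrm{Hom}_k(V^i,k)$. The dual of a left DG module is a right DG module, and the dual of a DG bimodule is a DG bimodule. *)

theory Defs
  imports Complex_Main "HOL-Library.Function_Algebras"
begin

text \<open>
  A graded vector space \<open>V\<close> is a family \<open>V i\<close> (\<open>i :: int\<close>) of subspaces of one type that carries a
  vector space structure.  The family is read as an external direct sum: the \<open>V i\<close> may overlap, so
  every operation takes the degrees of its homogeneous arguments.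
\<close>

definition ksign :: "int \<Rightarrow> 'm::ab_group_add \<Rightarrow> 'm" where
  "ksign n x = (if even n then x else - x)"

definition k_linear ::
  "('k \<Rightarrow> 'm \<Rightarrow> 'm) \<Rightarrow> 'm set \<Rightarrow> ('k \<Rightarrow> 'n \<Rightarrow> 'n) \<Rightarrow> 'n set \<Rightarrow> ('m::ab_group_add \<Rightarrow> 'n::ab_group_add) \<Rightarrow> bool"
where
  "k_linear s V t W f \<longleftrightarrow>
     (\<forall>x\<in>V. f x \<in> W) \<and> (\<forall>x\<in>V. \<forall>y\<in>V. f (x + y) = f x + f y) \<and> (\<forall>c. \<forall>x\<in>V. f (s c x) = t c (f x))"

record ('k, 'a) dg_alg =
  ascale :: "'k \<Rightarrow> 'a \<Rightarrow> 'a"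
  agrade :: "int \<Rightarrow> 'a set"
  adiff :: "int \<Rightarrow> 'a \<Rightarrow> 'a"
  amult :: "int \<Rightarrow> int \<Rightarrow> 'a \<Rightarrow> 'a \<Rightarrow> 'a"
  aunit :: "'a"

definition dg_algebra :: "('k::field, 'a::ab_group_add) dg_alg \<Rightarrow> bool" where
  "dg_algebra A \<longleftrightarrow>
     vector_space (ascale A) \<and>
     (\<forall>i. module.subspace (ascale A) (agrade A i)) \<and>
     (\<forall>i. k_linear (ascale A) (agrade A i) (ascale A) (agrade A (i + 1)) (adiff A i)) \<and>
     (\<forall>i. \<forall>a\<in>agrade A i. adiff A (i + 1) (adiff A i a) = 0) \<and>
     (\<forall>i j. \<forall>a\<in>agrade A i.
        k_linear (ascale A) (agrade A j) (ascale A) (agrade A (i + j)) (amult A i j a)) \<and>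
     (\<forall>i j. \<forall>b\<in>agrade A j.
        k_linear (ascale A) (agrade A i) (ascale A) (agrade A (i + j)) (\<lambda>a. amult A i j a b)) \<and>
     (\<forall>i j l. \<forall>a\<in>agrade A i. \<forall>b\<in>agrade A j. \<forall>c\<in>agrade A l.
        amult A (i + j) l (amult A i j a b) c = amult A i (j + l) a (amult A j l b c)) \<and>
     aunit A \<in> agrade A 0 \<and>
     (\<forall>i. \<forall>a\<in>agrade A i. amult A 0 i (aunit A) a = a \<and> amult A i 0 a (aunit A) = a) \<and>
     (\<forall>i j. \<forall>a\<in>agrade A i. \<forall>b\<in>agrade A j.
        adiff A (i + j) (amult A i j a b) =
          amult A (i + 1) j (adiff A i a) b + ksign i (amult A i (j + 1) a (adiff A j b)))"

definition connected_cochain :: "('k::field, 'a::ab_group_add) dg_alg \<Rightarrow> bool" where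
  "connected_cochain A \<longleftrightarrow>
     (\<forall>i<0. agrade A i = {0}) \<and> agrade A 0 = range (\<lambda>c. ascale A c (aunit A)) \<and> aunit A \<noteq> 0"

definition locally_finite :: "('k::field, 'a::ab_group_add) dg_alg \<Rightarrow> bool" where
  "locally_finite A \<longleftrightarrow>
     (\<forall>i. \<exists>B. finite B \<and> B \<subseteq> agrade A i \<and> module.span (ascale A) B = agrade A i)"

definition op_alg :: "('k, 'a::ab_group_add) dg_alg \<Rightarrow> ('k, 'a) dg_alg" where
  "op_alg A = A\<lparr>amult := \<lambda>i j a b. ksign (i * j) (amult A j i b a)\<rparr>"


text \<open>
  One record serves for left modules, right modules and bimodules.  A notion of left modules ignores
  the field \<open>ract\<close>.  Here \<open>lact M p i a m\<close> is \<open>a m\<close> and \<open>ract M i p m a\<close> is \<open>m a\<close>, for \<open>a\<close> of degree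
  \<open>p\<close> and \<open>m\<close> of degree \<open>i\<close>.
\<close>

record ('k, 'a, 'm) dg_mod =
  mscale :: "'k \<Rightarrow> 'm \<Rightarrow> 'm"
  mgrade :: "int \<Rightarrow> 'm set"
  mdiff :: "int \<Rightarrow> 'm \<Rightarrow> 'm"
  lact :: "int \<Rightarrow> int \<Rightarrow> 'a \<Rightarrow> 'm \<Rightarrow> 'm"
  ract :: "int \<Rightarrow> int \<Rightarrow> 'm \<Rightarrow> 'a \<Rightarrow> 'm"

definition left_dg_module ::
  "('k::field, 'a::ab_group_add) dg_alg \<Rightarrow> ('k, 'a, 'm::ab_group_add) dg_mod \<Rightarrow> bool"
where
  "left_dg_module A M \<longleftrightarrow>
     vector_space (mscale M) \<and>
     (\<forall>i. module.subspace (mscale M) (mgrade M i)) \<and>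
     (\<forall>i. k_linear (mscale M) (mgrade M i) (mscale M) (mgrade M (i + 1)) (mdiff M i)) \<and>
     (\<forall>i. \<forall>m\<in>mgrade M i. mdiff M (i + 1) (mdiff M i m) = 0) \<and>
     (\<forall>p i. \<forall>a\<in>agrade A p.
        k_linear (mscale M) (mgrade M i) (mscale M) (mgrade M (p + i)) (lact M p i a)) \<and>
     (\<forall>p i. \<forall>m\<in>mgrade M i.
        k_linear (ascale A) (agrade A p) (mscale M) (mgrade M (p + i)) (\<lambda>a. lact M p i a m)) \<and>
     (\<forall>p q i. \<forall>a\<in>agrade A p. \<forall>b\<in>agrade A q. \<forall>m\<in>mgrade M i.
        lact M (p + q) i (amult A p q a b) m = lact M p (q + i) a (lact M q i b m)) \<and>
     (\<forall>i. \<forall>m\<in>mgrade M i. lact M 0 i (aunit A) m = m) \<and>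
     (\<forall>p i. \<forall>a\<in>agrade A p. \<forall>m\<in>mgrade M i.
        mdiff M (p + i) (lact M p i a m) =
          lact M (p + 1) i (adiff A p a) m + ksign p (lact M p (i + 1) a (mdiff M i m)))"

text \<open>A right module becomes a left module over the opposite algebra by \<open>a \<cdot> m = (-1)^(|a||m|) m a\<close>.\<close>

definition op_left :: "('k, 'a, 'm::ab_group_add) dg_mod \<Rightarrow> ('k, 'a, 'm) dg_mod" where
  "op_left M = M\<lparr>lact := \<lambda>p i a m. ksign (p * i) (ract M i p m a)\<rparr>"

definition right_dg_module ::
  "('k::field, 'a::ab_group_add) dg_alg \<Rightarrow> ('k, 'a, 'm::ab_group_add) dg_mod \<Rightarrow> bool"
where
  "right_dg_module A M \<longleftrightarrow> left_dg_module (op_alg A) (op_left M)"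

text \<open>
  DG modules over the enveloping algebra \<open>A \<otimes> op_alg A\<close> are DG bimodules on which the ground field acts
  centrally (which follows here from \<open>k_linear\<close>), via \<open>(a \<otimes> b) m = (-1)^(|b||m|) a m b\<close>.
\<close>

definition dg_bimodule ::
  "('k::field, 'a::ab_group_add) dg_alg \<Rightarrow> ('k, 'a, 'm::ab_group_add) dg_mod \<Rightarrow> bool"
where
  "dg_bimodule A M \<longleftrightarrow>
     left_dg_module A M \<and> right_dg_module A M \<and>
     (\<forall>p q i. \<forall>a\<in>agrade A p. \<forall>b\<in>agrade A q. \<forall>m\<in>mgrade M i.
        ract M (p + i) q (lact M p i a m) b = lact M p (i + q) a (ract M i q m b))"

definition reg_bimodule :: "('k, 'a) dg_alg \<Rightarrow> ('k, 'a, 'a) dg_mod" where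
  "reg_bimodule A =
     \<lparr>mscale = ascale A, mgrade = agrade A, mdiff = adiff A, lact = amult A, ract = amult A\<rparr>"


definition cocycles :: "('k, 'a, 'm::ab_group_add) dg_mod \<Rightarrow> int \<Rightarrow> 'm set" where
  "cocycles M i = {x \<in> mgrade M i. mdiff M i x = 0}"

definition coboundaries :: "('k, 'a, 'm::ab_group_add) dg_mod \<Rightarrow> int \<Rightarrow> 'm set" where
  "coboundaries M i = mdiff M (i - 1) ` mgrade M (i - 1)"

text \<open>Surjectivity and injectivity in cohomology of a chain map.\<close>

definition cohomology_iso ::
  "('k, 'a, 'm::ab_group_add) dg_mod \<Rightarrow> ('k, 'b, 'n::ab_group_add) dg_mod \<Rightarrow> (int \<Rightarrow> 'm \<Rightarrow> 'n) \<Rightarrow> bool"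
where
  "cohomology_iso M N f \<longleftrightarrow>
     (\<forall>i. (\<forall>y\<in>cocycles N i. \<exists>x\<in>cocycles M i. y - f i x \<in> coboundaries N i) \<and>
          (\<forall>x\<in>cocycles M i. f i x \<in> coboundaries N i \<longrightarrow> x \<in> coboundaries M i))"

text \<open>Homogeneous maps of degree \<open>n\<close> with \<open>f(a m) = (-1)^(n|a|) a f(m)\<close>.\<close>

definition graded_hom ::
  "('k, 'a) dg_alg \<Rightarrow> int \<Rightarrow> ('k, 'a, 'm::ab_group_add) dg_mod \<Rightarrow> ('k, 'a, 'n::ab_group_add) dg_mod
     \<Rightarrow> (int \<Rightarrow> 'm \<Rightarrow> 'n) \<Rightarrow> bool"
where
  "graded_hom A n M N f \<longleftrightarrow>
     (\<forall>i. k_linear (mscale M) (mgrade M i) (mscale N) (mgrade N (i + n)) (f i)) \<and>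
     (\<forall>p i. \<forall>a\<in>agrade A p. \<forall>m\<in>mgrade M i.
        f (p + i) (lact M p i a m) = ksign (n * p) (lact N p (i + n) a (f i m)))"

definition dg_hom ::
  "('k, 'a) dg_alg \<Rightarrow> ('k, 'a, 'm::ab_group_add) dg_mod \<Rightarrow> ('k, 'a, 'n::ab_group_add) dg_mod
     \<Rightarrow> (int \<Rightarrow> 'm \<Rightarrow> 'n) \<Rightarrow> bool"
where
  "dg_hom A M N f \<longleftrightarrow>
     graded_hom A 0 M N f \<and> (\<forall>i. \<forall>m\<in>mgrade M i. f (i + 1) (mdiff M i m) = mdiff N i (f i m))"

definition quasi_iso ::
  "('k, 'a) dg_alg \<Rightarrow> ('k, 'a, 'm::ab_group_add) dg_mod \<Rightarrow> ('k, 'a, 'n::ab_group_add) dg_mod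
     \<Rightarrow> (int \<Rightarrow> 'm \<Rightarrow> 'n) \<Rightarrow> bool"
where
  "quasi_iso A M N f \<longleftrightarrow> dg_hom A M N f \<and> cohomology_iso M N f"

definition homotopic_homs ::
  "('k, 'a) dg_alg \<Rightarrow> ('k, 'a, 'm::ab_group_add) dg_mod \<Rightarrow> ('k, 'a, 'n::ab_group_add) dg_mod
     \<Rightarrow> (int \<Rightarrow> 'm \<Rightarrow> 'n) \<Rightarrow> (int \<Rightarrow> 'm \<Rightarrow> 'n) \<Rightarrow> bool"
where
  "homotopic_homs A M N f g \<longleftrightarrow>
     (\<exists>h. graded_hom A (-1) M N h \<and>
          (\<forall>i. \<forall>m\<in>mgrade M i. f i m - g i m = mdiff N (i - 1) (h i m) + h (i + 1) (mdiff M i m)))"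

text \<open>
  The complex \<open>Hom\<^sub>A(M, N)\<close>, with \<open>d f = d \<circ> f - (-1)^|f| f \<circ> d\<close>.  If \<open>N\<close> is a bimodule, this is a
  right \<open>A\<close>-module by \<open>(f a)(m) = (-1)^(|a||m|) f(m) a\<close>.  The left action is a dummy.  Maps vanish
  outside the components, so that equality of functions is equality of homomorphisms.
\<close>

definition hom_complex ::
  "('k, 'a) dg_alg \<Rightarrow> ('k, 'a, 'm::ab_group_add) dg_mod \<Rightarrow> ('k, 'a, 'n::ab_group_add) dg_mod
     \<Rightarrow> ('k, 'a, int \<Rightarrow> 'm \<Rightarrow> 'n) dg_mod"
where
  "hom_complex A M N =
     \<lparr>mscale = (\<lambda>c f i m. mscale N c (f i m)),
      mgrade = (\<lambda>n. {f. graded_hom A n M N f \<and> (\<forall>i m. m \<notin> mgrade M i \<longrightarrow> f i m = 0)}),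
      mdiff = (\<lambda>n f i m. if m \<in> mgrade M i
                 then mdiff N (i + n) (f i m) - ksign n (f (i + 1) (mdiff M i m)) else 0),
      lact = (\<lambda>p n a f i m. 0),
      ract = (\<lambda>n p f a i m. if m \<in> mgrade M i
                then ksign (p * i) (ract N (i + n) p (f i m) a) else 0)\<rparr>"

text \<open>The subcomplex of homomorphisms of bimodules.\<close>

definition bihom_complex ::
  "('k, 'a::ab_group_add) dg_alg \<Rightarrow> ('k, 'a, 'm::ab_group_add) dg_mod \<Rightarrow> ('k, 'a, 'n::ab_group_add) dg_mod
     \<Rightarrow> ('k, 'a, int \<Rightarrow> 'm \<Rightarrow> 'n) dg_mod"
where
  "bihom_complex A M N = (hom_complex A M N)
     \<lparr>mgrade := \<lambda>n. {f \<in> mgrade (hom_complex A M N) n.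
                       graded_hom (op_alg A) n (op_left M) (op_left N) f}\<rparr>"


text \<open>
  Quantification over all DG modules has to name a type.  We fix a vector space \<open>'u\<close> with scalar
  multiplication \<open>u\<close> and quantify over the DG modules inside it.  When \<open>u\<close> is infinite-dimensional and
  of dimension at least that of \<open>A\<close>, every DG module of dimension at most \<open>dim 'u\<close> has an
  isomorphic copy inside \<open>'u\<close>.  The notions below, for \<open>M\<close>, \<open>I\<close>, \<open>P\<close> inside \<open>'u\<close>, then do not depend
  on \<open>'u\<close>.
\<close>

definition universe :: "('k::field \<Rightarrow> 'u::ab_group_add \<Rightarrow> 'u) \<Rightarrow> bool" where
  "universe u \<longleftrightarrow> vector_space u \<and> \<not> (\<exists>B. finite B \<and> module.span u B = UNIV)"

definition dg_modules ::
  "('k::field \<Rightarrow> 'u \<Rightarrow> 'u) \<Rightarrow> ('k, 'a::ab_group_add) dg_alg \<Rightarrow> ('k, 'a, 'u::ab_group_add) dg_mod set"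
where
  "dg_modules u A = {M. left_dg_module A M \<and> mscale M = u}"

definition dg_bimodules ::
  "('k::field \<Rightarrow> 'u \<Rightarrow> 'u) \<Rightarrow> ('k, 'a::ab_group_add) dg_alg \<Rightarrow> ('k, 'a, 'u::ab_group_add) dg_mod set"
where
  "dg_bimodules u A = {M. dg_bimodule A M \<and> mscale M = u}"

definition dg_bihom ::
  "('k, 'a::ab_group_add) dg_alg \<Rightarrow> ('k, 'a, 'm::ab_group_add) dg_mod \<Rightarrow> ('k, 'a, 'n::ab_group_add) dg_mod
     \<Rightarrow> (int \<Rightarrow> 'm \<Rightarrow> 'n) \<Rightarrow> bool"
where
  "dg_bihom A M N f \<longleftrightarrow> dg_hom A M N f \<and> dg_hom (op_alg A) (op_left M) (op_left N) f"

definition precompose ::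
  "('k, 'a, 'm) dg_mod \<Rightarrow> (int \<Rightarrow> 'm \<Rightarrow> 'n) \<Rightarrow> int \<Rightarrow> (int \<Rightarrow> 'n \<Rightarrow> 'p::zero) \<Rightarrow> int \<Rightarrow> 'm \<Rightarrow> 'p"
where
  "precompose M f n g i m = (if m \<in> mgrade M i then g i (f i m) else 0)"

definition postcompose ::
  "('k, 'a, 'm) dg_mod \<Rightarrow> (int \<Rightarrow> 'n \<Rightarrow> 'p) \<Rightarrow> int \<Rightarrow> (int \<Rightarrow> 'm \<Rightarrow> 'n) \<Rightarrow> int \<Rightarrow> 'm \<Rightarrow> 'p::zero"
where
  "postcompose M f n g i m = (if m \<in> mgrade M i then f (i + n) (g i m) else 0)"

definition degreewise_surj ::
  "('k, 'a, 'm) dg_mod \<Rightarrow> ('k, 'b, 'n) dg_mod \<Rightarrow> (int \<Rightarrow> 'm \<Rightarrow> 'n) \<Rightarrow> bool"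
where
  "degreewise_surj M N f \<longleftrightarrow> (\<forall>i. f i ` mgrade M i = mgrade N i)"

definition degreewise_inj :: "('k, 'a, 'm) dg_mod \<Rightarrow> (int \<Rightarrow> 'm \<Rightarrow> 'n) \<Rightarrow> bool" where
  "degreewise_inj M f \<longleftrightarrow> (\<forall>i. inj_on (f i) (mgrade M i))"

text \<open>\<open>Hom\<^sub>A(-, I)\<close> takes injective quasi-isomorphisms to surjective quasi-isomorphisms.\<close>

definition semi_injective ::
  "('k::field \<Rightarrow> 'u \<Rightarrow> 'u) \<Rightarrow> ('k, 'a::ab_group_add) dg_alg \<Rightarrow> ('k, 'a, 'u::ab_group_add) dg_mod \<Rightarrow> bool"
where
  "semi_injective u A I \<longleftrightarrow>
     I \<in> dg_modules u A \<and>
     (\<forall>N\<in>dg_modules u A. \<forall>N'\<in>dg_modules u A. \<forall>f.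
        quasi_iso A N N' f \<and> degreewise_inj N f \<longrightarrow>
        degreewise_surj (hom_complex A N' I) (hom_complex A N I) (precompose N f) \<and>
        cohomology_iso (hom_complex A N' I) (hom_complex A N I) (precompose N f))"

definition semi_injective_bimodule ::
  "('k::field \<Rightarrow> 'u \<Rightarrow> 'u) \<Rightarrow> ('k, 'a::ab_group_add) dg_alg \<Rightarrow> ('k, 'a, 'u::ab_group_add) dg_mod \<Rightarrow> bool"
where
  "semi_injective_bimodule u A I \<longleftrightarrow>
     I \<in> dg_bimodules u A \<and>
     (\<forall>N\<in>dg_bimodules u A. \<forall>N'\<in>dg_bimodules u A. \<forall>f.
        dg_bihom A N N' f \<and> cohomology_iso N N' f \<and> degreewise_inj N f \<longrightarrow>
        degreewise_surj (bihom_complex A N' I) (bihom_complex A N I) (precompose N f) \<and>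
        cohomology_iso (bihom_complex A N' I) (bihom_complex A N I) (precompose N f))"

text \<open>\<open>Hom\<^sub>A(P, -)\<close> takes surjective quasi-isomorphisms to surjective quasi-isomorphisms.\<close>

definition semi_projective ::
  "('k::field \<Rightarrow> 'u \<Rightarrow> 'u) \<Rightarrow> ('k, 'a::ab_group_add) dg_alg \<Rightarrow> ('k, 'a, 'u::ab_group_add) dg_mod \<Rightarrow> bool"
where
  "semi_projective u A P \<longleftrightarrow>
     P \<in> dg_modules u A \<and>
     (\<forall>N\<in>dg_modules u A. \<forall>N'\<in>dg_modules u A. \<forall>f.
        quasi_iso A N N' f \<and> degreewise_surj N N' f \<longrightarrow>
        degreewise_surj (hom_complex A P N) (hom_complex A P N') (postcompose P f) \<and>
        cohomology_iso (hom_complex A P N) (hom_complex A P N') (postcompose P f))"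

text \<open>
  Derived functors are computed on resolutions: \<open>R\<Gamma>(M)\<close> is \<open>torsion A J\<close> for a semi-injective resolution
  \<open>M \<rightarrow> J\<close>, and \<open>RHom\<^sub>A(M, N)\<close> is \<open>hom_complex A P N\<close> for a semi-projective resolution \<open>P \<rightarrow> M\<close>.
\<close>

definition semi_injective_resolution ::
  "('k::field \<Rightarrow> 'u \<Rightarrow> 'u) \<Rightarrow> ('k, 'a::ab_group_add) dg_alg \<Rightarrow> ('k, 'a, 'm::ab_group_add) dg_mod
     \<Rightarrow> ('k, 'a, 'u::ab_group_add) dg_mod \<Rightarrow> (int \<Rightarrow> 'm \<Rightarrow> 'u) \<Rightarrow> bool"
where
  "semi_injective_resolution u A M I f \<longleftrightarrow> semi_injective u A I \<and> quasi_iso A M I f"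

definition semi_injective_bimodule_resolution ::
  "('k::field \<Rightarrow> 'u \<Rightarrow> 'u) \<Rightarrow> ('k, 'a::ab_group_add) dg_alg \<Rightarrow> ('k, 'a, 'm::ab_group_add) dg_mod
     \<Rightarrow> ('k, 'a, 'u::ab_group_add) dg_mod \<Rightarrow> (int \<Rightarrow> 'm \<Rightarrow> 'u) \<Rightarrow> bool"
where
  "semi_injective_bimodule_resolution u A M I f \<longleftrightarrow>
     semi_injective_bimodule u A I \<and> dg_bihom A M I f \<and> cohomology_iso M I f"

definition semi_projective_resolution ::
  "('k::field \<Rightarrow> 'u \<Rightarrow> 'u) \<Rightarrow> ('k, 'a::ab_group_add) dg_alg \<Rightarrow> ('k, 'a, 'm::ab_group_add) dg_mod
     \<Rightarrow> ('k, 'a, 'u::ab_group_add) dg_mod \<Rightarrow> (int \<Rightarrow> 'u \<Rightarrow> 'm) \<Rightarrow> bool"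
where
  "semi_projective_resolution u A M P f \<longleftrightarrow> semi_projective u A P \<and> quasi_iso A P M f"


text \<open>
  The derived category is the localization of the homotopy category at the quasi-isomorphisms, by the
  calculus of fractions.  A morphism from \<open>M\<close> to \<open>N\<close> is represented by a roof \<open>(Z, s, f)\<close>, that is
  \<open>M \<leftarrow> Z \<rightarrow> N\<close> with \<open>s : Z \<rightarrow> M\<close> a quasi-isomorphism.  The apex \<open>Z\<close> lies in the universe \<open>u\<close>, while
  \<open>M\<close> and \<open>N\<close> may live in other types.
\<close>

type_synonym ('k, 'a, 'z, 'm, 'n) roof =
  "('k, 'a, 'z) dg_mod \<times> (int \<Rightarrow> 'z \<Rightarrow> 'm) \<times> (int \<Rightarrow> 'z \<Rightarrow> 'n)"

definition is_roof ::
  "('k::field \<Rightarrow> 'u \<Rightarrow> 'u) \<Rightarrow> ('k, 'a::ab_group_add) dg_alg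
     \<Rightarrow> ('k, 'a, 'm::ab_group_add) dg_mod \<Rightarrow> ('k, 'a, 'n::ab_group_add) dg_mod
     \<Rightarrow> ('k, 'a, 'u::ab_group_add, 'm, 'n) roof \<Rightarrow> bool"
where
  "is_roof u A M N = (\<lambda>(Z, s, f). Z \<in> dg_modules u A \<and> quasi_iso A Z M s \<and> dg_hom A Z N f)"

definition roof_equiv ::
  "('k::field \<Rightarrow> 'u::ab_group_add \<Rightarrow> 'u) \<Rightarrow> ('k, 'a::ab_group_add) dg_alg
     \<Rightarrow> ('k, 'a, 'm::ab_group_add) dg_mod \<Rightarrow> ('k, 'a, 'n::ab_group_add) dg_mod
     \<Rightarrow> ('k, 'a, 'z::ab_group_add, 'm, 'n) roof \<Rightarrow> ('k, 'a, 'y::ab_group_add, 'm, 'n) roof \<Rightarrow> bool"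
where
  "roof_equiv u A M N = (\<lambda>(Z, s, f) (Z', s', f').
     \<exists>W\<in>dg_modules u A. \<exists>t t'.
       dg_hom A W Z t \<and> dg_hom A W Z' t' \<and>
       quasi_iso A W M (\<lambda>i w. s i (t i w)) \<and>
       homotopic_homs A W M (\<lambda>i w. s i (t i w)) (\<lambda>i w. s' i (t' i w)) \<and>
       homotopic_homs A W N (\<lambda>i w. f i (t i w)) (\<lambda>i w. f' i (t' i w)))"

definition roof_composite ::
  "('k::field \<Rightarrow> 'u \<Rightarrow> 'u) \<Rightarrow> ('k, 'a::ab_group_add) dg_alg \<Rightarrow> ('k, 'a, 'n::ab_group_add) dg_mod
     \<Rightarrow> ('k, 'a, 'u::ab_group_add, 'm, 'n) roof \<Rightarrow> ('k, 'a, 'u, 'n, 'p) roof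
     \<Rightarrow> ('k, 'a, 'u, 'm, 'p) roof \<Rightarrow> bool"
where
  "roof_composite u A N = (\<lambda>(Z, s, f) (Z', s', f') R.
     \<exists>W\<in>dg_modules u A. \<exists>t t'.
       quasi_iso A W Z t \<and> dg_hom A W Z' t' \<and>
       homotopic_homs A W N (\<lambda>i w. f i (t i w)) (\<lambda>i w. s' i (t' i w)) \<and>
       R = (W, (\<lambda>i w. s i (t i w)), (\<lambda>i w. f' i (t' i w))))"

definition id_roof :: "('k, 'a, 'm) dg_mod \<Rightarrow> ('k, 'a, 'm, 'm, 'm) roof" where
  "id_roof M = (M, (\<lambda>i m. m), (\<lambda>i m. m))"

definition derived_iso ::
  "('k::field \<Rightarrow> 'u::ab_group_add \<Rightarrow> 'u) \<Rightarrow> ('k, 'a::ab_group_add) dg_alg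
     \<Rightarrow> ('k, 'a, 'm::ab_group_add) dg_mod \<Rightarrow> ('k, 'a, 'n::ab_group_add) dg_mod \<Rightarrow> bool"
where
  "derived_iso u A M N \<longleftrightarrow>
     left_dg_module A M \<and> left_dg_module A N \<and>
     (\<exists>R R' S S'. is_roof u A M N R \<and> is_roof u A N M R' \<and>
        roof_composite u A N R R' S \<and> roof_equiv u A M M S (id_roof M) \<and>
        roof_composite u A M R' R S' \<and> roof_equiv u A N N S' (id_roof N))"

definition derived_hom ::
  "('k::field \<Rightarrow> 'u \<Rightarrow> 'u) \<Rightarrow> ('k, 'a::ab_group_add) dg_alg
     \<Rightarrow> ('k, 'a, 'm::ab_group_add) dg_mod \<Rightarrow> ('k, 'a, 'n::ab_group_add) dg_mod
     \<Rightarrow> ('k, 'a, 'u::ab_group_add, 'm, 'n) roof set set"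
where
  "derived_hom u A M N =
     Collect (is_roof u A M N) //
       {(R, R'). is_roof u A M N R \<and> is_roof u A M N R' \<and> roof_equiv u A M N R R'}"

definition derived_zero ::
  "('k::field \<Rightarrow> 'u \<Rightarrow> 'u) \<Rightarrow> ('k, 'a::ab_group_add) dg_alg
     \<Rightarrow> ('k, 'a, 'm::ab_group_add) dg_mod \<Rightarrow> ('k, 'a, 'n::ab_group_add) dg_mod
     \<Rightarrow> ('k, 'a, 'u::ab_group_add, 'm, 'n) roof set"
where
  "derived_zero u A M N =
     {(Z, s, f). is_roof u A M N (Z, s, f) \<and> roof_equiv u A M N (Z, s, f) (Z, s, \<lambda>i z. 0)}"

definition direct_sum :: "('j \<Rightarrow> ('k, 'a, 'm::ab_group_add) dg_mod) \<Rightarrow> ('k, 'a, 'j \<Rightarrow> 'm) dg_mod" where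
  "direct_sum N =
     \<lparr>mscale = (\<lambda>c x j. mscale (N j) c (x j)),
      mgrade = (\<lambda>i. {x. (\<forall>j. x j \<in> mgrade (N j) i) \<and> finite {j. x j \<noteq> 0}}),
      mdiff = (\<lambda>i x j. mdiff (N j) i (x j)),
      lact = (\<lambda>p i a x j. lact (N j) p i a (x j)),
      ract = (\<lambda>i p x a j. ract (N j) i p (x j) a)\<rparr>"

text \<open>The direct sum of the groups \<open>Hom(M, N j)\<close> in the derived category.\<close>

definition derived_hom_sum ::
  "('k::field \<Rightarrow> 'u \<Rightarrow> 'u) \<Rightarrow> ('k, 'a::ab_group_add) dg_alg
     \<Rightarrow> ('k, 'a, 'm::ab_group_add) dg_mod \<Rightarrow> ('j \<Rightarrow> ('k, 'a, 'n::ab_group_add) dg_mod)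
     \<Rightarrow> ('j \<Rightarrow> ('k, 'a, 'u::ab_group_add, 'm, 'n) roof set) set"
where
  "derived_hom_sum u A M N =
     {\<Phi>. (\<forall>j. \<Phi> j \<in> derived_hom u A M (N j)) \<and> finite {j. \<Phi> j \<noteq> derived_zero u A M (N j)}}"

text \<open>
  The canonical map from the direct sum of the groups \<open>Hom(M, N j)\<close> to \<open>Hom(M, direct_sum N)\<close>.  Finitely
  many fractions have a common denominator \<open>(Z, s)\<close>, and the sum of the \<open>inc j \<circ> f j / s\<close> is represented
  by the map with components \<open>f j\<close>, almost all of which are zero.
\<close>

definition derived_sum_map ::
  "('k::field \<Rightarrow> 'u \<Rightarrow> 'u) \<Rightarrow> ('k, 'a::ab_group_add) dg_alg
     \<Rightarrow> ('k, 'a, 'm::ab_group_add) dg_mod \<Rightarrow> ('j \<Rightarrow> ('k, 'a, 'n::ab_group_add) dg_mod)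
     \<Rightarrow> ('j \<Rightarrow> ('k, 'a, 'u::ab_group_add, 'm, 'n) roof set)
     \<Rightarrow> ('k, 'a, 'u, 'm, 'j \<Rightarrow> 'n) roof set"
where
  "derived_sum_map u A M N \<Phi> =
     {R. is_roof u A M (direct_sum N) R \<and>
         (\<exists>Z s f. (\<forall>j. (Z, s, f j) \<in> \<Phi> j) \<and>
            finite {j. \<exists>i. \<exists>z\<in>mgrade Z i. f j i z \<noteq> 0} \<and>
            roof_equiv u A M (direct_sum N) R (Z, s, \<lambda>i z j. f j i z))}"

text \<open>
  \<open>Hom(M, -)\<close> commutes with direct sums.  Families are indexed by the type \<open>'u\<close>; smaller index sets
  are covered by adding zero modules.
\<close>

definition compact_dg_module ::
  "('k::field \<Rightarrow> 'u \<Rightarrow> 'u) \<Rightarrow> ('k, 'a::ab_group_add) dg_alg \<Rightarrow> ('k, 'a, 'u::ab_group_add) dg_mod \<Rightarrow> bool"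
where
  "compact_dg_module u A M \<longleftrightarrow>
     M \<in> dg_modules u A \<and>
     (\<forall>N :: 'u \<Rightarrow> ('k, 'a, 'u) dg_mod. (\<forall>j. N j \<in> dg_modules u A) \<longrightarrow>
        bij_betw (derived_sum_map u A M N)
          (derived_hom_sum u A M N) (derived_hom u A M (direct_sum N)))"


definition torsion :: "('k, 'a) dg_alg \<Rightarrow> ('k, 'a, 'm::ab_group_add) dg_mod \<Rightarrow> ('k, 'a, 'm) dg_mod" where
  "torsion A M = M\<lparr>mgrade := \<lambda>i. {m \<in> mgrade M i.
     \<exists>n\<ge>1. \<forall>p\<ge>n. \<forall>a\<in>agrade A p. lact M p i a m = 0}\<rparr>"

text \<open>
  The degree \<open>j\<close> part of the Matlis dual is the space of linear functionals on \<open>M\<close> in degree \<open>-j\<close>,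
  extended by zero.  The signs are \<open>(d f)(m) = - (-1)^|f| f(d m)\<close>, \<open>(f a)(m) = f(a m)\<close> and
  \<open>(a f)(m) = (-1)^(|a|(|f| + |m|)) f(m a)\<close>; in the last one \<open>|f| + |m| = -|a|\<close>, so the sign is \<open>(-1)^|a|\<close>.
\<close>

definition matlis_dual :: "('k::field, 'a, 'm::ab_group_add) dg_mod \<Rightarrow> ('k, 'a, 'm \<Rightarrow> 'k) dg_mod" where
  "matlis_dual M =
     \<lparr>mscale = (\<lambda>c f m. c * f m),
      mgrade = (\<lambda>j. {f. k_linear (mscale M) (mgrade M (- j)) (*) UNIV f \<and>
                        (\<forall>m. m \<notin> mgrade M (- j) \<longrightarrow> f m = 0)}),
      mdiff = (\<lambda>j f m. if m \<in> mgrade M (- j - 1) then - ksign j (f (mdiff M (- j - 1) m)) else 0),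
      lact = (\<lambda>p j a f m. if m \<in> mgrade M (- j - p) then ksign p (f (ract M (- j - p) p m a)) else 0),
      ract = (\<lambda>j p f a m. if m \<in> mgrade M (- j - p) then f (lact M p (- j - p) a m) else 0)\<rparr>"

end

theory Submission
  imports Defs "HOL-Library.Product_Plus" "HOL-Library.Nat_Bijection"
begin

text \<open>
  The map \<open>g \<mapsto> (f \<mapsto> (x \<mapsto> \<plusminus> g (x \<otimes> f)))\<close> from \<open>(\<Gamma>(I \<otimes>\<^sub>A F))'\<close> to \<open>Hom\<^sub>A(F, \<Gamma>(I)')\<close> is bijective when
  \<open>F\<close> is built from finitely many free cells, because \<open>\<Gamma>\<close> commutes with finite sums.  A compact module
  is of this form up to homotopy.  Indeed, maps into suitable direct sums show that a K-projective
  resolution \<open>P\<close> is cohomologically bounded below and that \<open>k \<otimes>\<^sub>A P\<close> has finite-dimensional cohomology.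
  If \<open>C\<close> is the cone of \<open>F \<rightarrow> P\<close>, then the lowest cohomology class of \<open>C\<close> survives in \<open>k \<otimes>\<^sub>A C\<close>, and
  attaching a cell to \<open>F\<close> that kills it lowers the number of generators of \<open>C\<close>; so \<open>C\<close> becomes
  acyclic, hence contractible.

  Instead of \<open>I \<otimes>\<^sub>A F\<close>, a module \<open>T\<close> with a balanced pairing \<open>I \<times> F \<rightarrow> T\<close> is built along with \<open>F\<close>: each
  cell contributes a shifted copy of \<open>I\<close>.  Since \<open>I\<close> is K-injective over \<open>A\<close>, so is \<open>T\<close>, and \<open>A \<rightarrow> I\<close> induces
  a quasi-isomorphism \<open>F \<rightarrow> T\<close>.  Thus \<open>T\<close> and the given resolution \<open>J\<close> are homotopy equivalent, and so
  are their torsion submodules.  That \<open>I\<close> is K-injective as a left module follows by extending maps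
  \<open>N \<rightarrow> I\<close> to maps of bimodules \<open>N \<otimes> A \<rightarrow> I\<close>.
\<close>

text \<open>Compactness is given by direct sums in the derived category, not by a finite semi-basis,
  and it can only be tested against modules inside the one vector space \<open>'u\<close>. So
  finiteness has to be extracted from suitable test modules, and every auxiliary module (cones,
  truncations, a copy of \<open>A\<close>, \<open>N \<otimes> A\<close>) is built in
  \<open>'u\<close> or copied into it; an infinite basis of \<open>'u\<close> absorbs pairs and
  countable families. Semi-projectivity and semi-injectivity enter only through the acyclicity of
  Hom against acyclic modules, a property that passes to cones. Since \<open>A\<close> may be
  nonzero in degree 1, attaching cells degree by degree need not terminate: multiples of a new cell
  by elements of degree 1 land in the degree just treated. What decreases is the number of
  generators of the cohomology of \<open>C / A^+ C\<close>. The torsion functor need not preserve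
  quasi-isomorphisms. Therefore \<open>T\<close> is kept K-injective while it grows, so that it can
  be compared with \<open>J\<close> by a homotopy equivalence.\<close>

unbundle cardinal_syntax

section \<open>Signs and DG modules\<close>

lemma ksign_zero [simp]: "ksign n 0 = 0"
  and ksign_add: "ksign n (x + y) = ksign n x + ksign n y"
  and ksign_minus [simp]: "ksign n (- x) = - ksign n x"
  and ksign_diff: "ksign n (x - y) = ksign n x - ksign n y"
  and ksign_ksign [simp]: "ksign n (ksign m x) = ksign (n + m) x"
  and ksign_0 [simp]: "ksign 0 x = x"
  and ksign_1 [simp]: "ksign 1 x = - x"
  and ksign_m1 [simp]: "ksign (- 1) x = - x"
  and ksign_eq_0_iff [simp]: "ksign n x = 0 \<longleftrightarrow> x = 0"
  by (auto simp: ksign_def)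

lemma ksign_cancel: "ksign n x = ksign n y \<longleftrightarrow> x = y"
  by (auto simp: ksign_def)

lemma ksign_if: "ksign n x = (if even n then x else - x)"
  by (rule ksign_def)

lemma (in module) subspace_ksign: "subspace S \<Longrightarrow> x \<in> S \<Longrightarrow> ksign n x \<in> S"
  by (simp add: ksign_def subspace_neg)

lemma k_linearD:
  assumes "k_linear s V t W f"
  shows "x \<in> V \<Longrightarrow> f x \<in> W" "x \<in> V \<Longrightarrow> y \<in> V \<Longrightarrow> f (x + y) = f x + f y"
    "x \<in> V \<Longrightarrow> f (s c x) = t c (f x)"
  using assms by (auto simp: k_linear_def)

lemma k_linearI:
  assumes "\<And>x. x \<in> V \<Longrightarrow> f x \<in> W" "\<And>x y. x \<in> V \<Longrightarrow> y \<in> V \<Longrightarrow> f (x + y) = f x + f y"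
    "\<And>x c. x \<in> V \<Longrightarrow> f (s c x) = t c (f x)"
  shows "k_linear s V t W f"
  using assms by (auto simp: k_linear_def)

lemma k_linear_zero:
  assumes "k_linear s V t W f" "0 \<in> V"
  shows "f 0 = 0"
  using k_linearD(2)[OF assms(1) assms(2) assms(2)] by simp

lemma k_linear_minus:
  assumes "k_linear s V t W f" "vector_space s" "module.subspace s V" "x \<in> V"
  shows "f (- x) = - f x"
proof -
  interpret vector_space s by fact
  have "- x \<in> V" "0 \<in> V" using assms(3,4) subspace_neg subspace_0 by auto
  then show ?thesis using k_linearD(2)[OF assms(1,4), of "- x"] k_linear_zero[OF assms(1)]
    by (simp add: minus_unique)
qed

lemma k_linear_diff:
  assumes "k_linear s V t W f" "vector_space s" "module.subspace s V" "x \<in> V" "y \<in> V"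
  shows "f (x - y) = f x - f y"
proof -
  interpret vector_space s by fact
  have "- y \<in> V" using assms(3,5) subspace_neg by auto
  then show ?thesis using k_linearD(2)[OF assms(1,4), of "- y"] k_linear_minus[OF assms(1-3,5)] by simp
qed

lemma k_linear_ksign:
  assumes "k_linear s V t W f" "vector_space s" "module.subspace s V" "x \<in> V"
  shows "f (ksign n x) = ksign n (f x)"
  using k_linear_minus[OF assms] by (simp add: ksign_def)

lemma (in vector_space) scale_ksign: "scale c (ksign n x) = ksign n (scale c x)"
  by (simp add: ksign_def)

section \<open>Left DG modules and graded homomorphisms\<close>

locale lmod =
  fixes A :: "('k::field, 'a::ab_group_add) dg_alg" and M :: "('k, 'a, 'm::ab_group_add) dg_mod"
  assumes mod: "left_dg_module A M"
begin

sublocale V: vector_space "mscale M"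
  using mod by (simp add: left_dg_module_def)

lemma grade: "V.subspace (mgrade M i)"
  using mod by (simp add: left_dg_module_def)

lemma d_lin: "k_linear (mscale M) (mgrade M i) (mscale M) (mgrade M (i + 1)) (mdiff M i)"
  using mod by (simp add: left_dg_module_def)

lemma act_lin: "a \<in> agrade A p \<Longrightarrow>
    k_linear (mscale M) (mgrade M i) (mscale M) (mgrade M (p + i)) (lact M p i a)"
  using mod by (simp add: left_dg_module_def)

lemma act_lin2: "m \<in> mgrade M i \<Longrightarrow>
    k_linear (ascale A) (agrade A p) (mscale M) (mgrade M (p + i)) (\<lambda>a. lact M p i a m)"
  using mod by (simp add: left_dg_module_def)

lemma zero_mem [simp]: "0 \<in> mgrade M i"
  using grade V.subspace_0 by blast

lemma add_mem [simp]: "x \<in> mgrade M i \<Longrightarrow> y \<in> mgrade M i \<Longrightarrow> x + y \<in> mgrade M i"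
  using grade V.subspace_add by blast

lemma diff_mem [simp]: "x \<in> mgrade M i \<Longrightarrow> y \<in> mgrade M i \<Longrightarrow> x - y \<in> mgrade M i"
  using grade V.subspace_diff by blast

lemma neg_mem [simp]: "x \<in> mgrade M i \<Longrightarrow> - x \<in> mgrade M i"
  using grade V.subspace_neg by blast

lemma neg_mem_iff [simp]: "- x \<in> mgrade M i \<longleftrightarrow> x \<in> mgrade M i"
  using neg_mem neg_mem[of "- x"] by auto

lemma scale_mem [simp]: "x \<in> mgrade M i \<Longrightarrow> mscale M c x \<in> mgrade M i"
  using grade V.subspace_scale by blast

lemma ksign_mem [simp]: "ksign n x \<in> mgrade M i \<longleftrightarrow> x \<in> mgrade M i"
  by (simp add: ksign_def)

text \<open>Degrees are integer terms that often agree only up to arithmetic; hence the target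
  degree is a variable tied to the source by an equation.\<close>

lemma d_mem [simp]: "x \<in> mgrade M i \<Longrightarrow> j = i + 1 \<Longrightarrow> mdiff M i x \<in> mgrade M j"
  using k_linearD(1)[OF d_lin] by blast

lemma d_zero [simp]: "mdiff M i 0 = 0"
  using k_linear_zero[OF d_lin] by simp

lemma d_add [simp]: "x \<in> mgrade M i \<Longrightarrow> y \<in> mgrade M i \<Longrightarrow> mdiff M i (x + y) = mdiff M i x + mdiff M i y"
  using k_linearD(2)[OF d_lin] by blast

lemma d_scale [simp]: "x \<in> mgrade M i \<Longrightarrow> mdiff M i (mscale M c x) = mscale M c (mdiff M i x)"
  using k_linearD(3)[OF d_lin] by blast

lemma d_neg [simp]: "x \<in> mgrade M i \<Longrightarrow> mdiff M i (- x) = - mdiff M i x"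
  using k_linear_minus[OF d_lin V.vector_space_axioms grade] by blast

lemma d_diff [simp]: "x \<in> mgrade M i \<Longrightarrow> y \<in> mgrade M i \<Longrightarrow> mdiff M i (x - y) = mdiff M i x - mdiff M i y"
  using k_linear_diff[OF d_lin V.vector_space_axioms grade] by blast

lemma d_ksign [simp]: "x \<in> mgrade M i \<Longrightarrow> mdiff M i (ksign n x) = ksign n (mdiff M i x)"
  using k_linear_ksign[OF d_lin V.vector_space_axioms grade] by blast

lemma dd [simp]: "x \<in> mgrade M i \<Longrightarrow> j = i + 1 \<Longrightarrow> mdiff M j (mdiff M i x) = 0"
  using mod by (simp add: left_dg_module_def)

lemma act_mem [simp]: "a \<in> agrade A p \<Longrightarrow> x \<in> mgrade M i \<Longrightarrow> j = p + i \<Longrightarrow> lact M p i a x \<in> mgrade M j"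
  using k_linearD(1)[OF act_lin] by blast

lemma act_zero [simp]: "a \<in> agrade A p \<Longrightarrow> lact M p i a 0 = 0"
  using k_linear_zero[OF act_lin] by simp

lemma act_add [simp]: "a \<in> agrade A p \<Longrightarrow> x \<in> mgrade M i \<Longrightarrow> y \<in> mgrade M i \<Longrightarrow>
    lact M p i a (x + y) = lact M p i a x + lact M p i a y"
  using k_linearD(2)[OF act_lin] by blast

lemma act_scale [simp]: "a \<in> agrade A p \<Longrightarrow> x \<in> mgrade M i \<Longrightarrow>
    lact M p i a (mscale M c x) = mscale M c (lact M p i a x)"
  using k_linearD(3)[OF act_lin] by blast

lemma act_neg [simp]: "a \<in> agrade A p \<Longrightarrow> x \<in> mgrade M i \<Longrightarrow> lact M p i a (- x) = - lact M p i a x"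
  using k_linear_minus[OF act_lin V.vector_space_axioms grade] by blast

lemma act_diff [simp]: "a \<in> agrade A p \<Longrightarrow> x \<in> mgrade M i \<Longrightarrow> y \<in> mgrade M i \<Longrightarrow>
    lact M p i a (x - y) = lact M p i a x - lact M p i a y"
  using k_linear_diff[OF act_lin V.vector_space_axioms grade] by blast

lemma act_ksign [simp]: "a \<in> agrade A p \<Longrightarrow> x \<in> mgrade M i \<Longrightarrow>
    lact M p i a (ksign n x) = ksign n (lact M p i a x)"
  using k_linear_ksign[OF act_lin V.vector_space_axioms grade] by blast

lemma lact_add [simp]: "a \<in> agrade A p \<Longrightarrow> b \<in> agrade A p \<Longrightarrow> x \<in> mgrade M i \<Longrightarrow>
    lact M p i (a + b) x = lact M p i a x + lact M p i b x"
  using k_linearD(2)[OF act_lin2] by blast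

lemma lact_scale [simp]: "a \<in> agrade A p \<Longrightarrow> x \<in> mgrade M i \<Longrightarrow>
    lact M p i (ascale A c a) x = mscale M c (lact M p i a x)"
  using k_linearD(3)[OF act_lin2] by blast

lemma assoc: "a \<in> agrade A p \<Longrightarrow> b \<in> agrade A q \<Longrightarrow> x \<in> mgrade M i \<Longrightarrow>
    lact M (p + q) i (amult A p q a b) x = lact M p (q + i) a (lact M q i b x)"
  using mod by (simp add: left_dg_module_def)

lemma unit [simp]: "x \<in> mgrade M i \<Longrightarrow> lact M 0 i (aunit A) x = x"
  using mod by (simp add: left_dg_module_def)

lemma leibniz: "a \<in> agrade A p \<Longrightarrow> x \<in> mgrade M i \<Longrightarrow>
   mdiff M (p + i) (lact M p i a x) =
          lact M (p + 1) i (adiff A p a) x + ksign p (lact M p (i + 1) a (mdiff M i x))"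
  using mod by (simp add: left_dg_module_def)

end

lemma left_dg_moduleI:
  assumes "vector_space (mscale M)"
    and "\<And>i. module.subspace (mscale M) (mgrade M i)"
    and "\<And>i x. x \<in> mgrade M i \<Longrightarrow> mdiff M i x \<in> mgrade M (i + 1)"
    and "\<And>i x y. x \<in> mgrade M i \<Longrightarrow> y \<in> mgrade M i \<Longrightarrow> mdiff M i (x + y) = mdiff M i x + mdiff M i y"
    and "\<And>i c x. x \<in> mgrade M i \<Longrightarrow> mdiff M i (mscale M c x) = mscale M c (mdiff M i x)"
    and "\<And>i x. x \<in> mgrade M i \<Longrightarrow> mdiff M (i + 1) (mdiff M i x) = 0"
    and "\<And>p i a x. a \<in> agrade A p \<Longrightarrow> x \<in> mgrade M i \<Longrightarrow> lact M p i a x \<in> mgrade M (p + i)"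
    and "\<And>p i a x y. a \<in> agrade A p \<Longrightarrow> x \<in> mgrade M i \<Longrightarrow> y \<in> mgrade M i \<Longrightarrow>
        lact M p i a (x + y) = lact M p i a x + lact M p i a y"
    and "\<And>p i a c x. a \<in> agrade A p \<Longrightarrow> x \<in> mgrade M i \<Longrightarrow>
        lact M p i a (mscale M c x) = mscale M c (lact M p i a x)"
    and "\<And>p i a b x. a \<in> agrade A p \<Longrightarrow> b \<in> agrade A p \<Longrightarrow> x \<in> mgrade M i \<Longrightarrow>
        lact M p i (a + b) x = lact M p i a x + lact M p i b x"
    and "\<And>p i a c x. a \<in> agrade A p \<Longrightarrow> x \<in> mgrade M i \<Longrightarrow>
        lact M p i (ascale A c a) x = mscale M c (lact M p i a x)"
    and "\<And>p q i a b x. a \<in> agrade A p \<Longrightarrow> b \<in> agrade A q \<Longrightarrow> x \<in> mgrade M i \<Longrightarrow>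
        lact M (p + q) i (amult A p q a b) x = lact M p (q + i) a (lact M q i b x)"
    and "\<And>i x. x \<in> mgrade M i \<Longrightarrow> lact M 0 i (aunit A) x = x"
    and "\<And>p i a x. a \<in> agrade A p \<Longrightarrow> x \<in> mgrade M i \<Longrightarrow>
        mdiff M (p + i) (lact M p i a x) =
          lact M (p + 1) i (adiff A p a) x + ksign p (lact M p (i + 1) a (mdiff M i x))"
  shows "left_dg_module A M"
  unfolding left_dg_module_def k_linear_def
  by (intro conjI allI ballI; (rule assms; assumption)?; rule assms)

locale ghom = S: lmod A M + T: lmod A N
  for A :: "('k::field, 'a::ab_group_add) dg_alg" and M :: "('k, 'a, 'm::ab_group_add) dg_mod"
    and N :: "('k, 'a, 'n::ab_group_add) dg_mod" +
  fixes n :: int and f :: "int \<Rightarrow> 'm \<Rightarrow> 'n"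
  assumes hom: "graded_hom A n M N f"
begin

lemma lin: "k_linear (mscale M) (mgrade M i) (mscale N) (mgrade N (i + n)) (f i)"
  using hom by (simp add: graded_hom_def)

lemma mem [simp]: "x \<in> mgrade M i \<Longrightarrow> j = i + n \<Longrightarrow> f i x \<in> mgrade N j"
  using k_linearD(1)[OF lin] by blast

lemma zero [simp]: "f i 0 = 0"
  using k_linear_zero[OF lin] by simp

lemma add [simp]: "x \<in> mgrade M i \<Longrightarrow> y \<in> mgrade M i \<Longrightarrow> f i (x + y) = f i x + f i y"
  using k_linearD(2)[OF lin] by blast

lemma scale [simp]: "x \<in> mgrade M i \<Longrightarrow> f i (mscale M c x) = mscale N c (f i x)"
  using k_linearD(3)[OF lin] by blast

lemma neg [simp]: "x \<in> mgrade M i \<Longrightarrow> f i (- x) = - f i x"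
  using k_linear_minus[OF lin S.V.vector_space_axioms S.grade] by blast

lemma diff [simp]: "x \<in> mgrade M i \<Longrightarrow> y \<in> mgrade M i \<Longrightarrow> f i (x - y) = f i x - f i y"
  using k_linear_diff[OF lin S.V.vector_space_axioms S.grade] by blast

lemma ksgn [simp]: "x \<in> mgrade M i \<Longrightarrow> f i (ksign m x) = ksign m (f i x)"
  using k_linear_ksign[OF lin S.V.vector_space_axioms S.grade] by blast

lemma act: "a \<in> agrade A p \<Longrightarrow> x \<in> mgrade M i \<Longrightarrow>
    f (p + i) (lact M p i a x) = ksign (n * p) (lact N p (i + n) a (f i x))"
  using hom by (simp add: graded_hom_def)

end

lemma graded_homI:
  assumes "\<And>i x. x \<in> mgrade M i \<Longrightarrow> f i x \<in> mgrade N (i + n)"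
    and "\<And>i x y. x \<in> mgrade M i \<Longrightarrow> y \<in> mgrade M i \<Longrightarrow> f i (x + y) = f i x + f i y"
    and "\<And>i c x. x \<in> mgrade M i \<Longrightarrow> f i (mscale M c x) = mscale N c (f i x)"
    and "\<And>p i a x. a \<in> agrade A p \<Longrightarrow> x \<in> mgrade M i \<Longrightarrow>
      f (p + i) (lact M p i a x) = ksign (n * p) (lact N p (i + n) a (f i x))"
  shows "graded_hom A n M N f"
  unfolding graded_hom_def k_linear_def by (intro conjI allI ballI; rule assms; assumption)

lemma dg_homD: "dg_hom A M N f \<Longrightarrow> graded_hom A 0 M N f"
  "dg_hom A M N f \<Longrightarrow> x \<in> mgrade M i \<Longrightarrow> f (i + 1) (mdiff M i x) = mdiff N i (f i x)"
  by (auto simp: dg_hom_def)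

locale dghom = ghom A M N 0 f for A :: "('k::field, 'a::ab_group_add) dg_alg"
    and M :: "('k, 'a, 'm::ab_group_add) dg_mod"
    and N :: "('k, 'a, 'n::ab_group_add) dg_mod" and f +
  assumes dg: "dg_hom A M N f"
begin

lemma mem0 [simp]: "x \<in> mgrade M i \<Longrightarrow> f i x \<in> mgrade N i"
  by simp

lemma act0 [simp]: "a \<in> agrade A p \<Longrightarrow> x \<in> mgrade M i \<Longrightarrow>
    f (p + i) (lact M p i a x) = lact N p i a (f i x)"
  using act[of a p x i] by simp

lemma comm: "x \<in> mgrade M i \<Longrightarrow> j = i + 1 \<Longrightarrow> f j (mdiff M i x) = mdiff N i (f i x)"
  using dg dg_homD(2) by blast

end

lemma dghomI: "left_dg_module A M \<Longrightarrow> left_dg_module A N \<Longrightarrow> dg_hom A M N f \<Longrightarrow> dghom A M N f"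
  by (simp add: dghom_def dghom_axioms_def ghom_def ghom_axioms_def lmod_def dg_homD)

lemma ghomI: "left_dg_module A M \<Longrightarrow> left_dg_module A N \<Longrightarrow> graded_hom A n M N f \<Longrightarrow> ghom A M N n f"
  by (simp add: ghom_def ghom_axioms_def lmod_def)

lemma dg_homI: "graded_hom A 0 M N f \<Longrightarrow>
   (\<And>i x. x \<in> mgrade M i \<Longrightarrow> f (i + 1) (mdiff M i x) = mdiff N i (f i x)) \<Longrightarrow> dg_hom A M N f"
  by (auto simp: dg_hom_def)

lemma left_dg_module_sub:
  assumes "left_dg_module A M" "mscale L = mscale M" "mdiff L = mdiff M" "lact L = lact M"
    and "\<And>i. mgrade L i \<subseteq> mgrade M i" "\<And>i. module.subspace (mscale M) (mgrade L i)"
    and "\<And>i x. x \<in> mgrade L i \<Longrightarrow> mdiff M i x \<in> mgrade L (i + 1)"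
    and "\<And>p i a x. a \<in> agrade A p \<Longrightarrow> x \<in> mgrade L i \<Longrightarrow> lact M p i a x \<in> mgrade L (p + i)"
  shows "left_dg_module A L"
proof -
  interpret lmod A M by unfold_locales fact
  have s: "x \<in> mgrade M i" if "x \<in> mgrade L i" for x i using that assms(5) by auto
  show ?thesis
    by (rule left_dg_moduleI)
       (use assms V.vector_space_axioms in \<open>auto simp: s assoc leibniz\<close>)
qed

section \<open>Connected DG algebras\<close>

locale dga =
  fixes A :: "('k::field, 'a::ab_group_add) dg_alg"
  assumes alg: "dg_algebra A" and conn: "connected_cochain A"
begin

lemma reg_left: "left_dg_module A (reg_bimodule A)"
  using alg unfolding dg_algebra_def left_dg_module_def reg_bimodule_def by simp

sublocale R: lmod A "reg_bimodule A"
  rewrites "mscale (reg_bimodule A) = ascale A" and "mgrade (reg_bimodule A) = agrade A"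
    and "mdiff (reg_bimodule A) = adiff A" and "lact (reg_bimodule A) = amult A"
    and "ract (reg_bimodule A) = amult A"
  using reg_left by (unfold_locales) (auto simp: reg_bimodule_def)

lemma neg_grade: "p < 0 \<Longrightarrow> agrade A p = {0}"
  using conn by (simp add: connected_cochain_def)

lemma grade0: "agrade A 0 = range (\<lambda>c. ascale A c (aunit A))"
  using conn by (simp add: connected_cochain_def)

lemma unit_mem [simp]: "aunit A \<in> agrade A 0"
  using alg by (simp add: dg_algebra_def)

lemma runit [simp]: "a \<in> agrade A i \<Longrightarrow> amult A i 0 a (aunit A) = a"
  using alg by (simp add: dg_algebra_def)

lemma mult_add_left [simp]: "a \<in> agrade A p \<Longrightarrow> b \<in> agrade A p \<Longrightarrow> x \<in> agrade A i \<Longrightarrow>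
    amult A p i (a + b) x = amult A p i a x + amult A p i b x"
  by (rule R.lact_add)

text \<open>The Leibniz rule for \<open>1 = 1 1\<close> gives
  \<open>d 1 = d 1 + d 1\<close>.\<close>

lemma d_unit [simp]: "adiff A 0 (aunit A) = 0"
proof -
  have "adiff A (0 + 0) (amult A 0 0 (aunit A) (aunit A)) =
     amult A (0 + 1) 0 (adiff A 0 (aunit A)) (aunit A) + ksign 0 (amult A 0 (0 + 1) (aunit A) (adiff A 0 (aunit A)))"
    by (rule R.leibniz) simp_all
  moreover have "adiff A 0 (aunit A) \<in> agrade A 1" by simp
  ultimately show ?thesis by simp
qed

end

section \<open>Mapping cones\<close>

lemma linear_ksign:
  assumes "Vector_Spaces.linear s t f"
  shows "f (ksign n x) = ksign n (f x)"
proof -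
  interpret Vector_Spaces.linear s t f by fact
  show ?thesis by (simp add: ksign_def neg)
qed

section \<open>Embeddings into the universe\<close>

locale univ =
  fixes u :: "'k::field \<Rightarrow> 'u::ab_group_add \<Rightarrow> 'u"
  assumes uni: "universe u"
begin

sublocale U: vector_space u
  using uni by (simp add: universe_def)

text \<open>A basis of \<open>'u\<close>, infinite by \<open>universe\<close>. Its cardinality
  bounds the generating sets of the spaces that are copied into \<open>'u\<close>.\<close>

definition Bu :: "'u set" where
  "Bu = (SOME B. U.independent B \<and> U.span B = UNIV)"

lemma Bu: "U.independent Bu" "U.span Bu = UNIV"
proof -
  obtain B where "B \<subseteq> UNIV" "U.independent B" "UNIV \<subseteq> U.span B"
    by (rule U.maximal_independent_subset)
  then have "\<exists>B. U.independent B \<and> U.span B = UNIV" by blast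
  from someI_ex[OF this] show "U.independent Bu" "U.span Bu = UNIV" by (auto simp: Bu_def)
qed

lemma infinite_Bu: "infinite Bu"
  using uni Bu(2) by (auto simp: universe_def)

text \<open>A maximal independent subset of the generators \<open>X\<close> injects into
  \<open>Bu\<close>. The linear extension of this injection is injective on the span, which contains
  \<open>V\<close>.\<close>

lemma embed:
  assumes "vector_space s" "module.subspace s V" "X \<subseteq> V" "V \<subseteq> module.span s X" "|X| \<le>o |Bu|"
  obtains f g where "Vector_Spaces.linear s u f" "Vector_Spaces.linear u s g"
    "\<And>v. v \<in> V \<Longrightarrow> g (f v) = v"
proof -
  interpret W: vector_space s by fact
  interpret P: vector_space_pair s u ..
  obtain C where C: "C \<subseteq> X" "W.independent C" "X \<subseteq> W.span C"
    by (rule W.maximal_independent_subset)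
  have "|C| \<le>o |Bu|" using C(1) assms(5) card_of_mono1 ordLeq_transitive by blast
  then obtain j where j: "inj_on j C" "j ` C \<subseteq> Bu" using card_of_ordLeq[of C Bu] by auto
  obtain f where f: "Vector_Spaces.linear s u f" "\<forall>x\<in>C. f x = j x"
    using P.linear_independent_extend[OF C(2)] by blast
  have "f ` C = j ` C" "inj_on f C" using f(2) j(1) by (auto simp: inj_on_def)
  moreover have "U.independent (j ` C)" using j(2) Bu(1) U.independent_mono by blast
  ultimately have "inj_on f (W.span C)"
    using P.linear_inj_on_span_independent_image[OF f(1)] by simp
  moreover have "V \<subseteq> W.span C"
    using assms(4) C(3) W.span_mono W.span_span by blast
  ultimately have "inj_on f V" by (rule inj_on_subset)
  from P.linear_exists_left_inverse_on[OF f(1) assms(2) this] f(1) that show ?thesis by blast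
qed

lemma projection:
  assumes "U.subspace V"
  obtains q where "Vector_Spaces.linear u u q" "\<And>v. v \<in> V \<Longrightarrow> q v = v" "\<And>v. q v \<in> V"
proof -
  interpret P: vector_space_pair u u ..
  have "\<exists>g. g ` UNIV \<subseteq> V \<and> Vector_Spaces.linear u u g \<and> (\<forall>v\<in>V. g (id v) = v)"
    by (rule P.linear_exists_left_inverse_on) (use assms U.linear_id in \<open>auto simp: id_def\<close>)
  then show ?thesis using that by auto
qed

definition uu :: "'k \<Rightarrow> 'u \<times> 'u \<Rightarrow> 'u \<times> 'u" where "uu c w = (u c (fst w), u c (snd w))"

lemma uu: "vector_space uu"
  by unfold_locales (auto simp: uu_def U.scale_right_distrib U.scale_left_distrib)

text \<open>\<open>'u \<times> 'u\<close> is spanned by two copies of the infinite set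
  \<open>Bu\<close>, and their union is no larger than \<open>Bu\<close>. Hence the direct sum of
  two modules in \<open>'u\<close> again has a copy in \<open>'u\<close>.\<close>

lemma ex_pair: "\<exists>fg. Vector_Spaces.linear uu u (fst fg) \<and> Vector_Spaces.linear u uu (snd fg) \<and>
   (\<forall>v. snd fg (fst fg v) = v)"
proof -
  interpret W: vector_space uu by (rule uu)
  interpret PL: vector_space_pair u uu ..
  let ?X = "(\<lambda>x. (x, 0)) ` Bu \<union> (\<lambda>x. (0, x)) ` Bu"
  have l1: "Vector_Spaces.linear u uu (\<lambda>x. (x, 0))" "Vector_Spaces.linear u uu (\<lambda>x. (0, x))"
    using uu U.vector_space_axioms
    by (auto simp: uu_def Vector_Spaces.linear_iff)
  have "(x, 0) \<in> W.span ?X" "(0, x) \<in> W.span ?X" for x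
  proof -
    have "x \<in> U.span Bu" using Bu by simp
    then have "(x, 0) \<in> (\<lambda>x. (x, 0)) ` U.span Bu" "(0, x) \<in> (\<lambda>x. (0, x)) ` U.span Bu" by auto
    then have "(x, 0) \<in> W.span ((\<lambda>x. (x, 0)) ` Bu)" "(0, x) \<in> W.span ((\<lambda>x. (0, x)) ` Bu)"
      using PL.linear_span_image[OF l1(1), of Bu] PL.linear_span_image[OF l1(2), of Bu] by auto
    then show "(x, 0) \<in> W.span ?X" "(0, x) \<in> W.span ?X"
      using W.span_mono[of "(\<lambda>x. (x, 0)) ` Bu" ?X] W.span_mono[of "(\<lambda>x. (0, x)) ` Bu" ?X] by blast+
  qed
  then have "(x, 0) + (0, y) \<in> W.span ?X" for x y by (rule W.span_add)
  then have s: "UNIV \<subseteq> W.span ?X" by auto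
  have "|?X| \<le>o |Bu|"
  proof -
    have "|(\<lambda>x. (x, 0::'u)) ` Bu| \<le>o |Bu|" "|(\<lambda>x. (0::'u, x)) ` Bu| \<le>o |Bu|" by (rule card_of_image)+
    then show ?thesis using infinite_Bu by (intro card_of_Un_ordLeq_infinite_Field[OF _ _ _ card_of_Card_order]) (simp_all add: Field_card_of)
  qed
  show ?thesis
  proof (rule embed[OF uu W.subspace_UNIV subset_UNIV s \<open>|?X| \<le>o |Bu|\<close>])
    fix f g assume "Vector_Spaces.linear uu u f" "Vector_Spaces.linear u uu g" "\<And>v. v \<in> UNIV \<Longrightarrow> g (f v) = v"
    then show ?thesis by (intro exI[of _ "(f, g)"]) simp
  qed
qed

definition emb_pair where
  "emb_pair = (SOME fg. Vector_Spaces.linear uu u (fst fg) \<and> Vector_Spaces.linear u uu (snd fg) \<and>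
   (\<forall>v. snd fg (fst fg v) = v))"

text \<open>The coding of pairs is injective but need not be onto:
  \<open>pr (p1 w) (p2 w) = w\<close> holds only on the image of \<open>pr\<close>.\<close>

definition pr where "pr x y = fst emb_pair (x, y)"
definition p1 where "p1 w = fst (snd emb_pair w)"
definition p2 where "p2 w = snd (snd emb_pair w)"

lemma emb_pair: "Vector_Spaces.linear uu u (fst emb_pair)" "Vector_Spaces.linear u uu (snd emb_pair)"
   "snd emb_pair (fst emb_pair v) = v"
  using someI_ex[OF ex_pair] unfolding emb_pair_def by blast+

lemma p1_pr [simp]: "p1 (pr x y) = x" and p2_pr [simp]: "p2 (pr x y) = y"
  by (simp_all add: p1_def p2_def pr_def emb_pair)

lemma pr_add: "pr (x + x') (y + y') = pr x y + pr x' y'"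
proof -
  interpret Vector_Spaces.linear uu u "fst emb_pair" by (rule emb_pair)
  show ?thesis using add[of "(x, y)" "(x', y')"] by (simp add: pr_def)
qed

lemma pr_scale: "pr (u c x) (u c y) = u c (pr x y)"
proof -
  interpret Vector_Spaces.linear uu u "fst emb_pair" by (rule emb_pair)
  show ?thesis using scale[of c "(x, y)"] by (simp add: pr_def uu_def)
qed

lemma p1_add: "p1 (v + w) = p1 v + p1 w" and p2_add: "p2 (v + w) = p2 v + p2 w"
  and p1_scale: "p1 (u c v) = u c (p1 v)" and p2_scale: "p2 (u c v) = u c (p2 v)"
proof -
  interpret Vector_Spaces.linear u uu "snd emb_pair" by (rule emb_pair)
  show "p1 (v + w) = p1 v + p1 w" "p2 (v + w) = p2 v + p2 w"
    "p1 (u c v) = u c (p1 v)" "p2 (u c v) = u c (p2 v)"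
    by (simp_all add: p1_def p2_def add scale uu_def)
qed

lemma pr_eq [simp]: "pr x y = pr x' y' \<longleftrightarrow> x = x' \<and> y = y'"
  by (metis p1_pr p2_pr)

lemma pr_00 [simp]: "pr 0 0 = 0"
  using pr_add[of 0 0 0 0] by simp

lemma pr_eq_0 [simp]: "pr x y = 0 \<longleftrightarrow> x = 0 \<and> y = 0"
  using pr_eq[of x y 0 0] by (simp del: pr_eq)

lemma p1_0 [simp]: "p1 0 = 0" and p2_0 [simp]: "p2 0 = 0"
  using p1_add[of 0 0] p2_add[of 0 0] by simp_all

lemma pr_minus: "pr (- x) (- y) = - pr x y"
  using pr_add[of "- x" x "- y" y] by (simp add: eq_neg_iff_add_eq_0)

lemma pr_diff: "pr (x - x') (y - y') = pr x y - pr x' y'"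
  using pr_add[of x "- x'" y "- y'"] by (simp add: pr_minus)

lemma p1_minus: "p1 (- v) = - p1 v" and p2_minus: "p2 (- v) = - p2 v"
  using p1_add[of "- v" v] p2_add[of "- v" v] by (simp_all add: eq_neg_iff_add_eq_0)

lemma p1_diff: "p1 (v - w) = p1 v - p1 w" and p2_diff: "p2 (v - w) = p2 v - p2 w"
  using p1_add[of v "- w"] p2_add[of v "- w"] by (simp_all add: p1_minus p2_minus)

lemma pr_ksign: "pr (ksign n x) (ksign n y) = ksign n (pr x y)"
  by (simp add: ksign_def pr_minus)

lemma p1_ksign: "p1 (ksign n v) = ksign n (p1 v)" and p2_ksign: "p2 (ksign n v) = ksign n (p2 v)"
  by (simp_all add: ksign_def p1_minus p2_minus)

end

text \<open>
  The twisted direct sum of \<open>X\<close> and the shift \<open>Y[s]\<close>: the mapping cone of \<open>\<tau>\<close>, a map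
  \<open>Y \<rightarrow> X\<close> of degree \<open>1 - s\<close>.  The first index of \<open>\<tau>\<close> is the degree in the cone, not in \<open>Y\<close>.
\<close>

definition (in univ) gcone ::
  "('k, 'a, 'u) dg_mod \<Rightarrow> ('k, 'a, 'u) dg_mod \<Rightarrow> int \<Rightarrow> (int \<Rightarrow> 'u \<Rightarrow> 'u) \<Rightarrow> ('k, 'a, 'u) dg_mod" where
  "gcone X Y s \<tau> =
     \<lparr>mscale = u,
      mgrade = (\<lambda>i. {w. \<exists>x\<in>mgrade X i. \<exists>y\<in>mgrade Y (i + s). w = pr x y}),
      mdiff = (\<lambda>i w. pr (mdiff X i (p1 w) + \<tau> i (p2 w)) (ksign s (mdiff Y (i + s) (p2 w)))),
      lact = (\<lambda>p i a w. pr (lact X p i a (p1 w)) (ksign (s * p) (lact Y p (i + s) a (p2 w)))),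
      ract = (\<lambda>_ _ _ _. 0)\<rparr>"

text \<open>Precisely the compatibilities that make the cone a DG module: \<open>\<tau>\<close> is
  linear of degree \<open>1 - s\<close>, with the sign this entails, and the last condition says
  that the off-diagonal entry of \<open>d d\<close> vanishes, the differential of the shift being
  \<open>(-1)^s d\<close>.\<close>

definition twisting ::
  "('k::field, 'a::ab_group_add) dg_alg \<Rightarrow> ('k, 'a, 'm::ab_group_add) dg_mod \<Rightarrow> ('k, 'a, 'n::ab_group_add) dg_mod
    \<Rightarrow> int \<Rightarrow> (int \<Rightarrow> 'n \<Rightarrow> 'm) \<Rightarrow> bool" where
  "twisting A X Y s \<tau> \<longleftrightarrow>
    (\<forall>i. k_linear (mscale Y) (mgrade Y (i + s)) (mscale X) (mgrade X (i + 1)) (\<tau> i)) \<and>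
    (\<forall>p i. \<forall>a\<in>agrade A p. \<forall>y\<in>mgrade Y (i + s).
      \<tau> (p + i) (lact Y p (i + s) a y) = ksign (p * (1 + s)) (lact X p (i + 1) a (\<tau> i y))) \<and>
    (\<forall>i. \<forall>y\<in>mgrade Y (i + s). mdiff X (i + 1) (\<tau> i y) = - ksign s (\<tau> (i + 1) (mdiff Y (i + s) y)))"

locale dgu = dga A + univ u for A :: "('k::field, 'a::ab_group_add) dg_alg"
  and u :: "'k \<Rightarrow> 'u::ab_group_add \<Rightarrow> 'u"

locale cone = dgu A u + X: lmod A X + Y: lmod A Y
  for A :: "('k::field, 'a::ab_group_add) dg_alg"
  and u :: "'k \<Rightarrow> 'u::ab_group_add \<Rightarrow> 'u"
  and X Y :: "('k, 'a, 'u) dg_mod" +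
  fixes s :: int and \<tau> :: "int \<Rightarrow> 'u \<Rightarrow> 'u"
  assumes scX [simp]: "mscale X = u" and scY [simp]: "mscale Y = u"
    and tw: "twisting A X Y s \<tau>"
begin

abbreviation "G \<equiv> gcone X Y s \<tau>"

lemma t_lin: "k_linear (mscale Y) (mgrade Y (i + s)) (mscale X) (mgrade X (i + 1)) (\<tau> i)"
  using tw by (simp add: twisting_def)

lemma t_mem [simp]: "y \<in> mgrade Y (i + s) \<Longrightarrow> j = i + 1 \<Longrightarrow> \<tau> i y \<in> mgrade X j"
  using k_linearD(1)[OF t_lin] by blast

lemma t_zero [simp]: "\<tau> i 0 = 0"
  using k_linear_zero[OF t_lin] by simp

lemma t_add [simp]: "x \<in> mgrade Y (i + s) \<Longrightarrow> y \<in> mgrade Y (i + s) \<Longrightarrow> \<tau> i (x + y) = \<tau> i x + \<tau> i y"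
  using k_linearD(2)[OF t_lin] by blast

lemma t_scale [simp]: "x \<in> mgrade Y (i + s) \<Longrightarrow> \<tau> i (u c x) = u c (\<tau> i x)"
  using k_linearD(3)[OF t_lin] by simp

lemma t_diff [simp]: "x \<in> mgrade Y (i + s) \<Longrightarrow> y \<in> mgrade Y (i + s) \<Longrightarrow> \<tau> i (x - y) = \<tau> i x - \<tau> i y"
  using k_linear_diff[OF t_lin Y.V.vector_space_axioms Y.grade] by blast

lemma t_ksign [simp]: "x \<in> mgrade Y (i + s) \<Longrightarrow> \<tau> i (ksign m x) = ksign m (\<tau> i x)"
  using k_linear_ksign[OF t_lin Y.V.vector_space_axioms Y.grade] by blast

lemma t_act: "a \<in> agrade A p \<Longrightarrow> y \<in> mgrade Y (i + s) \<Longrightarrow>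
      \<tau> (p + i) (lact Y p (i + s) a y) = ksign (p * (1 + s)) (lact X p (i + 1) a (\<tau> i y))"
  using tw by (simp add: twisting_def)

lemma t_d: "y \<in> mgrade Y (i + s) \<Longrightarrow> mdiff X (i + 1) (\<tau> i y) = - ksign s (\<tau> (i + 1) (mdiff Y (i + s) y))"
  using tw by (simp add: twisting_def)

lemma G_sel [simp]: "mscale G = u"
  "mdiff G i (pr x y) = pr (mdiff X i x + \<tau> i y) (ksign s (mdiff Y (i + s) y))"
  "lact G p i a (pr x y) = pr (lact X p i a x) (ksign (s * p) (lact Y p (i + s) a y))"
  "pr x y \<in> mgrade G i \<longleftrightarrow> x \<in> mgrade X i \<and> y \<in> mgrade Y (i + s)"
  by (auto simp: gcone_def)

lemma GE: 
  assumes "w \<in> mgrade G i"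
  obtains x y where "w = pr x y" "x \<in> mgrade X i" "y \<in> mgrade Y (i + s)"
  using assms by (auto simp: gcone_def)

lemma G_mod: "left_dg_module A G"
proof (rule left_dg_moduleI)
  show "vector_space (mscale G)" by (simp add: U.vector_space_axioms)
  show "module.subspace (mscale G) (mgrade G i)" for i
    unfolding G_sel
  proof (rule U.subspaceI)
    show "0 \<in> mgrade G i" using G_sel(4)[of 0 0 i] by simp
    show "x + y \<in> mgrade G i" if "x \<in> mgrade G i" "y \<in> mgrade G i" for x y
      using that by (auto elim!: GE simp: pr_add[symmetric])
    show "u c x \<in> mgrade G i" if "x \<in> mgrade G i" for c x
      using that X.scale_mem Y.scale_mem by (auto elim!: GE simp: pr_scale[symmetric])
  qed
  fix i x assume x: "x \<in> mgrade G i"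
  then show "mdiff G i x \<in> mgrade G (i + 1)"
    by (auto elim!: GE simp: ac_simps)
  show "mdiff G (i + 1) (mdiff G i x) = 0"
    using x by (elim GE) (simp add: t_d)
  show "lact G 0 i (aunit A) x = x"
    using x by (elim GE) simp
  {
    fix c
    show "mdiff G i (mscale G c x) = mscale G c (mdiff G i x)"
      using x X.d_scale Y.d_scale
      by (auto elim!: GE simp: pr_scale[symmetric] U.scale_right_distrib U.scale_ksign)
  }
  {
    fix y assume "y \<in> mgrade G i"
    then show "mdiff G i (x + y) = mdiff G i x + mdiff G i y"
      using x by (auto elim!: GE simp: pr_add[symmetric] ksign_add algebra_simps)
  }
  fix p a assume a: "a \<in> agrade A p"
  show "lact G p i a x \<in> mgrade G (p + i)"
    using x a by (auto elim!: GE simp: ac_simps)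
  show "lact G p i a (mscale G c x) = mscale G c (lact G p i a x)" for c
    using x a X.act_scale[OF a] Y.act_scale[OF a] by (auto elim!: GE simp: pr_scale[symmetric] U.scale_ksign)
  show "lact G p i (ascale A c a) x = mscale G c (lact G p i a x)" for c
    using x a X.lact_scale[OF a] Y.lact_scale[OF a] by (auto elim!: GE simp: pr_scale[symmetric] U.scale_ksign)
  show "lact G p i a (x + y) = lact G p i a x + lact G p i a y" if "y \<in> mgrade G i" for y
    using x that a by (auto elim!: GE simp: pr_add[symmetric] ksign_add)
  show "lact G p i (a + b) x = lact G p i a x + lact G p i b x" if "b \<in> agrade A p" for b
    using x that a by (auto elim!: GE simp: pr_add[symmetric] ksign_add)
  show "lact G (p + q) i (amult A p q a b) x = lact G p (q + i) a (lact G q i b x)" if "b \<in> agrade A q" for b q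
    using x that a by (auto elim!: GE simp: X.assoc Y.assoc algebra_simps)
  show "mdiff G (p + i) (lact G p i a x) =
     lact G (p + 1) i (adiff A p a) x + ksign p (lact G p (i + 1) a (mdiff G i x))"
  proof -
    obtain m n where w: "x = pr m n" "m \<in> mgrade X i" "n \<in> mgrade Y (i + s)" using x by (rule GE)
    have 1: "mdiff Y (p + i + s) (lact Y p (i + s) a n) =
      lact Y (p + 1) (i + s) (adiff A p a) n + ksign p (lact Y p (i + 1 + s) a (mdiff Y (i + s) n))"
      using Y.leibniz[OF a w(3)] by (simp add: ac_simps)
    have 2: "lact Y p (i + s) a n \<in> mgrade Y (p + i + s)" using a w by (simp add: ac_simps)
    have 3: "mdiff Y (i + s) n \<in> mgrade Y (i + 1 + s)" using w by simp
    show ?thesis using w a 2 3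
      by (simp add: X.leibniz t_act[OF a w(3)] 1 pr_add[symmetric] pr_ksign[symmetric] ksign_add)
       (cases "even p"; cases "even s"; simp add: ksign_if algebra_simps)
  qed
qed

sublocale G: lmod A G
  by unfold_locales (rule G_mod)

lemma G_in: "G \<in> dg_modules u A"
  by (simp add: dg_modules_def G_mod)

end

lemma (in dgu) coneI:
  "X \<in> dg_modules u A \<Longrightarrow> Y \<in> dg_modules u A \<Longrightarrow> twisting A X Y s \<tau> \<Longrightarrow> cone A u X Y s \<tau>"
  by (simp add: cone_def cone_axioms_def dg_modules_def lmod_def dgu_axioms)

section \<open>Modules orthogonal to acyclic modules\<close>

definition acyclic_mod :: "('k, 'a, 'm::ab_group_add) dg_mod \<Rightarrow> bool" where
  "acyclic_mod M \<longleftrightarrow> (\<forall>i. \<forall>x\<in>mgrade M i. mdiff M i x = 0 \<longrightarrow> (\<exists>y\<in>mgrade M (i - 1). x = mdiff M (i - 1) y))"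

text \<open>A cocycle of degree \<open>n\<close> in the Hom complex, except that it may take any
  values outside the homogeneous components.\<close>

definition chain_hom ::
  "('k, 'a) dg_alg \<Rightarrow> int \<Rightarrow> ('k, 'a, 'm::ab_group_add) dg_mod \<Rightarrow> ('k, 'a, 'n::ab_group_add) dg_mod
     \<Rightarrow> (int \<Rightarrow> 'm \<Rightarrow> 'n) \<Rightarrow> bool"
where
  "chain_hom A n M N f \<longleftrightarrow> graded_hom A n M N f \<and>
     (\<forall>i. \<forall>m\<in>mgrade M i. mdiff N (i + n) (f i m) = ksign n (f (i + 1) (mdiff M i m)))"

definition null_hom ::
  "('k, 'a) dg_alg \<Rightarrow> int \<Rightarrow> ('k, 'a, 'm::ab_group_add) dg_mod \<Rightarrow> ('k, 'a, 'n::ab_group_add) dg_mod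
     \<Rightarrow> (int \<Rightarrow> 'm \<Rightarrow> 'n) \<Rightarrow> bool"
where
  "null_hom A n M N f \<longleftrightarrow> (\<exists>h. graded_hom A n M N h \<and>
     (\<forall>i. \<forall>m\<in>mgrade M i. f i m = mdiff N (i + n) (h i m) - ksign n (h (i + 1) (mdiff M i m))))"

text \<open>K-projectivity: \<open>Hom\<^sub>A(P, N)\<close> is acyclic for acyclic
  \<open>N\<close>. The quantifier over all degrees \<open>n\<close> takes the place of shifts of
  \<open>N\<close>.\<close>

definition kproj ::
  "('k::field \<Rightarrow> 'u \<Rightarrow> 'u) \<Rightarrow> ('k, 'a::ab_group_add) dg_alg \<Rightarrow> ('k, 'a, 'u::ab_group_add) dg_mod \<Rightarrow> bool" where
  "kproj u A P \<longleftrightarrow> (\<forall>N\<in>dg_modules u A. acyclic_mod N \<longrightarrow>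
      (\<forall>n f. chain_hom A (n + 1) P N f \<longrightarrow> null_hom A n P N f))"

definition kinj ::
  "('k::field \<Rightarrow> 'u \<Rightarrow> 'u) \<Rightarrow> ('k, 'a::ab_group_add) dg_alg \<Rightarrow> ('k, 'a, 'u::ab_group_add) dg_mod \<Rightarrow> bool" where
  "kinj u A J \<longleftrightarrow> (\<forall>N\<in>dg_modules u A. acyclic_mod N \<longrightarrow>
      (\<forall>n f. chain_hom A (n + 1) N J f \<longrightarrow> null_hom A n N J f))"

lemma chain_hom_0: "chain_hom A 0 M N f \<longleftrightarrow> dg_hom A M N f"
  by (auto simp: chain_hom_def dg_hom_def)

text \<open>Elements of \<open>hom_complex\<close> vanish outside the components, whereas
  \<open>f\<close> need not; the passage from one to the other is by restriction to the components,
  the map \<open>g\<close> below.\<close>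

lemma null_homI:
  assumes M: "left_dg_module A M" and N: "left_dg_module A N" and f: "chain_hom A (n + 1) M N f"
    and H: "\<And>g. graded_hom A (n + 1) M N g \<Longrightarrow> (\<And>i m. m \<in> mgrade M i \<Longrightarrow> g i m = f i m) \<Longrightarrow>
       g \<in> cocycles (hom_complex A M N) (n + 1) \<Longrightarrow> g \<in> coboundaries (hom_complex A M N) (n + 1)"
  shows "null_hom A n M N f"
proof -
  interpret ghom A M N "n + 1" f using f M N by (auto simp: chain_hom_def intro: ghomI)
  define g where "g = (\<lambda>i m. if m \<in> mgrade M i then f i m else 0)"
  have g: "graded_hom A (n + 1) M N g"
    by (rule graded_homI) (auto simp: g_def act ac_simps)
  have "g \<in> cocycles (hom_complex A M N) (n + 1)"
    using f g by (auto simp: cocycles_def hom_complex_def g_def chain_hom_def fun_eq_iff)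
  with H g have "g \<in> coboundaries (hom_complex A M N) (n + 1)" by (auto simp: g_def)
  then obtain h where "h \<in> mgrade (hom_complex A M N) n" and h: "g = mdiff (hom_complex A M N) n h"
    by (auto simp: coboundaries_def)
  then have "graded_hom A n M N h" by (auto simp: hom_complex_def)
  moreover have "f i m = mdiff N (i + n) (h i m) - ksign n (h (i + 1) (mdiff M i m))"
    if "m \<in> mgrade M i" for i m
    using fun_cong[OF fun_cong[OF h], of i m] that by (simp add: g_def hom_complex_def)
  ultimately show ?thesis by (auto simp: null_hom_def)
qed

definition zero_mod :: "('k \<Rightarrow> 'u \<Rightarrow> 'u) \<Rightarrow> ('k, 'a, 'u::ab_group_add) dg_mod" where
  "zero_mod u = \<lparr>mscale = u, mgrade = (\<lambda>_. {0}), mdiff = (\<lambda>_ _. 0), lact = (\<lambda>_ _ _ _. 0),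
     ract = (\<lambda>_ _ _ _. 0)\<rparr>"

lemma (in univ) zero_mod_mod: "left_dg_module A (zero_mod u)"
  by (rule left_dg_moduleI) (auto simp: zero_mod_def U.vector_space_axioms intro: U.subspaceI)

lemma (in univ) zero_mod: "zero_mod u \<in> dg_modules u A"
  using zero_mod_mod by (auto simp: dg_modules_def zero_mod_def)

text \<open>If \<open>N\<close> is acyclic then \<open>N \<rightarrow> 0\<close> is a surjective
  quasi-isomorphism, so \<open>Hom(P, N)\<close> has the cohomology of
  \<open>Hom(P, 0) = 0\<close>.\<close>

lemma (in univ) semi_projective_kproj:
  assumes P: "semi_projective u A P"
  shows "kproj u A P"
  unfolding kproj_def
proof (intro ballI impI allI)
  fix N n f assume N: "N \<in> dg_modules u A" and ac: "acyclic_mod N" and f: "chain_hom A (n + 1) P N f"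
  have PN: "left_dg_module A P" "left_dg_module A N" using P N by (auto simp: semi_projective_def dg_modules_def)
  interpret N: lmod A N by unfold_locales fact
  let ?z = "\<lambda>(i::int) (x::'u). 0::'u"
  have z: "quasi_iso A N (zero_mod u) ?z" "degreewise_surj N (zero_mod u) ?z"
    using ac N unfolding quasi_iso_def dg_hom_def graded_hom_def k_linear_def cohomology_iso_def degreewise_surj_def
     cocycles_def coboundaries_def
    by (auto simp: zero_mod_def dg_modules_def acyclic_mod_def) (use N.zero_mem in fastforce)+
  have c: "cohomology_iso (hom_complex A P N) (hom_complex A P (zero_mod u)) (postcompose P ?z)"
    using P N z zero_mod unfolding semi_projective_def by blast
  show "null_hom A n P N f"
  proof (rule null_homI[OF PN f])
    fix g assume "g \<in> cocycles (hom_complex A P N) (n + 1)"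
    moreover have "postcompose P ?z (n + 1) g \<in> coboundaries (hom_complex A P (zero_mod u)) (n + 1)"
      unfolding coboundaries_def
      by (rule image_eqI[of _ _ "\<lambda>_ _. 0"])
         (auto simp: hom_complex_def zero_mod_def postcompose_def graded_hom_def k_linear_def fun_eq_iff)
    ultimately show "g \<in> coboundaries (hom_complex A P N) (n + 1)"
      using c unfolding cohomology_iso_def by blast
  qed
qed

text \<open>If \<open>N\<close> is acyclic then \<open>0 \<rightarrow> N\<close> is an injective
  quasi-isomorphism, so \<open>Hom(N, J)\<close> has the cohomology of
  \<open>Hom(0, J) = 0\<close>.\<close>

lemma (in univ) semi_injective_kinj:
  fixes A :: "('k, 'a::ab_group_add) dg_alg"
  assumes J: "semi_injective u A J"
  shows "kinj u A J"
  unfolding kinj_def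
proof (intro ballI impI allI)
  fix N n f assume N: "N \<in> dg_modules u A" and ac: "acyclic_mod N" and f: "chain_hom A (n + 1) N J f"
  have JN: "left_dg_module A J" "left_dg_module A N" using J N by (auto simp: semi_injective_def dg_modules_def)
  interpret N: lmod A N by unfold_locales fact
  interpret J: lmod A J by unfold_locales fact
  let ?Z = "zero_mod u :: ('k, 'a, 'u) dg_mod"
  let ?z = "\<lambda>(i::int) (x::'u). 0::'u"
  have uz: "u c 0 = 0" for c by simp
  have z: "quasi_iso A ?Z N ?z" "degreewise_inj ?Z ?z"
    using ac N unfolding quasi_iso_def dg_hom_def graded_hom_def k_linear_def cohomology_iso_def degreewise_inj_def
     cocycles_def coboundaries_def
    by (auto simp: zero_mod_def dg_modules_def acyclic_mod_def image_iff)
  have c: "cohomology_iso (hom_complex A N J) (hom_complex A ?Z J) (precompose ?Z ?z)"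
    using J[unfolded semi_injective_def, THEN conjunct2, rule_format, OF zero_mod N conjI[OF z]] by blast
  show "null_hom A n N J f"
  proof (rule null_homI[OF JN(2,1) f])
    fix g assume g: "g \<in> cocycles (hom_complex A N J) (n + 1)" "graded_hom A (n + 1) N J g"
    interpret ghom A N J "n + 1" g using g JN by (intro ghomI)
    have "precompose ?Z ?z (n + 1) g \<in> coboundaries (hom_complex A ?Z J) (n + 1)"
      unfolding coboundaries_def
      by (rule image_eqI[of _ _ "\<lambda>_ _. 0"])
         (use J in \<open>auto simp: hom_complex_def zero_mod_def precompose_def graded_hom_def k_linear_def
           fun_eq_iff semi_injective_def dg_modules_def\<close>)
    with g(1) show "g \<in> coboundaries (hom_complex A N J) (n + 1)"
      using c unfolding cohomology_iso_def by blast
  qed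
qed

section \<open>Isomorphisms in cohomology: homotopy invariance and two out of three\<close>

lemma acyclic_modD:
  assumes "acyclic_mod M" "x \<in> mgrade M j" "j = i + 1" "mdiff M j x = 0"
  obtains y where "y \<in> mgrade M i" "x = mdiff M i y"
  using assms by (fastforce simp: acyclic_mod_def)

lemma acyclic_modI:
  assumes "\<And>i x. x \<in> mgrade M (i + 1) \<Longrightarrow> mdiff M (i + 1) x = 0 \<Longrightarrow> \<exists>y\<in>mgrade M i. x = mdiff M i y"
  shows "acyclic_mod M"
  unfolding acyclic_mod_def using assms[of _ "j - 1" for j] by auto

lemma all_shift: "(\<forall>i::int. P (i - 1)) \<longleftrightarrow> (\<forall>i. P i)"
  by (metis add_diff_cancel_right')

text \<open>Reindexed so that every differential goes from degree \<open>i\<close> to degree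
  \<open>i + 1\<close>, which keeps \<open>i - 1\<close> out of the diagram chases.\<close>

lemma cohomology_iso_alt:
  "cohomology_iso M N f \<longleftrightarrow>
     (\<forall>i. \<forall>y\<in>mgrade N (i + 1). mdiff N (i + 1) y = 0 \<longrightarrow>
        (\<exists>x\<in>mgrade M (i + 1). mdiff M (i + 1) x = 0 \<and> (\<exists>w\<in>mgrade N i. y - f (i + 1) x = mdiff N i w))) \<and>
     (\<forall>i. \<forall>x\<in>mgrade M (i + 1). mdiff M (i + 1) x = 0 \<longrightarrow>
        (\<forall>w\<in>mgrade N i. f (i + 1) x = mdiff N i w \<longrightarrow> (\<exists>v\<in>mgrade M i. x = mdiff M i v)))"
  (is "_ \<longleftrightarrow> (\<forall>i. ?A i) \<and> (\<forall>i. ?B i)")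
proof -
  have "cohomology_iso M N f \<longleftrightarrow> (\<forall>i. ?A (i - 1) \<and> ?B (i - 1))"
    unfolding cohomology_iso_def cocycles_def coboundaries_def
    by (rule iff_allI) (simp add: image_iff, blast)
  also have "\<dots> \<longleftrightarrow> (\<forall>i. ?A i \<and> ?B i)"
    by (rule all_shift)
  finally show ?thesis by blast
qed

lemma ciso_surj:
  assumes "cohomology_iso M N f" "y \<in> mgrade N j" "j = i + 1" "mdiff N j y = 0"
  obtains x w where "x \<in> mgrade M j" "mdiff M j x = 0" "w \<in> mgrade N i" "y - f j x = mdiff N i w"
  using assms unfolding cohomology_iso_alt by blast

lemma ciso_inj:
  assumes "cohomology_iso M N f" "x \<in> mgrade M j" "j = i + 1" "mdiff M j x = 0"
    "w \<in> mgrade N i" "f j x = mdiff N i w"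
  obtains v where "v \<in> mgrade M i" "x = mdiff M i v"
  using assms unfolding cohomology_iso_alt by blast

lemma cisoI:
  assumes "\<And>i y. y \<in> mgrade N (i + 1) \<Longrightarrow> mdiff N (i + 1) y = 0 \<Longrightarrow>
        \<exists>x\<in>mgrade M (i + 1). mdiff M (i + 1) x = 0 \<and> (\<exists>w\<in>mgrade N i. y - f (i + 1) x = mdiff N i w)"
    "\<And>i x w. x \<in> mgrade M (i + 1) \<Longrightarrow> mdiff M (i + 1) x = 0 \<Longrightarrow> w \<in> mgrade N i \<Longrightarrow>
        f (i + 1) x = mdiff N i w \<Longrightarrow> \<exists>v\<in>mgrade M i. x = mdiff M i v"
  shows "cohomology_iso M N f"
  unfolding cohomology_iso_alt using assms by blast

lemma homotopic_cocycle:
  assumes "left_dg_module A M" "homotopic_homs A M N f g" "x \<in> mgrade M j" "mdiff M j x = 0" "j = i + 1"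
  obtains w where "w \<in> mgrade N i" "f j x - g j x = mdiff N i w"
proof -
  interpret lmod A M by unfold_locales fact
  obtain h where h: "graded_hom A (-1) M N h" and
   e: "\<forall>i. \<forall>m\<in>mgrade M i. f i m - g i m = mdiff N (i - 1) (h i m) + h (i + 1) (mdiff M i m)"
    using assms(2) by (auto simp: homotopic_homs_def)
  have kl: "k_linear (mscale M) (mgrade M i) (mscale N) (mgrade N (i + -1)) (h i)" for i
    using h by (simp add: graded_hom_def)
  have "h (j + 1) 0 = 0" using k_linear_zero[OF kl] by simp
  moreover have "h j x \<in> mgrade N i" using k_linearD(1)[OF kl assms(3)] assms(5) by simp
  ultimately show ?thesis using that[of "h j x"] e assms(3-5) by fastforce
qed

text \<open>Inverses up to coboundaries, tested on cocycles only. The maps are merely assumed to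
  commute with the differentials, and the two modules may live over different algebras.\<close>

lemma ciso_inverse:
  assumes M: "left_dg_module A M" and N: "left_dg_module B N"
    and f: "\<And>i x. x \<in> mgrade M i \<Longrightarrow> f i x \<in> mgrade N i"
      "\<And>i x. x \<in> mgrade M i \<Longrightarrow> f (i + 1) (mdiff M i x) = mdiff N i (f i x)"
    and g: "\<And>i x. x \<in> mgrade N i \<Longrightarrow> g i x \<in> mgrade M i"
      "\<And>i x. x \<in> mgrade N i \<Longrightarrow> g (i + 1) (mdiff N i x) = mdiff M i (g i x)"
    and gf: "\<And>i x. x \<in> mgrade M (i + 1) \<Longrightarrow> mdiff M (i + 1) x = 0 \<Longrightarrow>
       \<exists>w\<in>mgrade M i. g (i + 1) (f (i + 1) x) - x = mdiff M i w"
    and fg: "\<And>i x. x \<in> mgrade N (i + 1) \<Longrightarrow> mdiff N (i + 1) x = 0 \<Longrightarrow>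
       \<exists>w\<in>mgrade N i. f (i + 1) (g (i + 1) x) - x = mdiff N i w"
  shows "cohomology_iso M N f"
proof -
  interpret M: lmod A M by unfold_locales fact
  interpret N: lmod B N by unfold_locales fact
  \<comment> \<open>\<open>g\<close> is not assumed additive; instead
    \<open>g 0 = g (d 0) = d (g 0)\<close>, and applying this twice gives
    \<open>g 0 = d (d (g 0)) = 0\<close>.\<close>
  have g0: "g (i + 1) 0 = 0" for i
    using M.dd[OF g(1)[of 0 "i - 1"], of i] g(2)[of 0 "i - 1"] g(2)[of 0 i] by simp
  show ?thesis
  proof (rule cisoI)
    fix i y assume y: "y \<in> mgrade N (i + 1)" "mdiff N (i + 1) y = 0"
    obtain w where w: "w\<in>mgrade N i" "f (i + 1) (g (i + 1) y) - y = mdiff N i w" using fg[OF y] by blast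
    have "mdiff M (i + 1) (g (i + 1) y) = g (i + 1 + 1) 0" using g(2)[OF y(1)] y(2) by simp
    then have "mdiff M (i + 1) (g (i + 1) y) = 0" using g0 by metis
    moreover have "y - f (i + 1) (g (i + 1) y) = mdiff N i (- w)" using w by simp (metis minus_diff_eq)
    ultimately show "\<exists>x\<in>mgrade M (i + 1). mdiff M (i + 1) x = 0 \<and> (\<exists>w\<in>mgrade N i. y - f (i + 1) x = mdiff N i w)"
      using g(1)[OF y(1)] w N.neg_mem by blast
  next
    fix i x w assume x: "x \<in> mgrade M (i + 1)" "mdiff M (i + 1) x = 0" and w: "w \<in> mgrade N i"
        "f (i + 1) x = mdiff N i w"
    obtain v where v: "v\<in>mgrade M i" "g (i + 1) (f (i + 1) x) - x = mdiff M i v" using gf[OF x] by blast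
    have "g (i + 1) (f (i + 1) x) = mdiff M i (g i w)" using w g(2) by simp
    then have "x = mdiff M i (g i w - v)" using v w g(1) by (simp add: algebra_simps)
    then show "\<exists>v\<in>mgrade M i. x = mdiff M i v" using v w g(1) by (intro bexI[of _ "g i w - v"]) auto
  qed
qed

lemma homotopy_equiv_ciso:
  assumes "left_dg_module A M" "left_dg_module A N" "dg_hom A M N f" "dg_hom A N M g"
    "homotopic_homs A M M (\<lambda>i x. g i (f i x)) (\<lambda>i x. x)" "homotopic_homs A N N (\<lambda>i x. f i (g i x)) (\<lambda>i x. x)"
  shows "cohomology_iso M N f"
proof -
  interpret f: dghom A M N f using assms by (intro dghomI)
  interpret g: dghom A N M g using assms by (intro dghomI)
  show ?thesis
    by (rule ciso_inverse[OF assms(1,2), of f g])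
       (auto simp: f.comm g.comm elim: homotopic_cocycle[OF assms(1,5)] homotopic_cocycle[OF assms(2,6)])
qed

lemma ciso_comp:
  assumes "left_dg_module A L" "left_dg_module A M" "left_dg_module A N" "dg_hom A L M f" "dg_hom A M N g"
    "cohomology_iso L M f" "cohomology_iso M N g"
  shows "cohomology_iso L N (\<lambda>i x. g i (f i x))"
proof -
  interpret f: dghom A L M f using assms by (intro dghomI)
  interpret g: dghom A M N g using assms by (intro dghomI)
  show ?thesis
  proof (rule cisoI)
    fix i y assume y: "y \<in> mgrade N (i + 1)" "mdiff N (i + 1) y = 0"
    obtain x w where x: "x \<in> mgrade M (i + 1)" "mdiff M (i + 1) x = 0" "w \<in> mgrade N i" "y - g (i + 1) x = mdiff N i w"
      using ciso_surj[OF assms(7) y(1) refl y(2)] .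
    obtain z v where z: "z \<in> mgrade L (i + 1)" "mdiff L (i + 1) z = 0" "v \<in> mgrade M i" "x - f (i + 1) z = mdiff M i v"
      using ciso_surj[OF assms(6) x(1) refl x(2)] .
    have "x = f (i + 1) z + mdiff M i v" using z(4) by (simp add: algebra_simps)
    then have "g (i + 1) x = g (i + 1) (f (i + 1) z) + mdiff N i (g i v)" using z by (simp add: g.comm)
    then have "y - g (i + 1) (f (i + 1) z) = mdiff N i (w + g i v)"
      using x z by (simp add: algebra_simps)
    then show "\<exists>x\<in>mgrade L (i + 1). mdiff L (i + 1) x = 0 \<and>
      (\<exists>w\<in>mgrade N i. y - g (i + 1) (f (i + 1) x) = mdiff N i w)"
      using z x by (intro bexI[of _ z] conjI bexI[of _ "w + g i v"]) auto
  next
    fix i x w assume x: "x \<in> mgrade L (i + 1)" "mdiff L (i + 1) x = 0" and w: "w \<in> mgrade N i"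
        "g (i + 1) (f (i + 1) x) = mdiff N i w"
    have "mdiff M (i + 1) (f (i + 1) x) = 0" using x f.comm[OF x(1) refl] by simp
    then obtain v where v: "v \<in> mgrade M i" "f (i + 1) x = mdiff M i v"
      using ciso_inj[OF assms(7) f.mem0[OF x(1)] refl _ w] by blast
    then show "\<exists>v\<in>mgrade L i. x = mdiff L i v" using ciso_inj[OF assms(6) x(1) refl x(2) v] by metis
  qed
qed

text \<open>Used for a roof whose leg to \<open>M\<close> factors through a resolution of
  \<open>M\<close>: the factor is then a quasi-isomorphism onto the resolution.\<close>

lemma ciso_cancel_left:
  assumes "left_dg_module A L" "left_dg_module A M" "left_dg_module A N" "dg_hom A L M f" "dg_hom A M N g"
    "cohomology_iso L N (\<lambda>i x. g i (f i x))" "cohomology_iso M N g"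
  shows "cohomology_iso L M f"
proof -
  interpret f: dghom A L M f using assms by (intro dghomI)
  interpret g: dghom A M N g using assms by (intro dghomI)
  show ?thesis
  proof (rule cisoI)
    fix i y assume y: "y \<in> mgrade M (i + 1)" "mdiff M (i + 1) y = 0"
    have gy: "g (i + 1) y \<in> mgrade N (i + 1)" "mdiff N (i + 1) (g (i + 1) y) = 0"
      using y g.comm[OF y(1) refl] by auto
    obtain x w where x: "x \<in> mgrade L (i + 1)" "mdiff L (i + 1) x = 0" "w \<in> mgrade N i"
       "g (i + 1) y - g (i + 1) (f (i + 1) x) = mdiff N i w"
      using ciso_surj[OF assms(6) gy(1) refl gy(2)] .
    have fx: "mdiff M (i + 1) (f (i + 1) x) = 0" using x f.comm[OF x(1) refl] by simp
    obtain v where "v \<in> mgrade M i" "y - f (i + 1) x = mdiff M i v"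
      by (rule ciso_inj[OF assms(7), of "y - f (i + 1) x" "i + 1" i w]) (use x y fx in simp_all)
    with x show "\<exists>x\<in>mgrade L (i + 1). mdiff L (i + 1) x = 0 \<and> (\<exists>w\<in>mgrade M i. y - f (i + 1) x = mdiff M i w)"
      by blast
  next
    fix i x w assume x: "x \<in> mgrade L (i + 1)" "mdiff L (i + 1) x = 0" and w: "w \<in> mgrade M i"
        "f (i + 1) x = mdiff M i w"
    show "\<exists>v\<in>mgrade L i. x = mdiff L i v"
      by (rule ciso_inj[OF assms(6) x(1) refl x(2), of "g i w"]) (use w in \<open>auto simp: g.comm\<close>)
  qed
qed

text \<open>The triangle is only required to commute up to homotopy, since extensions into
  K-injective modules (\<open>kinj_extend\<close>) provide no more than that.\<close>

lemma ciso_cancel_right: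
  assumes "left_dg_module A L" "left_dg_module A M" "left_dg_module A N" "dg_hom A L M f" "dg_hom A M N g"
    "dg_hom A L N h" "homotopic_homs A L N (\<lambda>i x. g i (f i x)) h" "cohomology_iso L N h" "cohomology_iso L M f"
  shows "cohomology_iso M N g"
proof -
  interpret f: dghom A L M f using assms by (intro dghomI)
  interpret g: dghom A M N g using assms by (intro dghomI)
  interpret h: dghom A L N h using assms by (intro dghomI)
  show ?thesis
  proof (rule cisoI)
    fix i y assume y: "y \<in> mgrade N (i + 1)" "mdiff N (i + 1) y = 0"
    obtain x w where x: "x \<in> mgrade L (i + 1)" "mdiff L (i + 1) x = 0" "w \<in> mgrade N i" "y - h (i + 1) x = mdiff N i w"
      using ciso_surj[OF assms(8) y(1) refl y(2)] .
    obtain v where v: "v \<in> mgrade N i" "g (i + 1) (f (i + 1) x) - h (i + 1) x = mdiff N i v"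
      using homotopic_cocycle[OF assms(1,7) x(1,2) refl] .
    have "y - g (i + 1) (f (i + 1) x) = (y - h (i + 1) x) - (g (i + 1) (f (i + 1) x) - h (i + 1) x)" by simp
    also have "\<dots> = mdiff N i (w - v)" unfolding x(4) v(2) using x v by simp
    finally have "y - g (i + 1) (f (i + 1) x) = mdiff N i (w - v)" .
    moreover have "mdiff M (i + 1) (f (i + 1) x) = 0" using x f.comm[OF x(1) refl] by simp
    ultimately show "\<exists>x\<in>mgrade M (i + 1). mdiff M (i + 1) x = 0 \<and>
      (\<exists>w\<in>mgrade N i. y - g (i + 1) x = mdiff N i w)"
      using x v by (intro bexI[of _ "f (i + 1) x"] conjI bexI[of _ "w - v"]) auto
  next
    fix i x w assume x: "x \<in> mgrade M (i + 1)" "mdiff M (i + 1) x = 0" and w: "w \<in> mgrade N i"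
        "g (i + 1) x = mdiff N i w"
    obtain y z where y: "y \<in> mgrade L (i + 1)" "mdiff L (i + 1) y = 0" "z \<in> mgrade M i" "x - f (i + 1) y = mdiff M i z"
      using ciso_surj[OF assms(9) x(1) refl x(2)] .
    obtain v where v: "v \<in> mgrade N i" "g (i + 1) (f (i + 1) y) - h (i + 1) y = mdiff N i v"
      using homotopic_cocycle[OF assms(1,7) y(1,2) refl] .
    have fy: "f (i + 1) y = x - mdiff M i z" using y(4) by (simp add: algebra_simps)
    have "g (i + 1) (f (i + 1) y) = mdiff N i (w - g i z)"
      unfolding fy using x w y by (simp add: g.comm)
    then have "h (i + 1) y = mdiff N i (w - g i z - v)" using v w y by (simp add: algebra_simps)
    then obtain e where e: "e \<in> mgrade L i" "y = mdiff L i e"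
      using ciso_inj[OF assms(8) y(1) refl y(2), of "w - g i z - v"] w v y by auto
    have "x = mdiff M i (f i e + z)" using y(4) e y by (simp add: f.comm algebra_simps)
    then show "\<exists>v\<in>mgrade M i. x = mdiff M i v" using e y by (intro bexI[of _ "f i e + z"]) auto
  qed
qed

section \<open>The differential of the Hom complex\<close>

definition hom_d :: "('k, 'a, 'm::ab_group_add) dg_mod \<Rightarrow> ('k, 'a, 'n::ab_group_add) dg_mod \<Rightarrow> int
    \<Rightarrow> (int \<Rightarrow> 'm \<Rightarrow> 'n) \<Rightarrow> int \<Rightarrow> 'm \<Rightarrow> 'n" where
  "hom_d M N n f i m = mdiff N (i + n) (f i m) - ksign n (f (i + 1) (mdiff M i m))"

lemma null_hom_alt: "null_hom A n M N f \<longleftrightarrow>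
   (\<exists>h. graded_hom A n M N h \<and> (\<forall>i. \<forall>m\<in>mgrade M i. f i m = hom_d M N n h i m))"
  by (simp add: null_hom_def hom_d_def)

lemma chain_hom_alt: 
  "chain_hom A n M N f \<longleftrightarrow> graded_hom A n M N f \<and> (\<forall>i. \<forall>m\<in>mgrade M i. hom_d M N n f i m = 0)"
  by (simp add: chain_hom_def hom_d_def)

context ghom
begin

lemma graded_hom_d:
  assumes "dga A"
  shows "graded_hom A (n + 1) M N (hom_d M N n f)"
proof (rule graded_homI)
  interpret dga A by fact
  fix p i a x assume a: "a \<in> agrade A p" and x: "x \<in> mgrade M i"
  have 1: "f (p + i) (lact M p i a x) = ksign (n * p) (lact N p (i + n) a (f i x))"
    by (rule act[OF a x])
  have 2: "f (p + i + 1) (lact M p (i + 1) a (mdiff M i x)) = ksign (n * p) (lact N p (i + n + 1) a (f (i + 1) (mdiff M i x)))"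
    using act[OF a, of "mdiff M i x" "i + 1"] x by (simp add: ac_simps)
  have 3: "f (p + i + 1) (lact M (p + 1) i (adiff A p a) x) = ksign (n * (p + 1)) (lact N (p + 1) (i + n) (adiff A p a) (f i x))"
    using act[OF R.d_mem[OF a refl] x] by (simp add: ac_simps)
  have 4: "mdiff N (p + i + n) (lact N p (i + n) a (f i x)) =
      lact N (p + 1) (i + n) (adiff A p a) (f i x) + ksign p (lact N p (i + n + 1) a (mdiff N (i + n) (f i x)))"
    using T.leibniz[OF a, of "f i x" "i + n"] x by (simp add: ac_simps)
  show "hom_d M N n f (p + i) (lact M p i a x) =
     ksign ((n + 1) * p) (lact N p (i + (n + 1)) a (hom_d M N n f i x))"
    using a x unfolding hom_d_def 1 S.leibniz[OF a x]
    by (simp add: 1 2 3 4 ksign_add ksign_diff add.assoc[symmetric])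
       (cases "even p"; cases "even n"; simp add: ksign_if algebra_simps)
qed (simp_all add: hom_d_def ksign_add S.V.scale_ksign T.V.scale_ksign T.V.scale_right_diff_distrib ac_simps)

lemma hom_d_hom_d: "x \<in> mgrade M i \<Longrightarrow> hom_d M N (n + 1) (hom_d M N n f) i x = 0"
  by (simp add: hom_d_def ksign_diff ac_simps) (simp add: ksign_if)

end

lemma graded_hom_diff:
  assumes "left_dg_module A N" "graded_hom A n M N f" "graded_hom A n M N g"
  shows "graded_hom A n M N (\<lambda>i x. f i x - g i x)"
proof -
  interpret N: lmod A N by unfold_locales fact
  have f: "k_linear (mscale M) (mgrade M i) (mscale N) (mgrade N (i + n)) (f i)"
    "k_linear (mscale M) (mgrade M i) (mscale N) (mgrade N (i + n)) (g i)" for i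
    using assms by (auto simp: graded_hom_def)
  show ?thesis
    by (rule graded_homI)
      (use assms(2,3) k_linearD[OF f(1)] k_linearD[OF f(2)] in
       \<open>simp_all add: graded_hom_def N.V.scale_right_diff_distrib ksign_diff\<close>)
qed

lemma graded_hom_add:
  assumes "left_dg_module A N" "graded_hom A n M N f" "graded_hom A n M N g"
  shows "graded_hom A n M N (\<lambda>i x. f i x + g i x)"
proof -
  interpret N: lmod A N by unfold_locales fact
  have f: "k_linear (mscale M) (mgrade M i) (mscale N) (mgrade N (i + n)) (f i)"
    "k_linear (mscale M) (mgrade M i) (mscale N) (mgrade N (i + n)) (g i)" for i
    using assms by (auto simp: graded_hom_def)
  show ?thesis
    by (rule graded_homI)
      (use assms(2,3) k_linearD[OF f(1)] k_linearD[OF f(2)] in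
       \<open>simp_all add: graded_hom_def N.V.scale_right_distrib ksign_add\<close>)
qed

lemma graded_hom_comp:
  assumes "left_dg_module A M" "left_dg_module A N" "left_dg_module A L"
    "graded_hom A n M N f" "graded_hom A m N L g"
  shows "graded_hom A (n + m) M L (\<lambda>i x. g (i + n) (f i x))"
proof -
  interpret f: ghom A M N n f using assms by (intro ghomI)
  interpret g: ghom A N L m g using assms by (intro ghomI)
  show ?thesis
  proof (rule graded_homI)
    fix p i a x assume a: "a \<in> agrade A p" and x: "x \<in> mgrade M i"
    have "lact N p (i + n) a (f i x) \<in> mgrade N (p + (i + n))" using a x by simp
    then show "g (p + i + n) (f (p + i) (lact M p i a x)) = ksign ((n + m) * p) (lact L p (i + (n + m)) a (g (i + n) (f i x)))"
      using f.act[OF a x] g.act[OF a, of "f i x" "i + n"] x by (simp add: algebra_simps)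
  qed (simp_all add: ac_simps)
qed

text \<open>Changing \<open>f\<close> by a coboundary alters neither hypothesis nor conclusion. With
  a suitable \<open>k\<close>, a map out of or into a cone is thereby made to vanish on one of the
  two summands.\<close>

lemma null_hom_minus_boundary:
  assumes A: "dga A" and M: "left_dg_module A M" and N: "left_dg_module A N"
    and f: "chain_hom A (n + 1) M N f" and k: "graded_hom A n M N k"
  shows "chain_hom A (n + 1) M N (\<lambda>i x. f i x - hom_d M N n k i x)"
    and "null_hom A n M N (\<lambda>i x. f i x - hom_d M N n k i x) \<Longrightarrow> null_hom A n M N f"
proof -
  interpret k: ghom A M N n k using assms by (intro ghomI)
  interpret d: ghom A M N "n + 1" "hom_d M N n k" using assms k.graded_hom_d by (intro ghomI)
  interpret f: ghom A M N "n + 1" f using assms by (intro ghomI) (auto simp: chain_hom_def)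
  have 1: "hom_d M N (n + 1) (\<lambda>i x. f i x - hom_d M N n k i x) i x = hom_d M N (n + 1) f i x - hom_d M N (n + 1) (hom_d M N n k) i x"
    if "x \<in> mgrade M i" for i x
    using that unfolding hom_d_def[of _ _ "n + 1"] by (simp add: ksign_diff)
  then show "chain_hom A (n + 1) M N (\<lambda>i x. f i x - hom_d M N n k i x)"
    using f k.hom_d_hom_d graded_hom_diff[OF N f.hom d.hom] by (simp add: chain_hom_alt)
  assume "null_hom A n M N (\<lambda>i x. f i x - hom_d M N n k i x)"
  then obtain h where h: "graded_hom A n M N h" "\<And>i x. x \<in> mgrade M i \<Longrightarrow> f i x - hom_d M N n k i x = hom_d M N n h i x"
    by (auto simp: null_hom_alt)
  interpret h: ghom A M N n h using M N h by (intro ghomI)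
  show "null_hom A n M N f"
    unfolding null_hom_alt
  proof (intro exI conjI allI ballI)
    show "graded_hom A n M N (\<lambda>i x. h i x + k i x)" by (rule graded_hom_add[OF N h(1) k])
    show "f i x = hom_d M N n (\<lambda>i x. h i x + k i x) i x" if "x \<in> mgrade M i" for i x
      using h(2)[OF that] that by (simp add: hom_d_def ksign_add algebra_simps)
  qed
qed

context univ
begin

lemma pr_0_ksign: "pr 0 (ksign n y) = ksign n (pr 0 y)" and pr_ksign_0: "pr (ksign n y) 0 = ksign n (pr y 0)"
  using pr_ksign[of n 0 y] pr_ksign[of n y 0] by simp_all

lemma pr_0_add: "pr 0 (x + y) = pr 0 x + pr 0 y" and pr_add_0: "pr (x + y) 0 = pr x 0 + pr y 0"
  using pr_add[of 0 0 x y] pr_add[of x y 0 0] by simp_all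

lemma pr_0_scale: "pr 0 (u c y) = u c (pr 0 y)" and pr_scale_0: "pr (u c y) 0 = u c (pr y 0)"
  using pr_scale[of c 0 y] pr_scale[of c y 0] by simp_all

end

section \<open>Cones inherit K-projectivity and K-injectivity\<close>

context cone
begin

lemma inl_hom: "graded_hom A 0 X G (\<lambda>i x. pr x 0)"
  by (rule graded_homI) (auto simp: pr_add_0 pr_scale_0)

lemma inl_dg_hom: "dg_hom A X G (\<lambda>i x. pr x 0)"
  by (rule dg_homI[OF inl_hom]) simp

text \<open>Only \<open>X\<close> is a DG submodule of the cone and only the shift of
  \<open>Y\<close> is a quotient. This inclusion and the projection onto \<open>X\<close> are graded
  maps, which fail to commute with \<open>d\<close> as soon as \<open>\<tau>\<close> is
  nonzero.\<close>

lemma inr_hom: "graded_hom A (- s) Y G (\<lambda>i. pr 0)"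
  by (rule graded_homI) (auto simp: pr_0_add pr_0_scale pr_0_ksign)

lemma prl_hom: "graded_hom A 0 G X (\<lambda>i. p1)"
  by (rule graded_homI) (auto elim!: GE simp: p1_add p1_scale)

lemma prr_hom: "graded_hom A s G Y (\<lambda>i. p2)"
  by (rule graded_homI) (auto elim!: GE simp: p2_add p2_scale)

text \<open>A nullhomotopy on the submodule \<open>X\<close> is extended by zero and its coboundary
  subtracted. What remains vanishes on \<open>X\<close>, hence factors through the shift of
  \<open>Y\<close>, where K-projectivity of \<open>Y\<close> applies.\<close>

lemma kproj_cone:
  assumes kX: "kproj u A X" and kY: "kproj u A Y"
  shows "kproj u A G"
  unfolding kproj_def
proof (intro ballI impI allI)
  fix N n f assume N: "N \<in> dg_modules u A" and ac: "acyclic_mod N" and f0: "chain_hom A (n + 1) G N f"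
  have A: "dga A" by unfold_locales
  have Nm: "left_dg_module A N" using N by (simp add: dg_modules_def)
  interpret N: lmod A N using Nm by unfold_locales
  have scN [simp]: "mscale N = u" using N by (simp add: dg_modules_def)
  \<comment> \<open>The case of a map that factors through the quotient of the cone by
    \<open>X\<close>.\<close>
  have case0: "null_hom A n G N f" if f: "chain_hom A (n + 1) G N f"
     and vanish: "\<And>i x. x \<in> mgrade X i \<Longrightarrow> f i (pr x 0) = 0" for f
  proof -
    interpret f: ghom A G N "n + 1" f using f by unfold_locales (simp add: chain_hom_def)
    have fd: "mdiff N (i + (n + 1)) (f i m) = ksign (n + 1) (f (i + 1) (mdiff G i m))" if "m \<in> mgrade G i" for i m
      using f that by (simp add: chain_hom_def)
    have fpr: "f i (pr x y) = f i (pr 0 y)" if "x \<in> mgrade X i" "y \<in> mgrade Y (i + s)" for i x y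
      using f.add[of "pr x 0" i "pr 0 y"] that by (simp add: pr_add[symmetric] vanish)
    have "chain_hom A (n - s + 1) Y N (\<lambda>j y. f (j - s) (pr 0 y))"
      unfolding chain_hom_def
    proof (intro conjI allI ballI)
      have e: "- s + (n + 1) = n - s + 1" by simp
      show "graded_hom A (n - s + 1) Y N (\<lambda>j y. f (j - s) (pr 0 y))"
        using graded_hom_comp[OF Y.mod G.mod N.mod inr_hom f.hom] unfolding e by simp
      show "mdiff N (i + (n - s + 1)) (f (i - s) (pr 0 m)) = ksign (n - s + 1) (f (i + 1 - s) (pr 0 (mdiff Y i m)))"
        if "m \<in> mgrade Y i" for i m
        using fd[of "pr 0 m" "i - s"] that fpr[of "\<tau> (i - s) m" "i - s + 1" "ksign s (mdiff Y i m)"]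
        by (simp add: pr_0_ksign algebra_simps) (simp add: ksign_if)
    qed
    then obtain h where h: "graded_hom A (n - s) Y N h"
      and he: "\<And>i y. y \<in> mgrade Y i \<Longrightarrow> f (i - s) (pr 0 y) = mdiff N (i + (n - s)) (h i y) - ksign (n - s) (h (i + 1) (mdiff Y i y))"
      using kY N ac unfolding kproj_def null_hom_def by blast
    interpret h: ghom A Y N "n - s" h using h by unfold_locales
    show ?thesis
      unfolding null_hom_def
    proof (intro exI conjI allI ballI)
      show "graded_hom A n G N (\<lambda>i w. h (i + s) (p2 w))"
        using graded_hom_comp[OF G.mod Y.mod N.mod prr_hom h.hom] by simp
      fix i m assume "m \<in> mgrade G i"
      then obtain x y where m: "m = pr x y" "x \<in> mgrade X i" "y \<in> mgrade Y (i + s)" by (rule GE)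
      then show "f i m = mdiff N (i + n) (h (i + s) (p2 m)) - ksign n (h (i + 1 + s) (p2 (mdiff G i m)))"
        using fpr[OF m(2,3)] he[OF m(3)] by (simp add: algebra_simps) (simp add: ksign_if)
    qed
  qed
  interpret f: ghom A G N "n + 1" f using f0 by unfold_locales (simp add: chain_hom_def)
  have "chain_hom A (n + 1) X N (\<lambda>i x. f i (pr x 0))"
    unfolding chain_hom_def
  proof (intro conjI allI ballI)
    show "graded_hom A (n + 1) X N (\<lambda>i x. f i (pr x 0))"
      using graded_hom_comp[OF X.mod G.mod N.mod inl_hom f.hom] by simp
    show "mdiff N (i + (n + 1)) (f i (pr m 0)) = ksign (n + 1) (f (i + 1) (pr (mdiff X i m) 0))"
      if "m \<in> mgrade X i" for i m
      using f0 that unfolding chain_hom_def by (metis G_sel(2,4) Y.d_zero Y.zero_mem add.right_neutral ksign_zero t_zero)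
  qed
  then obtain h where h: "graded_hom A n X N h"
    and he: "\<And>i m. m \<in> mgrade X i \<Longrightarrow> f i (pr m 0) = mdiff N (i + n) (h i m) - ksign n (h (i + 1) (mdiff X i m))"
    using kX N ac unfolding kproj_def null_hom_def by blast
  interpret h: ghom A X N n h using h by unfold_locales
  \<comment> \<open>The extension by zero need not be compatible with \<open>d\<close>, but it is a
    graded homomorphism, and that suffices for subtracting its coboundary.\<close>
  define k where "k = (\<lambda>i w. h i (p1 w))"
  have k: "graded_hom A n G N k"
    using graded_hom_comp[OF G.mod X.mod N.mod prl_hom h.hom] by (simp add: k_def)
  show "null_hom A n G N f"
  proof (rule null_hom_minus_boundary(2)[OF A G.mod N.mod f0 k], rule case0)
    show "chain_hom A (n + 1) G N (\<lambda>i x. f i x - hom_d G N n k i x)"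
      by (rule null_hom_minus_boundary(1)[OF A G.mod N.mod f0 k])
    show "f i (pr x 0) - hom_d G N n k i (pr x 0) = 0" if "x \<in> mgrade X i" for i x
      using he[OF that] by (simp add: hom_d_def k_def)
  qed
qed

text \<open>Dual to \<open>kproj_cone\<close>: first the component in the quotient is made zero by a
  graded lift of a nullhomotopy, then the map lands in the submodule \<open>X\<close>.\<close>

lemma kinj_cone:
  assumes kX: "kinj u A X" and kY: "kinj u A Y"
  shows "kinj u A G"
  unfolding kinj_def
proof (intro ballI impI allI)
  fix N n f assume N: "N \<in> dg_modules u A" and ac: "acyclic_mod N" and f0: "chain_hom A (n + 1) N G f"
  have A: "dga A" by unfold_locales
  have Nm: "left_dg_module A N" using N by (simp add: dg_modules_def)
  interpret N: lmod A N using Nm by unfold_locales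
  have scN [simp]: "mscale N = u" using N by (simp add: dg_modules_def)
  have case0: "null_hom A n N G f" if f: "chain_hom A (n + 1) N G f"
     and vanish: "\<And>i x. x \<in> mgrade N i \<Longrightarrow> p2 (f i x) = 0" for f
  proof -
    interpret f: ghom A N G "n + 1" f using f by unfold_locales (simp add: chain_hom_def)
    have fpr: "f i x = pr (p1 (f i x)) 0 \<and> p1 (f i x) \<in> mgrade X (i + n + 1)" if "x \<in> mgrade N i" for i x
      using f.mem[OF that refl] vanish[OF that] by (auto elim!: GE simp: ac_simps)
    have "chain_hom A (n + 1) N X (\<lambda>i x. p1 (f i x))"
      unfolding chain_hom_def
    proof (intro conjI allI ballI)
      show "graded_hom A (n + 1) N X (\<lambda>i x. p1 (f i x))"
        using graded_hom_comp[OF N.mod G.mod X.mod f.hom prl_hom] by simp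
      show "mdiff X (i + (n + 1)) (p1 (f i m)) = ksign (n + 1) (p1 (f (i + 1) (mdiff N i m)))"
        if "m \<in> mgrade N i" for i m
      proof -
        have "mdiff G (i + (n + 1)) (f i m) = ksign (n + 1) (f (i + 1) (mdiff N i m))"
          using f that by (simp add: chain_hom_def)
        moreover have "mdiff G (i + (n + 1)) (f i m) = pr (mdiff X (i + (n + 1)) (p1 (f i m))) 0"
          using fpr[OF that] G_sel(2)[of "i + (n + 1)" "p1 (f i m)" 0] by simp
        ultimately show ?thesis by (metis p1_ksign p1_pr)
      qed
    qed
    then obtain h where h: "graded_hom A n N X h"
      and he: "\<And>i y. y \<in> mgrade N i \<Longrightarrow> p1 (f i y) = mdiff X (i + n) (h i y) - ksign n (h (i + 1) (mdiff N i y))"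
      using kX N ac unfolding kinj_def null_hom_def by blast
    interpret h: ghom A N X n h using h by unfold_locales
    show ?thesis
      unfolding null_hom_def
    proof (intro exI conjI allI ballI)
      show "graded_hom A n N G (\<lambda>i w. pr (h i w) 0)"
        using graded_hom_comp[OF N.mod X.mod G.mod h.hom inl_hom] by simp
      show "f i m = mdiff G (i + n) (pr (h i m) 0) - ksign n (pr (h (i + 1) (mdiff N i m)) 0)"
        if "m \<in> mgrade N i" for i m
        using fpr[OF that] he[OF that] by (simp add: pr_ksign_0[symmetric] pr_diff[symmetric])
    qed
  qed
  interpret f: ghom A N G "n + 1" f using f0 by unfold_locales (simp add: chain_hom_def)
  have "chain_hom A (n + s + 1) N Y (\<lambda>i x. p2 (f i x))"
    unfolding chain_hom_def
  proof (intro conjI allI ballI)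
    show "graded_hom A (n + s + 1) N Y (\<lambda>i x. p2 (f i x))"
      using graded_hom_comp[OF N.mod G.mod Y.mod f.hom prr_hom] by (simp add: ac_simps)
    show "mdiff Y (i + (n + s + 1)) (p2 (f i m)) = ksign (n + s + 1) (p2 (f (i + 1) (mdiff N i m)))"
      if m': "m \<in> mgrade N i" for i m
    proof -
      have 1: "mdiff G (i + (n + 1)) (f i m) = ksign (n + 1) (f (i + 1) (mdiff N i m))"
        using f0 m' by (simp add: chain_hom_def)
      obtain x y where m: "f i m = pr x y" "x \<in> mgrade X (i + (n + 1))" "y \<in> mgrade Y (i + (n + 1) + s)"
        using f.mem[OF m' refl] by (rule GE)
      have "ksign s (mdiff Y (i + (n + 1) + s) y) = ksign (n + 1) (p2 (f (i + 1) (mdiff N i m)))"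
        using arg_cong[OF 1, of p2] m by (simp add: p2_ksign)
      then have "ksign s (ksign s (mdiff Y (i + (n + 1) + s) y)) = ksign s (ksign (n + 1) (p2 (f (i + 1) (mdiff N i m))))"
        by simp
      then show ?thesis using m by (simp add: algebra_simps) (simp add: ksign_if)
    qed
  qed
  then obtain h where h: "graded_hom A (n + s) N Y h"
    and he: "\<And>i m. m \<in> mgrade N i \<Longrightarrow> p2 (f i m) = mdiff Y (i + (n + s)) (h i m) - ksign (n + s) (h (i + 1) (mdiff N i m))"
    using kY N ac unfolding kinj_def null_hom_def by blast
  interpret h: ghom A N Y "n + s" h using h by unfold_locales
  \<comment> \<open>The sign compensates the factor \<open>(-1)^s\<close> in the differential of the
    shifted summand.\<close>
  define k where "k = (\<lambda>i x. ksign s (pr 0 (h i x)))"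
  have k: "graded_hom A n N G k"
  proof -
    have "graded_hom A n N G (\<lambda>i x. pr 0 (h i x))"
      using graded_hom_comp[OF N.mod Y.mod G.mod h.hom inr_hom] by simp
    then interpret K: ghom A N G n "\<lambda>i x. pr 0 (h i x)" by unfold_locales
    show ?thesis unfolding k_def
      by (rule graded_homI) (simp_all add: ksign_add pr_0_add U.scale_ksign K.act ac_simps K.scale[unfolded scN] del: G_sel(3,4))
  qed
  show "null_hom A n N G f"
  proof (rule null_hom_minus_boundary(2)[OF A N.mod G.mod f0 k], rule case0)
    show "chain_hom A (n + 1) N G (\<lambda>i x. f i x - hom_d N G n k i x)"
      by (rule null_hom_minus_boundary(1)[OF A N.mod G.mod f0 k])
    show "p2 (f i x - hom_d N G n k i x) = 0" if "x \<in> mgrade N i" for i x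
      using he[OF that] that by (simp add: hom_d_def k_def p2_diff p2_ksign pr_0_ksign[symmetric] algebra_simps)
        (simp add: ksign_if p2_add)
  qed
qed

end

lemma ksign_double [simp]: "ksign (2 * n) x = x" "ksign (n + n) x = x"
  by (simp_all add: ksign_def)

text \<open>The five lemma for the extension of a shift of \<open>Y\<close> by \<open>X\<close>, as
  a chase of elements; \<open>comm\<close> says that \<open>f\<close> and \<open>g\<close> form a
  map of cones.\<close>

lemma cone_five:
  assumes "cone A u X Y s \<tau>" "cone A u X' Y' s \<tau>'" "dg_hom A X X' f" "dg_hom A Y Y' g"
    and fc: "cohomology_iso X X' f" and gc: "cohomology_iso Y Y' g"
    and comm: "\<And>i y. y \<in> mgrade Y (i + s) \<Longrightarrow> \<tau>' i (g (i + s) y) = f (i + 1) (\<tau> i y)"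
  shows "cohomology_iso (univ.gcone u X Y s \<tau>) (univ.gcone u X' Y' s \<tau>')
     (\<lambda>i w. univ.pr u (f i (univ.p1 u w)) (g (i + s) (univ.p2 u w)))"
proof -
  interpret C: cone A u X Y s \<tau> by fact
  interpret C': cone A u X' Y' s \<tau>' by fact
  interpret f: dghom A X X' f using assms by (intro dghomI) (auto simp: C.X.mod C'.X.mod)
  interpret g: dghom A Y Y' g using assms by (intro dghomI) (auto simp: C.Y.mod C'.Y.mod)
  show ?thesis
  proof (rule cisoI)
    fix i y assume "y \<in> mgrade C'.G (i + 1)" "mdiff C'.G (i + 1) y = 0"
    then obtain x' y' where xy: "y = C.pr x' y'" "x' \<in> mgrade X' (i + 1)" "y' \<in> mgrade Y' (i + 1 + s)"
      and d: "mdiff X' (i + 1) x' + \<tau>' (i + 1) y' = 0" "mdiff Y' (i + 1 + s) y' = 0"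
      by (auto elim!: C'.GE)
    obtain y1 \<eta> where y1: "y1 \<in> mgrade Y (i + 1 + s)" "mdiff Y (i + 1 + s) y1 = 0" "\<eta> \<in> mgrade Y' (i + s)"
        "y' - g (i + 1 + s) y1 = mdiff Y' (i + s) \<eta>"
      using ciso_surj[OF gc xy(3), of "i + s"] d(2) by auto
    define e where "e = ksign s \<eta>"
    have e: "e \<in> mgrade Y' (i + s)" "mdiff Y' (i + s) e = ksign s (y' - g (i + 1 + s) y1)"
      using y1 by (auto simp: e_def)
    have y1': "y1 \<in> mgrade Y ((i + 1) + s)" using y1 by simp
    have t1: "\<tau> (i + 1) y1 \<in> mgrade X (i + 1 + 1)" using y1 by simp
    have t2: "mdiff X (i + 1 + 1) (\<tau> (i + 1) y1) = 0" using C.t_d[of y1 "i + 1"] y1 by simp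
    \<comment> \<open>Subtracting the coboundary of \<open>pr 0 e\<close> turns the given cocycle
      \<open>pr x' y'\<close> into \<open>pr x'' (g y1)\<close>, so its second component now lies in
      the image of \<open>g\<close>.\<close>
    define x'' where "x'' = x' - \<tau>' i e"
    have x'': "x'' \<in> mgrade X' (i + 1)" using xy e by (simp add: x''_def)
    have "mdiff X' (i + 1) (\<tau>' i e) = - ksign s (\<tau>' (i + 1) (ksign s (y' - g (i + 1 + s) y1)))"
      using C'.t_d[OF e(1)] e(2) by simp
    also have "\<dots> = - (\<tau>' (i + 1) y' - \<tau>' (i + 1) (g (i + 1 + s) y1))"
      using xy(3) y1(1) by simp
    finally have "mdiff X' (i + 1) (\<tau>' i e) = \<tau>' (i + 1) (g (i + 1 + s) y1) - \<tau>' (i + 1) y'" by simp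
    moreover have "mdiff X' (i + 1) x' = - \<tau>' (i + 1) y'" using d(1) by (simp add: eq_neg_iff_add_eq_0)
    ultimately have "mdiff X' (i + 1) x'' = - \<tau>' (i + 1) (g (i + 1 + s) y1)"
      using xy(2) e(1) by (simp add: x''_def)
    then have dx'': "mdiff X' (i + 1) x'' = - f (i + 1 + 1) (\<tau> (i + 1) y1)" using comm[OF y1'] by simp
    then have "f (i + 1 + 1) (\<tau> (i + 1) y1) = mdiff X' (i + 1) (- x'')" using x'' by simp
    \<comment> \<open>The obstruction \<open>\<tau> y1\<close> to completing \<open>y1\<close> to a
      cocycle of the source cone becomes a boundary under \<open>f\<close>, hence is one already;
      \<open>pr (- \<xi>) y1\<close> is then a cocycle.\<close>
    then obtain \<xi> where \<xi>: "\<xi> \<in> mgrade X (i + 1)" "\<tau> (i + 1) y1 = mdiff X (i + 1) \<xi>"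
      using ciso_inj[OF fc t1 refl t2, of "- x''"] x'' by auto
    have "x'' + f (i + 1) \<xi> \<in> mgrade X' (i + 1)" "mdiff X' (i + 1) (x'' + f (i + 1) \<xi>) = 0"
      using x'' \<xi> dx'' f.comm[OF \<xi>(1) refl] by simp_all
    then obtain \<zeta> w where \<zeta>: "\<zeta> \<in> mgrade X (i + 1)" "mdiff X (i + 1) \<zeta> = 0" "w \<in> mgrade X' i"
       "x'' + f (i + 1) \<xi> - f (i + 1) \<zeta> = mdiff X' i w"
      using ciso_surj[OF fc] by blast
    show "\<exists>x\<in>mgrade C.G (i + 1). mdiff C.G (i + 1) x = 0 \<and>
       (\<exists>w\<in>mgrade C'.G i. y - C.pr (f (i + 1) (C.p1 x)) (g (i + 1 + s) (C.p2 x)) = mdiff C'.G i w)"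
    proof (rule bexI[of _ "C.pr (\<zeta> - \<xi>) y1"], rule conjI[OF _ bexI[of _ "C.pr w e"]])
      show "mdiff C.G (i + 1) (C.pr (\<zeta> - \<xi>) y1) = 0"
        using \<zeta> \<xi> y1 by simp
      have "x' - f (i + 1) (\<zeta> - \<xi>) = mdiff X' i w + \<tau>' i e"
        using \<zeta>(4)[symmetric] \<zeta> \<xi> by (simp add: x''_def)
      then show "y - C.pr (f (i + 1) (C.p1 (C.pr (\<zeta> - \<xi>) y1))) (g (i + 1 + s) (C.p2 (C.pr (\<zeta> - \<xi>) y1))) =
        mdiff C'.G i (C.pr w e)"
        using e xy by (simp add: C.pr_diff[symmetric])
    qed (use \<zeta> \<xi> y1 e in auto)
  next
    fix i w1 w2 assume w1: "w1 \<in> mgrade C.G (i + 1)" "mdiff C.G (i + 1) w1 = 0" and w2: "w2 \<in> mgrade C'.G i"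
      and eq: "C.pr (f (i + 1) (C.p1 w1)) (g (i + 1 + s) (C.p2 w1)) = mdiff C'.G i w2"
    obtain x y where xy: "w1 = C.pr x y" "x \<in> mgrade X (i + 1)" "y \<in> mgrade Y (i + 1 + s)" using w1 by (auto elim: C.GE)
    have dxy: "mdiff X (i + 1) x + \<tau> (i + 1) y = 0" "mdiff Y (i + 1 + s) y = 0" using w1 xy by auto
    obtain x' y' where xy': "w2 = C.pr x' y'" "x' \<in> mgrade X' i" "y' \<in> mgrade Y' (i + s)" using w2 by (auto elim: C'.GE)
    have eqs: "f (i + 1) x = mdiff X' i x' + \<tau>' i y'" "g (i + 1 + s) y = ksign s (mdiff Y' (i + s) y')"
      using eq xy xy' by auto
    obtain \<eta> where \<eta>: "\<eta> \<in> mgrade Y (i + s)" "y = mdiff Y (i + s) \<eta>"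
      using ciso_inj[OF gc xy(3) _ dxy(2), of "i + s" "ksign s y'"] eqs(2) xy' by auto
    define e where "e = ksign s \<eta>"
    have e: "e \<in> mgrade Y (i + s)" "mdiff Y (i + s) e = ksign s y" using \<eta> by (auto simp: e_def)
    define x1 where "x1 = x - \<tau> i e"
    have x1: "x1 \<in> mgrade X (i + 1)" using xy e by (simp add: x1_def)
    have "mdiff X (i + 1) (\<tau> i e) = - ksign s (\<tau> (i + 1) (ksign s y))" using C.t_d[OF e(1)] e by simp
    then have "mdiff X (i + 1) (\<tau> i e) = - \<tau> (i + 1) y" using xy by simp
    then have dx1: "mdiff X (i + 1) x1 = 0" using dxy xy e by (simp add: x1_def)
    have "mdiff Y' (i + s) (y' - g (i + s) e) = mdiff Y' (i + s) y' - ksign s (g (i + 1 + s) y)"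
      using g.comm[OF e(1), of "i + 1 + s"] xy xy' e by simp
    also have "\<dots> = 0" unfolding eqs(2) by simp
    finally have cy: "mdiff Y' (i + s) (y' - g (i + s) e) = 0" .
    \<comment> \<open>The boundary of \<open>pr 0 e\<close> has the right second component, but
      \<open>e\<close> is determined only up to cocycles. The correction \<open>y1\<close> makes
      \<open>g (e + y1)\<close> differ from \<open>y'\<close> by a boundary, after which injectivity
      of \<open>f\<close> in cohomology applies to the first component.\<close>
    obtain y1 \<eta>1 where y1: "y1 \<in> mgrade Y (i + s)" "mdiff Y (i + s) y1 = 0" "\<eta>1 \<in> mgrade Y' (i - 1 + s)"
        "y' - g (i + s) e - g (i + s) y1 = mdiff Y' (i - 1 + s) \<eta>1"
      by (rule ciso_surj[OF gc, of "y' - g (i + s) e" "i + s" "i - 1 + s"]) (use cy xy' e in auto)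
    have y'e: "y' = g (i + s) e + g (i + s) y1 + mdiff Y' (i - 1 + s) \<eta>1" using y1(4) by (simp add: algebra_simps)
    have t: "\<tau>' i (mdiff Y' (i - 1 + s) \<eta>1) = - ksign s (mdiff X' i (\<tau>' (i - 1) \<eta>1))"
      using C'.t_d[OF y1(3)] by simp
    have "f (i + 1) (x1 - \<tau> i y1) = f (i + 1) x - \<tau>' i (g (i + s) e) - \<tau>' i (g (i + s) y1)"
      using xy e y1 by (simp add: x1_def comm)
    also have "\<dots> = mdiff X' i (x' - ksign s (\<tau>' (i - 1) \<eta>1))"
      unfolding eqs y'e using y1 e xy' by (simp add: t)
    finally have fe: "f (i + 1) (x1 - \<tau> i y1) = mdiff X' i (x' - ksign s (\<tau>' (i - 1) \<eta>1))" .
    have "mdiff X (i + 1) (x1 - \<tau> i y1) = 0" using C.t_d[OF y1(1)] y1 dx1 x1 by simp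
    then obtain \<xi> where \<xi>: "\<xi> \<in> mgrade X i" "x1 - \<tau> i y1 = mdiff X i \<xi>"
      using ciso_inj[OF fc _ refl _ _ fe] x1 y1 xy' by auto
    have x: "x = mdiff X i \<xi> + \<tau> i (y1 + e)" using \<xi>(2) y1 e by (simp add: x1_def algebra_simps)
    show "\<exists>v\<in>mgrade C.G i. w1 = mdiff C.G i v"
    proof (intro bexI[of _ "C.pr \<xi> (y1 + e)"])
      have "y = ksign s (mdiff Y (i + s) (y1 + e))" using y1 e by simp
      then show "w1 = mdiff C.G i (C.pr \<xi> (y1 + e))" using xy x by simp
    qed (use \<xi> y1 e in auto)
  qed
qed

section \<open>Cones of chain maps: lifting, extending and inverting up to homotopy\<close>

context dgu
begin

abbreviation "mcone X Y f \<equiv> gcone X Y 1 (\<lambda>i. f (i + 1))"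

lemma mcone:
  assumes "X \<in> dg_modules u A" "Y \<in> dg_modules u A" "dg_hom A Y X f"
  shows "cone A u X Y 1 (\<lambda>i. f (i + 1))"
proof (rule coneI[OF assms(1,2)])
  have X: "left_dg_module A X" "mscale X = u" and Y: "left_dg_module A Y" "mscale Y = u"
    using assms by (auto simp: dg_modules_def)
  interpret f: dghom A Y X f using assms X Y by (intro dghomI)
  show "twisting A X Y 1 (\<lambda>i. f (i + 1))"
    unfolding twisting_def
  proof (intro conjI allI ballI)
    fix p i a y assume "a \<in> agrade A p" "y \<in> mgrade Y (i + 1)"
    then show "f (p + i + 1) (lact Y p (i + 1) a y) = ksign (p * (1 + 1)) (lact X p (i + 1) a (f (i + 1) y))"
      using f.act0[of a p y "i + 1"] by (simp add: ksign_if ac_simps)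
  next
    fix i y assume "y \<in> mgrade Y (i + 1)"
    then show "mdiff X (i + 1) (f (i + 1) y) = - ksign 1 (f (i + 1 + 1) (mdiff Y (i + 1) y))"
      using f.comm[of y "i + 1" "i + 1 + 1"] by simp
  qed (use f.lin in auto)
qed

text \<open>One direction of the long exact sequence of the cone, on elements.\<close>

lemma mcone_acyclic:
  assumes "X \<in> dg_modules u A" "Y \<in> dg_modules u A" "quasi_iso A Y X f"
  shows "acyclic_mod (mcone X Y f)"
proof -
  have q: "dg_hom A Y X f" "cohomology_iso Y X f" using assms(3) by (auto simp: quasi_iso_def)
  interpret cone A u X Y 1 "\<lambda>i. f (i + 1)" by (rule mcone[OF assms(1,2) q(1)])
  interpret f: dghom A Y X f by (rule dghomI[OF Y.mod X.mod q(1)])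
  show ?thesis
  proof (rule acyclic_modI)
    fix i w assume w: "w \<in> mgrade G (i + 1)" "mdiff G (i + 1) w = 0"
    then obtain x y where xy: "w = pr x y" "x \<in> mgrade X (i + 1)" "y \<in> mgrade Y (i + 1 + 1)"
      and d: "mdiff X (i + 1) x + f (i + 1 + 1) y = 0" "mdiff Y (i + 1 + 1) y = 0"
      by (auto elim!: GE)
    have "f (i + 1 + 1) y = mdiff X (i + 1) (- x)" using d(1) xy by (simp add: eq_neg_iff_add_eq_0 add.commute)
    then obtain \<eta> where \<eta>: "\<eta> \<in> mgrade Y (i + 1)" "y = mdiff Y (i + 1) \<eta>"
      using ciso_inj[OF q(2) xy(3) refl d(2), of "- x"] xy by auto
    have "x + f (i + 1) \<eta> \<in> mgrade X (i + 1)" "mdiff X (i + 1) (x + f (i + 1) \<eta>) = 0"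
      using xy \<eta> d f.comm[OF \<eta>(1) refl] by simp_all
    then obtain \<xi> z where x: "\<xi> \<in> mgrade Y (i + 1)" "mdiff Y (i + 1) \<xi> = 0" "z \<in> mgrade X i"
      "x + f (i + 1) \<eta> - f (i + 1) \<xi> = mdiff X i z"
      using ciso_surj[OF q(2)] by blast
    show "\<exists>v\<in>mgrade G i. w = mdiff G i v"
    proof (intro bexI[of _ "pr z (\<xi> - \<eta>)"])
      show "w = mdiff G i (pr z (\<xi> - \<eta>))" using x xy \<eta> by (simp add: x(4)[symmetric])
    qed (use x \<eta> in auto)
  qed
qed

text \<open>The composite of \<open>g\<close> with the inclusion of \<open>N'\<close> into the
  acyclic cone of \<open>s\<close> is nullhomotopic. The two components of a nullhomotopy are the
  lift \<open>P \<rightarrow> N\<close> and the homotopy in \<open>N'\<close>.\<close>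

lemma kproj_lift:
  assumes "kproj u A P" "P \<in> dg_modules u A" "N \<in> dg_modules u A" "N' \<in> dg_modules u A"
    and s: "quasi_iso A N N' s" and g: "dg_hom A P N' g"
  obtains g' where "dg_hom A P N g'" "homotopic_homs A P N' g (\<lambda>i x. s i (g' i x))"
proof -
  have sd: "dg_hom A N N' s" using s by (simp add: quasi_iso_def)
  interpret cone A u N' N 1 "\<lambda>i. s (i + 1)" by (rule mcone[OF assms(4,3) sd])
  interpret P: lmod A P using assms by unfold_locales (simp add: dg_modules_def)
  interpret g: dghom A P N' g by (rule dghomI[OF P.mod X.mod g])
  interpret s: dghom A N N' s by (rule dghomI[OF Y.mod X.mod sd])
  have "chain_hom A (- 1 + 1) P G (\<lambda>i x. pr (g i x) 0)"
    using graded_hom_comp[OF P.mod X.mod G.mod g.hom inl_hom] g.comm by (simp add: chain_hom_def)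
  then obtain h where h: "graded_hom A (- 1) P G h"
    and he: "\<And>i x. x \<in> mgrade P i \<Longrightarrow> pr (g i x) 0 = mdiff G (i - 1) (h i x) + h (i + 1) (mdiff P i x)"
    using assms(1) G_in mcone_acyclic[OF assms(4,3) s] unfolding kproj_def null_hom_def by force
  interpret h: ghom A P G "- 1" h using h by unfold_locales
  have hp: "h i x = pr (p1 (h i x)) (p2 (h i x)) \<and> p1 (h i x) \<in> mgrade N' (i - 1) \<and> p2 (h i x) \<in> mgrade N i"
    if "x \<in> mgrade P i" for i x
    using h.mem[OF that refl] by (auto elim!: GE)
  have e1: "g i x = mdiff N' (i - 1) (p1 (h i x)) + s i (p2 (h i x)) + p1 (h (i + 1) (mdiff P i x))"
    and e2: "p2 (h (i + 1) (mdiff P i x)) = mdiff N i (p2 (h i x))" if "x \<in> mgrade P i" for i x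
  proof -
    have "mdiff G (i - 1) (h i x) = pr (mdiff N' (i - 1) (p1 (h i x)) + s i (p2 (h i x))) (- mdiff N i (p2 (h i x)))"
      using hp[OF that] G_sel(2)[of "i - 1" "p1 (h i x)" "p2 (h i x)"] by simp
    then have "pr (g i x) 0 = pr (mdiff N' (i - 1) (p1 (h i x)) + s i (p2 (h i x)) + p1 (h (i + 1) (mdiff P i x)))
       (- mdiff N i (p2 (h i x)) + p2 (h (i + 1) (mdiff P i x)))"
      using he[OF that] hp[of "mdiff P i x" "i + 1"] that by (metis P.d_mem pr_add)
    then show "g i x = mdiff N' (i - 1) (p1 (h i x)) + s i (p2 (h i x)) + p1 (h (i + 1) (mdiff P i x))"
     "p2 (h (i + 1) (mdiff P i x)) = mdiff N i (p2 (h i x))" by (simp_all add: algebra_simps)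
  qed
  show thesis
  proof (rule that[of "\<lambda>i x. p2 (h i x)"])
    show "dg_hom A P N (\<lambda>i x. p2 (h i x))"
      using graded_hom_comp[OF P.mod G.mod Y.mod h prr_hom] e2 by (auto simp: dg_hom_def)
    show "homotopic_homs A P N' g (\<lambda>i x. s i (p2 (h i x)))"
      unfolding homotopic_homs_def
    proof (intro exI conjI allI ballI)
      show "graded_hom A (-1) P N' (\<lambda>i x. p1 (h i x))"
        using graded_hom_comp[OF P.mod G.mod X.mod h prl_hom] by simp
    qed (use e1 in \<open>simp add: algebra_simps\<close>)
  qed
qed

text \<open>The map from the acyclic cone of \<open>s\<close> to \<open>J\<close> given by
  \<open>g\<close> on the shift of \<open>N\<close> is nullhomotopic. A nullhomotopy restricted to
  \<open>N'\<close> is a chain map; since the cone differential sends \<open>n\<close> to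
  \<open>s n\<close> minus \<open>d n\<close>, its negative is the extension, and its restriction to
  \<open>N\<close> is the homotopy.\<close>

lemma kinj_extend:
  assumes "kinj u A J" "J \<in> dg_modules u A" "N \<in> dg_modules u A" "N' \<in> dg_modules u A"
    and s: "quasi_iso A N N' s" and g: "dg_hom A N J g"
  obtains b where "dg_hom A N' J b" "homotopic_homs A N J (\<lambda>i x. b i (s i x)) g"
proof -
  have sd: "dg_hom A N N' s" using s by (simp add: quasi_iso_def)
  interpret cone A u N' N 1 "\<lambda>i. s (i + 1)" by (rule mcone[OF assms(4,3) sd])
  interpret J: lmod A J using assms by unfold_locales (simp add: dg_modules_def)
  interpret g: dghom A N J g by (rule dghomI[OF Y.mod J.mod g])
  interpret s: dghom A N N' s by (rule dghomI[OF Y.mod X.mod sd])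
  have "chain_hom A (0 + 1) G J (\<lambda>i w. g (i + 1) (p2 w))"
    using graded_hom_comp[OF G.mod Y.mod J.mod prr_hom g.hom]
    by (auto simp: chain_hom_def g.comm elim!: GE)
  then obtain h where h: "graded_hom A 0 G J h"
    and he: "\<And>i x. x \<in> mgrade G i \<Longrightarrow> g (i + 1) (p2 x) = mdiff J i (h i x) - h (i + 1) (mdiff G i x)"
    using assms(1) G_in mcone_acyclic[OF assms(4,3) s] unfolding kinj_def null_hom_def by force
  interpret h: ghom A G J 0 h using h by unfold_locales
  define b where "b i x = - h i (pr x 0)" for i x
  have bg: "graded_hom A 0 N' J b"
  proof -
    have "graded_hom A 0 N' J (\<lambda>i x. h i (pr x 0))"
      using graded_hom_comp[OF X.mod G.mod J.mod inl_hom h] by simp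
    then interpret K: ghom A N' J 0 "\<lambda>i x. h i (pr x 0)" by unfold_locales
    show ?thesis unfolding b_def by (rule graded_homI) (simp_all add: K.act K.scale[unfolded scX] del: G_sel)
  qed
  show thesis
  proof (rule that[of b])
    show "dg_hom A N' J b"
    proof (rule dg_homI[OF bg])
      fix i x assume "x \<in> mgrade N' i"
      then show "b (i + 1) (mdiff N' i x) = mdiff J i (b i x)"
        using he[of "pr x 0" i] by (simp add: b_def)
    qed
    show "homotopic_homs A N J (\<lambda>i x. b i (s i x)) g"
      unfolding homotopic_homs_def
    proof (intro exI conjI allI ballI)
      have "graded_hom A (-1) N J (\<lambda>i x. h (i - 1) (pr 0 x))"
        using graded_hom_comp[OF Y.mod G.mod J.mod inr_hom h] by simp
      then interpret K: ghom A N J "-1" "\<lambda>i x. h (i - 1) (pr 0 x)" by unfold_locales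
      show "graded_hom A (-1) N J (\<lambda>i x. - h (i - 1) (pr 0 x))"
        by (rule graded_homI) (simp_all add: K.act K.scale[unfolded scY] del: G_sel)
      fix i m assume m: "m \<in> mgrade N i"
      have "h i (mdiff G (i - 1) (pr 0 m)) = h i (pr (s i m) 0) - h i (pr 0 (mdiff N i m))"
        using m h.diff[of "pr (s i m) 0" i "pr 0 (mdiff N i m)"] by (simp add: pr_diff[symmetric])
      then have "g i m = mdiff J (i - 1) (h (i - 1) (pr 0 m)) - (h i (pr (s i m) 0) - h i (pr 0 (mdiff N i m)))"
        using he[of "pr 0 m" "i - 1"] m by simp
      then show "b i (s i m) - g i m = mdiff J (i - 1) (- h (i - 1) (pr 0 m)) + - h (i + 1 - 1) (pr 0 (mdiff N i m))"
        using m by (simp add: b_def)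
    qed
  qed
qed

text \<open>A contraction of the cone is a 2 by 2 matrix of maps: the entry from \<open>X\<close> to
  \<open>Y\<close> is the inverse \<open>r\<close>, and the diagonal entries are the two
  homotopies.\<close>

lemma contraction:
  assumes X: "X \<in> dg_modules u A" and Y: "Y \<in> dg_modules u A" and f: "dg_hom A Y X f"
    and n: "null_hom A (-1) (mcone X Y f) (mcone X Y f) (\<lambda>i x. x)"
  obtains r where "dg_hom A X Y r" "homotopic_homs A Y Y (\<lambda>i x. r i (f i x)) (\<lambda>i x. x)"
    "homotopic_homs A X X (\<lambda>i x. f i (r i x)) (\<lambda>i x. x)"
proof -
  interpret cone A u X Y 1 "\<lambda>i. f (i + 1)" by (rule mcone[OF X Y f])
  interpret f: dghom A Y X f by (rule dghomI[OF Y.mod X.mod f])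
  obtain h where h: "graded_hom A (-1) G G h"
    and he: "\<And>i x. x \<in> mgrade G i \<Longrightarrow> x = mdiff G (i - 1) (h i x) + h (i + 1) (mdiff G i x)"
    using n by (auto simp: null_hom_def)
  interpret h: ghom A G G "-1" h using h by unfold_locales
  have hp: "h i x = pr (p1 (h i x)) (p2 (h i x)) \<and> p1 (h i x) \<in> mgrade X (i - 1) \<and> p2 (h i x) \<in> mgrade Y i"
    if "x \<in> mgrade G i" for i x
    using h.mem[OF that refl] by (auto elim!: GE)
  have dh: "mdiff G (i - 1) (h i x) = pr (mdiff X (i - 1) (p1 (h i x)) + f i (p2 (h i x))) (- mdiff Y i (p2 (h i x)))"
    if "x \<in> mgrade G i" for i x
    using hp[OF that] G_sel(2)[of "i - 1" "p1 (h i x)" "p2 (h i x)"] by simp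
  define r where "r i x = p2 (h i (pr x 0))" for i x
  have rg: "graded_hom A 0 X Y r"
    using graded_hom_comp[OF X.mod G.mod Y.mod graded_hom_comp[OF X.mod G.mod G.mod inl_hom h] prr_hom]
    by (simp add: r_def[abs_def])
  have k: "graded_hom A (-1) X X (\<lambda>i x. p1 (h i (pr x 0)))"
    using graded_hom_comp[OF X.mod G.mod X.mod graded_hom_comp[OF X.mod G.mod G.mod inl_hom h] prl_hom] by simp
  have l: "graded_hom A (-1) Y Y (\<lambda>i x. p2 (h (i - 1) (pr 0 x)))"
    using graded_hom_comp[OF Y.mod G.mod Y.mod graded_hom_comp[OF Y.mod G.mod G.mod inr_hom h] prr_hom] by simp
  interpret k: ghom A X X "-1" "\<lambda>i x. p1 (h i (pr x 0))" using k by unfold_locales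
  interpret l: ghom A Y Y "-1" "\<lambda>i x. p2 (h (i - 1) (pr 0 x))" using l by unfold_locales
  have e: "x = mdiff X (i - 1) (p1 (h i (pr x 0))) + f i (r i x) + p1 (h (i + 1) (pr (mdiff X i x) 0)) \<and>
      0 = - mdiff Y i (r i x) + r (i + 1) (mdiff X i x)" if "x \<in> mgrade X i" for i x
  proof -
    have "pr x 0 = mdiff G (i - 1) (h i (pr x 0)) + h (i + 1) (pr (mdiff X i x) 0)"
      using he[of "pr x 0" i] that by simp
    then have "pr x 0 = pr (mdiff X (i - 1) (p1 (h i (pr x 0))) + f i (r i x) + p1 (h (i + 1) (pr (mdiff X i x) 0)))
         (- mdiff Y i (r i x) + r (i + 1) (mdiff X i x))"
      using dh[of "pr x 0" i] hp[of "pr (mdiff X i x) 0" "i + 1"] that unfolding r_def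
      by (metis G_sel(4) X.d_mem Y.zero_mem pr_add)
    then show ?thesis by (simp only: pr_eq)
  qed
  show thesis
  proof (rule that[of r])
    show rd: "dg_hom A X Y r"
      by (rule dg_homI[OF rg]) (use e in \<open>simp add: algebra_simps\<close>)
    interpret r: dghom A X Y r by (rule dghomI[OF X.mod Y.mod rd])
    show "homotopic_homs A X X (\<lambda>i x. f i (r i x)) (\<lambda>i x. x)"
      unfolding homotopic_homs_def
    proof (intro exI conjI allI ballI)
      show "graded_hom A (-1) X X (\<lambda>i x. - p1 (h i (pr x 0)))"
        by (rule graded_homI) (simp_all add: k.act k.scale[unfolded scX] del: G_sel)
      fix i m assume "m \<in> mgrade X i"
      then show "f i (r i m) - m = mdiff X (i - 1) (- p1 (h i (pr m 0))) + - p1 (h (i + 1) (pr (mdiff X i m) 0))"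
        using conjunct1[OF e[of m i]] by (simp add: algebra_simps)
    qed
    show "homotopic_homs A Y Y (\<lambda>i x. r i (f i x)) (\<lambda>i x. x)"
      unfolding homotopic_homs_def
    proof (intro exI conjI allI ballI)
      show "graded_hom A (-1) Y Y (\<lambda>i x. p2 (h (i - 1) (pr 0 x)))" by (rule l)
      fix i m assume m: "m \<in> mgrade Y i"
      have hd: "h i (pr (f i m) (- mdiff Y i m)) = h i (pr (f i m) 0) - h i (pr 0 (mdiff Y i m))"
        using m h.diff[of "pr (f i m) 0" i "pr 0 (mdiff Y i m)"] by (simp add: pr_diff[symmetric])
      have "pr 0 m = mdiff G (i - 1 - 1) (h (i - 1) (pr 0 m)) + h i (pr (f i m) (- mdiff Y i m))"
        using he[of "pr 0 m" "i - 1"] m by simp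
      then have "p2 (pr 0 m) = p2 (mdiff G (i - 1 - 1) (h (i - 1) (pr 0 m))) + p2 (h i (pr (f i m) (- mdiff Y i m)))"
        by (metis p2_add)
      then show "r i (f i m) - m = mdiff Y (i - 1) (p2 (h (i - 1) (pr 0 m))) + p2 (h (i + 1 - 1) (pr 0 (mdiff Y i m)))"
        using dh[of "pr 0 m" "i - 1"] m by (simp add: hd r_def p2_diff algebra_simps)
    qed
  qed
qed

end

section \<open>Compact modules\<close>

text \<open>The quotient of \<open>X\<close> by everything of degree above \<open>b\<close>. This is
  a DG quotient because \<open>A\<close> lives in nonnegative degrees.\<close>

definition trunc :: "('k, 'a, 'm::ab_group_add) dg_mod \<Rightarrow> int \<Rightarrow> ('k, 'a, 'm) dg_mod" where
  "trunc X b = \<lparr>mscale = mscale X, mgrade = (\<lambda>i. if i \<le> b then mgrade X i else {0}),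
     mdiff = (\<lambda>i x. if i + 1 \<le> b then mdiff X i x else 0),
     lact = (\<lambda>p i a x. if p + i \<le> b then lact X p i a x else 0),
     ract = (\<lambda>_ _ _ _. 0)\<rparr>"

text \<open>\<open>V\<close> concentrated in degree \<open>b\<close>, with zero differential and
  with elements of positive degree acting as zero: in the truncation everything that leaves degree
  \<open>b\<close> upwards is zero.\<close>

definition triv :: "('k, 'a, 'm::ab_group_add) dg_mod \<Rightarrow> int \<Rightarrow> 'm set \<Rightarrow> ('k, 'a, 'm) dg_mod" where
  "triv X b V = (trunc X b)\<lparr>mgrade := (\<lambda>i. if i = b then V else {0})\<rparr>"

definition aplus :: "('k::field, 'a) dg_alg \<Rightarrow> ('k, 'a, 'm::ab_group_add) dg_mod \<Rightarrow> int \<Rightarrow> 'm set" where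
  "aplus A M i = module.span (mscale M)
     {y. \<exists>p a x. 1 \<le> p \<and> a \<in> agrade A p \<and> x \<in> mgrade M (i - p) \<and> y = lact M p (i - p) a x}"

text \<open>The boundaries of \<open>M / A\<^sup>+ M\<close>, lifted to \<open>M\<close>.\<close>

definition bnd :: "('k::field, 'a) dg_alg \<Rightarrow> ('k, 'a, 'm::ab_group_add) dg_mod \<Rightarrow> int \<Rightarrow> 'm set" where
  "bnd A M i = {mdiff M (i - 1) y + w | y w. y \<in> mgrade M (i - 1) \<and> w \<in> aplus A M i}"

text \<open>The pairs in \<open>T\<close> represent a spanning set of the cohomology of
  \<open>M / A^+ M\<close>, that is, of the tensor product of the trivial module with
  \<open>M\<close> over \<open>A\<close>. Representatives are kept in \<open>M\<close>, so that no
  quotient has to be formed.\<close>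

definition generates :: "('k::field, 'a) dg_alg \<Rightarrow> ('k, 'a, 'm::ab_group_add) dg_mod \<Rightarrow> (int \<times> 'm) set \<Rightarrow> bool" where
  "generates A M T \<longleftrightarrow> (\<forall>(i, v)\<in>T. v \<in> mgrade M i) \<and>
     (\<forall>i. \<forall>x\<in>mgrade M i. mdiff M i x \<in> aplus A M (i + 1) \<longrightarrow>
        x \<in> module.span (mscale M) ({v. (i, v) \<in> T} \<union> bnd A M i))"

definition acyclic_below :: "int \<Rightarrow> ('k, 'a, 'm::ab_group_add) dg_mod \<Rightarrow> bool" where
  "acyclic_below b M \<longleftrightarrow>
    (\<forall>i x. i + 1 < b \<longrightarrow> x \<in> mgrade M (i + 1) \<longrightarrow> mdiff M (i + 1) x = 0 \<longrightarrow> (\<exists>y\<in>mgrade M i. x = mdiff M i y))"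

text \<open>Membership in \<open>V\<close> is carried through the induction, because the maps in
  question are linear only on homogeneous components.\<close>

lemma (in module) subspace_span_induct:
  assumes "x \<in> span S" "S \<subseteq> V" "subspace V" "\<And>x. x \<in> S \<Longrightarrow> P x" "P 0"
    "\<And>x y. x \<in> V \<Longrightarrow> y \<in> V \<Longrightarrow> P x \<Longrightarrow> P y \<Longrightarrow> P (x + y)"
    "\<And>c x. x \<in> V \<Longrightarrow> P x \<Longrightarrow> P (scale c x)"
  shows "x \<in> V \<and> P x"
proof (rule span_induct[OF assms(1), of "\<lambda>x. x \<in> V \<and> P x"])
  show "subspace {x. x \<in> V \<and> P x}"
    using assms(3,5-7) by (auto intro!: subspaceI simp: subspace_def)
  show "x \<in> V \<and> P x" if "x \<in> S" for x using that assms by auto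
qed

context lmod
begin

lemma aplus_mem:
  assumes "w \<in> aplus A M i"
  shows "w \<in> mgrade M i"
proof -
  have "aplus A M i \<subseteq> mgrade M i"
    unfolding aplus_def by (rule V.span_minimal[OF _ grade]) auto
  with assms show ?thesis by auto
qed

lemma aplus_subspace: "V.subspace (aplus A M i)"
  unfolding aplus_def by (rule V.subspace_span)

lemma aplus_act: "1 \<le> p \<Longrightarrow> a \<in> agrade A p \<Longrightarrow> x \<in> mgrade M i \<Longrightarrow> j = p + i \<Longrightarrow> lact M p i a x \<in> aplus A M j"
  unfolding aplus_def
  by (rule V.span_base) (auto intro!: exI[of _ p] exI[of _ a] exI[of _ x])

lemma aplus_induct:
  assumes "w \<in> aplus A M i"
    and "\<And>p a x j. 1 \<le> p \<Longrightarrow> a \<in> agrade A p \<Longrightarrow> x \<in> mgrade M j \<Longrightarrow> i = p + j \<Longrightarrow> P (lact M p j a x)"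
    and "P 0" "\<And>x y. x \<in> mgrade M i \<Longrightarrow> y \<in> mgrade M i \<Longrightarrow> P x \<Longrightarrow> P y \<Longrightarrow> P (x + y)"
    and "\<And>c x. x \<in> mgrade M i \<Longrightarrow> P x \<Longrightarrow> P (mscale M c x)"
  shows "P w"
proof -
  have "w \<in> mgrade M i \<and> P w"
    by (rule V.subspace_span_induct[OF assms(1)[unfolded aplus_def] _ grade])
      (use assms(2-) in \<open>auto\<close>)
  then show ?thesis by blast
qed

lemma bndI: "y \<in> mgrade M (i - 1) \<Longrightarrow> w \<in> aplus A M i \<Longrightarrow> x = mdiff M (i - 1) y + w \<Longrightarrow> x \<in> bnd A M i"
  unfolding bnd_def by blast

lemma bndE:
  assumes "x \<in> bnd A M i"
  obtains y w where "y \<in> mgrade M (i - 1)" "w \<in> aplus A M i" "x = mdiff M (i - 1) y + w"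
  using assms unfolding bnd_def by blast

lemma bnd_subspace: "V.subspace (bnd A M i)"
proof (rule V.subspaceI)
  show "0 \<in> bnd A M i"
    by (rule bndI[of 0 _ 0]) (simp_all add: V.subspace_0[OF aplus_subspace])
  show "x + y \<in> bnd A M i" if xy: "x \<in> bnd A M i" "y \<in> bnd A M i" for x y
  proof -
    obtain a b where a: "a \<in> mgrade M (i - 1)" "b \<in> aplus A M i" "x = mdiff M (i - 1) a + b" using xy(1) by (rule bndE)
    obtain c d where c: "c \<in> mgrade M (i - 1)" "d \<in> aplus A M i" "y = mdiff M (i - 1) c + d" using xy(2) by (rule bndE)
    show ?thesis
      by (rule bndI[OF add_mem[OF a(1) c(1)] V.subspace_add[OF aplus_subspace a(2) c(2)]]) (use a c in simp)
  qed
  show "mscale M c x \<in> bnd A M i" if "x \<in> bnd A M i" for c x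
    using that by (elim bndE, intro bndI[OF scale_mem V.subspace_scale[OF aplus_subspace]])
      (auto simp: V.scale_right_distrib)
qed

lemma bnd_d: "y \<in> mgrade M j \<Longrightarrow> i = j + 1 \<Longrightarrow> mdiff M j y \<in> bnd A M i"
  by (rule bndI[of y _ 0]) (simp_all add: V.subspace_0[OF aplus_subspace])

lemma bnd_aplus: "w \<in> aplus A M i \<Longrightarrow> w \<in> bnd A M i"
  by (rule bndI[of 0]) simp_all

lemma bnd_mem: "w \<in> bnd A M i \<Longrightarrow> w \<in> mgrade M i"
  unfolding bnd_def by (auto simp: aplus_mem)

end

lemma (in ghom) aplus_image:
  assumes "w \<in> aplus A M i"
  shows "f i w \<in> aplus A N (i + n)"
proof (rule S.aplus_induct[OF assms])
  fix p a x j assume ax: "1 \<le> p" "a \<in> agrade A p" "x \<in> mgrade M j" "i = p + j"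
  show "f i (lact M p j a x) \<in> aplus A N (i + n)"
    unfolding ax(4) act[OF ax(2,3)]
    by (rule T.V.subspace_ksign[OF T.aplus_subspace T.aplus_act]) (use ax in auto)
qed (auto simp: T.V.subspace_0[OF T.aplus_subspace] T.V.subspace_add[OF T.aplus_subspace]
   T.V.subspace_scale[OF T.aplus_subspace])

lemma (in dga) aplus_d:
  assumes "left_dg_module A M" "w \<in> aplus A M i"
  shows "mdiff M i w \<in> aplus A M (i + 1)"
proof -
  interpret lmod A M by unfold_locales fact
  show ?thesis
  proof (rule aplus_induct[OF assms(2)])
    fix p a x j assume ax: "1 \<le> p" "a \<in> agrade A p" "x \<in> mgrade M j" "i = p + j"
    show "mdiff M i (lact M p j a x) \<in> aplus A M (i + 1)"
      unfolding ax(4) leibniz[OF ax(2,3)]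
      by (rule V.subspace_add[OF aplus_subspace aplus_act V.subspace_ksign[OF aplus_subspace aplus_act]])
        (use ax in auto)
  qed (auto simp: V.subspace_0[OF aplus_subspace] V.subspace_add[OF aplus_subspace]
     V.subspace_scale[OF aplus_subspace])
qed

lemma (in dga) mult_zero_left [simp]: "b \<in> agrade A q \<Longrightarrow> amult A p q 0 b = 0"
  using mult_add_left[of 0 p 0 b q] by simp

lemma (in dga) lact_zero_left:
  assumes "left_dg_module A M" "x \<in> mgrade M i"
  shows "lact M p i 0 x = 0"
proof -
  interpret lmod A M by unfold_locales fact
  show ?thesis using lact_add[of 0 p 0 x i] assms by simp
qed

lemma (in dga) trunc_mod:
  assumes "left_dg_module A X"
  shows "left_dg_module A (trunc X b)"
proof -
  interpret lmod A X by unfold_locales fact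
  have neg: "a = 0" if "a \<in> agrade A p" "\<not> p + i \<le> b" "i \<le> b" "p < 0" for a p i using that by auto
  \<comment> \<open>Acting from above the cut back to below it takes an element of negative degree,
    and such elements are zero.\<close>
  have neg': "a = 0" if "a \<in> agrade A p" "p + i \<le> b" "\<not> i \<le> b" for a p i
    using that neg_grade[of p] by auto
  show ?thesis
  proof (rule left_dg_moduleI)
    show "module.subspace (mscale (trunc X b)) (mgrade (trunc X b) i)" for i
      using grade by (auto simp: trunc_def V.subspace_0 intro!: V.subspaceI)
    fix p q i a c x assume *: "a \<in> agrade A p" "c \<in> agrade A q" "x \<in> mgrade (trunc X b) i"
    show "lact (trunc X b) (p + q) i (amult A p q a c) x = lact (trunc X b) p (q + i) a (lact (trunc X b) q i c x)"
    proof (cases "p + q + i \<le> b \<and> \<not> q + i \<le> b")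
      case True
      then have "a = 0" using neg'[of a p "q + i"] * by (simp add: ac_simps)
      then show ?thesis using * lact_zero_left[OF assms, of x i]
        by (auto simp: trunc_def lact_zero_left[OF assms] split: if_splits)
    next
      case False
      then show ?thesis using * assoc[of a p c q x i] by (auto simp: trunc_def ac_simps split: if_splits)
    qed
  next
    fix p i a x assume *: "a \<in> agrade A p" "x \<in> mgrade (trunc X b) i"
    show "mdiff (trunc X b) (p + i) (lact (trunc X b) p i a x) =
      lact (trunc X b) (p + 1) i (adiff A p a) x + ksign p (lact (trunc X b) p (i + 1) a (mdiff (trunc X b) i x))"
    proof (cases "p + i + 1 \<le> b \<and> \<not> i + 1 \<le> b")
      case True
      then have "a = 0" using neg'[of a p "i + 1"] * by (simp add: ac_simps)
      then show ?thesis using * by (auto simp: trunc_def lact_zero_left[OF assms] split: if_splits)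
    next
      case False
      then show ?thesis using * leibniz[of a p x i] by (auto simp: trunc_def ac_simps split: if_splits)
    qed
  qed (auto simp: trunc_def V.vector_space_axioms split: if_splits)
qed

lemma (in dga) trunc_hom:
  assumes "left_dg_module A X"
  shows "dg_hom A X (trunc X b) (\<lambda>i x. if i \<le> b then x else 0)"
proof -
  interpret lmod A X by unfold_locales fact
  show ?thesis
  proof (rule dg_homI[OF graded_homI])
    fix p i a x assume *: "a \<in> agrade A p" "x \<in> mgrade X i"
    show "(if p + i \<le> b then lact X p i a x else 0) =
      ksign (0 * p) (lact (trunc X b) p (i + 0) a (if i \<le> b then x else 0))"
      using * neg_grade[of p] by (auto simp: trunc_def lact_zero_left[OF assms])
  qed (auto simp: trunc_def)
qed

lemma (in dga) triv_mod:
  assumes "left_dg_module A X" "module.subspace (mscale X) V" "V \<subseteq> mgrade X b"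
  shows "left_dg_module A (triv X b V)"
proof -
  interpret lmod A X by unfold_locales fact
  have V0: "0 \<in> V" using V.subspace_0[OF assms(2)] .
  show ?thesis
  proof (rule left_dg_module_sub[OF trunc_mod[OF assms(1), of b]])
    fix p i a x assume *: "a \<in> agrade A p" "x \<in> mgrade (triv X b V) i"
    show "lact (trunc X b) p i a x \<in> mgrade (triv X b V) (p + i)"
    proof (cases "p = 0 \<and> i = b")
      \<comment> \<open>Here connectedness enters: the degree 0 part of \<open>A\<close> consists of
        scalars, so it preserves every subspace \<open>V\<close>.\<close>
      case True
      then obtain c where "a = ascale A c (aunit A)" using * grade0 by auto
      then have "lact X p i a x = mscale X c x" using True * assms(3) by (auto simp: triv_def)
      then show ?thesis using True * V.subspace_scale[OF assms(2)] by (auto simp: triv_def trunc_def)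
    next
      case False
      then show ?thesis using * V0 assms(3) neg_grade[of p]
        by (auto simp: triv_def trunc_def lact_zero_left[OF assms(1)] split: if_splits)
    qed
  qed (use assms(2,3) V0 in \<open>auto simp: triv_def trunc_def V.subspace_0 split: if_splits\<close>)
qed

lemma direct_sum_graded_hom:
  assumes "graded_hom A n M (direct_sum N) f"
  shows "graded_hom A n M (N j) (\<lambda>i x. f i x j)"
proof -
  have k: "k_linear (mscale M) (mgrade M i) (mscale (direct_sum N)) (mgrade (direct_sum N) (i + n)) (f i)" for i
    using assms by (simp add: graded_hom_def)
  show ?thesis
  proof (rule graded_homI)
    fix p i a x assume "a \<in> agrade A p" "x \<in> mgrade M i"
    then have "f (p + i) (lact M p i a x) = ksign (n * p) (lact (direct_sum N) p (i + n) a (f i x))"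
      using assms by (simp add: graded_hom_def)
    from fun_cong[OF this, of j]
    show "f (p + i) (lact M p i a x) j = ksign (n * p) (lact (N j) p (i + n) a (f i x j))"
      by (auto simp: direct_sum_def ksign_def)
  qed (use k_linearD[OF k] in \<open>auto simp: direct_sum_def\<close>)
qed

lemma direct_sum_dg_hom:
  "dg_hom A M (direct_sum N) f \<Longrightarrow> dg_hom A M (N j) (\<lambda>i x. f i x j)"
  using direct_sum_graded_hom[of A 0 M N f j] by (auto simp: dg_hom_def direct_sum_def)

lemma homotopic_refl:
  assumes "left_dg_module A M" "left_dg_module A N"
  shows "homotopic_homs A M N f f"
proof -
  interpret N: lmod A N by unfold_locales fact
  show ?thesis unfolding homotopic_homs_def
    by (intro exI[of _ "\<lambda>_ _. 0"] conjI graded_homI) auto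
qed

lemma homotopic_refl_sum:
  assumes "left_dg_module A M" "\<And>j. left_dg_module A (N j)"
  shows "homotopic_homs A M (direct_sum N) f f"
proof -
  have [simp]: "0 \<in> mgrade (N j) i" "mdiff (N j) i 0 = 0" "mscale (N j) c 0 = 0"
    "a \<in> agrade A p \<Longrightarrow> lact (N j) p i a 0 = 0" for j i c a p
  proof -
    interpret lmod A "N j" by unfold_locales (rule assms)
    show "0 \<in> mgrade (N j) i" "mdiff (N j) i 0 = 0" "mscale (N j) c 0 = 0"
      "a \<in> agrade A p \<Longrightarrow> lact (N j) p i a 0 = 0" by simp_all
  qed
  show ?thesis unfolding homotopic_homs_def
    by (intro exI[of _ "\<lambda>_ _. 0"] conjI graded_homI) (auto simp: direct_sum_def fun_eq_iff ksign_def)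
qed

lemma direct_sum_dg_homI:
  assumes f: "\<And>j. dg_hom A M (N j) (\<lambda>i x. f i x j)" and fin: "\<And>i x. finite {j. f i x j \<noteq> 0}"
  shows "dg_hom A M (direct_sum N) f"
proof (rule dg_homI[OF graded_homI])
  have l: "k_linear (mscale M) (mgrade M i) (mscale (N j)) (mgrade (N j) i) (\<lambda>x. f i x j)" for i j
    using f by (simp add: dg_hom_def graded_hom_def)
  fix i x assume x: "x \<in> mgrade M i"
  show "f i x \<in> mgrade (direct_sum N) (i + 0)"
    using fin k_linearD(1)[OF l x] by (simp add: direct_sum_def)
  show "f i (x + y) = f i x + f i y" if "y \<in> mgrade M i" for y
    using k_linearD(2)[OF l x that] by (simp add: fun_eq_iff)
  show "f i (mscale M c x) = mscale (direct_sum N) c (f i x)" for c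
    using k_linearD(3)[OF l x] by (simp add: fun_eq_iff direct_sum_def)
  show "f (p + i) (lact M p i a x) = ksign (0 * p) (lact (direct_sum N) p (i + 0) a (f i x))"
    if "a \<in> agrade A p" for p a
    using f x that unfolding dg_hom_def graded_hom_def by (simp add: fun_eq_iff direct_sum_def)
  show "f (i + 1) (mdiff M i x) = mdiff (direct_sum N) i (f i x)"
    using f x unfolding dg_hom_def by (simp add: fun_eq_iff direct_sum_def)
qed

context dgu
begin

text \<open>
  A map from a compact module to a direct sum is a finite sum in the derived category, so almost
  all of its components vanish there.
\<close>

lemma compact_null:
  fixes M P :: "('k, 'a, 'u) dg_mod"
  assumes M: "compact_dg_module u A M" and kP: "kproj u A P" and P: "P \<in> dg_modules u A"
    and q: "quasi_iso A P M \<pi>" and N: "\<And>j. N j \<in> dg_modules u A" and f: "dg_hom A P (direct_sum N) f"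
  shows "\<exists>S. finite S \<and> (\<forall>j::'u. j \<notin> S \<longrightarrow> null_hom A (-1) P (N j) (\<lambda>i x. f i x j))"
proof -
  have Mm: "left_dg_module A M" "M \<in> dg_modules u A" using M by (auto simp: compact_dg_module_def dg_modules_def)
  interpret P: lmod A P using P by unfold_locales (simp add: dg_modules_def)
  have Nm: "left_dg_module A (N j)" for j using N by (simp add: dg_modules_def)
  let ?R = "(P, \<pi>, f)" and ?D = "direct_sum N"
  let ?rel = "{(R, R'). is_roof u A M ?D R \<and> is_roof u A M ?D R' \<and> roof_equiv u A M ?D R R'}"
  have roof: "is_roof u A M ?D ?R" using P q f by (simp add: is_roof_def)
  have idP: "dg_hom A P P (\<lambda>i x. x)" by (intro dg_homI graded_homI) auto
  have "roof_equiv u A M ?D ?R ?R"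
    unfolding roof_equiv_def prod.case
    by (rule bexI[OF _ P], intro exI[of _ "\<lambda>i x. x"] conjI idP homotopic_refl homotopic_refl_sum)
      (use q Mm Nm P.mod in auto)
  then have refl: "?R \<in> ?rel `` {?R}" using roof by auto
  have mem: "?rel `` {?R} \<in> derived_hom u A M ?D"
    unfolding derived_hom_def using roof by (intro quotientI) auto
  have "bij_betw (derived_sum_map u A M N) (derived_hom_sum u A M N) (derived_hom u A M ?D)"
    by (rule mp[OF spec[OF conjunct2[OF M[unfolded compact_dg_module_def]], of N]]) (use N in simp)
  \<comment> \<open>Only surjectivity of the canonical map is used: the class of \<open>f\<close>
    comes from a family whose components, over a common apex \<open>Z\<close>, are almost all zero
    as maps.\<close>
  from mem[folded bij_betw_imp_surj_on[OF this]]
  obtain \<Phi> where "?rel `` {?R} = derived_sum_map u A M N \<Phi>" by (rule imageE)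
  from subst[of _ _ "\<lambda>S. ?R \<in> S", OF this refl] have "?R \<in> derived_sum_map u A M N \<Phi>" .
  then obtain Z :: "('k, 'a, 'u) dg_mod" and s g where fin: "finite {j. \<exists>i. \<exists>z\<in>mgrade Z i. g j i z \<noteq> 0}"
    and eq: "roof_equiv u A M ?D ?R (Z, s, \<lambda>i z j. g j i z)"
    unfolding derived_sum_map_def by blast
  then obtain W t t' where W: "W \<in> dg_modules u A" and t: "dg_hom A W P t" "dg_hom A W Z t'"
    "quasi_iso A W M (\<lambda>i w. \<pi> i (t i w))"
    "homotopic_homs A W ?D (\<lambda>i w. f i (t i w)) (\<lambda>i w j. g j i (t' i w))"
    unfolding roof_equiv_def prod.case by blast
  interpret W: lmod A W using W by unfold_locales (simp add: dg_modules_def)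
  interpret t: dghom A W P t using W.mod P.mod t(1) by (rule dghomI)
  have "cohomology_iso W P t"
    using ciso_cancel_left[OF W.mod P.mod Mm(1) t(1)] q t(3) by (auto simp: quasi_iso_def)
  then have "quasi_iso A W P t" using t by (simp add: quasi_iso_def)
  \<comment> \<open>\<open>t\<close> has a section \<open>g'\<close> up to homotopy, since
    \<open>P\<close> is K-projective; through \<open>g'\<close> the vanishing on \<open>W\<close> is
    brought back to \<open>P\<close>.\<close>
  from kproj_lift[OF kP P W P this idP] obtain g' where g': "dg_hom A P W g'"
     "homotopic_homs A P P (\<lambda>i x. x) (\<lambda>i x. t i (g' i x))" by blast
  interpret g': dghom A P W g' using P.mod W.mod g'(1) by (rule dghomI)
  obtain k where k: "graded_hom A (-1) P P k"
    and ke: "\<And>i x. x \<in> mgrade P i \<Longrightarrow> x - t i (g' i x) = mdiff P (i - 1) (k i x) + k (i + 1) (mdiff P i x)"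
    using g'(2) by (auto simp: homotopic_homs_def)
  obtain h where h: "graded_hom A (-1) W ?D h"
    and he: "\<And>i w. w \<in> mgrade W i \<Longrightarrow> f i (t i w) - (\<lambda>j. g j i (t' i w)) = mdiff ?D (i - 1) (h i w) + h (i + 1) (mdiff W i w)"
    using t(4) by (auto simp: homotopic_homs_def)
  interpret k: ghom A P P "-1" k using k by unfold_locales
  have t'm: "t' i w \<in> mgrade Z i" if "w \<in> mgrade W i" for i w
    using t(2) that by (auto simp: dg_hom_def graded_hom_def k_linear_def)
  show ?thesis
  proof (intro exI[of _ "{j. \<exists>i. \<exists>z\<in>mgrade Z i. g j i z \<noteq> 0}"] conjI fin allI impI)
    fix j assume "j \<notin> {j. \<exists>i. \<exists>z\<in>mgrade Z i. g j i z \<noteq> 0}"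
    then have g0: "g j i (t' i w) = 0" if "w \<in> mgrade W i" for i w using t'm[OF that] by blast
    have fj: "dg_hom A P (N j) (\<lambda>i x. f i x j)" by (rule direct_sum_dg_hom[OF f])
    interpret fj: dghom A P "N j" "\<lambda>i x. f i x j" by (rule dghomI[OF P.mod Nm fj])
    have hj: "graded_hom A (-1) W (N j) (\<lambda>i x. h i x j)" by (rule direct_sum_graded_hom[OF h])
    have hj': "f i (t i w) j = mdiff (N j) (i - 1) (h i w j) + h (i + 1) (mdiff W i w) j" if "w \<in> mgrade W i" for i w
      using fun_cong[OF he[OF that], of j] g0[OF that] by (simp add: direct_sum_def)
    show "null_hom A (-1) P (N j) (\<lambda>i x. f i x j)"
      unfolding null_hom_def
    proof (intro exI conjI allI ballI)
      \<comment> \<open>Write \<open>f = f (1 - t g') + f t g'\<close>: the first summand is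
        nullhomotopic through \<open>k\<close>, the second through \<open>h\<close>.\<close>
      show "graded_hom A (-1) P (N j) (\<lambda>i x. f (i + -1) (k i x) j + h (i + 0) (g' i x) j)"
        using graded_hom_comp[OF P.mod P.mod Nm k fj.hom] graded_hom_comp[OF P.mod W.mod Nm g'.hom hj]
        by (intro graded_hom_add[OF Nm]) simp_all
      fix i m assume m: "m \<in> mgrade P i"
      interpret hj: ghom A W "N j" "-1" "\<lambda>i x. h i x j" using hj by unfold_locales
      have m': "m = t i (g' i m) + (mdiff P (i - 1) (k i m) + k (i + 1) (mdiff P i m))"
        using ke[OF m] by (simp add: algebra_simps)
      have "f i m j = f i (t i (g' i m)) j + (f i (mdiff P (i - 1) (k i m)) j + f i (k (i + 1) (mdiff P i m)) j)"
        using m by (subst m') simp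
      also have "f i (mdiff P (i - 1) (k i m)) j = mdiff (N j) (i - 1) (f (i - 1) (k i m) j)"
        using m by (intro fj.comm) auto
      also have "f i (t i (g' i m)) j = mdiff (N j) (i - 1) (h i (g' i m) j) + h (i + 1) (g' (i + 1) (mdiff P i m)) j"
        using hj'[of "g' i m" i] m by (simp add: g'.comm)
      finally show "f i m j = mdiff (N j) (i + - 1) (f (i + - 1) (k i m) j + h (i + 0) (g' i m) j) -
        ksign (- 1) (f (i + 1 + - 1) (k (i + 1) (mdiff P i m)) j + h (i + 1 + 0) (g' (i + 1) (mdiff P i m)) j)"
        using m by (simp add: algebra_simps)
    qed
  qed
qed

lemma infinite_u: "infinite (UNIV :: 'u set)"
  using infinite_Bu finite_subset subset_UNIV by blast

text \<open>Compactness concerns families indexed by \<open>'u\<close>. This makes room for families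
  indexed by a degree together with a basis vector of that degree.\<close>

lemma ex_inj_int: "\<exists>e :: int \<times> 'u \<Rightarrow> 'u. inj e"
proof -
  have "|UNIV :: int set| \<le>o |UNIV :: 'u set|"
  proof -
    obtain e :: "nat \<Rightarrow> 'u" where "inj e" using infinite_u infinite_countable_subset by blast
    then have "inj (e \<circ> int_encode)" using inj_int_encode[of UNIV] by (rule inj_compose)
    then show ?thesis using card_of_ordLeq[of "UNIV :: int set" "UNIV :: 'u set"] by auto
  qed
  then have "|(UNIV :: int set) \<times> (UNIV :: 'u set)| =o |UNIV :: 'u set|"
    using card_of_Times_infinite[OF infinite_u, of "UNIV :: int set"] by simp
  then have "|UNIV :: (int \<times> 'u) set| \<le>o |UNIV :: 'u set|"
    by (simp add: ordIso_iff_ordLeq)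
  then show ?thesis using card_of_ordLeq[of "UNIV :: (int \<times> 'u) set" "UNIV :: 'u set"] by auto
qed

lemma trunc_in: "X \<in> dg_modules u A \<Longrightarrow> trunc X b \<in> dg_modules u A"
  using trunc_mod by (auto simp: dg_modules_def trunc_def)

text \<open>\<open>P\<close> maps to the sum over \<open>n \<ge> 0\<close> of its truncations at
  \<open>- n\<close>: an element of degree \<open>i\<close> has nonzero image only where
  \<open>n \<le> - i\<close>. By compactness one of these maps is nullhomotopic, and then
  \<open>P\<close> has no cohomology below the corresponding degree.\<close>

lemma compact_bounded_below:
  fixes M P :: "('k, 'a, 'u) dg_mod"
  assumes M: "compact_dg_module u A M" and kP: "kproj u A P" and P: "P \<in> dg_modules u A"
    and q: "quasi_iso A P M \<pi>"
  shows "\<exists>b. acyclic_below b P"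
proof -
  interpret P: lmod A P using P by unfold_locales (simp add: dg_modules_def)
  obtain e :: "nat \<Rightarrow> 'u" where e: "inj e"
    using infinite_u infinite_countable_subset by blast
  define N where "N j = (if j \<in> range e then trunc P (- int (inv e j)) else zero_mod u)" for j
  define f where "f = (\<lambda>i x j. if j \<in> range e \<and> i \<le> - int (inv e j) then x else (0::'u))"
  have N: "N j \<in> dg_modules u A" for j using P by (auto simp: N_def trunc_in zero_mod)
  have f: "dg_hom A P (direct_sum N) f"
  proof -
    have *: "finite {j. f i x j \<noteq> 0}" for i x
    proof (rule finite_subset)
      show "{j. f i x j \<noteq> 0} \<subseteq> e ` {..nat (- i)}" using e by (auto simp: f_def split: if_splits)
    qed simp
    have **: "dg_hom A P (N j) (\<lambda>i x. f i x j)" for j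
    proof (cases "j \<in> range e")
      case True
      then show ?thesis using trunc_hom[OF P.mod, of "- int (inv e j)"] by (simp add: N_def f_def)
    next
      case False
      then show ?thesis by (auto intro!: dg_homI graded_homI simp: N_def f_def zero_mod_def)
    qed
    from direct_sum_dg_homI[OF this *] show ?thesis .
  qed
  from compact_null[OF M kP P q N f] obtain S where S: "finite S"
    "\<And>j. j \<notin> S \<Longrightarrow> null_hom A (-1) P (N j) (\<lambda>i x. f i x j)" by blast
  have "infinite (range e)" using e by (simp add: finite_image_iff)
  then have "\<not> range e \<subseteq> S" using finite_subset[OF _ S(1)] by auto
  then obtain n where n: "e n \<notin> S" by auto
  have Nn: "N (e n) = trunc P (- int n)" using e by (simp add: N_def)
  obtain h where h: "graded_hom A (-1) P (N (e n)) h"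
    and he: "\<And>i x. x \<in> mgrade P i \<Longrightarrow> f i x (e n) = mdiff (N (e n)) (i - 1) (h i x) + h (i + 1) (mdiff P i x)"
    using S(2)[OF n] by (auto simp: null_hom_def)
  interpret h: ghom A P "N (e n)" "-1" h using h by unfold_locales (use N in \<open>auto simp: dg_modules_def\<close>)
  have "\<exists>y\<in>mgrade P i. x = mdiff P i y" if "i + 1 < - int n" "x \<in> mgrade P (i + 1)" "mdiff P (i + 1) x = 0" for i x
  proof (rule bexI)
    show "h (i + 1) x \<in> mgrade P i" using h.mem[OF that(2), of i] that(1) by (simp add: Nn trunc_def)
    show "x = mdiff P i (h (i + 1) x)"
      using he[OF that(2)] that h.zero[of "i + 1 + 1"] e by (simp add: Nn f_def trunc_def)
  qed
  then show ?thesis by (auto simp: acyclic_below_def)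
qed

end

context dgu
begin

text \<open>Choose representatives of a basis of the cohomology of \<open>P / A^+ P\<close>. Each
  gives a coordinate map from \<open>P\<close> to a one-dimensional trivial module, and all of them
  together a map to the direct sum. No single coordinate map is nullhomotopic, so compactness leaves
  only finitely many.\<close>

lemma compact_finite_generates:
  fixes M P :: "('k, 'a, 'u) dg_mod"
  assumes M: "compact_dg_module u A M" and kP: "kproj u A P" and P: "P \<in> dg_modules u A"
    and q: "quasi_iso A P M \<pi>"
  shows "\<exists>T. finite T \<and> generates A P T"
proof -
  interpret P: lmod A P using P by unfold_locales (simp add: dg_modules_def)
  have sc [simp]: "mscale P = u" using P by (simp add: dg_modules_def)
  define Z where "Z i = {x \<in> mgrade P i. mdiff P i x \<in> aplus A P (i + 1)}" for i
  have ap_sub: "U.subspace (aplus A P i)" and bnd_sub: "U.subspace (bnd A P i)" for i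
    using P.aplus_subspace P.bnd_subspace by simp_all
  have dscale: "mdiff P i (u c x) = u c (mdiff P i x)" if "x \<in> mgrade P i" for c i x
    using P.d_scale[OF that] by simp
  have bndZ: "bnd A P i \<subseteq> Z i" for i
  proof
    fix x assume x: "x \<in> bnd A P i"
    then obtain y w where "y \<in> mgrade P (i - 1)" "w \<in> aplus A P i" "x = mdiff P (i - 1) y + w" by (rule P.bndE)
    then show "x \<in> Z i" using aplus_d[OF P.mod] P.bnd_mem[OF x] P.aplus_mem by (simp add: Z_def)
  qed
  \<comment> \<open>Nested bases \<open>D \<subseteq> E \<subseteq> F\<close> of the boundaries
    modulo \<open>A^+ P\<close>, of the cocycles modulo \<open>A^+ P\<close>, and of all of
    \<open>'u\<close>. The difference of \<open>E\<close> and \<open>D\<close> represents a basis of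
    the cohomology, and \<open>F\<close> makes coordinates available on all of
    \<open>'u\<close>.\<close>
  have "\<exists>t. fst t \<subseteq> bnd A P i \<and> bnd A P i \<subseteq> U.span (fst t) \<and>
      fst t \<subseteq> fst (snd t) \<and> fst (snd t) \<subseteq> Z i \<and> Z i \<subseteq> U.span (fst (snd t)) \<and>
      fst (snd t) \<subseteq> snd (snd t) \<and> U.independent (snd (snd t)) \<and> U.span (snd (snd t)) = UNIV" for i
  proof -
    obtain D where D: "D \<subseteq> bnd A P i" "U.independent D" "bnd A P i \<subseteq> U.span D"
      by (rule U.maximal_independent_subset)
    obtain E where E: "D \<subseteq> E" "E \<subseteq> Z i" "U.independent E" "Z i \<subseteq> U.span E"
      using U.maximal_independent_subset_extend[OF subset_trans[OF D(1) bndZ] D(2)] by metis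
    obtain F where F: "E \<subseteq> F" "U.independent F" "UNIV \<subseteq> U.span F"
      using U.maximal_independent_subset_extend[OF subset_UNIV E(3)] by metis
    show ?thesis using D E F by (intro exI[of _ "(D, E, F)"]) auto
  qed
  then have "\<forall>i. \<exists>t. fst t \<subseteq> bnd A P i \<and> bnd A P i \<subseteq> U.span (fst t) \<and>
      fst t \<subseteq> fst (snd t) \<and> fst (snd t) \<subseteq> Z i \<and> Z i \<subseteq> U.span (fst (snd t)) \<and>
      fst (snd t) \<subseteq> snd (snd t) \<and> U.independent (snd (snd t)) \<and> U.span (snd (snd t)) = UNIV" by blast
  from choice[OF this] obtain t where t: "\<And>i. fst (t i) \<subseteq> bnd A P i \<and> bnd A P i \<subseteq> U.span (fst (t i)) \<and>
      fst (t i) \<subseteq> fst (snd (t i)) \<and> fst (snd (t i)) \<subseteq> Z i \<and> Z i \<subseteq> U.span (fst (snd (t i))) \<and>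
      fst (snd (t i)) \<subseteq> snd (snd (t i)) \<and> U.independent (snd (snd (t i))) \<and> U.span (snd (snd (t i))) = UNIV" by blast
  define D where "D i = fst (t i)" for i
  define E where "E i = fst (snd (t i))" for i
  define F where "F i = snd (snd (t i))" for i
  have D: "D i \<subseteq> bnd A P i" "bnd A P i \<subseteq> U.span (D i)" and E: "D i \<subseteq> E i" "E i \<subseteq> Z i" "Z i \<subseteq> U.span (E i)"
    and F: "E i \<subseteq> F i" "U.independent (F i)" "U.span (F i) = UNIV" for i
    using t[of i] by (auto simp: D_def E_def F_def)
  define B where "B i = E i - D i" for i
  define rep where "rep i = U.representation (F i)" for i
  have rep_add: "rep i (x + y) b = rep i x b + rep i y b" for i x y b
    unfolding rep_def by (rule U.representation_add[THEN fun_cong]) (use F in auto)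
  have rep_scale: "rep i (u c x) b = c * rep i x b" for i c x b
    unfolding rep_def by (rule U.representation_scale[THEN fun_cong]) (use F in auto)
  have rep_fin: "finite {b. rep i x b \<noteq> 0}" for i x
    unfolding rep_def by (rule U.finite_representation)
  have rep_basis: "rep i b b = 1" if "b \<in> B i" for i b
    unfolding rep_def using that F(1,2)[of i] by (subst U.representation_basis) (auto simp: B_def)
  \<comment> \<open>Boundaries expand in \<open>D\<close> alone, so coordinates at elements of
    \<open>B\<close> vanish on them; this makes each coordinate map compatible with \<open>d\<close>
    and zero on \<open>A^+ P\<close>.\<close>
  have rep_bnd: "rep i x b = 0" if "x \<in> bnd A P i" "b \<in> B i" for i x b
  proof -
    have "rep i x = U.representation (D i) x"
      unfolding rep_def by (rule U.representation_extend) (use F(1,2)[of i] E(1)[of i] D(2)[of i] that in auto)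
    then have "rep i x b \<noteq> 0 \<Longrightarrow> b \<in> D i" using U.representation_ne_zero by metis
    then show ?thesis using that by (auto simp: B_def)
  qed
  have B0: "b \<noteq> 0" if "b \<in> B i" for b i
    using that F(1,2)[of i] U.dependent_zero by (auto simp: B_def)
  have BP: "b \<in> mgrade P i" "mdiff P i b \<in> aplus A P (i + 1)" if "b \<in> B i" for b i
    using that E(2)[of i] by (auto simp: B_def Z_def)
  obtain e :: "int \<times> 'u \<Rightarrow> 'u" where e: "inj e" using ex_inj_int by blast
  define J where "J = {e (i, b) | i b. b \<in> B i}"
  define dg where "dg j = fst (inv e j)" for j
  define bs where "bs j = snd (inv e j)" for j
  have dgbs [simp]: "dg (e (i, b)) = i" "bs (e (i, b)) = b" for i b using e by (auto simp: dg_def bs_def)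
  have JB: "bs j \<in> B (dg j)" if "j \<in> J" for j using that by (auto simp: J_def)
  define N where "N j = (if j \<in> J then triv P (dg j) (U.span {bs j}) else zero_mod u)" for j
  define f where "f = (\<lambda>i x j. if j \<in> J \<and> dg j = i then u (rep i x (bs j)) (bs j) else 0)"
  have spP: "U.span {bs j} \<subseteq> mgrade P (dg j)" if "j \<in> J" for j
    using U.span_minimal[of "{bs j}" "mgrade P (dg j)"] P.grade BP(1)[OF JB[OF that]] by simp
  have N: "N j \<in> dg_modules u A" for j
  proof (cases "j \<in> J")
    case True
    have "left_dg_module A (triv P (dg j) (U.span {bs j}))"
      using spP[OF True] by (intro triv_mod[OF P.mod]) (simp_all add: U.subspace_span)
    then show ?thesis using True by (simp add: N_def dg_modules_def) (simp add: triv_def trunc_def)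
  qed (simp add: N_def zero_mod)
  have f: "dg_hom A P (direct_sum N) f"
  proof (rule direct_sum_dg_homI)
    fix i x
    \<comment> \<open>Only modules in degree \<open>i\<close> receive anything from
      \<open>x\<close>, and \<open>x\<close> has finitely many nonzero coordinates.\<close>
    have "{j. f i x j \<noteq> 0} \<subseteq> (\<lambda>b. e (i, b)) ` {b. rep i x b \<noteq> 0}"
      by (auto simp: f_def J_def)
    then show "finite {j. f i x j \<noteq> 0}" using rep_fin finite_subset by blast
  next
    fix j
    show "dg_hom A P (N j) (\<lambda>i x. f i x j)"
    proof (cases "j \<in> J")
      case False
      then show ?thesis by (auto intro!: dg_homI graded_homI simp: N_def f_def zero_mod_def)
    next
      case True
      define i' b where "i' = dg j" and "b = bs j"
      have b: "b \<in> B i'" using JB[OF True] by (simp add: i'_def b_def)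
      have Nj: "N j = triv P i' (U.span {b})" using True by (simp add: N_def i'_def b_def)
      have fj: "f i x j = (if i' = i then u (rep i x b) b else 0)" for i x
        using True by (auto simp: f_def i'_def b_def)
      have bsp: "u c b \<in> U.span {b}" for c by (simp add: U.span_base U.span_scale)
      show ?thesis unfolding Nj fj
      proof (rule dg_homI[OF graded_homI])
        fix p i a x assume a: "a \<in> agrade A p" and x: "x \<in> mgrade P i"
        consider "p < 0" | "p = 0" | "p \<ge> 1" by linarith
        then show "(if i' = p + i then u (rep (p + i) (lact P p i a x) b) b else 0) =
          ksign (0 * p) (lact (triv P i' (U.span {b})) p (i + 0) a (if i' = i then u (rep i x b) b else 0))"
        proof cases
          case 1
          then have "a = 0" using a neg_grade by auto
          then show ?thesis using x P.scale_mem[OF BP(1)[OF b]] rep_bnd[OF _ b, of 0] U.subspace_0[OF bnd_sub]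
            by (auto simp: triv_def trunc_def lact_zero_left[OF P.mod])
        next
          case 2
          then obtain c where c: "a = ascale A c (aunit A)" using a grade0 by auto
          show ?thesis using c 2 x P.lact_scale[of "aunit A" 0 _ _ c] P.scale_mem[OF BP(1)[OF b]]
            by (auto simp: triv_def trunc_def rep_scale)
        next
          case 3
          then have "lact P p i a x \<in> bnd A P (p + i)" using P.bnd_aplus P.aplus_act a x by simp
          then show ?thesis using 3 rep_bnd[OF _ b] a by (auto simp: triv_def trunc_def)
        qed
      next
        fix i x assume x: "x \<in> mgrade P i"
        show "(if i' = i + 1 then u (rep (i + 1) (mdiff P i x) b) b else 0) =
           mdiff (triv P i' (U.span {b})) i (if i' = i then u (rep i x b) b else 0)"
          using rep_bnd[OF P.bnd_d[OF x] b] by (auto simp: triv_def trunc_def)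
      qed (use bsp in \<open>auto simp: triv_def trunc_def rep_add rep_scale U.scale_left_distrib\<close>)
    qed
  qed
  from compact_null[OF M kP P q N f] obtain S where S: "finite S"
    "\<And>j. j \<notin> S \<Longrightarrow> null_hom A (-1) P (N j) (\<lambda>i x. f i x j)" by blast
  have "J \<subseteq> S"
  proof
    fix j assume j: "j \<in> J"
    show "j \<in> S"
    proof (rule ccontr)
      assume "j \<notin> S"
      from S(2)[OF this] obtain h where h: "graded_hom A (-1) P (N j) h"
        and he: "\<And>i x. x \<in> mgrade P i \<Longrightarrow> f i x j = mdiff (N j) (i - 1) (h i x) + h (i + 1) (mdiff P i x)"
        by (auto simp: null_hom_def)
      define i b where "i = dg j" and "b = bs j"
      have b: "b \<in> B i" using JB[OF j] by (simp add: i_def b_def)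
      have Nj: "N j = triv P i (U.span {b})" using j by (simp add: N_def i_def b_def)
      interpret h: ghom A P "N j" "-1" h using h by unfold_locales (use N in \<open>auto simp: dg_modules_def\<close>)
      \<comment> \<open>The target sits in the single degree \<open>i\<close>, so a homotopy is
        nonzero only on degree \<open>i + 1\<close>. There it kills \<open>A^+ P\<close>, which
        contains \<open>d b\<close>; so the coordinate map would have to kill \<open>b\<close>, on
        which it takes the value \<open>b\<close>.\<close>
      have h0: "h k x = 0" if "x \<in> mgrade P k" "k \<noteq> i + 1" for k x
        using h.mem[OF that(1), of "k - 1"] that(2) by (simp add: Nj triv_def)
      have "h (i + 1) w = 0" if "w \<in> aplus A P (i + 1)" for w
      proof (rule P.aplus_induct[OF that])
        fix p a x k assume "1 \<le> p" "a \<in> agrade A p" "x \<in> mgrade P k" "i + 1 = p + k"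
        then show "h (i + 1) (lact P p k a x) = 0" using h.act[of a p x k] h0[of x k] by simp
      qed (use h.scale h.T.V.scale_zero_right in auto)
      then have "h (i + 1) (mdiff P i b) = 0" using BP(2)[OF b] by blast
      moreover have "mdiff (N j) (i - 1) (h i b) = 0" using h0[OF BP(1)[OF b]] by simp
      ultimately have "f i b j = 0" using he[OF BP(1)[OF b]] by simp
      moreover have "f i b j = b" using j rep_basis[OF b] by (simp add: f_def i_def b_def)
      ultimately show False using B0[OF b] by simp
    qed
  qed
  then have fJ: "finite J" using S(1) finite_subset by auto
  define T where "T = {(i, b). b \<in> B i}"
  have "e ` T = J" by (auto simp: T_def J_def image_iff)
  then have "finite T" using fJ e by (metis finite_imageD inj_on_subset subset_UNIV)
  moreover have "generates A P T"
    unfolding generates_def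
  proof (intro conjI allI ballI impI)
    show "case x of (i, v) \<Rightarrow> v \<in> mgrade P i" if "x \<in> T" for x using that BP by (auto simp: T_def)
    fix i x assume "x \<in> mgrade P i" "mdiff P i x \<in> aplus A P (i + 1)"
    then have "x \<in> U.span (E i)" using E(3)[of i] by (auto simp: Z_def)
    moreover have "E i \<subseteq> {v. (i, v) \<in> T} \<union> bnd A P i" using D(1)[of i] by (auto simp: T_def B_def)
    ultimately show "x \<in> module.span (mscale P) ({v. (i, v) \<in> T} \<union> bnd A P i)"
      using U.span_mono by (metis sc subsetD)
  qed
  ultimately show ?thesis by blast
qed

end

section \<open>Bimodules\<close>

text \<open>The axioms in the usual form for right modules; the signs introduced by
  \<open>op_alg\<close> and \<open>op_left\<close> cancel against each other.\<close>

lemma right_dg_moduleI: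
  assumes sub: "vector_space (mscale M)" "\<And>i. module.subspace (mscale M) (mgrade M i)"
    and d: "\<And>i x. x \<in> mgrade M i \<Longrightarrow> mdiff M i x \<in> mgrade M (i + 1)"
    "\<And>i x y. x \<in> mgrade M i \<Longrightarrow> y \<in> mgrade M i \<Longrightarrow> mdiff M i (x + y) = mdiff M i x + mdiff M i y"
    "\<And>i c x. x \<in> mgrade M i \<Longrightarrow> mdiff M i (mscale M c x) = mscale M c (mdiff M i x)"
    "\<And>i x. x \<in> mgrade M i \<Longrightarrow> mdiff M (i + 1) (mdiff M i x) = 0"
    and r: "\<And>p i a x. a \<in> agrade A p \<Longrightarrow> x \<in> mgrade M i \<Longrightarrow> ract M i p x a \<in> mgrade M (i + p)"
    "\<And>p i a x y. a \<in> agrade A p \<Longrightarrow> x \<in> mgrade M i \<Longrightarrow> y \<in> mgrade M i \<Longrightarrow>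
        ract M i p (x + y) a = ract M i p x a + ract M i p y a"
    "\<And>p i a c x. a \<in> agrade A p \<Longrightarrow> x \<in> mgrade M i \<Longrightarrow>
        ract M i p (mscale M c x) a = mscale M c (ract M i p x a)"
    "\<And>p i a b x. a \<in> agrade A p \<Longrightarrow> b \<in> agrade A p \<Longrightarrow> x \<in> mgrade M i \<Longrightarrow>
        ract M i p x (a + b) = ract M i p x a + ract M i p x b"
    "\<And>p i a c x. a \<in> agrade A p \<Longrightarrow> x \<in> mgrade M i \<Longrightarrow>
        ract M i p x (ascale A c a) = mscale M c (ract M i p x a)"
    "\<And>p q i a b x. a \<in> agrade A p \<Longrightarrow> b \<in> agrade A q \<Longrightarrow> x \<in> mgrade M i \<Longrightarrow>
        ract M i (p + q) x (amult A p q a b) = ract M (i + p) q (ract M i p x a) b"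
    "\<And>i x. x \<in> mgrade M i \<Longrightarrow> ract M i 0 x (aunit A) = x"
    "\<And>p i a x. a \<in> agrade A p \<Longrightarrow> x \<in> mgrade M i \<Longrightarrow>
        mdiff M (i + p) (ract M i p x a) =
          ract M (i + 1) p (mdiff M i x) a + ksign i (ract M i (p + 1) x (adiff A p a))"
    and A: "dga A"
  shows "right_dg_module A M"
  unfolding right_dg_module_def
proof -
  interpret vector_space "mscale M" by fact
  interpret dga A by fact
  have dk: "mdiff M i (ksign n x) = ksign n (mdiff M i x)" if "x \<in> mgrade M i" for i n x
  proof -
    have "k_linear (mscale M) (mgrade M i) (mscale M) (mgrade M (i + 1)) (mdiff M i)"
      using d by (simp add: k_linear_def)
    from k_linear_ksign[OF this vector_space_axioms sub(2) that] show ?thesis .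
  qed
  have rk: "ract M i p (ksign n x) a = ksign n (ract M i p x a)" if "a \<in> agrade A p" "x \<in> mgrade M i" for i n x a p
  proof -
    have "k_linear (mscale M) (mgrade M i) (mscale M) (mgrade M (i + p)) (\<lambda>x. ract M i p x a)"
      by (rule k_linearI) (use r(1,2,3) that in auto)
    from k_linear_ksign[OF this vector_space_axioms sub(2) that(2)] show ?thesis .
  qed
  have rk2: "ract M i p x (ksign n a) = ksign n (ract M i p x a)" if "a \<in> agrade A p" "x \<in> mgrade M i" for i n x a p
  proof -
    have "k_linear (ascale A) (agrade A p) (mscale M) (mgrade M (i + p)) (\<lambda>a. ract M i p x a)"
      by (rule k_linearI) (use r(1,4,5) that in auto)
    from k_linear_ksign[OF this R.V.vector_space_axioms R.grade that(1)] show ?thesis .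
  qed
  have sk: "ksign n x \<in> mgrade M i \<longleftrightarrow> x \<in> mgrade M i" for n x i
    using subspace_neg[OF sub(2), of x i] subspace_neg[OF sub(2), of "- x" i] by (auto simp: ksign_def)
  have l: "lact (op_left M) p i a m = ksign (p * i) (ract M i p m a)" for p i a m
    by (simp add: op_left_def)
  have o: "mscale (op_left M) = mscale M" "mgrade (op_left M) = mgrade M" "mdiff (op_left M) = mdiff M"
    "agrade (op_alg A) = agrade A" "ascale (op_alg A) = ascale A" "adiff (op_alg A) = adiff A" "aunit (op_alg A) = aunit A"
    "amult (op_alg A) p q a b = ksign (p * q) (amult A q p b a)" for p q a b
    by (simp_all add: op_left_def op_alg_def)
  show "left_dg_module (op_alg A) (op_left M)"
  proof (rule left_dg_moduleI, unfold l o)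
    fix p q i a b x assume a: "a \<in> agrade A p" and b: "b \<in> agrade A q" and x: "x \<in> mgrade M i"
    have "amult A q p b a \<in> agrade A (p + q)" using a b by simp
    then show "ksign ((p + q) * i) (ract M i (p + q) x (ksign (p * q) (amult A q p b a))) =
        ksign (p * (q + i)) (ract M (q + i) p (ksign (q * i) (ract M i q x b)) a)"
      using r(6)[OF b a x] r(1)[OF b x] a x by (simp add: rk rk2 ac_simps) (simp add: ksign_if algebra_simps)
  next
    fix p i a x assume a: "a \<in> agrade A p" and x: "x \<in> mgrade M i"
    show "mdiff M (p + i) (ksign (p * i) (ract M i p x a)) =
       ksign ((p + 1) * i) (ract M i (p + 1) x (adiff A p a)) +
       ksign p (ksign (p * (i + 1)) (ract M (i + 1) p (mdiff M i x) a))"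
      using r(8)[OF a x] r(1)[OF a x] by (simp add: dk ac_simps) (simp add: ksign_if algebra_simps)
    show "ksign (p * i) (ract M i p x a) \<in> mgrade M (p + i)"
      using r(1)[OF a x] by (simp add: sk ac_simps)
  qed (use sub d r in \<open>auto simp: ksign_add scale_ksign\<close>)
qed

lemma dg_bimoduleI:
  "left_dg_module A M \<Longrightarrow> right_dg_module A M \<Longrightarrow>
   (\<And>p q i a b m. a \<in> agrade A p \<Longrightarrow> b \<in> agrade A q \<Longrightarrow> m \<in> mgrade M i \<Longrightarrow>
       ract M (p + i) q (lact M p i a m) b = lact M p (i + q) a (ract M i q m b)) \<Longrightarrow> dg_bimodule A M"
  by (simp add: dg_bimodule_def)

locale rmod = dga A for A :: "('k::field, 'a::ab_group_add) dg_alg" +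
  fixes M :: "('k, 'a, 'm::ab_group_add) dg_mod"
  assumes rmod: "right_dg_module A M"
begin

lemma op_sel: "mscale (op_left M) = mscale M" "mgrade (op_left M) = mgrade M" "mdiff (op_left M) = mdiff M"
    "agrade (op_alg A) = agrade A" "ascale (op_alg A) = ascale A" "adiff (op_alg A) = adiff A" "aunit (op_alg A) = aunit A"
    "amult (op_alg A) p q a b = ksign (p * q) (amult A q p b a)"
    "lact (op_left M) p i a m = ksign (p * i) (ract M i p m a)"
  by (simp_all add: op_left_def op_alg_def)

lemma op_lmod: "lmod (op_alg A) (op_left M)"
  using rmod by (simp add: right_dg_module_def lmod_def)

lemma r_mem [simp]: "a \<in> agrade A p \<Longrightarrow> x \<in> mgrade M i \<Longrightarrow> j = i + p \<Longrightarrow> ract M i p x a \<in> mgrade M j"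
  using lmod.act_mem[OF op_lmod, of a p x i j] lmod.ksign_mem[OF op_lmod] by (simp add: op_sel)

lemma r_add [simp]: "a \<in> agrade A p \<Longrightarrow> x \<in> mgrade M i \<Longrightarrow> y \<in> mgrade M i \<Longrightarrow>
        ract M i p (x + y) a = ract M i p x a + ract M i p y a"
  using lmod.act_add[OF op_lmod, of a p x i y] by (simp add: op_sel ksign_add[symmetric] ksign_cancel)

lemma r_scale [simp]: "a \<in> agrade A p \<Longrightarrow> x \<in> mgrade M i \<Longrightarrow>
        ract M i p (mscale M c x) a = mscale M c (ract M i p x a)"
  using lmod.act_scale[OF op_lmod, of a p x i c] vector_space.scale_ksign[of "mscale M"] rmod
  by (simp add: op_sel ksign_cancel right_dg_module_def left_dg_module_def)

lemma r_add2 [simp]: "a \<in> agrade A p \<Longrightarrow> b \<in> agrade A p \<Longrightarrow> x \<in> mgrade M i \<Longrightarrow>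
        ract M i p x (a + b) = ract M i p x a + ract M i p x b"
  using lmod.lact_add[OF op_lmod, of a p b x i] by (simp add: op_sel ksign_add[symmetric] ksign_cancel)

lemma r_scale2 [simp]: "a \<in> agrade A p \<Longrightarrow> x \<in> mgrade M i \<Longrightarrow>
        ract M i p x (ascale A c a) = mscale M c (ract M i p x a)"
  using lmod.lact_scale[OF op_lmod, of a p x i c] vector_space.scale_ksign[of "mscale M"] rmod
  by (simp add: op_sel ksign_cancel right_dg_module_def left_dg_module_def)

lemma r_unit [simp]: "x \<in> mgrade M i \<Longrightarrow> ract M i 0 x (aunit A) = x"
  using lmod.unit[OF op_lmod, of x i] by (simp add: op_sel)

lemma r_zero [simp]: "a \<in> agrade A p \<Longrightarrow> ract M i p 0 a = 0"
  using lmod.act_zero[OF op_lmod, of a p i] by (simp add: op_sel)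

lemma r_ksign [simp]: "a \<in> agrade A p \<Longrightarrow> x \<in> mgrade M i \<Longrightarrow> ract M i p (ksign n x) a = ksign n (ract M i p x a)"
  using lmod.act_ksign[OF op_lmod, of a p x i n] by (simp add: op_sel) (metis ksign_cancel ksign_ksign add.commute)

lemma r_ksign2 [simp]: "a \<in> agrade A p \<Longrightarrow> x \<in> mgrade M i \<Longrightarrow> ract M i p x (ksign n a) = ksign n (ract M i p x a)"
proof -
  assume "a \<in> agrade A p" "x \<in> mgrade M i"
  then have "k_linear (ascale A) (agrade A p) (mscale M) (mgrade M (i + p)) (\<lambda>a. ract M i p x a)"
    by (simp add: k_linear_def)
  from k_linear_ksign[OF this R.V.vector_space_axioms R.grade \<open>a \<in> agrade A p\<close>] show ?thesis .
qed

lemma r_assoc: "a \<in> agrade A p \<Longrightarrow> b \<in> agrade A q \<Longrightarrow> x \<in> mgrade M i \<Longrightarrow>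
        ract M i (p + q) x (amult A p q a b) = ract M (i + p) q (ract M i p x a) b"
  using lmod.assoc[OF op_lmod, of b q a p x i]
  by (simp add: op_sel ac_simps) (cases "even p"; cases "even q"; cases "even i"; simp add: ksign_if)

lemma r_leibniz: "a \<in> agrade A p \<Longrightarrow> x \<in> mgrade M i \<Longrightarrow>
        mdiff M (i + p) (ract M i p x a) =
          ract M (i + 1) p (mdiff M i x) a + ksign i (ract M i (p + 1) x (adiff A p a))"
  using lmod.leibniz[OF op_lmod, of a p x i] lmod.d_ksign[OF op_lmod, of "ract M i p x a" "i + p" "p * i"]
  by (simp add: op_sel ac_simps) (cases "even p"; cases "even i"; simp add: ksign_if algebra_simps)

end

locale bimod = L: lmod A M + rmod A M for A :: "('k::field, 'a::ab_group_add) dg_alg"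
    and M :: "('k, 'a, 'm::ab_group_add) dg_mod" +
  assumes bimod: "dg_bimodule A M"
begin

lemma lr: "a \<in> agrade A p \<Longrightarrow> b \<in> agrade A q \<Longrightarrow> m \<in> mgrade M i \<Longrightarrow>
       ract M (p + i) q (lact M p i a m) b = lact M p (i + q) a (ract M i q m b)"
  using bimod by (simp add: dg_bimodule_def)

end

lemma bimodI: "dga A \<Longrightarrow> dg_bimodule A M \<Longrightarrow> bimod A M"
  by (simp add: bimod_def lmod_def rmod_def rmod_axioms_def bimod_axioms_def dg_bimodule_def)

text \<open>A copy of \<open>M\<close> along embeddings \<open>f i\<close>, chosen degree by degree
  and inverted by \<open>g i\<close> on the components. Images of different degrees may overlap,
  which an external grading permits.\<close>

definition transport :: "('k \<Rightarrow> 'u \<Rightarrow> 'u) \<Rightarrow> (int \<Rightarrow> 'm \<Rightarrow> 'u) \<Rightarrow> (int \<Rightarrow> 'u \<Rightarrow> 'm) \<Rightarrow>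
   ('k, 'a, 'm::ab_group_add) dg_mod \<Rightarrow> ('k, 'a, 'u::ab_group_add) dg_mod" where
  "transport u f g M = \<lparr>mscale = u, mgrade = (\<lambda>i. f i ` mgrade M i),
     mdiff = (\<lambda>i w. f (i + 1) (mdiff M i (g i w))),
     lact = (\<lambda>p i a w. f (p + i) (lact M p i a (g i w))),
     ract = (\<lambda>i p w a. f (i + p) (ract M i p (g i w) a))\<rparr>"

lemma transport_left:
  assumes M: "left_dg_module A M" and f: "\<And>i. Vector_Spaces.linear (mscale M) u (f i)"
    and g: "\<And>i x. x \<in> mgrade M i \<Longrightarrow> g i (f i x) = x"
  shows "left_dg_module A (transport u f g M)"
    and "dg_hom A M (transport u f g M) f" and "dg_hom A (transport u f g M) M g"
proof -
  interpret lmod A M by unfold_locales fact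
  have u: "vector_space u" using f[of 0] by (simp add: Vector_Spaces.linear_def)
  have fa: "f i (x + y) = f i x + f i y" and fs: "f i (mscale M c x) = u c (f i x)" for i x y c
    using f[of i] by (simp_all add: Vector_Spaces.linear_iff)
  have fk: "f i (ksign n x) = ksign n (f i x)" for i n x
    using linear_ksign[OF f] .
  have f0: "f i 0 = 0" for i using fa[of i 0 0] by simp
  have sub: "module.subspace u (f i ` mgrade M i)" for i
  proof -
    interpret u: vector_space u by fact
    show ?thesis
      by (rule u.subspaceI) (auto simp: image_iff fa[symmetric] fs[symmetric]
         intro: bexI[of _ 0] simp: f0)
  qed
  show *: "left_dg_module A (transport u f g M)"
    by (rule left_dg_moduleI)
      (auto simp: transport_def u sub g fa[symmetric] fs[symmetric] fk[symmetric] f0 ac_simps assoc leibniz)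
  show "dg_hom A M (transport u f g M) f"
    by (rule dg_homI[OF graded_homI]) (auto simp: transport_def fa fs g)
  show "dg_hom A (transport u f g M) M g"
    by (rule dg_homI[OF graded_homI]) (auto simp: transport_def fa[symmetric] fs[symmetric] g)
qed

lemma transport_op:
  assumes f: "\<And>i. Vector_Spaces.linear (mscale M) u (f i)"
  shows "op_left (transport u f g M) = transport u f g (op_left M)"
  using linear_ksign[OF f] by (auto simp: op_left_def transport_def fun_eq_iff ac_simps)

lemma transport_bi:
  assumes M: "dg_bimodule A M" and f: "\<And>i. Vector_Spaces.linear (mscale M) u (f i)"
    and g: "\<And>i x. x \<in> mgrade M i \<Longrightarrow> g i (f i x) = x" and A: "dga A"
  shows "dg_bimodule A (transport u f g M)"
    and "dg_bihom A M (transport u f g M) f" and "dg_bihom A (transport u f g M) M g"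
proof -
  interpret bimod A M by (rule bimodI[OF A M])
  have op: "left_dg_module (op_alg A) (op_left M)" using M by (simp add: dg_bimodule_def right_dg_module_def)
  have fo: "Vector_Spaces.linear (mscale (op_left M)) u (f i)" and go: "x \<in> mgrade (op_left M) i \<Longrightarrow> g i (f i x) = x" for i x
    using f g by (simp_all add: op_left_def)
  note T = transport_left[where f = f and g = g, OF L.mod f g]
  note To = transport_left[where f = f and g = g, OF op fo go]
  show "dg_bimodule A (transport u f g M)"
  proof (rule dg_bimoduleI)
    show "right_dg_module A (transport u f g M)"
      using To(1) by (simp add: right_dg_module_def transport_op[OF f])
  qed (use T in \<open>auto simp: transport_def g lr add.assoc\<close>)
  show "dg_bihom A M (transport u f g M) f" "dg_bihom A (transport u f g M) M g"
    using T To by (auto simp: dg_bihom_def transport_op[OF f])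
qed

section \<open>Pairings and the attachment of cells\<close>

text \<open>A balanced pairing \<open>I \<times> F \<rightarrow> T\<close>, standing for a chain map from \<open>I \<otimes>\<^sub>A F\<close> to \<open>T\<close>.\<close>

locale pairing = I: bimod A I + F: lmod A F + T: lmod A T
  for A :: "('k::field, 'a::ab_group_add) dg_alg" and I :: "('k, 'a, 'i::ab_group_add) dg_mod"
    and F :: "('k, 'a, 'f::ab_group_add) dg_mod" and T :: "('k, 'a, 't::ab_group_add) dg_mod" +
  fixes t :: "int \<Rightarrow> int \<Rightarrow> 'i \<Rightarrow> 'f \<Rightarrow> 't"
  assumes t_mem [simp]: "x \<in> mgrade I i \<Longrightarrow> f \<in> mgrade F j \<Longrightarrow> l = i + j \<Longrightarrow> t i j x f \<in> mgrade T l"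
    and t_add1 [simp]: "x \<in> mgrade I i \<Longrightarrow> y \<in> mgrade I i \<Longrightarrow> f \<in> mgrade F j \<Longrightarrow> t i j (x + y) f = t i j x f + t i j y f"
    and t_add2 [simp]: "x \<in> mgrade I i \<Longrightarrow> f \<in> mgrade F j \<Longrightarrow> g \<in> mgrade F j \<Longrightarrow> t i j x (f + g) = t i j x f + t i j x g"
    and t_scale1 [simp]: "x \<in> mgrade I i \<Longrightarrow> f \<in> mgrade F j \<Longrightarrow> t i j (mscale I c x) f = mscale T c (t i j x f)"
    and t_scale2 [simp]: "x \<in> mgrade I i \<Longrightarrow> f \<in> mgrade F j \<Longrightarrow> t i j x (mscale F c f) = mscale T c (t i j x f)"
    and t_left: "a \<in> agrade A p \<Longrightarrow> x \<in> mgrade I i \<Longrightarrow> f \<in> mgrade F j \<Longrightarrow>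
      t (p + i) j (lact I p i a x) f = lact T p (i + j) a (t i j x f)"
    and t_bal: "a \<in> agrade A p \<Longrightarrow> x \<in> mgrade I i \<Longrightarrow> f \<in> mgrade F j \<Longrightarrow>
      t (i + p) j (ract I i p x a) f = t i (p + j) x (lact F p j a f)"
    and t_d: "x \<in> mgrade I i \<Longrightarrow> f \<in> mgrade F j \<Longrightarrow>
      mdiff T (i + j) (t i j x f) = t (i + 1) j (mdiff I i x) f + ksign i (t i (j + 1) x (mdiff F j f))"
begin

lemma t_zero1 [simp]: "f \<in> mgrade F j \<Longrightarrow> t i j 0 f = 0"
  using t_add1[of 0 i 0 f j] by simp

lemma t_zero2 [simp]: "x \<in> mgrade I i \<Longrightarrow> t i j x 0 = 0"
  using t_add2[of x i 0 j 0] by simp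

lemma t_neg2: "x \<in> mgrade I i \<Longrightarrow> f \<in> mgrade F j \<Longrightarrow> t i j x (- f) = - t i j x f"
  using t_add2[of x i f j "- f"] by (simp add: eq_neg_iff_add_eq_0 add.commute)

lemma t_ksign2 [simp]: "x \<in> mgrade I i \<Longrightarrow> f \<in> mgrade F j \<Longrightarrow> t i j x (ksign n f) = ksign n (t i j x f)"
  by (simp add: ksign_def t_neg2)

lemma t_neg1: "x \<in> mgrade I i \<Longrightarrow> f \<in> mgrade F j \<Longrightarrow> t i j (- x) f = - t i j x f"
  using t_add1[of x i "- x" f j] by (simp add: eq_neg_iff_add_eq_0 add.commute)

lemma t_ksign1 [simp]: "x \<in> mgrade I i \<Longrightarrow> f \<in> mgrade F j \<Longrightarrow> t i j (ksign n x) f = ksign n (t i j x f)"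
  by (simp add: ksign_def t_neg1)

text \<open>\<open>t\<close> is left linear in its first argument, so whatever annihilates
  \<open>x\<close> annihilates \<open>t x f\<close>.\<close>

lemma t_torsion:
  assumes x: "x \<in> mgrade (torsion A I) i" and f: "f \<in> mgrade F j" and l: "l = i + j"
  shows "t i j x f \<in> mgrade (torsion A T) l"
proof -
  obtain n where n: "n \<ge> 1" "\<forall>p\<ge>n. \<forall>a\<in>agrade A p. lact I p i a x = 0" and xI: "x \<in> mgrade I i"
    using x by (auto simp: torsion_def)
  have "\<forall>p\<ge>n. \<forall>a\<in>agrade A p. lact T p l a (t i j x f) = 0"
    using n xI f t_left[of _ _ x i f j] by (simp add: l) (metis t_zero1)
  then show ?thesis using n xI f l by (auto simp: torsion_def)
qed

end

text \<open>
  Together, the following two properties say that the pairing identifies the dual of the torsion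
  of \<open>T\<close> with \<open>Hom\<^sub>A(F, (\<Gamma> I)')\<close>.
\<close>

definition dual_inj where
  "dual_inj A I F T t \<longleftrightarrow>
    (\<forall>i g. k_linear (mscale T) (mgrade (torsion A T) i) (*) UNIV g \<longrightarrow>
       (\<forall>j. \<forall>x\<in>mgrade (torsion A I) (i - j). \<forall>f\<in>mgrade F j. g (t (i - j) j x f) = 0) \<longrightarrow>
       (\<forall>w\<in>mgrade (torsion A T) i. g w = 0))"

definition dual_surj where
  "dual_surj A I F T t \<longleftrightarrow>
    (\<forall>n G. graded_hom A n F (matlis_dual (torsion A I)) G \<longrightarrow>
       (\<exists>g. k_linear (mscale T) (mgrade (torsion A T) (- n)) (*) UNIV g \<and>
         (\<forall>j. \<forall>f\<in>mgrade F j. \<forall>x\<in>mgrade (torsion A I) (- (j + n)).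
            G j f x = ksign ((n + 1) * j) (g (t (- (j + n)) j x f)))))"

text \<open>The invariant of cell attachment. For \<open>e\<close> the image of \<open>1\<close> in
  \<open>I\<close>, the map \<open>f \<mapsto> t e f\<close> stands for the map from
  \<open>F\<close>, as \<open>A \<otimes>\<^sub>A F\<close>, to \<open>I \<otimes>\<^sub>A F\<close>
  induced by the resolution.\<close>

definition admissible ::
  "('k::field \<Rightarrow> 'u \<Rightarrow> 'u) \<Rightarrow> ('k, 'a::ab_group_add) dg_alg \<Rightarrow> ('k, 'a, 'u) dg_mod \<Rightarrow> 'u
   \<Rightarrow> ('k, 'a, 'u::ab_group_add) dg_mod \<Rightarrow> ('k, 'a, 'u) dg_mod \<Rightarrow> (int \<Rightarrow> int \<Rightarrow> 'u \<Rightarrow> 'u \<Rightarrow> 'u) \<Rightarrow> bool" where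
  "admissible u A I e F T t \<longleftrightarrow>
    F \<in> dg_modules u A \<and> T \<in> dg_modules u A \<and> kproj u A F \<and> kinj u A T \<and>
    pairing A I F T t \<and> cohomology_iso F T (\<lambda>j f. t 0 j e f) \<and>
    dual_inj A I F T t \<and> dual_surj A I F T t"

text \<open>\<open>Au\<close> is a copy of the free left module \<open>A\<close> in the universe,
  with mutually inverse isomorphisms \<open>\<kappa>\<close> and \<open>ki\<close>; cells are shifts
  of \<open>Au\<close>.\<close>

locale free_ctx = dgu A u for A :: "('k::field, 'a::ab_group_add) dg_alg"
  and u :: "'k \<Rightarrow> 'u::ab_group_add \<Rightarrow> 'u" +
  fixes Au :: "('k, 'a, 'u) dg_mod" and \<kappa> :: "int \<Rightarrow> 'a \<Rightarrow> 'u" and ki :: "int \<Rightarrow> 'u \<Rightarrow> 'a"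
  assumes Au: "Au \<in> dg_modules u A"
    and \<kappa>: "dg_hom A (reg_bimodule A) Au \<kappa>" and ki: "dg_hom A Au (reg_bimodule A) ki"
    and ki_\<kappa> [simp]: "a \<in> agrade A i \<Longrightarrow> ki i (\<kappa> i a) = a"
    and \<kappa>_ki [simp]: "w \<in> mgrade Au i \<Longrightarrow> \<kappa> i (ki i w) = w"
begin

lemma reg_sel: "mscale (reg_bimodule A) = ascale A" "mgrade (reg_bimodule A) = agrade A"
    "mdiff (reg_bimodule A) = adiff A" "lact (reg_bimodule A) = amult A"
    "ract (reg_bimodule A) = amult A"
  by (simp_all add: reg_bimodule_def)

sublocale Au: lmod A Au
  using Au by unfold_locales (simp add: dg_modules_def)

sublocale \<kappa>: dghom A "reg_bimodule A" Au \<kappa>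
  rewrites "mscale (reg_bimodule A) = ascale A" and "mgrade (reg_bimodule A) = agrade A"
    and "mdiff (reg_bimodule A) = adiff A" and "lact (reg_bimodule A) = amult A"
    and "ract (reg_bimodule A) = amult A"
  using \<kappa> reg_left Au.mod by (auto intro!: dghomI simp: reg_sel)

sublocale ki: dghom A Au "reg_bimodule A" ki
  rewrites "mscale (reg_bimodule A) = ascale A" and "mgrade (reg_bimodule A) = agrade A"
    and "mdiff (reg_bimodule A) = adiff A" and "lact (reg_bimodule A) = amult A"
    and "ract (reg_bimodule A) = amult A"
  using ki reg_left Au.mod by (auto intro!: dghomI simp: reg_sel)

lemma sc_Au [simp]: "mscale Au = u"
  using Au by (simp add: dg_modules_def)

definition one where "one = \<kappa> 0 (aunit A)"

lemma one [simp]: "one \<in> mgrade Au 0" "mdiff Au 0 one = 0" "ki 0 one = aunit A"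
  using \<kappa>.comm[of "aunit A" 0 1] by (simp_all add: one_def)

lemma Au_gen: "w \<in> mgrade Au i \<Longrightarrow> lact Au i 0 (ki i w) one = w"
  using \<kappa>.act0[of "ki i w" i "aunit A" 0] by (simp add: one_def)

text \<open>A map out of \<open>A\<close> is determined by the image \<open>y\<close> of
  \<open>1\<close>, here a cocycle. A preimage \<open>w\<close> of \<open>y\<close> under
  \<open>d\<close>, which exists in an acyclic module, determines the nullhomotopy.\<close>

lemma kproj_free: "kproj u A Au"
  unfolding kproj_def
proof (intro ballI impI allI)
  fix N n f assume N: "N \<in> dg_modules u A" and ac: "acyclic_mod N" and f: "chain_hom A (n + 1) Au N f"
  interpret N: lmod A N using N by unfold_locales (simp add: dg_modules_def)
  have sc [simp]: "mscale N = u" using N by (simp add: dg_modules_def)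
  have fd: "mdiff N (i + (n + 1)) (f i m) = ksign (n + 1) (f (i + 1) (mdiff Au i m))" if "m \<in> mgrade Au i" for i m
    using f that by (simp add: chain_hom_def)
  interpret f: ghom A Au N "n + 1" f using f by unfold_locales (simp add: chain_hom_def)
  define y where "y = f 0 one"
  have y: "y \<in> mgrade N (n + 1)" "mdiff N (n + 1) y = 0" using fd[of one 0] by (simp_all add: y_def)
  obtain w where w: "w \<in> mgrade N n" "y = mdiff N n w" by (rule acyclic_modD[OF ac y(1) refl y(2)])
  have fy: "f i v = ksign ((n + 1) * i) (lact N i (n + 1) (ki i v) y)" if v: "v \<in> mgrade Au i" for i v
    using f.act[OF ki.mem0[OF v], of one 0] v by (simp add: Au_gen y_def)
  define h where "h i v = ksign (n * i) (lact N i n (ki i v) w)" for i v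
  show "null_hom A n Au N f"
    unfolding null_hom_def
  proof (intro exI conjI allI ballI)
    show "graded_hom A n Au N h"
    proof (rule graded_homI)
      fix p i a v assume a: "a \<in> agrade A p" and v: "v \<in> mgrade Au i"
      show "h (p + i) (lact Au p i a v) = ksign (n * p) (lact N p (i + n) a (h i v))"
        using a v w by (simp add: h_def N.assoc) (simp add: algebra_simps)
    next
      fix i c x assume "x \<in> mgrade Au i"
      then show "h i (mscale Au c x) = mscale N c (h i x)"
        using w ki.scale[of x i c] N.lact_scale[of "ki i x" i w n c] by (simp add: h_def U.scale_ksign)
    qed (use w in \<open>simp_all add: h_def ksign_add\<close>)
    fix i m assume m: "m \<in> mgrade Au i"
    show "f i m = mdiff N (i + n) (h i m) - ksign n (h (i + 1) (mdiff Au i m))"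
      using m w N.leibniz[of "ki i m" i w n] unfolding fy[OF m] h_def
      by (simp add: ki.comm ksign_add ac_simps) (cases "even n"; cases "even i"; simp add: ksign_if algebra_simps)
  qed
qed

end

locale adm_ctx = free_ctx A u Au \<kappa> ki + I: bimod A I
  for A :: "('k::field, 'a::ab_group_add) dg_alg"
  and u :: "'k \<Rightarrow> 'u::ab_group_add \<Rightarrow> 'u" and Au \<kappa> ki and I :: "('k, 'a, 'u) dg_mod" +
  fixes \<iota> :: "int \<Rightarrow> 'a \<Rightarrow> 'u"
  assumes scI [simp]: "mscale I = u" and kI: "kinj u A I"
    and \<iota>: "dg_bihom A (reg_bimodule A) I \<iota>" and \<iota>c: "cohomology_iso (reg_bimodule A) I \<iota>"
begin

lemma I_in: "I \<in> dg_modules u A"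
  by (simp add: dg_modules_def I.L.mod)

definition e0 where "e0 = \<iota> 0 (aunit A)"

sublocale \<iota>: dghom A "reg_bimodule A" I \<iota>
  rewrites "mscale (reg_bimodule A) = ascale A" and "mgrade (reg_bimodule A) = agrade A"
    and "mdiff (reg_bimodule A) = adiff A" and "lact (reg_bimodule A) = amult A"
    and "ract (reg_bimodule A) = amult A"
  using \<iota> reg_left I.L.mod by (auto intro!: dghomI simp: reg_sel dg_bihom_def)

lemma e0 [simp]: "e0 \<in> mgrade I 0" "mdiff I 0 e0 = 0"
  using \<iota>.comm[of "aunit A" 0 1] by (simp_all add: e0_def)

lemma \<iota>_left: "a \<in> agrade A p \<Longrightarrow> \<iota> p a = lact I p 0 a e0"
  using \<iota>.act0[of a p "aunit A" 0] by (simp add: e0_def)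

text \<open>With \<open>\<iota>_left\<close> this shows that \<open>e0\<close> commutes with
  \<open>A\<close>, as the image of \<open>1\<close> under a bimodule map. It is the reason why
  pairing with \<open>e0\<close> is a module homomorphism.\<close>

lemma \<iota>_right: "a \<in> agrade A p \<Longrightarrow> \<iota> p a = ract I 0 p e0 a"
proof -
  assume a: "a \<in> agrade A p"
  have "graded_hom (op_alg A) 0 (op_left (reg_bimodule A)) (op_left I) \<iota>"
    using \<iota> by (simp add: dg_bihom_def dg_hom_def)
  then have "\<forall>p i. \<forall>a\<in>agrade A p. \<forall>m\<in>agrade A i.
      ksign (p * i) (\<iota> (p + i) (amult A i p m a)) = ksign (p * i) (ract I i p (\<iota> i m) a)"
    unfolding graded_hom_def by (auto simp: op_left_def op_alg_def reg_bimodule_def)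
  from this[rule_format, OF a, of "aunit A" 0] show ?thesis using a by (simp add: e0_def)
qed

text \<open>This is \<open>\<iota>\<close> on the copy \<open>Au\<close>, written as right
  multiplication on \<open>e0\<close>, the form in which pairing \<open>e0\<close> with a cell
  produces it.\<close>

lemma \<iota>_surj: "cohomology_iso Au I (\<lambda>i w. ract I 0 i e0 (ki i w))"
  and \<iota>_ki_dg: "dg_hom A Au I (\<lambda>i w. ract I 0 i e0 (ki i w))"
proof -
  have eq: "ract I 0 i e0 (ki i w) = \<iota> i (ki i w)" if "w \<in> mgrade Au i" for i w
    using \<iota>_right[of "ki i w" i] that by simp
  show "dg_hom A Au I (\<lambda>i w. ract I 0 i e0 (ki i w))"
  proof (rule dg_homI[OF graded_homI])
    fix i c x assume x: "x \<in> mgrade Au i"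
    show "ract I 0 i e0 (ki i (mscale Au c x)) = mscale I c (ract I 0 i e0 (ki i x))"
      using x ki.scale[of x i c] I.r_scale2[of "ki i x" i e0 0 c] by simp
  next
    fix p i a x assume "a \<in> agrade A p" "x \<in> mgrade Au i"
    moreover from this have "ract I 0 (p + i) e0 (ki (p + i) (lact Au p i a x)) = \<iota> (p + i) (ki (p + i) (lact Au p i a x))"
      by (intro eq) simp
    ultimately show "ract I 0 (p + i) e0 (ki (p + i) (lact Au p i a x)) = ksign (0 * p) (lact I p (i + 0) a (ract I 0 i e0 (ki i x)))"
      by (simp add: eq)
  next
    fix i x assume "x \<in> mgrade Au i"
    moreover from this have "ract I 0 (i + 1) e0 (ki (i + 1) (mdiff Au i x)) = \<iota> (i + 1) (ki (i + 1) (mdiff Au i x))"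
      by (intro eq) simp
    ultimately show "ract I 0 (i + 1) e0 (ki (i + 1) (mdiff Au i x)) = mdiff I i (ract I 0 i e0 (ki i x))"
      by (simp add: eq ki.comm \<iota>.comm)
  qed simp_all
  show "cohomology_iso Au I (\<lambda>i w. ract I 0 i e0 (ki i w))"
  proof (rule cisoI)
    fix i y assume y: "y \<in> mgrade I (i + 1)" "mdiff I (i + 1) y = 0"
    obtain a v where "a \<in> agrade A (i + 1)" "adiff A (i + 1) a = 0" "v \<in> mgrade I i" "y - \<iota> (i + 1) a = mdiff I i v"
      using ciso_surj[OF \<iota>c y(1) refl y(2), unfolded reg_sel] .
    then show "\<exists>x\<in>mgrade Au (i + 1). mdiff Au (i + 1) x = 0 \<and> (\<exists>w\<in>mgrade I i. y - ract I 0 (i + 1) e0 (ki (i + 1) x) = mdiff I i w)"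
      using \<kappa>.comm[of a "i + 1" "i + 1 + 1"] by (intro bexI[of _ "\<kappa> (i + 1) a"] conjI bexI[of _ v]) (auto simp: \<iota>_right)
  next
    fix i x w assume x: "x \<in> mgrade Au (i + 1)" "mdiff Au (i + 1) x = 0" and w: "w \<in> mgrade I i"
      "ract I 0 (i + 1) e0 (ki (i + 1) x) = mdiff I i w"
    have k: "ki (i + 1) x \<in> agrade A (i + 1)" "adiff A (i + 1) (ki (i + 1) x) = 0"
      using x ki.comm[of x "i + 1" "i + 1 + 1"] by simp_all
    have "\<iota> (i + 1) (ki (i + 1) x) = mdiff I i w" using w eq[OF x(1)] by simp
    then obtain v where v: "v \<in> agrade A i" "ki (i + 1) x = adiff A i v"
      using ciso_inj[OF \<iota>c, unfolded reg_sel, OF k(1) refl k(2) w(1)] by blast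
    have "x = mdiff Au i (\<kappa> i v)" using x v \<kappa>_ki[OF x(1)] \<kappa>.comm[OF v(1) refl] by simp
    then show "\<exists>v\<in>mgrade Au i. x = mdiff Au i v" using v by (intro bexI[of _ "\<kappa> i v"]) auto
  qed
qed

text \<open>Attaching a cell: \<open>F\<close> is extended by a free generator with differential \<open>f0\<close> of degree \<open>m = 1 - s\<close>.\<close>

definition tauF where
  "tauF F s f0 i w = ksign ((1 - s) * (i + s)) (lact F (i + s) (1 - s) (ki (i + s) w) f0)"

text \<open>The counterpart of \<open>tauF\<close> after tensoring with \<open>I\<close>: the new
  cell contributes a shift of \<open>I\<close>, glued by \<open>x \<mapsto> x \<otimes> f0\<close>
  with the same sign.\<close>

definition tauT where
  "tauT t s f0 i x = ksign ((1 - s) * (i + s)) (t (i + s) (1 - s) x f0)"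

text \<open>On the new cell the pairing is the right action of \<open>A\<close> on \<open>I\<close>,
  with the sign for moving the shift by \<open>s\<close> past \<open>x\<close>.\<close>

definition cellt where
  "cellt t s i j x w = pr (t i j x (p1 w)) (ksign (s * i) (ract I i (j + s) x (ki (j + s) (p2 w))))"

lemma tauF_twisting:
  assumes F: "F \<in> dg_modules u A" and f0: "f0 \<in> mgrade F (1 - s)" "mdiff F (1 - s) f0 = 0"
  shows "twisting A F Au s (tauF F s f0)"
proof -
  interpret F: lmod A F using F by unfold_locales (simp add: dg_modules_def)
  have sc [simp]: "mscale F = u" using F by (simp add: dg_modules_def)
  have e: "i + s + (1 - s) = i + 1" for i by simp
  show ?thesis
    unfolding twisting_def
  proof (intro conjI allI ballI)
    fix i show "k_linear (mscale Au) (mgrade Au (i + s)) (mscale F) (mgrade F (i + 1)) (tauF F s f0 i)"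
    proof (rule k_linearI)
      fix x c assume x: "x \<in> mgrade Au (i + s)"
      show "tauF F s f0 i (mscale Au c x) = mscale F c (tauF F s f0 i x)"
        using x f0 ki.scale[of x "i + s" c] F.lact_scale[of "ki (i + s) x" "i + s" f0 "1 - s" c]
        by (simp add: tauF_def U.scale_ksign)
    qed (use f0 in \<open>simp_all add: tauF_def ksign_add\<close>)
    fix y assume y: "y \<in> mgrade Au (i + s)"
    show "mdiff F (i + 1) (tauF F s f0 i y) = - ksign s (tauF F s f0 (i + 1) (mdiff Au (i + s) y))"
    proof -
      have "mdiff F (i + 1) (lact F (i + s) (1 - s) (ki (i + s) y) f0) =
         lact F (i + 1 + s) (1 - s) (ki (i + 1 + s) (mdiff Au (i + s) y)) f0"
        using F.leibniz[of "ki (i + s) y" "i + s" f0 "1 - s"] y f0 ki.comm[OF y, of "i + 1 + s"]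
        by (simp add: ac_simps)
      then show ?thesis using y f0
        by (simp add: tauF_def) (cases "even s"; cases "even i"; simp add: ksign_if)
    qed
    fix p a assume a: "a \<in> agrade A p"
    show "tauF F s f0 (p + i) (lact Au p (i + s) a y) = ksign (p * (1 + s)) (lact F p (i + 1) a (tauF F s f0 i y))"
    proof -
      have "lact F (p + i + s) (1 - s) (ki (p + i + s) (lact Au p (i + s) a y)) f0 =
        lact F p (i + 1) a (lact F (i + s) (1 - s) (ki (i + s) y) f0)"
        using ki.act0[OF a y] F.assoc[OF a, of "ki (i + s) y" "i + s" f0 "1 - s"] y f0
        by (simp add: add.assoc)
      then show ?thesis using y f0 a
        by (simp add: tauF_def) (cases "even s"; cases "even i"; cases "even p"; simp add: ksign_if)
    qed
  qed
qed

lemma tauT_twisting: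
  assumes F: "F \<in> dg_modules u A" and T: "T \<in> dg_modules u A" and "pairing A I F T t"
    and f0: "f0 \<in> mgrade F (1 - s)" "mdiff F (1 - s) f0 = 0"
  shows "twisting A T I s (tauT t s f0)"
proof -
  interpret pairing A I F T t by fact
  have sc [simp]: "mscale F = u" "mscale T = u" using F T by (simp_all add: dg_modules_def)
  show ?thesis
    unfolding twisting_def
  proof (intro conjI allI ballI)
    fix i show "k_linear (mscale I) (mgrade I (i + s)) (mscale T) (mgrade T (i + 1)) (tauT t s f0 i)"
    proof (rule k_linearI)
      fix x c assume x: "x \<in> mgrade I (i + s)"
      show "tauT t s f0 i (mscale I c x) = mscale T c (tauT t s f0 i x)"
        using x f0 t_scale1[of x "i + s" f0 "1 - s" c] by (simp add: tauT_def U.scale_ksign)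
    qed (use f0 in \<open>simp_all add: tauT_def ksign_add\<close>)
    fix y assume y: "y \<in> mgrade I (i + s)"
    show "mdiff T (i + 1) (tauT t s f0 i y) = - ksign s (tauT t s f0 (i + 1) (mdiff I (i + s) y))"
    proof -
      have "mdiff T (i + 1) (t (i + s) (1 - s) y f0) = t (i + 1 + s) (1 - s) (mdiff I (i + s) y) f0"
        using t_d[OF y f0(1)] y f0 by (simp add: ac_simps)
      then show ?thesis using y f0
        by (simp add: tauT_def) (cases "even s"; cases "even i"; simp add: ksign_if)
    qed
    fix p a assume a: "a \<in> agrade A p"
    show "tauT t s f0 (p + i) (lact I p (i + s) a y) = ksign (p * (1 + s)) (lact T p (i + 1) a (tauT t s f0 i y))"
    proof -
      have "t (p + i + s) (1 - s) (lact I p (i + s) a y) f0 = lact T p (i + 1) a (t (i + s) (1 - s) y f0)"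
        using t_left[OF a y f0(1)] by (simp add: add.assoc)
      then show ?thesis using y f0 a
        by (simp add: tauT_def) (cases "even s"; cases "even i"; cases "even p"; simp add: ksign_if)
    qed
  qed
qed

text \<open>The decisive point is the differential on the new cell: gluing \<open>x k\<close> along
  \<open>tauT\<close> and pairing \<open>x\<close> with \<open>k\<close> glued along
  \<open>tauF\<close> must agree, and they do because the old pairing identifies
  \<open>x k \<otimes> f0\<close> with \<open>x \<otimes> k f0\<close>.\<close>

lemma cell_pairing:
  assumes F: "F \<in> dg_modules u A" and T: "T \<in> dg_modules u A" and p: "pairing A I F T t"
    and f0: "f0 \<in> mgrade F (1 - s)" "mdiff F (1 - s) f0 = 0"
  shows "pairing A I (gcone F Au s (tauF F s f0)) (gcone T I s (tauT t s f0)) (cellt t s)"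
proof -
  interpret P: pairing A I F T t by fact
  interpret CF: cone A u F Au s "tauF F s f0" by (rule coneI[OF F Au tauF_twisting[OF F f0]])
  interpret CT: cone A u T I s "tauT t s f0" by (rule coneI[OF T I_in tauT_twisting[OF F T p f0]])
  note CF.GE [elim!]
  show ?thesis
  proof (unfold_locales)
    fix x i w j l assume x: "x \<in> mgrade I i" and w: "w \<in> mgrade CF.G j"
    show "l = i + j \<Longrightarrow> cellt t s i j x w \<in> mgrade CT.G l"
      using x w by (auto simp: cellt_def)
    show "cellt t s i j (x + y) w = cellt t s i j x w + cellt t s i j y w" if "y \<in> mgrade I i" for y
      using x w that by (auto simp: cellt_def ksign_add pr_add)
    show "cellt t s i j x (w + v) = cellt t s i j x w + cellt t s i j x v" if "v \<in> mgrade CF.G j" for v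
      using x w that by (auto simp: cellt_def ksign_add pr_add p1_add p2_add)
    show "cellt t s i j (mscale I c x) w = mscale CT.G c (cellt t s i j x w)" for c
      using x w P.t_scale1[OF x, of _ j c] I.r_scale[OF _ x, of _ "j + s" c]
      by (auto simp: cellt_def pr_scale[symmetric] U.scale_ksign)
    show "cellt t s i j x (mscale CF.G c w) = mscale CT.G c (cellt t s i j x w)" for c
      using x w P.t_scale2[OF x, of _ j c] I.r_scale2[OF _ x, of _ "j + s" c] ki.scale[of _ "j + s" c]
      by (auto simp: cellt_def pr_scale[symmetric] U.scale_ksign p1_scale p2_scale)
    obtain f v where w': "w = pr f v" "f \<in> mgrade F j" "v \<in> mgrade Au (j + s)" using w by (rule CF.GE)
    have "cellt t s (p + i) j (lact I p i a x) w = lact CT.G p (i + j) a (cellt t s i j x w)" if a: "a \<in> agrade A p" for a p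
    proof -
      have "ract I (p + i) (j + s) (lact I p i a x) (ki (j + s) v) = lact I p (i + j + s) a (ract I i (j + s) x (ki (j + s) v))"
        using I.lr[OF a _ x, of "ki (j + s) v" "j + s"] w' by (simp add: ac_simps)
      then show ?thesis using x w' a P.t_left[OF a x w'(2)]
        by (simp add: cellt_def algebra_simps)
    qed
    then show "a \<in> agrade A p \<Longrightarrow> cellt t s (p + i) j (lact I p i a x) w = lact CT.G p (i + j) a (cellt t s i j x w)" for a p .
    have "cellt t s (i + p) j (ract I i p x a) w = cellt t s i (p + j) x (lact CF.G p j a w)" if a: "a \<in> agrade A p" for a p
    proof -
      have "ract I (i + p) (j + s) (ract I i p x a) (ki (j + s) v) = ract I i (p + j + s) x (ki (p + j + s) (lact Au p (j + s) a v))"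
        using I.r_assoc[OF a _ x, of "ki (j + s) v" "j + s"] w' a ki.act0[OF a w'(3)] by (simp add: add.assoc)
      moreover have "ki (p + j + s) (ksign n (lact Au p (j + s) a v)) = ksign n (ki (p + j + s) (lact Au p (j + s) a v))" for n
        using w' a by (simp add: add.assoc)
      moreover have "ki (p + j + s) (lact Au p (j + s) a v) \<in> agrade A (p + j + s)" using w' a by (simp add: add.assoc)
      ultimately show ?thesis using x w' a P.t_bal[OF a x w'(2)]
        by (simp add: cellt_def) (simp add: algebra_simps)
    qed
    then show "a \<in> agrade A p \<Longrightarrow> cellt t s (i + p) j (ract I i p x a) w = cellt t s i (p + j) x (lact CF.G p j a w)" for a p .
    show "mdiff CT.G (i + j) (cellt t s i j x w) = cellt t s (i + 1) j (mdiff I i x) w + ksign i (cellt t s i (j + 1) x (mdiff CF.G j w))"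
    proof -
      define k where "k = ki (j + s) v"
      have k: "k \<in> agrade A (j + s)" using w' by (simp add: k_def)
      have kd: "ki (j + 1 + s) (mdiff Au (j + s) v) = adiff A (j + s) k"
        using ki.comm[OF w'(3), of "j + 1 + s"] by (simp add: k_def)
      have kd': "ki (j + 1 + s) (ksign s (mdiff Au (j + s) v)) = ksign s (adiff A (j + s) k)"
        using w' by (simp add: kd)
      have dk: "adiff A (j + s) k \<in> agrade A (j + 1 + s)" using k by simp
      have b: "t (i + j + s) (1 - s) (ract I i (j + s) x k) f0 = t i (j + 1) x (lact F (j + s) (1 - s) k f0)"
        using P.t_bal[OF k x f0(1)] by (simp add: add.assoc)
      have lm: "lact F (j + s) (1 - s) k f0 \<in> mgrade F (j + 1)" using k f0 by simp
      have rm: "ract I i (j + s) x k \<in> mgrade I (i + j + s)" using k x by simp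
      have l: "mdiff I (i + j + s) (ract I i (j + s) x k) =
          ract I (i + 1) (j + s) (mdiff I i x) k + ksign i (ract I i (j + 1 + s) x (adiff A (j + s) k))"
        using I.r_leibniz[OF k x] by (simp add: ac_simps)
      have tF: "tauF F s f0 j v = ksign ((1 - s) * (j + s)) (lact F (j + s) (1 - s) k f0)"
        by (simp add: tauF_def k_def)
      have tT: "tauT t s f0 (i + j) (ksign (s * i) (ract I i (j + s) x k)) =
          ksign ((1 - s) * (i + j + s) + s * i) (t i (j + 1) x (lact F (j + s) (1 - s) k f0))"
        using rm f0 by (simp add: tauT_def b)
      have c1: "cellt t s i j x w = pr (t i j x f) (ksign (s * i) (ract I i (j + s) x k))"
        by (simp add: cellt_def w' k_def)
      have c2: "cellt t s (i + 1) j (mdiff I i x) w = pr (t (i + 1) j (mdiff I i x) f) (ksign (s * (i + 1)) (ract I (i + 1) (j + s) (mdiff I i x) k))"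
        by (simp add: cellt_def w' k_def)
      have c3: "cellt t s i (j + 1) x (mdiff CF.G j w) =
         pr (t i (j + 1) x (mdiff F j f) + ksign ((1 - s) * (j + s)) (t i (j + 1) x (lact F (j + s) (1 - s) k f0)))
            (ksign (s * i + s) (ract I i (j + 1 + s) x (adiff A (j + s) k)))"
        using x w' dk lm by (simp add: cellt_def kd' tF)
      have "mdiff CT.G (i + j) (cellt t s i j x w) =
         pr (t (i + 1) j (mdiff I i x) f + ksign i (t i (j + 1) x (mdiff F j f)) +
           ksign ((1 - s) * (i + j + s) + s * i) (t i (j + 1) x (lact F (j + s) (1 - s) k f0)))
          (ksign (s + s * i) (ract I (i + 1) (j + s) (mdiff I i x) k + ksign i (ract I i (j + 1 + s) x (adiff A (j + s) k))))"
        using P.t_d[OF x w'(2)] rm by (simp add: c1 tT l)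
      also have "\<dots> = cellt t s (i + 1) j (mdiff I i x) w + ksign i (cellt t s i (j + 1) x (mdiff CF.G j w))"
        unfolding c2 c3 pr_ksign[symmetric] pr_add[symmetric]
        by (cases "even s"; cases "even i"; cases "even j"; simp add: ksign_if)
      finally show ?thesis .
    qed
  qed
qed

end

section \<open>Torsion and Matlis duals\<close>

lemma (in rmod) r_zero2 [simp]: "x \<in> mgrade M i \<Longrightarrow> ract M i p x 0 = 0"
  using r_add2[of 0 p 0 x i] by simp

lemma torsion_sel [simp]: "mscale (torsion A M) = mscale M" "mdiff (torsion A M) = mdiff M"
  "lact (torsion A M) = lact M" "ract (torsion A M) = ract M"
  by (simp_all add: torsion_def)

lemma torsion_mem: "x \<in> mgrade (torsion A M) i \<longleftrightarrow>
    x \<in> mgrade M i \<and> (\<exists>n\<ge>1. \<forall>p\<ge>n. \<forall>a\<in>agrade A p. lact M p i a x = 0)"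
  by (simp add: torsion_def)

lemma torsion_sub: "x \<in> mgrade (torsion A M) i \<Longrightarrow> x \<in> mgrade M i"
  by (simp add: torsion_def)

lemma torsionI: "x \<in> mgrade M i \<Longrightarrow> (\<And>p a. n \<le> p \<Longrightarrow> a \<in> agrade A p \<Longrightarrow> lact M p i a x = 0) \<Longrightarrow>
   x \<in> mgrade (torsion A M) i"
  unfolding torsion_mem by (intro conjI exI[of _ "max n 1"]) auto

lemma torsionE:
  assumes "x \<in> mgrade (torsion A M) i"
  obtains n where "x \<in> mgrade M i" "\<forall>p\<ge>n. \<forall>a\<in>agrade A p. lact M p i a x = 0"
  using assms unfolding torsion_mem by blast

context dga
begin

lemma torsion_left:
  assumes "left_dg_module A M"
  shows "left_dg_module A (torsion A M)"
proof -
  interpret lmod A M by unfold_locales fact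
  show ?thesis
  proof (rule left_dg_module_sub[OF assms])
    show "mgrade (torsion A M) i \<subseteq> mgrade M i" for i by (auto simp: torsion_sub)
    show "V.subspace (mgrade (torsion A M) i)" for i
    proof (rule V.subspaceI)
      show "0 \<in> mgrade (torsion A M) i" by (rule torsionI) auto
      fix x assume "x \<in> mgrade (torsion A M) i"
      then obtain n where x: "x \<in> mgrade M i" "\<forall>p\<ge>n. \<forall>a\<in>agrade A p. lact M p i a x = 0"
        by (rule torsionE)
      show "mscale M c x \<in> mgrade (torsion A M) i" for c
        using x by (intro torsionI[of _ _ _ n]) auto
      fix y assume "y \<in> mgrade (torsion A M) i"
      then obtain k where "y \<in> mgrade M i" "\<forall>p\<ge>k. \<forall>a\<in>agrade A p. lact M p i a y = 0"
        by (rule torsionE)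
      then show "x + y \<in> mgrade (torsion A M) i"
        using x by (intro torsionI[of _ _ _ "max n k"]) auto
    qed
    fix i x assume "x \<in> mgrade (torsion A M) i"
    then obtain n where x: "x \<in> mgrade M i" "\<forall>p\<ge>n. \<forall>a\<in>agrade A p. lact M p i a x = 0"
      by (rule torsionE)
    show "mdiff M i x \<in> mgrade (torsion A M) (i + 1)"
    proof (rule torsionI[of _ _ _ n])
      fix p a assume "n \<le> p" "a \<in> agrade A p"
      then show "lact M p (i + 1) a (mdiff M i x) = 0" using leibniz[of a p x i] x by simp
    qed (use x in simp)
    fix p a assume a: "a \<in> agrade A p"
    show "lact M p i a x \<in> mgrade (torsion A M) (p + i)"
    proof (cases "p < 0")
      case True
      then have "a = 0" using a neg_grade by auto
      then show ?thesis using x lact_zero_left[OF assms] by (intro torsionI) auto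
    next
      case False
      show ?thesis
      proof (rule torsionI[of _ _ _ n])
        fix q b assume "n \<le> q" "b \<in> agrade A q"
        then show "lact M q (p + i) b (lact M p i a x) = 0"
          using a x False assoc[of b q a p x i, symmetric] by simp
      qed (use a x in simp)
    qed
  qed simp_all
qed

text \<open>The right action preserves left torsion, since the two actions commute.\<close>

lemma torsion_bi:
  assumes "dg_bimodule A M"
  shows "dg_bimodule A (torsion A M)"
proof -
  interpret bimod A M by (rule bimodI) (use assms in \<open>auto intro: dga_axioms\<close>)
  have T: "left_dg_module A (torsion A M)" by (rule torsion_left[OF L.mod])
  interpret T: lmod A "torsion A M" using T by unfold_locales
  show ?thesis
  proof (rule dg_bimoduleI[OF T])
    have r: "ract M i p x a \<in> mgrade (torsion A M) (i + p)" if a: "a \<in> agrade A p" and x': "x \<in> mgrade (torsion A M) i" for a p x i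
    proof -
      obtain n where x: "x \<in> mgrade M i" "\<forall>p\<ge>n. \<forall>a\<in>agrade A p. lact M p i a x = 0"
        using x' by (rule torsionE)
      show ?thesis
      proof (rule torsionI[of _ _ _ n])
        fix q b assume "n \<le> q" "b \<in> agrade A q"
        then show "lact M q (i + p) b (ract M i p x a) = 0"
          using a x lr[of b q a p x i, symmetric] by simp
      qed (use a x in simp)
    qed
    show "right_dg_module A (torsion A M)"
      by (rule right_dg_moduleI)
        (use T.grade T.V.vector_space_axioms T.d_mem in \<open>auto simp: r torsion_sub r_assoc r_leibniz intro: dga_axioms\<close>)
  qed (simp add: lr torsion_sub)
qed

end

lemma matlis_sel [simp]: "mscale (matlis_dual M) = (\<lambda>c f m. c * f m)"
  "mgrade (matlis_dual M) j = {f. k_linear (mscale M) (mgrade M (- j)) (*) UNIV f \<and> (\<forall>m. m \<notin> mgrade M (- j) \<longrightarrow> f m = 0)}"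
  "mdiff (matlis_dual M) j f m = (if m \<in> mgrade M (- j - 1) then - ksign j (f (mdiff M (- j - 1) m)) else 0)"
  "lact (matlis_dual M) p j a f m = (if m \<in> mgrade M (- j - p) then ksign p (f (ract M (- j - p) p m a)) else 0)"
  "ract (matlis_dual M) j p f a m = (if m \<in> mgrade M (- j - p) then f (lact M p (- j - p) a m) else 0)"
  by (simp_all add: matlis_dual_def)

lemma matlis_vs: "vector_space (\<lambda>c (f :: 'm \<Rightarrow> 'k::field) m. c * f m)"
  by unfold_locales (auto simp: fun_eq_iff algebra_simps)

lemma matlis_subspace:
  fixes M :: "('k::field, 'a, 'm::ab_group_add) dg_mod"
  shows "module.subspace (\<lambda>c (f :: 'm \<Rightarrow> 'k) m. c * f m) (mgrade (matlis_dual M) j)"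
proof -
  interpret vector_space "\<lambda>c (f :: 'm \<Rightarrow> 'k) m. c * f m" by (rule matlis_vs)
  show ?thesis by (rule subspaceI) (auto simp: k_linear_def algebra_simps)
qed

lemma k_ksign_mult: "ksign n (c * x) = c * ksign n (x :: 'k::field)"
  by (simp add: ksign_def)

lemma matlis_d_facts:
  assumes "left_dg_module A (M :: ('k::field, 'a::ab_group_add, 'm::ab_group_add) dg_mod)"
  shows "f \<in> mgrade (matlis_dual M) i \<Longrightarrow> mdiff (matlis_dual M) i f \<in> mgrade (matlis_dual M) (i + 1)"
    and "mdiff (matlis_dual M) i (f + g) = mdiff (matlis_dual M) i f + mdiff (matlis_dual M) i g"
    and "mdiff (matlis_dual M) i (\<lambda>m. c * f m) = (\<lambda>m. c * mdiff (matlis_dual M) i f m)"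
    and "f \<in> mgrade (matlis_dual M) i \<Longrightarrow> mdiff (matlis_dual M) (i + 1) (mdiff (matlis_dual M) i f) = 0"
proof -
  interpret lmod A M by unfold_locales fact
  have e: "- i - 1 = - (i + 1)" for i :: int by simp
  show "mdiff (matlis_dual M) i f \<in> mgrade (matlis_dual M) (i + 1)" if "f \<in> mgrade (matlis_dual M) i"
    using that by (auto simp: k_linear_def ksign_add k_ksign_mult)
  show "mdiff (matlis_dual M) i (f + g) = mdiff (matlis_dual M) i f + mdiff (matlis_dual M) i g"
    by (auto simp: fun_eq_iff ksign_add)
  show "mdiff (matlis_dual M) i (\<lambda>m. c * f m) = (\<lambda>m. c * mdiff (matlis_dual M) i f m)"
    by (auto simp: fun_eq_iff k_ksign_mult)
  show "mdiff (matlis_dual M) (i + 1) (mdiff (matlis_dual M) i f) = 0" if f: "f \<in> mgrade (matlis_dual M) i"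
  proof
    fix m
    have f0: "f 0 = 0" using f k_linear_zero[of "mscale M" "mgrade M (- i)" "(*)" UNIV f] by simp
    have "mdiff M (- i - 1) (mdiff M (- (i + 1) - 1) m) = 0" if "m \<in> mgrade M (- (i + 1) - 1)"
      using dd[OF that, of "- i - 1"] by simp
    then show "mdiff (matlis_dual M) (i + 1) (mdiff (matlis_dual M) i f) m = 0 m"
      using f0 by (simp del: minus_add_distrib)
  qed
qed

lemma (in dga) matlis_right:
  assumes "left_dg_module A (M :: ('k, 'a, 'm::ab_group_add) dg_mod)"
  shows "right_dg_module A (matlis_dual M)"
proof -
  interpret lmod A M by unfold_locales fact
  note md = matlis_d_facts[OF assms]
  show ?thesis
  proof (rule right_dg_moduleI)
    show "vector_space (mscale (matlis_dual M))" by (simp add: matlis_vs)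
    show "module.subspace (mscale (matlis_dual M)) (mgrade (matlis_dual M) i)" for i
      using matlis_subspace[of M i] by simp
    fix i f assume f: "f \<in> mgrade (matlis_dual M) i"
    then have fl: "k_linear (mscale M) (mgrade M (- i)) (*) UNIV f" by simp
    note fl = k_linearD(2,3)[OF fl] k_linear_zero[OF fl zero_mem]
    show "mdiff (matlis_dual M) i f \<in> mgrade (matlis_dual M) (i + 1)" "mdiff (matlis_dual M) (i + 1) (mdiff (matlis_dual M) i f) = 0"
      using md(1,4)[OF f] by blast+
    show "mdiff (matlis_dual M) i (f + g) = mdiff (matlis_dual M) i f + mdiff (matlis_dual M) i g" for g by (rule md(2))
    show "mdiff (matlis_dual M) i (mscale (matlis_dual M) c f) = mscale (matlis_dual M) c (mdiff (matlis_dual M) i f)" for c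
      using md(3)[of i c f] by simp
    fix p a assume a: "a \<in> agrade A p"
    have e: "- (i + p) = - i - p" by simp
    show "ract (matlis_dual M) i p f a \<in> mgrade (matlis_dual M) (i + p)"
      using a by (simp add: k_linear_def fl)
    show "ract (matlis_dual M) i p (f + g) a = ract (matlis_dual M) i p f a + ract (matlis_dual M) i p g a" for g
      by (auto simp: fun_eq_iff)
    show "ract (matlis_dual M) i p (mscale (matlis_dual M) c f) a = mscale (matlis_dual M) c (ract (matlis_dual M) i p f a)" for c
      by (auto simp: fun_eq_iff)
    show "ract (matlis_dual M) i p f (a + b) = ract (matlis_dual M) i p f a + ract (matlis_dual M) i p f b" if "b \<in> agrade A p" for b
      using a that by (auto simp: fun_eq_iff fl)
    show "ract (matlis_dual M) i p f (ascale A c a) = mscale (matlis_dual M) c (ract (matlis_dual M) i p f a)" for c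
      using a by (auto simp: fun_eq_iff fl)
    show "ract (matlis_dual M) i (p + q) f (amult A p q a b) = ract (matlis_dual M) (i + p) q (ract (matlis_dual M) i p f a) b"
      if b: "b \<in> agrade A q" for q b
    proof
      fix m
      have 1: "- i - (p + q) = - (i + p) - q" by simp
      have 2: "q + (- (i + p) - q) = - i - p" by simp
      show "ract (matlis_dual M) i (p + q) f (amult A p q a b) m = ract (matlis_dual M) (i + p) q (ract (matlis_dual M) i p f a) b m"
        using assoc[OF a b, of m "- (i + p) - q"] act_mem[OF b, of m "- (i + p) - q" "- i - p"]
        unfolding matlis_sel 1 2 by simp
    qed
    show "mdiff (matlis_dual M) (i + p) (ract (matlis_dual M) i p f a) =
      ract (matlis_dual M) (i + 1) p (mdiff (matlis_dual M) i f) a + ksign i (ract (matlis_dual M) i (p + 1) f (adiff A p a))"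
    proof
      fix m
      \<comment> \<open>\<open>l\<close> is the degree of \<open>m\<close>. Writing all degrees as
        sums with \<open>l\<close> makes the degree arguments of the various actions literally
        equal.\<close>
      define l where "l = - i - p - 1"
      have 1: "- (i + p) - 1 = l" "- (i + 1) - p = l" "- i - (p + 1) = l" "- i - p = l + 1" "- i - 1 = p + l" "- i = p + l + 1"
        by (simp_all add: l_def)
      have kf: "ksign i g m = ksign i (g m)" for g :: "'m \<Rightarrow> 'k" by (simp add: ksign_def)
      show "mdiff (matlis_dual M) (i + p) (ract (matlis_dual M) i p f a) m =
        (ract (matlis_dual M) (i + 1) p (mdiff (matlis_dual M) i f) a + ksign i (ract (matlis_dual M) i (p + 1) f (adiff A p a))) m"
      proof (cases "m \<in> mgrade M l")
        case True
        have "f (mdiff M (p + l) (lact M p l a m)) = f (lact M (p + 1) l (adiff A p a) m) + ksign p (f (lact M p (l + 1) a (mdiff M l m)))"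
        proof -
          have u: "lact M (p + 1) l (adiff A p a) m \<in> mgrade M (- i)" "lact M p (l + 1) a (mdiff M l m) \<in> mgrade M (- i)"
            using True a unfolding 1 by simp_all
          show ?thesis
            unfolding leibniz[OF a True]
            using u fl(1) fl(2)[of _ "-1"] k_linear_ksign[OF _ V.vector_space_axioms grade, of "- i" "(*)" UNIV f] f
            by simp
        qed
        then show ?thesis using True a
          unfolding matlis_sel plus_fun_apply kf 1
          by (simp add: ksign_add)
      next
        case False
        then show ?thesis unfolding matlis_sel plus_fun_apply kf 1 by simp
      qed
    qed
  next
    fix i f assume f: "f \<in> mgrade (matlis_dual M) i"
    then show "ract (matlis_dual M) i 0 f (aunit A) = f" by (auto simp: fun_eq_iff)
  qed (rule dga_axioms)
qed

lemma (in dga) matlis_left: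
  assumes "left_dg_module A (M :: ('k, 'a, 'm::ab_group_add) dg_mod)" "right_dg_module A M"
  shows "left_dg_module A (matlis_dual M)"
proof -
  interpret lmod A M by unfold_locales fact
  interpret M: rmod A M by unfold_locales fact
  note md = matlis_d_facts[OF assms(1)]
  show ?thesis
  proof (rule left_dg_moduleI)
    show "vector_space (mscale (matlis_dual M))" by (simp add: matlis_vs)
    show "module.subspace (mscale (matlis_dual M)) (mgrade (matlis_dual M) i)" for i
      using matlis_subspace[of M i] by simp
    fix i f assume f: "f \<in> mgrade (matlis_dual M) i"
    then have fl: "k_linear (mscale M) (mgrade M (- i)) (*) UNIV f" by simp
    note fk = k_linear_ksign[OF fl V.vector_space_axioms grade]
    note fl = k_linearD(2,3)[OF fl] k_linear_zero[OF fl zero_mem]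
    show "mdiff (matlis_dual M) i f \<in> mgrade (matlis_dual M) (i + 1)" "mdiff (matlis_dual M) (i + 1) (mdiff (matlis_dual M) i f) = 0"
      using md(1,4)[OF f] by blast+
    show "mdiff (matlis_dual M) i (f + g) = mdiff (matlis_dual M) i f + mdiff (matlis_dual M) i g" for g by (rule md(2))
    show "mdiff (matlis_dual M) i (mscale (matlis_dual M) c f) = mscale (matlis_dual M) c (mdiff (matlis_dual M) i f)" for c
      using md(3)[of i c f] by simp
    fix p a assume a: "a \<in> agrade A p"
    have kf: "ksign n g m = ksign n (g m)" for n m and g :: "'m \<Rightarrow> 'k" by (simp add: ksign_def)
    have e: "- (p + i) = - i - p" by simp
    show "lact (matlis_dual M) p i a f \<in> mgrade (matlis_dual M) (p + i)"
      using a unfolding matlis_sel(2) mem_Collect_eq e by (simp add: k_linear_def fl ksign_add k_ksign_mult)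
    show "lact (matlis_dual M) p i a (f + g) = lact (matlis_dual M) p i a f + lact (matlis_dual M) p i a g" for g
      by (auto simp: fun_eq_iff ksign_add)
    show "lact (matlis_dual M) p i a (mscale (matlis_dual M) c f) = mscale (matlis_dual M) c (lact (matlis_dual M) p i a f)" for c
      by (auto simp: fun_eq_iff k_ksign_mult)
    show "lact (matlis_dual M) p i (a + b) f = lact (matlis_dual M) p i a f + lact (matlis_dual M) p i b f" if "b \<in> agrade A p" for b
      using a that by (auto simp: fun_eq_iff fl ksign_add)
    show "lact (matlis_dual M) p i (ascale A c a) f = mscale (matlis_dual M) c (lact (matlis_dual M) p i a f)" for c
      using a by (auto simp: fun_eq_iff fl k_ksign_mult)
    show "lact (matlis_dual M) (p + q) i (amult A p q a b) f = lact (matlis_dual M) p (q + i) a (lact (matlis_dual M) q i b f)"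
      if b: "b \<in> agrade A q" for q b
    proof
      fix m
      have 1: "- i - (p + q) = - (q + i) - p" by simp
      have 2: "- (q + i) - p + p = - i - q" by simp
      show "lact (matlis_dual M) (p + q) i (amult A p q a b) f m = lact (matlis_dual M) p (q + i) a (lact (matlis_dual M) q i b f) m"
        using M.r_assoc[OF a b, of m "- (q + i) - p"] M.r_mem[OF a, of m "- (q + i) - p" "- i - q"]
        unfolding matlis_sel 1 2 by simp
    qed
    show "mdiff (matlis_dual M) (p + i) (lact (matlis_dual M) p i a f) =
      lact (matlis_dual M) (p + 1) i (adiff A p a) f + ksign p (lact (matlis_dual M) p (i + 1) a (mdiff (matlis_dual M) i f))"
    proof
      fix m
      define l where "l = - i - p - 1"
      have 1: "- (p + i) - 1 = l" "- (i + 1) - p = l" "- i - (p + 1) = l" "- i - p = l + 1" "- i - 1 = l + p" "- i = l + 1 + p"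
        by (simp_all add: l_def)
      show "mdiff (matlis_dual M) (p + i) (lact (matlis_dual M) p i a f) m =
        (lact (matlis_dual M) (p + 1) i (adiff A p a) f + ksign p (lact (matlis_dual M) p (i + 1) a (mdiff (matlis_dual M) i f))) m"
      proof (cases "m \<in> mgrade M l")
        case True
        have u: "ract M l (p + 1) m (adiff A p a) \<in> mgrade M (- i)" "ract M (l + 1) p (mdiff M l m) a \<in> mgrade M (- i)"
          using True a unfolding 1 by simp_all
        have "f (mdiff M (l + p) (ract M l p m a)) = f (ract M (l + 1) p (mdiff M l m) a) + ksign l (f (ract M l (p + 1) m (adiff A p a)))"
          unfolding M.r_leibniz[OF a True] using u fl(1) fk by simp
        moreover have "even l \<longleftrightarrow> odd (i + p)" by (auto simp: l_def)
        ultimately show ?thesis using True a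
          unfolding matlis_sel plus_fun_apply kf 1
          by (simp add: ksign_add) (cases "even i"; cases "even p"; simp add: ksign_if)
      next
        case False
        then show ?thesis unfolding matlis_sel plus_fun_apply kf 1 by simp
      qed
    qed
  next
    fix i f assume f: "f \<in> mgrade (matlis_dual M) i"
    then show "lact (matlis_dual M) 0 i (aunit A) f = f" by (auto simp: fun_eq_iff)
  qed
qed

lemma (in dga) matlis_bi:
  assumes "dg_bimodule A (M :: ('k, 'a, 'm::ab_group_add) dg_mod)"
  shows "dg_bimodule A (matlis_dual M)"
proof -
  interpret bimod A M by (rule bimodI) (use assms in \<open>auto intro: dga_axioms\<close>)
  show ?thesis
  proof (rule dg_bimoduleI[OF matlis_left[OF L.mod rmod] matlis_right[OF L.mod]])
    fix p q i a b f assume a: "a \<in> agrade A p" and b: "b \<in> agrade A q" and f: "f \<in> mgrade (matlis_dual M) i"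
    show "ract (matlis_dual M) (p + i) q (lact (matlis_dual M) p i a f) b = lact (matlis_dual M) p (i + q) a (ract (matlis_dual M) i q f b)"
    proof
      fix m
      define l where "l = - i - p - q"
      have 1: "- (p + i) - q = l" "- (i + q) - p = l" "- i - p = q + l" "- i - q = l + p" by (simp_all add: l_def)
      show "ract (matlis_dual M) (p + i) q (lact (matlis_dual M) p i a f) b m = lact (matlis_dual M) p (i + q) a (ract (matlis_dual M) i q f b) m"
        using lr[OF b a, of m l] a b unfolding matlis_sel 1 by simp
    qed
  qed
qed

section \<open>Torsion of cones and admissibility of a new cell\<close>

context cone
begin

text \<open>The action on a cone is diagonal up to sign, so the maximum of two annihilation bounds
  serves for the pair.\<close>

lemma torsion_cone: "pr x y \<in> mgrade (torsion A G) i \<longleftrightarrow>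
    x \<in> mgrade (torsion A X) i \<and> y \<in> mgrade (torsion A Y) (i + s)"
proof
  assume "pr x y \<in> mgrade (torsion A G) i"
  then obtain n where n: "pr x y \<in> mgrade G i" "\<forall>p\<ge>n. \<forall>a\<in>agrade A p. lact G p i a (pr x y) = 0" by (rule torsionE)
  then show "x \<in> mgrade (torsion A X) i \<and> y \<in> mgrade (torsion A Y) (i + s)"
    by (auto intro!: torsionI[of _ _ _ n])
next
  assume "x \<in> mgrade (torsion A X) i \<and> y \<in> mgrade (torsion A Y) (i + s)"
  then have xy: "x \<in> mgrade (torsion A X) i" "y \<in> mgrade (torsion A Y) (i + s)" by auto
  obtain n where n: "x \<in> mgrade X i" "\<forall>p\<ge>n. \<forall>a\<in>agrade A p. lact X p i a x = 0" using xy(1) by (rule torsionE)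
  obtain k where k: "y \<in> mgrade Y (i + s)" "\<forall>p\<ge>k. \<forall>a\<in>agrade A p. lact Y p (i + s) a y = 0" using xy(2) by (rule torsionE)
  show "pr x y \<in> mgrade (torsion A G) i"
    using n k by (intro torsionI[of _ _ _ "max n k"]) auto
qed

end

context adm_ctx
begin

text \<open>\<open>t e0 (a f) = t (e0 a) f = t (a e0) f = a (t e0 f)\<close>, by balance, centrality
  of \<open>e0\<close> and left linearity.\<close>

lemma e0_act_dg_hom:
  assumes "pairing A I F T t" "mscale F = u" "mscale T = u"
  shows "dg_hom A F T (\<lambda>j f. t 0 j e0 f)"
proof -
  interpret pairing A I F T t by fact
  show ?thesis
  proof (rule dg_homI[OF graded_homI])
    fix p i a x assume a: "a \<in> agrade A p" and x: "x \<in> mgrade F i"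
    have "t p i (lact I p 0 a e0) x = t p i (ract I 0 p e0 a) x"
      using a by (metis \<iota>_left \<iota>_right)
    then show "t 0 (p + i) e0 (lact F p i a x) = ksign (0 * p) (lact T p (i + 0) a (t 0 i e0 x))"
      using t_left[OF a e0(1) x] t_bal[OF a e0(1) x] by simp
  next
    fix i x assume x: "x \<in> mgrade F i"
    then show "t 0 (i + 1) e0 (mdiff F i x) = mdiff T i (t 0 i e0 x)"
      using t_d[OF e0(1) x] by simp
  qed simp_all
qed

text \<open>As a graded space the torsion of the new \<open>T\<close> is that of the old one plus a
  shift of the torsion of \<open>I\<close>, while a graded map out of the new \<open>F\<close> is
  one out of the old \<open>F\<close> plus a value on the new generator. Both duality properties are
  therefore checked on two summands; the quasi-isomorphism survives by the five lemma.\<close>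

lemma cell_admissible:
  assumes adm: "admissible u A I e0 F T t" and f0: "f0 \<in> mgrade F (1 - s)" "mdiff F (1 - s) f0 = 0"
  shows "admissible u A I e0 (gcone F Au s (tauF F s f0)) (gcone T I s (tauT t s f0)) (cellt t s)"
proof -
  have F: "F \<in> dg_modules u A" and T: "T \<in> dg_modules u A" and kF: "kproj u A F" and kT: "kinj u A T"
    and p: "pairing A I F T t" and c: "cohomology_iso F T (\<lambda>j f. t 0 j e0 f)"
    and di: "dual_inj A I F T t" and ds: "dual_surj A I F T t"
    using adm by (auto simp: admissible_def)
  have sc [simp]: "mscale F = u" "mscale T = u" using F T by (auto simp: dg_modules_def)
  interpret P: pairing A I F T t by fact
  interpret CF: cone A u F Au s "tauF F s f0" by (rule coneI[OF F Au tauF_twisting[OF F f0]])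
  interpret CT: cone A u T I s "tauT t s f0" by (rule coneI[OF T I_in tauT_twisting[OF F T p f0]])
  have p': "pairing A I CF.G CT.G (cellt t s)" by (rule cell_pairing[OF F T p f0])
  interpret P': pairing A I CF.G CT.G "cellt t s" by (rule p')
  interpret \<Gamma>I: lmod A "torsion A I" by unfold_locales (rule torsion_left[OF I.L.mod])
  interpret \<Gamma>T: lmod A "torsion A T" by unfold_locales (rule torsion_left[OF P.T.mod])
  have ci: "cohomology_iso CF.G CT.G (\<lambda>i w. pr (t 0 i e0 (p1 w)) (ract I 0 (i + s) e0 (ki (i + s) (p2 w))))"
  proof (rule cone_five[OF CF.cone_axioms CT.cone_axioms e0_act_dg_hom[OF p sc] \<iota>_ki_dg c \<iota>_surj])
    fix i y assume y: "y \<in> mgrade Au (i + s)"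
    show "tauT t s f0 i (ract I 0 (i + s) e0 (ki (i + s) y)) = t 0 (i + 1) e0 (tauF F s f0 i y)"
      using P.t_bal[OF ki.mem0[OF y] e0(1) f0(1)] y f0 by (simp add: tauT_def tauF_def)
  qed
  have inlc: "cellt t s i j x (pr f 0) = pr (t i j x f) 0" if "x \<in> mgrade I i" for i j x f
    using that by (simp add: cellt_def)
  have inrc: "cellt t s i j x (pr 0 v) = pr 0 (ksign (s * i) (ract I i (j + s) x (ki (j + s) v)))" if "x \<in> mgrade I i" for i j x v
    using that by (simp add: cellt_def)
  have di': "dual_inj A I CF.G CT.G (cellt t s)"
    unfolding dual_inj_def
  proof (intro allI impI ballI)
    fix i g w
    assume g: "k_linear (mscale CT.G) (mgrade (torsion A CT.G) i) (*) UNIV g"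
      and van: "\<forall>j. \<forall>x\<in>mgrade (torsion A I) (i - j). \<forall>f\<in>mgrade CF.G j. g (cellt t s (i - j) j x f) = 0"
      and w: "w \<in> mgrade (torsion A CT.G) i"
    obtain a b where ab: "w = pr a b" using torsion_sub[OF w] by (auto elim: CT.GE)
    have a: "a \<in> mgrade (torsion A T) i" and b: "b \<in> mgrade (torsion A I) (i + s)"
      using w CT.torsion_cone unfolding ab by auto
    have "k_linear (mscale T) (mgrade (torsion A T) i) (*) UNIV (\<lambda>a. g (pr a 0))"
    proof (rule k_linearI)
      fix x y assume xy: "x \<in> mgrade (torsion A T) i" "y \<in> mgrade (torsion A T) i"
      have z: "pr x 0 \<in> mgrade (torsion A CT.G) i" "pr y 0 \<in> mgrade (torsion A CT.G) i"
        using xy by (simp_all add: CT.torsion_cone)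
      show "g (pr (x + y) 0) = g (pr x 0) + g (pr y 0)" using k_linearD(2)[OF g z] by (simp add: pr_add_0)
    next
      fix x c assume xy: "x \<in> mgrade (torsion A T) i"
      have z: "pr x 0 \<in> mgrade (torsion A CT.G) i"
        using xy by (simp add: CT.torsion_cone)
      show "g (pr (mscale T c x) 0) = c * g (pr x 0)" using k_linearD(3)[OF g z, of c] by (simp add: pr_scale_0)
    qed simp
    moreover have "\<forall>j. \<forall>x\<in>mgrade (torsion A I) (i - j). \<forall>f\<in>mgrade F j. g (pr (t (i - j) j x f) 0) = 0"
    proof (intro allI ballI)
      fix j x f assume x: "x \<in> mgrade (torsion A I) (i - j)" and f: "f \<in> mgrade F j"
      show "g (pr (t (i - j) j x f) 0) = 0"
        using van[rule_format, OF x, of "pr f 0"] f inlc[OF torsion_sub[OF x]] by simp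
    qed
    ultimately have ga: "g (pr a 0) = 0" using di a unfolding dual_inj_def by blast
    \<comment> \<open>\<open>pr 0 b\<close> is itself a value of the pairing, namely of
      \<open>b\<close> with the new generator, which has degree \<open>- s\<close>; the sign cancels
      the one in \<open>cellt\<close>.\<close>
    have "g (cellt t s (i - (- s)) (- s) (ksign (s * (i + s)) b) (pr 0 one)) = 0"
      by (rule van[rule_format]) (use b in auto)
    then have gb: "g (pr 0 b) = 0"
      using torsion_sub[OF b] by (simp add: inrc)
    have "pr a 0 \<in> mgrade (torsion A CT.G) i" "pr 0 b \<in> mgrade (torsion A CT.G) i"
      using a b by (simp_all add: CT.torsion_cone)
    from k_linearD(2)[OF g this] show "g w = 0" using ga gb by (simp add: ab pr_add[symmetric])
  qed
  have ds': "dual_surj A I CF.G CT.G (cellt t s)"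
    unfolding dual_surj_def
  proof (intro allI impI)
    fix n G assume G: "graded_hom A n CF.G (matlis_dual (torsion A I)) G"
    let ?D = "matlis_dual (torsion A I)"
    have "dg_bimodule A ?D" by (rule matlis_bi[OF torsion_bi[OF I.bimod]])
    then interpret D: bimod A ?D by (rule bimodI[OF dga_axioms])
    interpret G: ghom A CF.G ?D n G by (rule ghomI[OF CF.G.mod D.L.mod G])
    have "graded_hom A n F ?D (\<lambda>j f. G j (pr f 0))"
      using graded_hom_comp[OF P.F.mod CF.G.mod D.L.mod CF.inl_hom G] by simp
    then obtain g where g: "k_linear (mscale T) (mgrade (torsion A T) (- n)) (*) UNIV g"
      and ge: "\<And>j f x. f \<in> mgrade F j \<Longrightarrow> x \<in> mgrade (torsion A I) (- (j + n)) \<Longrightarrow>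
            G j (pr f 0) x = ksign ((n + 1) * j) (g (t (- (j + n)) j x f))"
      using ds unfolding dual_surj_def by blast
    \<comment> \<open>The value of \<open>G\<close> on the new generator is a functional on the
      torsion of \<open>I\<close>, which is exactly the missing component of the functional to be
      found.\<close>
    define \<omega> where "\<omega> = G (- s) (pr 0 one)"
    have "\<omega> \<in> mgrade ?D (- s + n)" unfolding \<omega>_def by (rule G.mem) simp_all
    then have \<omega>: "k_linear u (mgrade (torsion A I) (- n + s)) (*) UNIV \<omega>"
      by simp
    define h where "h w = g (p1 w) + \<omega> (p2 w)" for w
    show "\<exists>g. k_linear (mscale CT.G) (mgrade (torsion A CT.G) (- n)) (*) UNIV g \<and>
           (\<forall>j. \<forall>f\<in>mgrade CF.G j. \<forall>x\<in>mgrade (torsion A I) (- (j + n)).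
              G j f x = ksign ((n + 1) * j) (g (cellt t s (- (j + n)) j x f)))"
    proof (intro exI[of _ h] conjI allI ballI)
      have mem: "p1 w \<in> mgrade (torsion A T) (- n) \<and> p2 w \<in> mgrade (torsion A I) (- n + s)"
        if w: "w \<in> mgrade (torsion A CT.G) (- n)" for w
      proof -
        obtain a b where "w = pr a b" using torsion_sub[OF w] by (auto elim: CT.GE)
        then show ?thesis using w CT.torsion_cone by simp
      qed
      show "k_linear (mscale CT.G) (mgrade (torsion A CT.G) (- n)) (*) UNIV h"
        by (rule k_linearI) (use mem k_linearD[OF g] k_linearD[OF \<omega>] in
            \<open>simp_all add: h_def p1_add p2_add p1_scale p2_scale algebra_simps\<close>)
      fix j w x assume w: "w \<in> mgrade CF.G j" and x: "x \<in> mgrade (torsion A I) (- (j + n))"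
      obtain f v where w': "w = pr f v" "f \<in> mgrade F j" "v \<in> mgrade Au (j + s)" using w by (rule CF.GE)
      define k where "k = ki (j + s) v"
      have k: "k \<in> agrade A (j + s)" using w' by (simp add: k_def)
      have xI: "x \<in> mgrade I (- (j + n))" by (rule torsion_sub[OF x])
      have Gw: "G j w = G j (pr f 0) + G j (pr 0 v)"
        using G.add[of "pr f 0" j "pr 0 v"] w' by (simp add: pr_add[symmetric])
      \<comment> \<open>Every element of the cell is a multiple \<open>k\<close> of its generator,
        so there \<open>G\<close> is determined by \<open>\<omega>\<close> through
        linearity.\<close>
      have "pr 0 v = ksign (s * (j + s)) (lact CF.G (j + s) (- s) k (pr 0 one))"
        using k Au_gen[OF w'(3)] by (simp add: k_def pr_0_ksign)
      moreover have "lact CF.G (j + s) (- s) k (pr 0 one) \<in> mgrade CF.G j"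
        by (rule CF.G.act_mem[OF k]) simp_all
      ultimately have "G j (pr 0 v) = ksign (s * (j + s)) (G j (lact CF.G (j + s) (- s) k (pr 0 one)))"
        using G.ksgn by simp
      also have "G j (lact CF.G (j + s) (- s) k (pr 0 one)) = ksign (n * (j + s)) (lact ?D (j + s) (- s + n) k \<omega>)"
        using G.act[OF k, of "pr 0 one" "- s"] by (simp add: \<omega>_def del: CF.G_sel(3) matlis_sel)
      finally have Gv: "G j (pr 0 v) = ksign (s * (j + s) + n * (j + s)) (lact ?D (j + s) (- s + n) k \<omega>)" by simp
      have e: "- (- s + n) - (j + s) = - (j + n)" by simp
      have kf: "ksign n g x = ksign n (g x)" for n and g :: "'u \<Rightarrow> 'k" by (simp add: ksign_def)
      have "G j (pr 0 v) x = ksign (s * (j + s) + n * (j + s) + (j + s)) (\<omega> (ract I (- (j + n)) (j + s) x k))"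
        using x unfolding Gv kf matlis_sel e by simp
      also have "\<dots> = ksign ((n + 1) * j) (\<omega> (ksign (s * (- (j + n))) (ract I (- (j + n)) (j + s) x k)))"
      proof -
        have "ract (torsion A I) (- (j + n)) (j + s) x k \<in> mgrade (torsion A I) (- n + s)"
        proof -
          have "dg_bimodule A (torsion A I)" by (rule torsion_bi[OF I.bimod])
          then interpret TI: bimod A "torsion A I" by (rule bimodI[OF dga_axioms])
          show ?thesis by (rule TI.r_mem[OF k x]) simp
        qed
        then have "ract I (- (j + n)) (j + s) x k \<in> mgrade (torsion A I) (- n + s)" by simp
        moreover have "\<Gamma>I.V.subspace (mgrade (torsion A I) (- n + s))" by (rule \<Gamma>I.grade)
        moreover have "k_linear (mscale (torsion A I)) (mgrade (torsion A I) (- n + s)) (*) UNIV \<omega>" using \<omega> by simp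
        ultimately have "\<omega> (ksign (s * (- (j + n))) (ract I (- (j + n)) (j + s) x k)) =
           ksign (s * (- (j + n))) (\<omega> (ract I (- (j + n)) (j + s) x k))"
          using k_linear_ksign \<Gamma>I.V.vector_space_axioms by blast
        then show ?thesis by simp (cases "even n"; cases "even j"; cases "even s"; simp add: ksign_if)
      qed
      finally show "G j w x = ksign ((n + 1) * j) (h (cellt t s (- (j + n)) j x w))"
        unfolding Gw plus_fun_apply ge[OF w'(2) x] using \<open>w = pr f v\<close> by (simp add: h_def cellt_def ksign_add k_def)
    qed
  qed
  have "(\<lambda>i w. pr (t 0 i e0 (p1 w)) (ract I 0 (i + s) e0 (ki (i + s) (p2 w)))) = (\<lambda>j w. cellt t s 0 j e0 w)"
    by (simp add: cellt_def fun_eq_iff)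
  with ci have ci': "cohomology_iso CF.G CT.G (\<lambda>j w. cellt t s 0 j e0 w)" by simp
  show ?thesis
    unfolding admissible_def
    by (intro conjI CF.G_in CT.G_in CF.kproj_cone[OF kF kproj_free] CT.kinj_cone[OF kT kI] p' ci' di' ds')
qed

lemma zero_admissible: "admissible u A I e0 (zero_mod u) (zero_mod u) (\<lambda>_ _ _ _. 0)"
  unfolding admissible_def
proof (intro conjI zero_mod)
  interpret Z: lmod A "zero_mod u" by unfold_locales (rule zero_mod_mod)
  have z: "mgrade (zero_mod u) i = {0}" "mscale (zero_mod u) = u" for i by (simp_all add: zero_mod_def)
  show "kproj u A (zero_mod u)"
    unfolding kproj_def null_hom_def
  proof (intro ballI allI impI exI[of _ "\<lambda>_ _. 0"] conjI)
    fix N n f assume N: "N \<in> dg_modules u A" and f: "chain_hom A (n + 1) (zero_mod u) N f"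
    interpret N: lmod A N using N by unfold_locales (simp add: dg_modules_def)
    interpret f: ghom A "zero_mod u" N "n + 1" f using f by unfold_locales (simp add: chain_hom_def)
    show "graded_hom A n (zero_mod u) N (\<lambda>_ _. 0)" by (rule graded_homI) auto
    show "f i m = mdiff N (i + n) 0 - ksign n 0" if "m \<in> mgrade (zero_mod u) i" for i m
      using that by (simp add: z)
  qed
  show "kinj u A (zero_mod u)"
    unfolding kinj_def null_hom_def
  proof (intro ballI allI impI exI[of _ "\<lambda>_ _. 0"] conjI)
    fix N n f assume N: "N \<in> dg_modules u A" and f: "chain_hom A (n + 1) N (zero_mod u) f"
    interpret N: lmod A N using N by unfold_locales (simp add: dg_modules_def)
    interpret f: ghom A N "zero_mod u" "n + 1" f using f by unfold_locales (simp add: chain_hom_def)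
    show "graded_hom A n N (zero_mod u) (\<lambda>_ _. 0)" by (rule graded_homI) auto
    show "f i m = mdiff (zero_mod u) (i + n) 0 - ksign n 0" if "m \<in> mgrade N i" for i m
      using f.mem[OF that refl] by (simp add: zero_mod_def)
  qed
  show "pairing A I (zero_mod u) (zero_mod u) (\<lambda>_ _ _ _. 0)"
    by unfold_locales (auto simp: z)
  show "cohomology_iso (zero_mod u) (zero_mod u) (\<lambda>j f. 0)"
    by (rule cisoI) (auto simp: z zero_mod_def)
  show "dual_inj A I (zero_mod u) (zero_mod u) (\<lambda>_ _ _ _. 0)"
    unfolding dual_inj_def
  proof (intro allI impI ballI)
    fix i g w assume g: "k_linear (mscale (zero_mod u)) (mgrade (torsion A (zero_mod u)) i) (*) UNIV g"
      and w: "w \<in> mgrade (torsion A (zero_mod u)) i"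
    have "w = 0" using torsion_sub[OF w] by (simp add: z)
    then show "g w = 0" using k_linear_zero[OF g] w by simp
  qed
  show "dual_surj A I (zero_mod u) (zero_mod u) (\<lambda>_ _ _ _. 0)"
    unfolding dual_surj_def
  proof (intro allI impI exI[of _ "\<lambda>_. 0"] conjI ballI)
    fix n G assume G: "graded_hom A n (zero_mod u) (matlis_dual (torsion A I)) G"
    show "k_linear (mscale (zero_mod u)) (mgrade (torsion A (zero_mod u)) (- n)) (*) UNIV (\<lambda>_. 0)"
      by (rule k_linearI) auto
    have "dg_bimodule A (matlis_dual (torsion A I))" by (rule matlis_bi[OF torsion_bi[OF I.bimod]])
    then interpret D: bimod A "matlis_dual (torsion A I)" by (rule bimodI[OF dga_axioms])
    interpret G: ghom A "zero_mod u" "matlis_dual (torsion A I)" n G by (rule ghomI[OF Z.mod D.L.mod G])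
    show "G j f x = ksign ((n + 1) * j) 0" if "f \<in> mgrade (zero_mod u) j" for j f x
      using that by (simp add: z)
  qed
qed

end

section \<open>Approximation of a compact module by cells\<close>

text \<open>Steinitz exchange in the quotient by \<open>W\<close>: as \<open>z\<close> is nonzero
  there, it can replace one of the spanning vectors.\<close>

lemma (in vector_space) exchange_modulo:
  assumes "finite F" "z \<in> span (F \<union> W)" "subspace W" "z \<notin> W"
  shows "\<exists>v\<in>F. v \<in> span (insert z ((F - {v}) \<union> W))"
  using assms(1,2)
proof (induction F)
  case empty
  then show ?case using assms(3,4) span_minimal[of W W] by auto
next
  case (insert a F)
  show ?case
  proof (cases "z \<in> span (F \<union> W)")
    case True
    then obtain v where v: "v \<in> F" "v \<in> span (insert z ((F - {v}) \<union> W))" using insert by blast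
    have "span (insert z ((F - {v}) \<union> W)) \<subseteq> span (insert z ((insert a F - {v}) \<union> W))"
      by (rule span_mono) auto
    then show ?thesis using v by blast
  next
    case False
    then have "a \<in> span (insert z (F \<union> W))" using insert.prems in_span_insert[of z a "F \<union> W"] by simp
    moreover have "insert a F - {a} = F" using insert by auto
    ultimately show ?thesis by auto
  qed
qed

lemma (in ghom) span_image:
  assumes "x \<in> S.V.span Z" "Z \<subseteq> mgrade M i"
  shows "f i x \<in> T.V.span (f i ` Z)"
  using S.V.subspace_span_induct[OF assms S.grade, of "\<lambda>x. f i x \<in> T.V.span (f i ` Z)"]
  by (auto intro: T.V.span_base T.V.span_zero T.V.span_add T.V.span_scale)

context dgu
begin

text \<open>
  The lowest class of a k-projective module survives in \<open>C / A\<^sup>+ C\<close>: up to homotopy \<open>C\<close> maps to the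
  lowest cohomology, with trivial action, and this map kills \<open>A\<^sup>+ C\<close>.
\<close>

lemma lowest_class:
  assumes kC: "kproj u A C" and C: "C \<in> dg_modules u A" and ab: "acyclic_below b C"
    and z: "z \<in> mgrade C b" "mdiff C b z = 0" "z \<in> bnd A C b"
  shows "\<exists>y\<in>mgrade C (b - 1). z = mdiff C (b - 1) y"
proof -
  interpret C: lmod A C using C by unfold_locales (simp add: dg_modules_def)
  have sc [simp]: "mscale C = u" using C by (simp add: dg_modules_def)
  define B where "B = mdiff C (b - 1) ` mgrade C (b - 1)"
  have gsub: "U.subspace (mgrade C i)" for i using C.grade by simp
  have Bsub: "U.subspace B"
  proof (rule U.subspaceI)
    show "0 \<in> B" unfolding B_def by (rule image_eqI[of _ _ 0]) simp_all
    show "x + y \<in> B" if xy: "x \<in> B" "y \<in> B" for x y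
    proof -
      obtain a c where "a \<in> mgrade C (b - 1)" "c \<in> mgrade C (b - 1)" "x = mdiff C (b - 1) a" "y = mdiff C (b - 1) c"
        using xy by (auto simp: B_def)
      then show ?thesis unfolding B_def by (intro image_eqI[of _ _ "a + c"]) simp_all
    qed
    show "u c x \<in> B" if x: "x \<in> B" for c x
      using x C.d_scale C.scale_mem unfolding B_def by (auto simp: image_iff) (metis sc)
  qed
  obtain q where q: "Vector_Spaces.linear u u q" "\<And>v. v \<in> B \<Longrightarrow> q v = v" "\<And>v. q v \<in> B"
    using projection[OF Bsub] by blast
  have qa: "q (x + y) = q x + q y" "q (u c x) = u c (q x)" "q (x - y) = q x - q y" for x y c
    using q(1) by (auto simp: Vector_Spaces.linear_iff module_hom.diff[OF Vector_Spaces.linear.axioms(3)])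
  have q0: "q 0 = 0" using qa(1)[of 0 0] by simp
  have BC: "B \<subseteq> mgrade C b" by (auto simp: B_def)
  \<comment> \<open>\<open>S\<close> is a complement of the boundaries in degree \<open>b\<close>.
    Placed in degree \<open>b\<close> with trivial action it is quasi-isomorphic to the truncation
    at \<open>b\<close>: below \<open>b\<close> there is no cohomology, and in the top degree of the
    truncation everything is a cocycle.\<close>
  define S where "S = {x \<in> mgrade C b. q x = 0}"
  have Ssub: "U.subspace S"
    by (rule U.subspaceI) (use U.subspace_scale[OF gsub] in \<open>auto simp: S_def qa q0\<close>)
  let ?G = "trunc C b" and ?S = "triv C b S"
  have G: "?G \<in> dg_modules u A" by (rule trunc_in[OF C])
  have S: "?S \<in> dg_modules u A"
    using triv_mod[OF C.mod, of S b] Ssub by (auto simp: dg_modules_def S_def) (simp add: triv_def trunc_def)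
  interpret G: lmod A ?G using G by unfold_locales (simp add: dg_modules_def)
  interpret S: lmod A ?S using S by unfold_locales (simp add: dg_modules_def)
  have "quasi_iso A ?S ?G (\<lambda>i x. x)"
    unfolding quasi_iso_def
  proof
    show "dg_hom A ?S ?G (\<lambda>i x. x)"
      by (rule dg_homI[OF graded_homI]) (auto simp: triv_def trunc_def S_def split: if_splits)
    show "cohomology_iso ?S ?G (\<lambda>i x. x)"
    proof (rule cisoI)
      fix i y assume y: "y \<in> mgrade ?G (i + 1)" "mdiff ?G (i + 1) y = 0"
      consider "i + 1 > b" | "i + 1 = b" | "i + 1 < b" by linarith
      then show "\<exists>x\<in>mgrade ?S (i + 1). mdiff ?S (i + 1) x = 0 \<and> (\<exists>w\<in>mgrade ?G i. y - x = mdiff ?G i w)"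
      proof cases
        case 1
        then have "y = 0" using y by (simp add: trunc_def)
        then show ?thesis by (intro bexI[of _ 0] conjI bexI[of _ "0 :: 'u"]) simp_all
      next
        case 2
        then have yC: "y \<in> mgrade C b" using y by (simp add: trunc_def)
        obtain w where w: "w \<in> mgrade C (b - 1)" "q y = mdiff C (b - 1) w" using q(3)[of y] by (auto simp: B_def)
        have i: "i = b - 1" using 2 by simp
        have "y - q y \<in> S" using yC q(2)[OF q(3)] q(3)[of y] BC by (auto simp: S_def qa)
        then show ?thesis using w
          by (intro bexI[of _ "y - q y"] conjI bexI[of _ w]) (auto simp: i triv_def trunc_def)
      next
        case 3
        then have "y \<in> mgrade C (i + 1)" "mdiff C (i + 1) y = 0" using y by (auto simp: trunc_def)
        then obtain w where "w \<in> mgrade C i" "y = mdiff C i w" using ab 3 unfolding acyclic_below_def by blast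
        then show ?thesis using 3 by (intro bexI[of _ "0 :: 'u"] conjI bexI[of _ w]) (auto simp: trunc_def)
      qed
    next
      fix i x w assume x: "x \<in> mgrade ?S (i + 1)" "mdiff ?S (i + 1) x = 0" and w: "w \<in> mgrade ?G i" "x = mdiff ?G i w"
      have "x = 0"
      proof (cases "i + 1 = b")
        case True
        then have "x \<in> S" "x \<in> B" using x w by (auto simp: triv_def trunc_def B_def intro!: image_eqI[of _ _ w])
        then show ?thesis using q(2)[of x] by (simp add: S_def)
      qed (use x in \<open>simp add: triv_def\<close>)
      then show "\<exists>v\<in>mgrade ?S i. x = mdiff ?S i v" by (intro bexI[of _ 0]) simp_all
    qed
  qed
  from kproj_lift[OF kC C S G this trunc_hom[OF C.mod]] obtain g where g: "dg_hom A C ?S g"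
    and h: "homotopic_homs A C ?G (\<lambda>i x. if i \<le> b then x else 0) (\<lambda>i x. g i x)" by blast
  interpret g: dghom A C ?S g by (rule dghomI[OF C.mod S.mod g])
  \<comment> \<open>For \<open>w = a x\<close> with \<open>a\<close> of positive degree,
    \<open>x\<close> has degree below \<open>b\<close>, where the target is zero.\<close>
  have gz: "g b w = 0" if "w \<in> aplus A C b" for w
  proof (rule C.aplus_induct[OF that])
    fix p a x j assume ax: "1 \<le> p" "a \<in> agrade A p" "x \<in> mgrade C j" "b = p + j"
    have "g j x = 0" using g.mem0[OF ax(3)] ax(1,4) by (simp add: triv_def)
    then show "g b (lact C p j a x) = 0" unfolding ax(4) g.act0[OF ax(2,3)] using S.act_zero[OF ax(2)] ax(4) by simp
  qed (use g.scale S.V.scale_zero_right in auto)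
  obtain y w where yw: "y \<in> mgrade C (b - 1)" "w \<in> aplus A C b" "z = mdiff C (b - 1) y + w" using z(3) by (rule C.bndE)
  have "g (b - 1) y = 0" using g.mem0[OF yw(1)] by (simp add: triv_def)
  then have "g b (mdiff C (b - 1) y) = 0" using g.comm[OF yw(1), of b] by simp
  then have "g b z = 0" using yw gz C.aplus_mem by simp
  \<comment> \<open>\<open>g\<close> is homotopic to the truncation map, so \<open>z\<close> is a
    boundary in the truncation; from degree \<open>b - 1\<close> to \<open>b\<close> its
    differential is that of \<open>C\<close>.\<close>
  moreover obtain v where "v \<in> mgrade ?G (b - 1)" "(if b \<le> b then z else 0) - g b z = mdiff ?G (b - 1) v"
    by (rule homotopic_cocycle[OF C.mod h z(1,2), of "b - 1"]) simp
  ultimately show ?thesis by (auto simp: trunc_def)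
qed

end

text \<open>
  Attaching a cell \<open>e\<close> that bounds a class \<open>z\<close> not killed in \<open>C / A\<^sup>+ C\<close> makes one generator superfluous.
\<close>

lemma (in dga) generates_cell:
  fixes C C' :: "('k, 'a, 'm::ab_group_add) dg_mod"
  assumes C: "left_dg_module A C" and C': "left_dg_module A C'" and sc: "mscale C' = mscale C"
    and inc: "dg_hom A C C' inc" and ret: "graded_hom A 0 C' C ret"
    and ri: "\<And>i x. x \<in> mgrade C i \<Longrightarrow> ret i (inc i x) = x"
    and z: "z \<in> mgrade C b" "mdiff C b z = 0" "z \<notin> bnd A C b"
    and e: "e \<in> mgrade C' (b - 1)" "mdiff C' (b - 1) e = inc b z"
    and dec: "\<And>i w. w \<in> mgrade C' i \<Longrightarrow> \<exists>c\<in>mgrade C i. \<exists>l. \<exists>v\<in>aplus A C' i.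
        w = inc i c + (if i = b - 1 then mscale C l e else 0) + v"
    and gen: "generates A C S" and fin: "finite S"
  shows "\<exists>S'. finite S' \<and> card S' < card S \<and> generates A C' S'"
proof -
  interpret C: lmod A C by unfold_locales fact
  interpret C': lmod A C' by unfold_locales fact
  interpret inc: dghom A C C' inc by (rule dghomI[OF C C' inc])
  interpret ret: ghom A C' C 0 ret by (rule ghomI[OF C' C ret])
  have SC: "v \<in> mgrade C i" if "(i, v) \<in> S" for i v using gen that by (auto simp: generates_def)
  have sp: "x \<in> C.V.span ({v. (i, v) \<in> S} \<union> bnd A C i)"
    if "x \<in> mgrade C i" "mdiff C i x \<in> aplus A C (i + 1)" for i x
    using gen that by (auto simp: generates_def)
  have fb: "finite {v. (b, v) \<in> S}"
    using finite_imageI[OF fin, of snd] by (rule finite_subset[rotated]) force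
  have "z \<in> C.V.span ({v. (b, v) \<in> S} \<union> bnd A C b)"
    using sp z C.V.subspace_0[OF C.aplus_subspace] by auto
  \<comment> \<open>\<open>z\<close> takes the place of some generator \<open>v0\<close> modulo
    boundaries. In \<open>C'\<close> the image of \<open>z\<close> bounds \<open>e\<close>, so
    nothing is left to replace \<open>v0\<close> and the generating set shrinks.\<close>
  from C.V.exchange_modulo[OF fb this C.bnd_subspace z(3)] obtain v0 where v0: "(b, v0) \<in> S"
    "v0 \<in> C.V.span (insert z (({v. (b, v) \<in> S} - {v0}) \<union> bnd A C b))" by auto
  define S' where "S' = (\<lambda>(i, v). (i, inc i v)) ` (S - {(b, v0)})"
  have bnd: "inc i x \<in> bnd A C' i" if xb: "x \<in> bnd A C i" for i x
  proof -
    obtain y w where yw: "y \<in> mgrade C (i - 1)" "w \<in> aplus A C i" "x = mdiff C (i - 1) y + w" using xb by (rule C.bndE)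
    show ?thesis
      by (rule C'.bndI[of "inc (i - 1) y" _ "inc i w"])
       (use yw inc.aplus_image[OF yw(2)] C.aplus_mem[OF yw(2)] inc.comm[OF yw(1), of i] in auto)
  qed
  have zb: "inc b z \<in> bnd A C' b"
    using C'.bnd_d[OF e(1), of b] e(2) by simp
  have SS: "inc i v \<in> C.V.span ({v. (i, v) \<in> S'} \<union> bnd A C' i)" if v: "(i, v) \<in> S" for i v
  proof (cases "(i, v) = (b, v0)")
    case True
    have sub: "insert z (({v. (b, v) \<in> S} - {v0}) \<union> bnd A C b) \<subseteq> mgrade C b" using z SC C.bnd_mem by auto
    have "inc b v0 \<in> C.V.span (inc b ` insert z (({v. (b, v) \<in> S} - {v0}) \<union> bnd A C b))"
      using inc.span_image[OF v0(2) sub] by (simp add: sc)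
    also have "\<dots> \<subseteq> C.V.span ({v. (b, v) \<in> S'} \<union> bnd A C' b)"
      by (rule C.V.span_mono) (use bnd zb in \<open>force simp: S'_def\<close>)
    finally show ?thesis using True by simp
  next
    case False
    then show ?thesis using v by (intro C.V.span_base) (force simp: S'_def)
  qed
  have "generates A C' S'"
    unfolding generates_def sc
  proof (intro conjI allI ballI impI)
    show "case t of (i, v) \<Rightarrow> v \<in> mgrade C' i" if "t \<in> S'" for t using that SC by (auto simp: S'_def)
    fix n x assume x: "x \<in> mgrade C' n" "mdiff C' n x \<in> aplus A C' (n + 1)"
    obtain c l v where c: "c \<in> mgrade C n" and v: "v \<in> aplus A C' n"
      and xe: "x = inc n c + (if n = b - 1 then mscale C l e else 0) + v" using dec[OF x(1)] by blast
    let ?l = "if n = b - 1 then mscale C l e else 0"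
    let ?z = "if n = b - 1 then mscale C l z else 0"
    have le: "?l \<in> mgrade C' n" using e C'.scale_mem by (auto simp: sc)
    have lz: "?z \<in> mgrade C (n + 1)" using z by auto
    have dl: "mdiff C' n ?l = inc (n + 1) ?z" using e C'.d_scale[OF e(1)] inc.scale[OF z(1)] by (auto simp: sc)
    have dv: "mdiff C' n v \<in> aplus A C' (n + 1)" by (rule aplus_d[OF C' v])
    have "mdiff C' n x = inc (n + 1) (mdiff C n c + ?z) + mdiff C' n v"
      unfolding xe using c le lz v C'.aplus_mem[OF v] dl inc.comm[OF c refl] by simp
    then have "inc (n + 1) (mdiff C n c + ?z) \<in> aplus A C' (n + 1)"
      using C'.V.subspace_diff[OF C'.aplus_subspace x(2) dv] by simp
    \<comment> \<open>\<open>ret\<close> is only a graded homomorphism, but it respects the action,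
      and that is enough to bring membership in \<open>A^+ C'\<close> back to
      \<open>C\<close>.\<close>
    from ret.aplus_image[OF this] have *: "mdiff C n c + ?z \<in> aplus A C (n + 1)" using ri c lz by simp
    \<comment> \<open>If \<open>e\<close> occurred with a nonzero coefficient, dividing by it would
      show \<open>z\<close> to be a boundary modulo \<open>A^+ C\<close>. So \<open>e\<close>
      contributes no new class.\<close>
    have l0: "?z = 0"
    proof (rule ccontr)
      assume "?z \<noteq> 0"
      then have n: "n = b - 1" and l: "l \<noteq> 0" by (auto split: if_splits)
      have "mscale C (inverse l) (mdiff C n c + mscale C l z) \<in> aplus A C b"
        using C.V.subspace_scale[OF C.aplus_subspace *] n by simp
      then have a: "mscale C (inverse l) (mdiff C n c) + z \<in> aplus A C b" using l by (simp add: C.V.scale_right_distrib)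
      have "z \<in> bnd A C b"
        by (rule C.bndI[of "- mscale C (inverse l) c" _ "mscale C (inverse l) (mdiff C n c) + z"]) (use c n a in auto)
      then show False using z by simp
    qed
    have xs: "?l = 0 \<or> n = b - 1 \<and> z = 0"
    proof (cases "n = b - 1")
      case True
      then have "l = 0 \<or> z = 0" using l0 by (auto simp: C.V.scale_eq_0_iff)
      then show ?thesis using True by auto
    qed simp
    moreover have "z \<noteq> 0" using z(3) C.V.subspace_0[OF C.bnd_subspace] by auto
    ultimately have l: "?l = 0" by blast
    have "c \<in> C.V.span ({v. (n, v) \<in> S} \<union> bnd A C n)" using sp[OF c] * l0 by simp
    then have "inc n c \<in> C.V.span (inc n ` ({v. (n, v) \<in> S} \<union> bnd A C n))"
      using inc.span_image[of c "{v. (n, v) \<in> S} \<union> bnd A C n" n] SC C.bnd_mem by (auto simp: sc)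
    also have "\<dots> \<subseteq> C.V.span ({v. (n, v) \<in> S'} \<union> bnd A C' n)"
      by (rule C.V.span_minimal[OF _ C.V.subspace_span]) (use SS bnd C.V.span_base in blast)
    finally have "inc n c \<in> C.V.span ({v. (n, v) \<in> S'} \<union> bnd A C' n)" .
    moreover have "v \<in> C.V.span ({v. (n, v) \<in> S'} \<union> bnd A C' n)" using C'.bnd_aplus[OF v] by (intro C.V.span_base) auto
    ultimately show "x \<in> C.V.span ({v. (n, v) \<in> S'} \<union> bnd A C' n)"
      unfolding xe l by (simp add: C.V.span_add)
  qed
  moreover have "finite S'" using fin by (simp add: S'_def)
  moreover have "card S' < card S"
    using card_image_le[of "S - {(b, v0)}" "\<lambda>(i, v). (i, inc i v)"] card_Diff1_less[OF fin v0(1)] fin by (simp add: S'_def)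
  ultimately show ?thesis by blast
qed

lemma ghom_bnd:
  assumes "left_dg_module A M" "left_dg_module A N" "dg_hom A M N f" "x \<in> bnd A M i"
  shows "f i x \<in> bnd A N i"
proof -
  interpret f: dghom A M N f using assms by (intro dghomI)
  obtain y w where yw: "y \<in> mgrade M (i - 1)" "w \<in> aplus A M i" "x = mdiff M (i - 1) y + w"
    using assms(4) by (rule f.S.bndE)
  show ?thesis
    by (rule f.T.bndI[of "f (i - 1) y" _ "f i w"])
      (use yw f.aplus_image[OF yw(2)] f.S.aplus_mem[OF yw(2)] f.comm[OF yw(1), of i] in auto)
qed

lemma (in dga) lact_ksign_left:
  assumes "left_dg_module A M" "a \<in> agrade A p" "x \<in> mgrade M i"
  shows "lact M p i (ksign n a) x = ksign n (lact M p i a x)"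
proof -
  interpret lmod A M by unfold_locales fact
  show ?thesis
    using k_linear_ksign[OF act_lin2[OF assms(3)] R.V.vector_space_axioms R.grade assms(2)] .
qed

context adm_ctx
begin

text \<open>Start of the induction: the cone of \<open>0 \<rightarrow> P\<close> is a copy of
  \<open>P\<close>, with elements \<open>pr x 0\<close>, so the finiteness found for
  \<open>P\<close> carries over.\<close>

lemma initial_cone:
  assumes P: "P \<in> dg_modules u A" and gen: "generates A P S" and fin: "finite S" and ab: "acyclic_below b P"
  defines "\<delta> \<equiv> \<lambda>(i::int) (x::'u). 0::'u"
  shows "dg_hom A (zero_mod u) P \<delta>"
    and "\<exists>S'. finite S' \<and> generates A (mcone P (zero_mod u) \<delta>) S'"
    and "acyclic_below b (mcone P (zero_mod u) \<delta>)"
proof -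
  interpret P: lmod A P using P by unfold_locales (simp add: dg_modules_def)
  have sc [simp]: "mscale P = u" using P by (simp add: dg_modules_def)
  show \<delta>: "dg_hom A (zero_mod u) P \<delta>"
    by (rule dg_homI[OF graded_homI]) (auto simp: \<delta>_def)
  interpret cone A u P "zero_mod u" 1 "\<lambda>i. \<delta> (i + 1)" by (rule mcone[OF P zero_mod \<delta>])
  have GE': "\<exists>p. x = pr p 0 \<and> p \<in> mgrade P i" if "x \<in> mgrade G i" for x i
    using that by (elim GE) (simp add: zero_mod_def)
  have \<delta>0: "\<delta> i 0 = 0" for i by (simp add: \<delta>_def)
  have d0: "mdiff (zero_mod u :: ('k, 'a, 'u) dg_mod) i 0 = 0" for i by (simp add: zero_mod_def)
  interpret inl: dghom A P G "\<lambda>i x. pr x 0" by (rule dghomI[OF P.mod G.mod inl_dg_hom])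
  interpret prl: ghom A G P 0 "\<lambda>i. p1" by (rule ghomI[OF G.mod P.mod prl_hom])
  let ?S = "(\<lambda>(i, v). (i, pr v 0)) ` S"
  have SP: "v \<in> mgrade P i" if "(i, v) \<in> S" for i v using gen that by (auto simp: generates_def)
  have "generates A G ?S"
    unfolding generates_def
  proof (intro conjI allI ballI impI)
    show "case t of (i, v) \<Rightarrow> v \<in> mgrade G i" if "t \<in> ?S" for t using that SP by auto
    fix i x assume x: "x \<in> mgrade G i" "mdiff G i x \<in> aplus A G (i + 1)"
    obtain p where p: "x = pr p 0" "p \<in> mgrade P i" using GE'[OF x(1)] by blast
    have "mdiff P i p \<in> aplus A P (i + 1)"
      using prl.aplus_image[OF x(2)] p by simp
    then have "p \<in> U.span ({v. (i, v) \<in> S} \<union> bnd A P i)" using gen p by (simp add: generates_def)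
    then have "pr p 0 \<in> U.span ((\<lambda>x. pr x 0) ` ({v. (i, v) \<in> S} \<union> bnd A P i))"
      using inl.span_image[of p "{v. (i, v) \<in> S} \<union> bnd A P i" i] SP P.bnd_mem by auto
    also have "\<dots> \<subseteq> U.span ({v. (i, v) \<in> ?S} \<union> bnd A G i)"
      by (rule U.span_mono) (use ghom_bnd[OF P.mod G.mod inl_dg_hom] in force)
    finally show "x \<in> module.span (mscale G) ({v. (i, v) \<in> ?S} \<union> bnd A G i)" using p by simp
  qed
  then show "\<exists>S'. finite S' \<and> generates A G S'" using fin by blast
  show "acyclic_below b G"
    unfolding acyclic_below_def
  proof (intro allI impI)
    fix i x assume i: "i + 1 < b" and x: "x \<in> mgrade G (i + 1)" "mdiff G (i + 1) x = 0"
    obtain p where p: "x = pr p 0" "p \<in> mgrade P (i + 1)" using GE'[OF x(1)] by blast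
    then have "mdiff P (i + 1) p = 0" using x by (simp add: \<delta>0)
    then obtain y where "y \<in> mgrade P i" "p = mdiff P i y" using ab i p unfolding acyclic_below_def by blast
    then show "\<exists>y\<in>mgrade G i. x = mdiff G i y" using p by (intro bexI[of _ "pr y 0"]) (auto simp: \<delta>0)
  qed
qed

lemma cone_step:
  assumes kP: "kproj u A P" and P: "P \<in> dg_modules u A"
    and adm: "admissible u A I e0 F T t" and \<delta>: "dg_hom A F P \<delta>"
    and S: "finite S" "generates A (mcone P F \<delta>) S" and ab: "acyclic_below b (mcone P F \<delta>)"
    and z: "z \<in> mgrade (mcone P F \<delta>) b" "mdiff (mcone P F \<delta>) b z = 0"
      "\<not> (\<exists>y\<in>mgrade (mcone P F \<delta>) (b - 1). z = mdiff (mcone P F \<delta>) (b - 1) y)"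
  shows "\<exists>F' T' t' \<delta>' S'. admissible u A I e0 F' T' t' \<and> dg_hom A F' P \<delta>' \<and> finite S' \<and>
    card S' < card S \<and> generates A (mcone P F' \<delta>') S' \<and> acyclic_below (b - 1) (mcone P F' \<delta>')"
proof -
  have F: "F \<in> dg_modules u A" and kF: "kproj u A F"
    using adm by (auto simp: admissible_def)
  have sc [simp]: "mscale F = u" "mscale P = u" using F P by (auto simp: dg_modules_def)
  interpret C: cone A u P F 1 "\<lambda>i. \<delta> (i + 1)" by (rule mcone[OF P F \<delta>])
  interpret \<delta>: dghom A F P \<delta> by (rule dghomI[OF C.Y.mod C.X.mod \<delta>])
  have zb: "z \<notin> bnd A C.G b"
    using lowest_class[OF C.kproj_cone[OF kP kF] C.G_in ab z(1,2)] z(3) by blast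
  obtain p f where pf: "z = pr p f" "p \<in> mgrade P b" "f \<in> mgrade F (b + 1)" using z(1) by (rule C.GE)
  have df: "mdiff F (b + 1) f = 0" and dp: "mdiff P b p = - \<delta> (b + 1) f"
    using z(2) pf by (simp_all add: eq_neg_iff_add_eq_0)
  \<comment> \<open>The cell generator has degree \<open>- s\<close> in the extended
    \<open>F\<close>, and must lie one below its differential \<open>f\<close>, which has degree
    \<open>b + 1\<close>.\<close>
  define s where "s = - b"
  have f0: "f \<in> mgrade F (1 - s)" "mdiff F (1 - s) f = 0" using pf df by (simp_all add: s_def add.commute)
  interpret D: cone A u F Au s "tauF F s f" by (rule coneI[OF F Au tauF_twisting[OF F f0]])
  have adm': "admissible u A I e0 D.G (gcone T I s (tauT t s f)) (cellt t s)"
    by (rule cell_admissible[OF adm f0])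
  define g where "g i v = ksign (s * (i + s)) (lact P (i + s) b (ki (i + s) v) p)" for i v
  define \<delta>' where "\<delta>' i w = \<delta> i (p1 w) - g i (p2 w)" for i w
  have gm: "g i v \<in> mgrade P i" if "v \<in> mgrade Au (i + s)" for i v
    using that pf by (simp add: g_def s_def)
  have g0: "g i 0 = 0" for i using pf lact_zero_left[OF C.X.mod] by (simp add: g_def)
  have gadd: "g i (v + w) = g i v + g i w" if "v \<in> mgrade Au (i + s)" "w \<in> mgrade Au (i + s)" for i v w
    using that pf by (simp add: g_def ksign_add)
  have gsc: "g i (u c v) = u c (g i v)" if "v \<in> mgrade Au (i + s)" for i v c
    using that pf ki.scale[of v "i + s" c] C.X.lact_scale[of "ki (i + s) v" "i + s" p b c]
    by (simp add: g_def U.scale_ksign)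
  have gk: "g i (ksign n v) = ksign n (g i v)" if "v \<in> mgrade Au (i + s)" for i v n
    using that pf lact_ksign_left[OF C.X.mod, of "ki (i + s) v" "i + s" p b n]
    by (simp add: g_def add.commute)
  have \<delta>': "dg_hom A D.G P \<delta>'"
  proof (rule dg_homI[OF graded_homI])
    fix i x assume x: "x \<in> mgrade D.G i"
    then obtain f1 v where w: "x = pr f1 v" "f1 \<in> mgrade F i" "v \<in> mgrade Au (i + s)" by (rule D.GE)
    show "\<delta>' i x \<in> mgrade P (i + 0)" using w gm by (simp add: \<delta>'_def)
    show "\<delta>' i (x + y) = \<delta>' i x + \<delta>' i y" if "y \<in> mgrade D.G i" for y
      using that w gadd by (auto elim!: D.GE simp: \<delta>'_def p1_add p2_add)
    show "\<delta>' i (mscale D.G c x) = mscale P c (\<delta>' i x)" for c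
      using w gsc \<delta>.scale[of f1 i c] by (simp add: \<delta>'_def p1_scale p2_scale U.scale_right_diff_distrib)
    show "\<delta>' (q + i) (lact D.G q i a x) = ksign (0 * q) (lact P q (i + 0) a (\<delta>' i x))" if a: "a \<in> agrade A q" for a q
    proof -
      have am: "lact Au q (i + s) a v \<in> mgrade Au (q + i + s)" using a w by simp
      have "lact P (q + i + s) b (ki (q + i + s) (lact Au q (i + s) a v)) p = lact P q (i + s + b) a (lact P (i + s) b (ki (i + s) v) p)"
        using ki.act0[OF a w(3)] C.X.assoc[OF a, of "ki (i + s) v" "i + s" p b] w pf by (simp add: add.assoc)
      then have "g (q + i) (ksign (s * q) (lact Au q (i + s) a v)) = lact P q i a (g i v)"
        using gk[OF am] a w pf unfolding g_def
        by (simp add: s_def) (cases "even b"; cases "even q"; simp add: ksign_if)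
      then show ?thesis using w a gm by (simp add: \<delta>'_def)
    qed
    show "\<delta>' (i + 1) (mdiff D.G i x) = mdiff P i (\<delta>' i x)"
    proof -
      define k where "k = ki (i + s) v"
      have k: "k \<in> agrade A (i + s)" using w by (simp add: k_def)
      have dv: "mdiff Au (i + s) v \<in> mgrade Au (i + 1 + s)" using w by simp
      have kd: "ki (i + 1 + s) (mdiff Au (i + s) v) = adiff A (i + s) k"
        using ki.comm[OF w(3), of "i + 1 + s"] by (simp add: k_def)
      have 1: "\<delta> (i + 1) (tauF F s f i v) = ksign ((1 - s) * (i + s)) (lact P (i + s) (b + 1) k (\<delta> (b + 1) f))"
      proof -
        have e1: "i + s + (b + 1) = i + 1" and e2: "1 - s = b + 1" by (simp_all add: s_def)
        have m: "lact F (i + s) (b + 1) k f \<in> mgrade F (i + 1)"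
          using C.Y.act_mem[OF k pf(3) refl] unfolding e1 .
        have "\<delta> (i + 1) (lact F (i + s) (b + 1) k f) = lact P (i + s) (b + 1) k (\<delta> (b + 1) f)"
          using \<delta>.act0[OF k pf(3)] unfolding e1 .
        then show ?thesis unfolding tauF_def k_def[symmetric] e2 using \<delta>.ksgn[OF m] by simp
      qed
      have tm: "tauF F s f i v \<in> mgrade F (i + 1)" using w by simp
      have 2: "mdiff P i (lact P (i + s) b k p) =
          lact P (i + 1 + s) b (adiff A (i + s) k) p - ksign (i + s) (lact P (i + s) (b + 1) k (\<delta> (b + 1) f))"
        using C.X.leibniz[OF k pf(2)] dp k pf by (simp add: s_def ac_simps)
      have lm: "lact P (i + s) b k p \<in> mgrade P i" using k pf by (simp add: s_def)
      have "\<delta>' (i + 1) (mdiff D.G i x) = \<delta> (i + 1) (mdiff F i f1) + ksign ((1 - s) * (i + s)) (lact P (i + s) (b + 1) k (\<delta> (b + 1) f)) -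
         ksign (s + s * (i + 1 + s)) (lact P (i + 1 + s) b (adiff A (i + s) k) p)"
        using w tm dv by (simp add: \<delta>'_def gk 1 kd) (simp add: g_def kd)
      also have "\<dots> = mdiff P i (\<delta>' i x)"
        using w lm gm[OF w(3)] \<delta>.comm[OF w(2) refl]
        by (simp add: \<delta>'_def g_def k_def[symmetric] 2) (cases "even s"; cases "even i"; simp add: ksign_if)
      finally show ?thesis .
    qed
  qed
  interpret \<delta>': dghom A D.G P \<delta>' by (rule dghomI[OF D.G.mod C.X.mod \<delta>'])
  interpret C': cone A u P D.G 1 "\<lambda>i. \<delta>' (i + 1)" by (rule mcone[OF P D.G_in \<delta>'])
  define inc where "inc = (\<lambda>(i::int) w. pr (p1 w) (pr (p2 w) 0))"
  define ret where "ret = (\<lambda>(i::int) w. pr (p1 w) (p1 (p2 w)))"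
  \<comment> \<open>The minus sign offsets two others: the cone negates the differential
    \<open>f\<close> of the generator, and \<open>\<delta>'\<close> sends the generator to
    \<open>- p\<close>.\<close>
  define e where "e = - pr 0 (pr 0 one)"
  have bs: "b + s = 0" by (simp add: s_def)
  have e1: "pr 0 (pr 0 one) \<in> mgrade C'.G (b - 1)" by (simp add: bs)
  have \<delta>'0: "\<delta>' i (pr x 0) = \<delta> i x" for i x using g0 by (simp add: \<delta>'_def)
  have inc: "dg_hom A C.G C'.G inc"
    by (rule dg_homI[OF graded_homI])
      (auto elim!: C.GE simp: inc_def p1_add p2_add p1_scale p2_scale pr_add[symmetric] pr_scale[symmetric]
        pr_ksign[symmetric] \<delta>'0 ac_simps pr_minus[symmetric])
  have ret: "graded_hom A 0 C'.G C.G ret"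
    by (rule graded_homI)
      (auto elim!: C'.GE D.GE simp: ret_def p1_add p2_add p1_scale p2_scale pr_add[symmetric] pr_scale[symmetric]
        pr_ksign[symmetric] p1_ksign ac_simps)
  interpret inc: dghom A C.G C'.G inc by (rule dghomI[OF C.G.mod C'.G.mod inc])
  have ri: "ret i (inc i x) = x" if "x \<in> mgrade C.G i" for i x
    using that by (auto elim!: C.GE simp: inc_def ret_def)
  have de: "mdiff C'.G (b - 1) e = inc b z"
  proof -
    have t1: "tauF F s f b one = f" using f0 by (simp add: tauF_def bs)
    have "g b one = p" using pf by (simp add: g_def bs)
    then have "\<delta>' b (pr 0 one) = - p" by (simp add: \<delta>'_def)
    then have "mdiff C'.G (b - 1) (pr 0 (pr 0 one)) = pr (- p) (pr (- f) 0)"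
      using t1 by (simp add: bs pr_minus[symmetric])
    then have "mdiff C'.G (b - 1) e = - pr (- p) (pr (- f) 0)"
      unfolding e_def using C'.G.d_neg[OF e1] by simp
    then show ?thesis by (simp add: inc_def pf(1) pr_minus[symmetric])
  qed
  have dec: "\<exists>c\<in>mgrade C.G i. \<exists>l. \<exists>v\<in>aplus A C'.G i. w = inc i c + (if i = b - 1 then mscale C.G l e else 0) + v"
    if w: "w \<in> mgrade C'.G i" for i w
  proof -
    obtain p' f' where w1: "w = pr p' f'" "p' \<in> mgrade P i" "f' \<in> mgrade D.G (i + 1)" using w by (rule C'.GE)
    obtain f1 v where w2: "f' = pr f1 v" "f1 \<in> mgrade F (i + 1)" "v \<in> mgrade Au (i + 1 + s)" using w1(3) by (rule D.GE)
    have c: "pr p' f1 \<in> mgrade C.G i" using w1 w2 by simp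
    have wd: "w = inc i (pr p' f1) + pr 0 (pr 0 v)" using w1 w2 by (simp add: inc_def pr_add[symmetric])
    define k where "k = ki (i + 1 + s) v"
    have k: "k \<in> agrade A (i + 1 + s)" "v = lact Au (i + 1 + s) 0 k one" using w2 Au_gen[OF w2(3)] by (simp_all add: k_def)
    \<comment> \<open>The coefficient \<open>k\<close> of the generator is zero in negative degree
      and a scalar in degree 0; in positive degree the multiple of the generator lies in
      \<open>A^+ C'\<close>.\<close>
    consider "i + 1 + s < 0" | "i + 1 + s = 0" | "1 \<le> i + 1 + s" by linarith
    then show ?thesis
    proof cases
      case 1
      then have "i \<noteq> b - 1" using bs by linarith
      have "k = 0" using k neg_grade 1 by auto
      then have "v = 0" using k(2) lact_zero_left[OF Au.mod, of one 0] by simp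
      then show ?thesis using c wd \<open>i \<noteq> b - 1\<close> C'.G.V.subspace_0[OF C'.G.aplus_subspace]
        by (intro bexI[of _ "pr p' f1"] exI[of _ 0] bexI[of _ 0]) auto
    next
      case 2
      then have i: "i = b - 1" using bs by linarith
      obtain l where l: "k = ascale A l (aunit A)" using k grade0 2 by auto
      have "v = u l one" using k(2) Au.lact_scale[of "aunit A" 0 one 0 l] 2 by (simp add: l)
      then have "pr 0 (pr 0 v) = u (- l) e"
        by (simp add: e_def pr_0_scale U.scale_minus_left U.scale_minus_right)
      then show ?thesis using c wd i C'.G.V.subspace_0[OF C'.G.aplus_subspace]
        by (intro bexI[of _ "pr p' f1"] exI[of _ "- l"] bexI[of _ 0]) auto
    next
      case 3
      have "lact C'.G (i + 1 + s) (b - 1) k (pr 0 (pr 0 one)) \<in> aplus A C'.G i"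
        by (rule C'.G.aplus_act[OF 3 k(1) e1]) (use bs in linarith)
      moreover have "lact C'.G (i + 1 + s) (b - 1) k (pr 0 (pr 0 one)) =
          ksign ((1 + s) * (i + 1 + s)) (pr 0 (pr 0 v))"
      proof -
        have "lact C'.G (i + 1 + s) (b - 1) k (pr 0 (pr 0 one)) = pr 0 (ksign (1 * (i + 1 + s)) (pr 0 (ksign (s * (i + 1 + s)) v)))"
          using k(1) by (simp add: bs k(2)[symmetric])
        then show ?thesis by (simp add: pr_0_ksign algebra_simps)
      qed
      ultimately have m: "ksign ((1 + s) * (i + 1 + s)) (pr 0 (pr 0 v)) \<in> aplus A C'.G i" by (simp only:)
      have "ksign ((1 + s) * (i + 1 + s)) (ksign ((1 + s) * (i + 1 + s)) (pr 0 (pr 0 v))) \<in> aplus A C'.G i"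
        by (rule C'.G.V.subspace_ksign[OF C'.G.aplus_subspace m])
      then have "pr 0 (pr 0 v) \<in> aplus A C'.G i" by simp
      moreover have "i \<noteq> b - 1" using 3 bs by linarith
      ultimately show ?thesis using c wd
        by (intro bexI[of _ "pr p' f1"] exI[of _ 0] bexI[of _ "pr 0 (pr 0 v)"]) auto
    qed
  qed
  have "e \<in> mgrade C'.G (b - 1)" using e1 C'.G.neg_mem unfolding e_def by blast
  from generates_cell[OF C.G.mod C'.G.mod _ inc ret ri z(1,2) zb this de dec S(2,1)]
  obtain S' where S': "finite S'" "card S' < card S" "generates A C'.G S'" by auto
  \<comment> \<open>The new cell starts in degree \<open>b - 1\<close> of the cone, so cocycles
    below that degree come from the old cone, where they bound.\<close>
  have "acyclic_below (b - 1) C'.G"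
    unfolding acyclic_below_def
  proof (intro allI impI)
    fix i x assume i: "i + 1 < b - 1" and x: "x \<in> mgrade C'.G (i + 1)" "mdiff C'.G (i + 1) x = 0"
    obtain p' f' where w1: "x = pr p' f'" "p' \<in> mgrade P (i + 1)" "f' \<in> mgrade D.G (i + 1 + 1)" using x(1) by (rule C'.GE)
    obtain f1 v where w2: "f' = pr f1 v" "f1 \<in> mgrade F (i + 1 + 1)" "v \<in> mgrade Au (i + 1 + 1 + s)" using w1(3) by (rule D.GE)
    have "ki (i + 1 + 1 + s) v = 0" using ki.mem0[OF w2(3)] neg_grade[of "i + 1 + 1 + s"] i by (simp add: s_def)
    then have v0: "v = 0" using \<kappa>_ki[OF w2(3)] by simp
    have c: "pr p' f1 \<in> mgrade C.G (i + 1)" and xi: "x = inc (i + 1) (pr p' f1)" using w1 w2 v0 by (simp_all add: inc_def)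
    have "inc (i + 1 + 1) (mdiff C.G (i + 1) (pr p' f1)) = 0" using inc.comm[OF c refl] x xi by simp
    then have "mdiff C.G (i + 1) (pr p' f1) = 0" using ri[of "mdiff C.G (i + 1) (pr p' f1)" "i + 1 + 1"] C.G.d_mem[OF c refl]
      by (metis p1_0 p2_0 pr_00 ret_def)
    then obtain y where y: "y \<in> mgrade C.G i" "pr p' f1 = mdiff C.G i y" using ab c i unfolding acyclic_below_def by force
    then show "\<exists>y\<in>mgrade C'.G i. x = mdiff C'.G i y" using xi inc.comm[OF y(1) refl] by (intro bexI[of _ "inc i y"]) auto
  qed
  then show ?thesis using adm' \<delta>' S' by blast
qed

text \<open>Induction on the number of generators, with the bound \<open>b\<close> free to drop.
  There is no separate base case: as long as the cone is not acyclic, \<open>cone_step\<close>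
  yields a strictly smaller generating set.\<close>

lemma acyclic_cone_exists:
  assumes kP: "kproj u A P" and P: "P \<in> dg_modules u A"
  shows "admissible u A I e0 F T t \<Longrightarrow> dg_hom A F P \<delta> \<Longrightarrow> finite S \<Longrightarrow> generates A (mcone P F \<delta>) S \<Longrightarrow>
    acyclic_below b (mcone P F \<delta>) \<Longrightarrow>
    \<exists>F' T' t' \<delta>'. admissible u A I e0 F' T' t' \<and> dg_hom A F' P \<delta>' \<and> acyclic_mod (mcone P F' \<delta>')"
proof (induction "card S" arbitrary: F T t \<delta> S b rule: less_induct)
  case less
  show ?case
  proof (cases "acyclic_mod (mcone P F \<delta>)")
    case True
    then show ?thesis using less.prems by blast
  next
    case False
    let ?C = "mcone P F \<delta>"
    let ?bad = "\<lambda>i. \<exists>x\<in>mgrade ?C (i + 1). mdiff ?C (i + 1) x = 0 \<and> \<not> (\<exists>y\<in>mgrade ?C i. x = mdiff ?C i y)"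
    have "\<exists>i. ?bad i" using False acyclic_modI[of ?C] by blast
    then obtain i where i: "?bad i" by blast
    have lower: "b \<le> j + 1" if bad: "?bad j" for j
    proof (rule ccontr)
      assume "\<not> b \<le> j + 1"
      then have "j + 1 < b" by simp
      with less.prems(5) bad show False unfolding acyclic_below_def by blast
    qed
    \<comment> \<open>The lowest degree with cohomology, counted from \<open>b\<close>; it exists
      because nothing occurs below \<open>b\<close>. The offset is \<open>b - 1\<close> since
      \<open>?bad i\<close> concerns degree \<open>i + 1\<close>.\<close>
    define n where "n = (LEAST n. ?bad (b - 1 + int n))"
    have "?bad (b - 1 + int (nat (i + 1 - b)))" using i lower[OF i] by simp
    then have n: "?bad (b - 1 + int n)" unfolding n_def by (rule LeastI)
    define b' where "b' = b - 1 + int n + 1"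
    have "acyclic_below b' ?C"
      unfolding acyclic_below_def
    proof (intro allI impI)
      fix j x assume j: "j + 1 < b'" and x: "x \<in> mgrade ?C (j + 1)" "mdiff ?C (j + 1) x = 0"
      show "\<exists>y\<in>mgrade ?C j. x = mdiff ?C j y"
      proof (rule ccontr)
        assume "\<not> ?thesis"
        then have bad: "?bad j" using x by blast
        then have "?bad (b - 1 + int (nat (j + 1 - b)))" using lower[OF bad] by simp
        then have "n \<le> nat (j + 1 - b)" unfolding n_def by (rule Least_le)
        then show False using j lower[OF bad] by (simp add: b'_def)
      qed
    qed
    moreover have e: "b' - 1 = b - 1 + int n" by (simp add: b'_def)
    moreover obtain z where "z \<in> mgrade ?C b'" "mdiff ?C b' z = 0" "\<not> (\<exists>y\<in>mgrade ?C (b' - 1). z = mdiff ?C (b' - 1) y)"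
      using n unfolding e unfolding b'_def by blast
    ultimately obtain F' T' t' \<delta>' S' where "admissible u A I e0 F' T' t'" "dg_hom A F' P \<delta>'" "finite S'"
      "card S' < card S" "generates A (mcone P F' \<delta>') S'" "acyclic_below (b' - 1) (mcone P F' \<delta>')"
      using cone_step[OF kP P less.prems(1-4)] by blast
    then show ?thesis using less.hyps by blast
  qed
qed

end

section \<open>Semi-injective bimodules\<close>

lemma vector_space_mult: "vector_space ((*) :: 'k::field \<Rightarrow> 'k \<Rightarrow> 'k)"
  by unfold_locales (auto simp: algebra_simps)

text \<open>Elements of \<open>N \<otimes> A\<close> are encoded through their values on forms; a
  map out of it into \<open>'u\<close> is pinned down by composing with linear functionals.\<close>

lemma (in vector_space) functionals_separate:
  assumes "\<And>\<mu>. Vector_Spaces.linear scale (*) \<mu> \<Longrightarrow> \<mu> x = \<mu> y"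
  shows "x = y"
proof (rule ccontr)
  interpret P: vector_space_pair scale "(*) :: 'a \<Rightarrow> 'a \<Rightarrow> 'a"
    by (simp add: vector_space_pair_def vector_space_axioms vector_space_mult)
  assume "x \<noteq> y"
  then have "independent {x - y}" by simp
  from P.linear_independent_extend[OF this, of "\<lambda>_. 1"]
  obtain \<mu> where \<mu>: "Vector_Spaces.linear scale (*) \<mu>" "\<mu> (x - y) = 1" by auto
  have "\<mu> (x - y) = \<mu> x - \<mu> y" using P.linear_diff[OF \<mu>(1)] .
  then show False using assms[OF \<mu>(1)] \<mu>(2) by simp
qed

text \<open>Local finiteness makes each component of \<open>A\<close> finite-dimensional, hence
  embeddable in the infinite-dimensional universe.\<close>

lemma ex_free:
  assumes "dgu A u" "locally_finite A"
  shows "\<exists>Au \<kappa> ki. free_ctx A u Au \<kappa> ki"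
proof -
  interpret dgu A u by fact
  have "\<exists>fg. Vector_Spaces.linear (ascale A) u (fst fg) \<and> (\<forall>a\<in>agrade A i. snd fg (fst fg a) = a)" for i
  proof -
    obtain B where B: "finite B" "B \<subseteq> agrade A i" "R.V.span B = agrade A i"
      using assms(2) unfolding locally_finite_def by blast
    have le: "|B| \<le>o |Bu|"
      using finite_ordLess_infinite[OF card_of_Well_order card_of_Well_order, of B Bu] B(1) infinite_Bu
      by (simp add: Field_card_of ordLess_imp_ordLeq)
    show ?thesis
    proof (rule embed[OF R.V.vector_space_axioms R.grade B(2) _ le])
      show "agrade A i \<subseteq> R.V.span B" using B(3) by simp
      fix f g assume "Vector_Spaces.linear (ascale A) u f" "\<And>v. v \<in> agrade A i \<Longrightarrow> g (f v) = v"
      then show ?thesis by (intro exI[of _ "(f, g)"]) simp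
    qed
  qed
  then have "\<forall>i. \<exists>fg. Vector_Spaces.linear (ascale A) u (fst fg) \<and> (\<forall>a\<in>agrade A i. snd fg (fst fg a) = a)" by blast
  from choice[OF this] obtain fg where fg: "\<And>i. Vector_Spaces.linear (ascale A) u (fst (fg i))"
    "\<And>i a. a \<in> agrade A i \<Longrightarrow> snd (fg i) (fst (fg i) a) = a" by blast
  define f where "f i = fst (fg i)" for i
  define g where "g i = snd (fg i)" for i
  have fl: "\<And>i. Vector_Spaces.linear (mscale (reg_bimodule A)) u (f i)" and gf: "\<And>i x. x \<in> mgrade (reg_bimodule A) i \<Longrightarrow> g i (f i x) = x"
    using fg by (auto simp: f_def g_def reg_bimodule_def)
  note T = transport_left[where f = f and g = g, OF reg_left fl gf]
  have "free_ctx A u (transport u f g (reg_bimodule A)) f g"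
    unfolding free_ctx_def free_ctx_axioms_def
    using T gf dgu_axioms by (auto simp: dg_modules_def transport_def reg_bimodule_def)
  then show ?thesis by blast
qed

text \<open>Over a field an acyclic complex is contractible. The contraction is linear over the
  field, not over \<open>A\<close>.\<close>

lemma acyclic_contraction:
  assumes "univ u" and N: "left_dg_module A N" "mscale N = u" and ac: "acyclic_mod N"
  obtains h where "\<And>i x. x \<in> mgrade N (i + 1) \<Longrightarrow> h (i + 1) x \<in> mgrade N i"
    "\<And>i x y. x \<in> mgrade N i \<Longrightarrow> y \<in> mgrade N i \<Longrightarrow> h i (x + y) = h i x + h i y"
    "\<And>i x c. x \<in> mgrade N i \<Longrightarrow> h i (u c x) = u c (h i x)"
    "\<And>i x. x \<in> mgrade N (i + 1) \<Longrightarrow> mdiff N i (h (i + 1) x) + h (i + 1 + 1) (mdiff N (i + 1) x) = x"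
proof -
  interpret univ u by fact
  interpret N: lmod A N by unfold_locales fact
  interpret PL: vector_space_pair u u ..
  have gsub: "U.subspace (mgrade N i)" for i using N.grade N(2) by simp
  define Z where "Z i = {x \<in> mgrade N i. mdiff N i x = 0}" for i
  have ds: "mdiff N i (u c x) = u c (mdiff N i x)" if "x \<in> mgrade N i" for i c x
    using N.d_scale[OF that] N(2) by simp
  have "\<exists>\<sigma>. Vector_Spaces.linear u u \<sigma> \<and> (\<forall>z\<in>Z (i + 1). \<sigma> z \<in> mgrade N i \<and> mdiff N i (\<sigma> z) = z)" for i
  proof -
    obtain E where E: "E \<subseteq> Z (i + 1)" "U.independent E" "Z (i + 1) \<subseteq> U.span E"
      by (rule U.maximal_independent_subset)
    have "\<forall>e\<in>E. \<exists>y. y \<in> mgrade N i \<and> mdiff N i y = e"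
    proof
      fix e assume "e \<in> E"
      then have "e \<in> mgrade N (i + 1)" "mdiff N (i + 1) e = 0" using E(1) by (auto simp: Z_def)
      then show "\<exists>y. y \<in> mgrade N i \<and> mdiff N i y = e" using acyclic_modD[OF ac _ refl] by metis
    qed
    then obtain pre where pre: "\<And>e. e \<in> E \<Longrightarrow> pre e \<in> mgrade N i \<and> mdiff N i (pre e) = e" by metis
    obtain \<sigma> where \<sigma>: "Vector_Spaces.linear u u \<sigma>" "\<forall>e\<in>E. \<sigma> e = pre e"
      using PL.linear_independent_extend[OF E(2)] by blast
    have \<sigma>l: "\<sigma> (x + y) = \<sigma> x + \<sigma> y" "\<sigma> (u c x) = u c (\<sigma> x)" "\<sigma> 0 = 0" for x y c
      using \<sigma>(1) PL.linear_0[OF \<sigma>(1)] by (auto simp: Vector_Spaces.linear_iff)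
    have "\<sigma> z \<in> mgrade N i \<and> mdiff N i (\<sigma> z) = z" if "z \<in> U.span E" for z
      using U.subspace_span_induct[OF that subset_UNIV U.subspace_UNIV, of "\<lambda>z. \<sigma> z \<in> mgrade N i \<and> mdiff N i (\<sigma> z) = z"]
        pre \<sigma>(2) U.subspace_scale[OF gsub] by (auto simp: \<sigma>l ds)
    then show ?thesis using \<sigma>(1) E(3) by blast
  qed
  then have "\<forall>i. \<exists>\<sigma>. Vector_Spaces.linear u u \<sigma> \<and> (\<forall>z\<in>Z (i + 1). \<sigma> z \<in> mgrade N i \<and> mdiff N i (\<sigma> z) = z)" by blast
  from choice[OF this] obtain \<sigma> where \<sigma>: "\<And>i. Vector_Spaces.linear u u (\<sigma> i)"
    "\<And>i z. z \<in> Z (i + 1) \<Longrightarrow> \<sigma> i z \<in> mgrade N i \<and> mdiff N i (\<sigma> i z) = z" by blast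
  have \<sigma>l: "\<sigma> i (x + y) = \<sigma> i x + \<sigma> i y" "\<sigma> i (u c x) = u c (\<sigma> i x)" "\<sigma> i (x - y) = \<sigma> i x - \<sigma> i y" "\<sigma> i 0 = 0" for i x y c
    using \<sigma>(1)[of i] PL.linear_0[OF \<sigma>(1)] PL.linear_diff[OF \<sigma>(1)] by (auto simp: Vector_Spaces.linear_iff)
  \<comment> \<open>\<open>\<sigma>\<close> is a linear section of \<open>d\<close> on cocycles, and
    \<open>x - \<sigma> (d x)\<close> is the cocycle part of \<open>x\<close>.\<close>
  define h where "h i x = \<sigma> (i - 1) (x - \<sigma> i (mdiff N i x))" for i x
  have dZ: "mdiff N i x \<in> Z (i + 1)" if "x \<in> mgrade N i" for i x using that by (simp add: Z_def)
  have cZ: "x - \<sigma> i (mdiff N i x) \<in> Z i" if "x \<in> mgrade N i" for i x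
    using that \<sigma>(2)[OF dZ[OF that]] by (simp add: Z_def)
  show thesis
  proof (rule that[of h])
    fix i x assume x: "x \<in> mgrade N (i + 1)"
    show "h (i + 1) x \<in> mgrade N i" using \<sigma>(2)[OF cZ[OF x]] by (simp add: h_def)
    have "mdiff N i (h (i + 1) x) = x - \<sigma> (i + 1) (mdiff N (i + 1) x)"
      using \<sigma>(2)[OF cZ[OF x]] by (simp add: h_def)
    moreover have "h (i + 1 + 1) (mdiff N (i + 1) x) = \<sigma> (i + 1) (mdiff N (i + 1) x)"
      using x by (simp add: h_def \<sigma>l add.commute)
    ultimately show "mdiff N i (h (i + 1) x) + h (i + 1 + 1) (mdiff N (i + 1) x) = x" by simp
  next
    fix i x y assume "x \<in> mgrade N i" "y \<in> mgrade N i"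
    then show "h i (x + y) = h i x + h i y" by (simp add: h_def \<sigma>l)
  next
    fix i x c assume "x \<in> mgrade N i"
    then show "h i (u c x) = u c (h i x)" by (simp add: h_def \<sigma>l ds U.scale_right_diff_distrib[symmetric])
  qed
qed

text \<open>The bimodule version of \<open>semi_injective_kinj\<close>, again by
  \<open>0 \<rightarrow> N\<close>. Only the left linearity of the resulting homotopy is
  recorded.\<close>

lemma semi_injective_bimodule_null:
  fixes A :: "('k::field, 'a::ab_group_add) dg_alg" and u :: "'k \<Rightarrow> 'u::ab_group_add \<Rightarrow> 'u"
  assumes A: "dgu A u" and I: "semi_injective_bimodule u A I" and N: "N \<in> dg_bimodules u A"
    and ac: "acyclic_mod N" and f: "chain_hom A (n + 1) N I f"
    and fr: "graded_hom (op_alg A) (n + 1) (op_left N) (op_left I) f"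
  shows "null_hom A n N I f"
proof -
  interpret dgu A u by fact
  have Ib: "dg_bimodule A I" "mscale I = u" and Nb: "dg_bimodule A N" "mscale N = u"
    using I N by (auto simp: semi_injective_bimodule_def dg_bimodules_def)
  interpret I: bimod A I by (rule bimodI[OF dga_axioms Ib(1)])
  interpret N: bimod A N by (rule bimodI[OF dga_axioms Nb(1)])
  let ?Z = "zero_mod u :: ('k, 'a, 'u) dg_mod"
  let ?z = "\<lambda>(i::int) (x::'u). 0::'u"
  have Zop: "right_dg_module A ?Z"
    by (rule right_dg_moduleI) (auto simp: zero_mod_def U.vector_space_axioms intro: U.subspaceI dga_axioms)
  have Z: "?Z \<in> dg_bimodules u A"
    using zero_mod_mod Zop by (auto simp: dg_bimodules_def dg_bimodule_def) (auto simp: zero_mod_def)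
  have zl: "dg_hom A ?Z N ?z"
    by (rule dg_homI[OF graded_homI]) (use Nb in auto)
  have zr: "dg_hom (op_alg A) (op_left ?Z) (op_left N) ?z"
    using lmod.act_zero[OF N.op_lmod] lmod.d_zero[OF N.op_lmod] lmod.zero_mem[OF N.op_lmod]
    by (intro dg_homI graded_homI) (auto simp: N.op_sel(1) Nb)
  have zc: "cohomology_iso ?Z N ?z" "degreewise_inj ?Z ?z"
    using ac by (auto simp: cohomology_iso_def degreewise_inj_def cocycles_def coboundaries_def acyclic_mod_def
      zero_mod_def image_iff)
  have c: "cohomology_iso (bihom_complex A N I) (bihom_complex A ?Z I) (precompose ?Z ?z)"
    using I[unfolded semi_injective_bimodule_def, THEN conjunct2, rule_format, OF Z N] zl zr zc
    by (auto simp: dg_bihom_def)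
  interpret f: ghom A N I "n + 1" f using f by (auto simp: chain_hom_def intro!: ghomI N.L.mod I.L.mod)
  define g where "g = (\<lambda>i m. if m \<in> mgrade N i then f i m else 0)"
  have g: "graded_hom A (n + 1) N I g"
    by (rule graded_homI) (auto simp: g_def f.act ac_simps)
  have gr: "graded_hom (op_alg A) (n + 1) (op_left N) (op_left I) g"
  proof -
    interpret fr: ghom "op_alg A" "op_left N" "op_left I" "n + 1" f
      using fr N.op_lmod I.op_lmod by (simp add: ghom_def ghom_axioms_def)
    have "fr.S.V.subspace (mgrade (op_left N) i)" for i by (rule fr.S.grade)
    show ?thesis
      by (rule graded_homI)
        (use fr.act fr.S.act_mem[OF _ _ refl] fr.T.act_mem fr.S.scale_mem fr.scale fr.add fr.S.add_mem fr.mem in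
          \<open>auto simp: g_def N.op_sel(2)\<close>)
  qed
  have g0: "g i 0 = 0" for i by (simp add: g_def)
  have "g \<in> cocycles (bihom_complex A N I) (n + 1)"
    using f g gr by (auto simp: cocycles_def bihom_complex_def hom_complex_def g_def chain_hom_def fun_eq_iff)
  moreover have "precompose ?Z ?z (n + 1) g \<in> coboundaries (bihom_complex A ?Z I) (n + 1)"
  proof -
    have l: "graded_hom A n ?Z I (\<lambda>_ _. 0)" by (rule graded_homI) (use Ib in auto)
    have r: "graded_hom (op_alg A) n (op_left ?Z) (op_left I) (\<lambda>_ _. 0)"
      using lmod.act_zero[OF I.op_lmod] lmod.zero_mem[OF I.op_lmod]
      by (intro graded_homI) (auto simp: I.op_sel(1) Ib)
    show ?thesis
      unfolding coboundaries_def
      by (rule image_eqI[of _ _ "\<lambda>_ _. 0"])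
        (use l r in \<open>auto simp: bihom_complex_def hom_complex_def precompose_def fun_eq_iff g0\<close>)
  qed
  ultimately have "g \<in> coboundaries (bihom_complex A N I) (n + 1)"
    using c unfolding cohomology_iso_def by blast
  then obtain h where h: "graded_hom A n N I h" and hg: "g = mdiff (hom_complex A N I) n h"
    by (auto simp: coboundaries_def bihom_complex_def hom_complex_def)
  have "f i m = mdiff I (i + n) (h i m) - ksign n (h (i + 1) (mdiff N i m))" if "m \<in> mgrade N i" for i m
    using fun_cong[OF fun_cong[OF hg], of i m] that by (simp add: g_def hom_complex_def)
  then show ?thesis using h by (auto simp: null_hom_def)
qed

text \<open>
  The bimodule \<open>N \<otimes> A\<close> for a left module \<open>N\<close>.  Its elements in degree \<open>n\<close> are the combinations of
  evaluations at pairs \<open>(x, a)\<close>, as functionals on the families \<open>\<beta>\<close> of bilinear forms \<open>\<beta> j\<close> on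
  \<open>N\<^sup>n\<^sup>-\<^sup>j \<times> A\<^sup>j\<close>.
\<close>

locale tens = dgu A u + N: lmod A N
  for A :: "('k::field, 'a::ab_group_add) dg_alg"
  and u :: "'k \<Rightarrow> 'u::ab_group_add \<Rightarrow> 'u" and N :: "('k, 'a, 'u) dg_mod" +
  assumes scN [simp]: "mscale N = u"
begin

declare plus_fun_apply [simp del] zero_fun_apply [simp del]

definition bil :: "int \<Rightarrow> (int \<Rightarrow> 'u \<Rightarrow> 'a \<Rightarrow> 'k) \<Rightarrow> bool" where
  "bil n \<beta> \<longleftrightarrow> (\<forall>j. (\<forall>a\<in>agrade A j. k_linear u (mgrade N (n - j)) (*) UNIV (\<lambda>x. \<beta> j x a)) \<and>
     (\<forall>x\<in>mgrade N (n - j). k_linear (ascale A) (agrade A j) (*) UNIV (\<beta> j x)))"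

text \<open>The elementary tensor \<open>x \<otimes> a\<close>. Families that are not bilinear are
  sent to 0, so that the tensor relations become equalities of functions.\<close>

definition pt :: "int \<Rightarrow> int \<Rightarrow> 'u \<Rightarrow> 'a \<Rightarrow> (int \<Rightarrow> 'u \<Rightarrow> 'a \<Rightarrow> 'k) \<Rightarrow> 'k" where
  "pt n j x a = (\<lambda>\<beta>. if bil n \<beta> then \<beta> j x a else 0)"

definition fs :: "'k \<Rightarrow> ((int \<Rightarrow> 'u \<Rightarrow> 'a \<Rightarrow> 'k) \<Rightarrow> 'k) \<Rightarrow> (int \<Rightarrow> 'u \<Rightarrow> 'a \<Rightarrow> 'k) \<Rightarrow> 'k" where
  "fs c w = (\<lambda>\<beta>. c * w \<beta>)"

text \<open>Operations on \<open>N \<otimes> A\<close> are transposes of operations on families of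
  bilinear forms. They are thus linear and well defined by construction, and only their effect on
  elementary tensors has to be computed.\<close>

definition pull :: "int \<Rightarrow> ((int \<Rightarrow> 'u \<Rightarrow> 'a \<Rightarrow> 'k) \<Rightarrow> int \<Rightarrow> 'u \<Rightarrow> 'a \<Rightarrow> 'k) \<Rightarrow>
    ((int \<Rightarrow> 'u \<Rightarrow> 'a \<Rightarrow> 'k) \<Rightarrow> 'k) \<Rightarrow> (int \<Rightarrow> 'u \<Rightarrow> 'a \<Rightarrow> 'k) \<Rightarrow> 'k" where
  "pull n F w = (\<lambda>\<beta>. if bil n \<beta> then w (F \<beta>) else 0)"

definition K :: "('k, 'a, (int \<Rightarrow> 'u \<Rightarrow> 'a \<Rightarrow> 'k) \<Rightarrow> 'k) dg_mod" where
  "K = \<lparr>mscale = fs,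
    mgrade = (\<lambda>n. module.span fs {pt n j x a | j x a. x \<in> mgrade N (n - j) \<and> a \<in> agrade A j}),
    mdiff = (\<lambda>n. pull (n + 1) (\<lambda>\<beta> j x a. \<beta> j (mdiff N (n - j) x) a + ksign (n - j) (\<beta> (j + 1) x (adiff A j a)))),
    lact = (\<lambda>p n b. pull (p + n) (\<lambda>\<beta> j x a. \<beta> j (lact N p (n - j) b x) a)),
    ract = (\<lambda>n q w c. pull (n + q) (\<lambda>\<beta> j x a. \<beta> (j + q) x (amult A j q a c)) w)\<rparr>"

lemma fs: "vector_space fs"
  by unfold_locales (auto simp: fs_def fun_eq_iff plus_fun_apply zero_fun_apply algebra_simps)

sublocale F: vector_space fs by (rule fs)

lemma K_sel [simp]: "mscale K = fs"
  by (simp add: K_def)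

lemma K_grade: "mgrade K n = F.span {pt n j x a | j x a. x \<in> mgrade N (n - j) \<and> a \<in> agrade A j}"
  by (simp add: K_def)

lemma pull_add: "pull n F (v + w) = pull n F v + pull n F w"
  and pull_scale: "pull n F (fs c w) = fs c (pull n F w)"
  by (auto simp: pull_def fs_def fun_eq_iff plus_fun_apply zero_fun_apply)

lemma pull_zero [simp]: "pull n F 0 = 0"
  by (auto simp: pull_def fun_eq_iff plus_fun_apply zero_fun_apply)

lemma pull_ksign: "pull n F (ksign m w) = ksign m (pull n F w)"
  by (auto simp: pull_def ksign_def fun_eq_iff plus_fun_apply zero_fun_apply)

lemma pt_add1: "x \<in> mgrade N (n - j) \<Longrightarrow> y \<in> mgrade N (n - j) \<Longrightarrow> a \<in> agrade A j \<Longrightarrow> pt n j (x + y) a = pt n j x a + pt n j y a"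
  and pt_add2: "x \<in> mgrade N (n - j) \<Longrightarrow> a \<in> agrade A j \<Longrightarrow> b \<in> agrade A j \<Longrightarrow> pt n j x (a + b) = pt n j x a + pt n j x b"
  and pt_scale1: "x \<in> mgrade N (n - j) \<Longrightarrow> a \<in> agrade A j \<Longrightarrow> pt n j (u c x) a = fs c (pt n j x a)"
  and pt_scale2: "x \<in> mgrade N (n - j) \<Longrightarrow> a \<in> agrade A j \<Longrightarrow> pt n j x (ascale A c a) = fs c (pt n j x a)"
  by (auto simp: pt_def fun_eq_iff plus_fun_apply zero_fun_apply bil_def fs_def k_linear_def)

lemma pt_ksign1: "x \<in> mgrade N (n - j) \<Longrightarrow> a \<in> agrade A j \<Longrightarrow> pt n j (ksign m x) a = ksign m (pt n j x a)"
  using pt_scale1[of x n j a "-1"] by (auto simp: ksign_def fs_def fun_eq_iff plus_fun_apply zero_fun_apply)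

lemma pt_zero1 [simp]: "a \<in> agrade A j \<Longrightarrow> pt n j 0 a = 0"
  using pt_add1[of 0 n j 0 a] by simp

lemma pt_zero2 [simp]: "x \<in> mgrade N (n - j) \<Longrightarrow> pt n j x 0 = 0"
  using pt_add2[of x n j 0 0] by simp

lemma pt_mem: "x \<in> mgrade N (n - j) \<Longrightarrow> a \<in> agrade A j \<Longrightarrow> pt n j x a \<in> mgrade K n"
  unfolding K_grade by (rule F.span_base) blast

lemma K_subspace: "F.subspace (mgrade K n)"
  unfolding K_grade by (rule F.subspace_span)

lemma K_induct:
  assumes "w \<in> mgrade K n" "\<And>j x a. x \<in> mgrade N (n - j) \<Longrightarrow> a \<in> agrade A j \<Longrightarrow> P (pt n j x a)"
    "P 0" "\<And>v w. P v \<Longrightarrow> P w \<Longrightarrow> P (v + w)" "\<And>c w. P w \<Longrightarrow> P (fs c w)"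
  shows "P w"
proof -
  have "w \<in> UNIV \<and> P w"
    by (rule F.subspace_span_induct[OF assms(1)[unfolded K_grade]])
      (use assms(2-) F.subspace_UNIV in auto)
  then show ?thesis by simp
qed

lemma bil_D:
  assumes "bil n \<beta>"
  shows "x \<in> mgrade N (n - j) \<Longrightarrow> y \<in> mgrade N (n - j) \<Longrightarrow> a \<in> agrade A j \<Longrightarrow> \<beta> j (x + y) a = \<beta> j x a + \<beta> j y a"
    "x \<in> mgrade N (n - j) \<Longrightarrow> a \<in> agrade A j \<Longrightarrow> b \<in> agrade A j \<Longrightarrow> \<beta> j x (a + b) = \<beta> j x a + \<beta> j x b"
    "x \<in> mgrade N (n - j) \<Longrightarrow> a \<in> agrade A j \<Longrightarrow> \<beta> j (u c x) a = c * \<beta> j x a"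
    "x \<in> mgrade N (n - j) \<Longrightarrow> a \<in> agrade A j \<Longrightarrow> \<beta> j x (ascale A c a) = c * \<beta> j x a"
  using assms by (auto simp: bil_def k_linear_def)

lemma bilI:
  assumes "\<And>j x y a. x \<in> mgrade N (n - j) \<Longrightarrow> y \<in> mgrade N (n - j) \<Longrightarrow> a \<in> agrade A j \<Longrightarrow> \<beta> j (x + y) a = \<beta> j x a + \<beta> j y a"
    "\<And>j x a b. x \<in> mgrade N (n - j) \<Longrightarrow> a \<in> agrade A j \<Longrightarrow> b \<in> agrade A j \<Longrightarrow> \<beta> j x (a + b) = \<beta> j x a + \<beta> j x b"
    "\<And>j x a c. x \<in> mgrade N (n - j) \<Longrightarrow> a \<in> agrade A j \<Longrightarrow> \<beta> j (u c x) a = c * \<beta> j x a"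
    "\<And>j x a c. x \<in> mgrade N (n - j) \<Longrightarrow> a \<in> agrade A j \<Longrightarrow> \<beta> j x (ascale A c a) = c * \<beta> j x a"
  shows "bil n \<beta>"
  unfolding bil_def k_linear_def using assms by auto

lemma nd: "mdiff N i (u c x) = u c (mdiff N i x)" if "x \<in> mgrade N i" for c x i
  using N.d_scale[OF that] by simp

lemma nl: "lact N p i b (u c x) = u c (lact N p i b x)" if "b \<in> agrade A p" "x \<in> mgrade N i" for b p c x i
  using N.act_scale[OF that] by simp

lemma bil_d:
  assumes "bil (n + 1) \<beta>"
  shows "bil n (\<lambda>j x a. \<beta> j (mdiff N (n - j) x) a + ksign (n - j) (\<beta> (j + 1) x (adiff A j a)))"
  by (rule bilI)
    (simp_all add: bil_D[OF assms] nd ksign_add k_ksign_mult distrib_left)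

lemma bil_l: "b \<in> agrade A p \<Longrightarrow> bil (p + n) \<beta> \<Longrightarrow> bil n (\<lambda>j x a. \<beta> j (lact N p (n - j) b x) a)"
  by (rule bilI) (simp_all add: bil_D[of "p + n"] nl)

lemma bil_r: "c \<in> agrade A q \<Longrightarrow> bil (n + q) \<beta> \<Longrightarrow> bil n (\<lambda>j x a. \<beta> (j + q) x (amult A j q a c))"
  by (rule bilI) (simp_all add: bil_D[of "n + q"])

lemma ksign_apply: "ksign m g \<beta> = ksign m (g \<beta>)" for g :: "'x \<Rightarrow> 'k"
  by (simp add: ksign_def)

lemma K_d: "mdiff K n (pt n j x a) = pt (n + 1) j (mdiff N (n - j) x) a + ksign (n - j) (pt (n + 1) (j + 1) x (adiff A j a))"
  by (auto simp: K_def pull_def pt_def bil_d fun_eq_iff plus_fun_apply ksign_apply)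

lemma K_l: "b \<in> agrade A p \<Longrightarrow> lact K p n b (pt n j x a) = pt (p + n) j (lact N p (n - j) b x) a"
  by (auto simp: K_def pull_def pt_def bil_l fun_eq_iff plus_fun_apply zero_fun_apply)

lemma K_r: "c \<in> agrade A q \<Longrightarrow> ract K n q (pt n j x a) c = pt (n + q) (j + q) x (amult A j q a c)"
  by (auto simp: K_def pull_def pt_def bil_r fun_eq_iff plus_fun_apply zero_fun_apply)

lemma K_d_lin [simp]: "mdiff K n (v + w) = mdiff K n v + mdiff K n w" "mdiff K n (fs c w) = fs c (mdiff K n w)"
    "mdiff K n 0 = 0" "mdiff K n (ksign m w) = ksign m (mdiff K n w)"
  and K_l_lin [simp]: "lact K p n b (v + w) = lact K p n b v + lact K p n b w" "lact K p n b (fs c w) = fs c (lact K p n b w)"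
    "lact K p n b 0 = 0" "lact K p n b (ksign m w) = ksign m (lact K p n b w)"
  and K_r_lin [simp]: "ract K n q (v + w) a = ract K n q v a + ract K n q w a" "ract K n q (fs c w) a = fs c (ract K n q w a)"
    "ract K n q 0 a = 0" "ract K n q (ksign m w) a = ksign m (ract K n q w a)"
  by (simp_all add: K_def pull_add pull_scale pull_ksign)

lemma fs_add [simp]: "fs c (v + w) = fs c v + fs c w"
  by (rule F.scale_right_distrib)

lemma fs_ksign: "ksign m (fs c w) = fs c (ksign m w)"
  by (simp add: F.scale_ksign)

lemma K_d_mem: "w \<in> mgrade K n \<Longrightarrow> mdiff K n w \<in> mgrade K (n + 1)"
proof (erule K_induct)
  fix j x a assume "x \<in> mgrade N (n - j)" "a \<in> agrade A j"
  then show "mdiff K n (pt n j x a) \<in> mgrade K (n + 1)"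
    unfolding K_d by (intro F.subspace_add[OF K_subspace] F.subspace_ksign[OF K_subspace] pt_mem) (simp_all add: algebra_simps)
qed (use K_subspace F.subspace_0 F.subspace_add F.subspace_scale in auto)

lemma K_l_mem: "b \<in> agrade A p \<Longrightarrow> w \<in> mgrade K n \<Longrightarrow> lact K p n b w \<in> mgrade K (p + n)"
proof (erule K_induct)
  fix j x a assume "b \<in> agrade A p" "x \<in> mgrade N (n - j)" "a \<in> agrade A j"
  then show "lact K p n b (pt n j x a) \<in> mgrade K (p + n)"
    by (auto simp: K_l intro!: pt_mem)
qed (use K_subspace F.subspace_0 F.subspace_add F.subspace_scale in auto)

lemma K_r_mem: "c \<in> agrade A q \<Longrightarrow> w \<in> mgrade K n \<Longrightarrow> ract K n q w c \<in> mgrade K (n + q)"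
proof (erule K_induct)
  fix j x a assume "c \<in> agrade A q" "x \<in> mgrade N (n - j)" "a \<in> agrade A j"
  then show "ract K n q (pt n j x a) c \<in> mgrade K (n + q)"
    by (auto simp: K_r intro!: pt_mem)
qed (use K_subspace F.subspace_0 F.subspace_add F.subspace_scale in auto)

lemma K_dd: "w \<in> mgrade K n \<Longrightarrow> mdiff K (n + 1) (mdiff K n w) = 0"
proof (erule K_induct)
  fix j x a assume x: "x \<in> mgrade N (n - j)" and a: "a \<in> agrade A j"
  have e: "n + 1 - j = n - j + 1" "n + 1 - (j + 1) = n - j" by simp_all
  show "mdiff K (n + 1) (mdiff K n (pt n j x a)) = 0"
    using x a by (simp add: K_d e ksign_add) (simp add: ksign_if)
qed simp_all

lemma K_left: "left_dg_module A K"
proof (rule left_dg_moduleI)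
  show "module.subspace (mscale K) (mgrade K i)" for i by (simp add: K_subspace)
  fix p i b w assume b: "b \<in> agrade A p" and w: "w \<in> mgrade K i"
  show "lact K p i (b + c) w = lact K p i b w + lact K p i c w" if c: "c \<in> agrade A p" for c
    using w
  proof (rule K_induct)
    fix j x a assume x: "x \<in> mgrade N (i - j)" and a: "a \<in> agrade A j"
    have "lact N p (i - j) d x \<in> mgrade N (p + i - j)" if "d \<in> agrade A p" for d using x that by simp
    then show "lact K p i (b + c) (pt i j x a) = lact K p i b (pt i j x a) + lact K p i c (pt i j x a)"
      using b c x a by (simp add: K_l pt_add1)
  qed (simp_all add: algebra_simps)
  show "lact K p i (ascale A c b) w = mscale K c (lact K p i b w)" for c
    using w
  proof (rule K_induct)
    fix j x a assume x: "x \<in> mgrade N (i - j)" and a: "a \<in> agrade A j"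
    have "lact N p (i - j) b x \<in> mgrade N (p + i - j)" using x b by simp
    then show "lact K p i (ascale A c b) (pt i j x a) = mscale K c (lact K p i b (pt i j x a))"
      using b x a N.lact_scale[OF b x] by (simp add: K_l pt_scale1)
  qed (simp_all add: F.scale_left_commute)
  show "lact K (p + q) i (amult A p q b c) w = lact K p (q + i) b (lact K q i c w)" if c: "c \<in> agrade A q" for q c
    using w
  proof (rule K_induct)
    fix j x a assume x: "x \<in> mgrade N (i - j)" and a: "a \<in> agrade A j"
    show "lact K (p + q) i (amult A p q b c) (pt i j x a) = lact K p (q + i) b (lact K q i c (pt i j x a))"
      using b c x a N.assoc[OF b c x] by (simp add: K_l ac_simps add_diff_eq)
  qed simp_all
  show "mdiff K (p + i) (lact K p i b w) = lact K (p + 1) i (adiff A p b) w + ksign p (lact K p (i + 1) b (mdiff K i w))"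
    using w
  proof (rule K_induct)
    fix j x a assume x: "x \<in> mgrade N (i - j)" and a: "a \<in> agrade A j"
    have e: "p + i - j = p + (i - j)" "i + 1 - (j + 1) = i - j" "i + 1 - j = i - j + 1" by simp_all
    have db: "adiff A p b \<in> agrade A (p + 1)" using b by simp
    have m: "lact N (p + 1) (i - j) (adiff A p b) x \<in> mgrade N (p + i + 1 - j)"
      "lact N p (i - j + 1) b (mdiff N (i - j) x) \<in> mgrade N (p + i + 1 - j)" using b x db by simp_all
    have l: "mdiff N (p + i - j) (lact N p (i - j) b x) =
       lact N (p + 1) (i - j) (adiff A p b) x + ksign p (lact N p (i - j + 1) b (mdiff N (i - j) x))"
      using N.leibniz[OF b x] by (simp add: e)
    have "mdiff K (p + i) (lact K p i b (pt i j x a)) =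
       pt (p + i + 1) j (lact N (p + 1) (i - j) (adiff A p b) x) a +
       ksign p (pt (p + i + 1) j (lact N p (i - j + 1) b (mdiff N (i - j) x)) a) +
       ksign (p + i - j) (pt (p + i + 1) (j + 1) (lact N p (i - j) b x) (adiff A j a))"
      using m a by (simp add: K_l[OF b] K_d l pt_add1 pt_ksign1)
    also have "\<dots> = lact K (p + 1) i (adiff A p b) (pt i j x a) + ksign p (lact K p (i + 1) b (mdiff K i (pt i j x a)))"
      unfolding K_d K_l_lin K_l[OF b] K_l[OF db] e
      by (simp add: ksign_add add.commute add.left_commute e)
    finally show "mdiff K (p + i) (lact K p i b (pt i j x a)) =
       lact K (p + 1) i (adiff A p b) (pt i j x a) + ksign p (lact K p (i + 1) b (mdiff K i (pt i j x a)))" .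
  qed (simp_all add: ksign_add fs_ksign algebra_simps)
next
  fix i w assume "w \<in> mgrade K i"
  then show "lact K 0 i (aunit A) w = w"
    by (rule K_induct) (simp_all add: K_l)
qed (simp_all add: fs K_d_mem K_dd K_l_mem)

end

context tens
begin

lemma K_right: "right_dg_module A K"
proof (rule right_dg_moduleI)
  show "module.subspace (mscale K) (mgrade K i)" for i by (simp add: K_subspace)
  fix p i b w assume b: "b \<in> agrade A p" and w: "w \<in> mgrade K i"
  show "ract K i p w (b + c) = ract K i p w b + ract K i p w c" if c: "c \<in> agrade A p" for c
    using w
  proof (rule K_induct)
    fix j x a assume x: "x \<in> mgrade N (i - j)" and a: "a \<in> agrade A j"
    have "x \<in> mgrade N (i + p - (j + p))" using x by simp
    then show "ract K i p (pt i j x a) (b + c) = ract K i p (pt i j x a) b + ract K i p (pt i j x a) c"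
      using b c a by (simp add: K_r pt_add2)
  qed (simp_all add: algebra_simps)
  show "ract K i p w (ascale A c b) = mscale K c (ract K i p w b)" for c
    using w
  proof (rule K_induct)
    fix j x a assume x: "x \<in> mgrade N (i - j)" and a: "a \<in> agrade A j"
    have "x \<in> mgrade N (i + p - (j + p))" using x by simp
    then show "ract K i p (pt i j x a) (ascale A c b) = mscale K c (ract K i p (pt i j x a) b)"
      using b a R.act_scale[OF a b] by (simp add: K_r pt_scale2)
  qed (simp_all add: F.scale_left_commute)
  show "ract K i (p + q) w (amult A p q b c) = ract K (i + p) q (ract K i p w b) c" if c: "c \<in> agrade A q" for q c
    using w
  proof (rule K_induct)
    fix j x a assume x: "x \<in> mgrade N (i - j)" and a: "a \<in> agrade A j"
    show "ract K i (p + q) (pt i j x a) (amult A p q b c) = ract K (i + p) q (ract K i p (pt i j x a) b) c"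
      using b c x a R.assoc[OF a b c] by (simp add: K_r add.assoc)
  qed simp_all
  show "mdiff K (i + p) (ract K i p w b) = ract K (i + 1) p (mdiff K i w) b + ksign i (ract K i (p + 1) w (adiff A p b))"
    using w
  proof (rule K_induct)
    fix j x a assume x: "x \<in> mgrade N (i - j)" and a: "a \<in> agrade A j"
    have db: "adiff A p b \<in> agrade A (p + 1)" using b by simp
    have x': "x \<in> mgrade N (i + p + 1 - (j + p + 1))" using x by simp
    have m: "amult A (j + 1) p (adiff A j a) b \<in> agrade A (j + p + 1)" "amult A j (p + 1) a (adiff A p b) \<in> agrade A (j + p + 1)"
      using a b by simp_all
    have pk: "pt (i + p + 1) (j + p + 1) x (ksign j c) = ksign j (pt (i + p + 1) (j + p + 1) x c)" if "c \<in> agrade A (j + p + 1)" for c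
      using pt_scale2[OF x' that, of "-1"] by (simp add: ksign_def)
    have "mdiff K (i + p) (ract K i p (pt i j x a) b) =
       pt (i + p + 1) (j + p) (mdiff N (i - j) x) (amult A j p a b) +
       ksign (i - j) (pt (i + p + 1) (j + p + 1) x (amult A (j + 1) p (adiff A j a) b)) +
       ksign (i - j + j) (pt (i + p + 1) (j + p + 1) x (amult A j (p + 1) a (adiff A p b)))"
      using R.leibniz[OF a b] m x' by (simp add: K_r[OF b] K_d pt_add2 pk ksign_add)
    also have "\<dots> = ract K (i + 1) p (mdiff K i (pt i j x a)) b + ksign i (ract K i (p + 1) (pt i j x a) (adiff A p b))"
      unfolding K_d K_r_lin K_r[OF b] K_r[OF db]
      by (simp add: add.commute add.left_commute)
    finally show "mdiff K (i + p) (ract K i p (pt i j x a) b) =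
       ract K (i + 1) p (mdiff K i (pt i j x a)) b + ksign i (ract K i (p + 1) (pt i j x a) (adiff A p b))" .
  qed (simp_all add: ksign_add fs_ksign algebra_simps)
next
  fix i w assume "w \<in> mgrade K i"
  then show "ract K i 0 w (aunit A) = w"
    by (rule K_induct) (simp_all add: K_r)
qed (simp_all add: fs K_d_mem K_dd K_r_mem dga_axioms)

lemma K_bi: "dg_bimodule A K"
proof (rule dg_bimoduleI[OF K_left K_right])
  fix p q i a b w assume a: "a \<in> agrade A p" and b: "b \<in> agrade A q" and w: "w \<in> mgrade K i"
  show "ract K (p + i) q (lact K p i a w) b = lact K p (i + q) a (ract K i q w b)"
    using w
  proof (rule K_induct)
    fix j x c assume "x \<in> mgrade N (i - j)" "c \<in> agrade A j"
    then show "ract K (p + i) q (lact K p i a (pt i j x c)) b = lact K p (i + q) a (ract K i q (pt i j x c) b)"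
      using a b by (simp add: K_r K_l add.assoc)
  qed simp_all
qed

text \<open>A contraction of \<open>N\<close> over the field, tensored with the identity of
  \<open>A\<close>, contracts \<open>N \<otimes> A\<close>.\<close>

lemma K_acyclic:
  assumes "acyclic_mod N"
  shows "acyclic_mod K"
proof -
  obtain h where h: "\<And>i x. x \<in> mgrade N (i + 1) \<Longrightarrow> h (i + 1) x \<in> mgrade N i"
    "\<And>i x y. x \<in> mgrade N i \<Longrightarrow> y \<in> mgrade N i \<Longrightarrow> h i (x + y) = h i x + h i y"
    "\<And>i x c. x \<in> mgrade N i \<Longrightarrow> h i (u c x) = u c (h i x)"
    "\<And>i x. x \<in> mgrade N (i + 1) \<Longrightarrow> mdiff N i (h (i + 1) x) + h (i + 1 + 1) (mdiff N (i + 1) x) = x"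
    using acyclic_contraction[OF univ_axioms N.mod scN assms] by blast
  have h1: "h l x \<in> mgrade N i" if "x \<in> mgrade N l" "l = i + 1" for i l x using h(1) that by simp
  define hK where "hK n = pull n (\<lambda>\<beta> j x a. \<beta> j (h (n + 1 - j) x) a)" for n
  have bh: "bil (n + 1) (\<lambda>j x a. \<beta> j (h (n + 1 - j) x) a)" if "bil n \<beta>" for n \<beta>
  proof -
    have m: "h (n + 1 - j) x \<in> mgrade N (n - j)" if "x \<in> mgrade N (n + 1 - j)" for j x
      by (rule h1[OF that]) simp
    show ?thesis by (rule bilI) (simp_all add: h(2,3) m bil_D[OF that])
  qed
  have hpt: "hK n (pt (n + 1) j x a) = pt n j (h (n + 1 - j) x) a" for n j x a
    by (auto simp: hK_def pull_def pt_def bh fun_eq_iff)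
  have hlin: "hK n (v + w) = hK n v + hK n w" "hK n (fs c w) = fs c (hK n w)" "hK n 0 = 0"
      "hK n (ksign m w) = ksign m (hK n w)" for n v w c m
    by (simp_all add: hK_def pull_add pull_scale pull_ksign)
  have hmem: "hK n w \<in> mgrade K n" if "w \<in> mgrade K (n + 1)" for n w
    using that
  proof (rule K_induct)
    fix j x a assume x: "x \<in> mgrade N (n + 1 - j)" and a: "a \<in> agrade A j"
    show "hK n (pt (n + 1) j x a) \<in> mgrade K n"
      unfolding hpt by (rule pt_mem[OF h1[OF x] a]) simp
  qed (use K_subspace F.subspace_0 F.subspace_add F.subspace_scale in \<open>auto simp: hlin\<close>)
  have hd: "mdiff K n (hK n w) + hK (n + 1) (mdiff K (n + 1) w) = w" if "w \<in> mgrade K (n + 1)" for n w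
    using that
  proof (rule K_induct)
    fix j x a assume x: "x \<in> mgrade N (n + 1 - j)" and a: "a \<in> agrade A j"
    have e: "n + 1 - j = n - j + 1" "n + 1 + 1 - j = n - j + 1 + 1" "n + 1 + 1 - (j + 1) = n - j + 1" by simp_all
    have x': "x \<in> mgrade N (n - j + 1)" using x by (simp add: e)
    have m: "mdiff N (n - j) (h (n - j + 1) x) \<in> mgrade N (n + 1 - j)" "h (n - j + 1 + 1) (mdiff N (n - j + 1) x) \<in> mgrade N (n + 1 - j)"
      using h1[OF x', of "n - j"] h1[of "mdiff N (n - j + 1) x" "n - j + 1 + 1" "n - j + 1"] x' by (simp_all add: e)
    have "mdiff K n (hK n (pt (n + 1) j x a)) + hK (n + 1) (mdiff K (n + 1) (pt (n + 1) j x a)) =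
      pt (n + 1) j (mdiff N (n - j) (h (n - j + 1) x)) a + pt (n + 1) j (h (n - j + 1 + 1) (mdiff N (n - j + 1) x)) a +
      (ksign (n - j) (pt (n + 1) (j + 1) (h (n - j + 1) x) (adiff A j a)) + ksign (n - j + 1) (pt (n + 1) (j + 1) (h (n - j + 1) x) (adiff A j a)))"
      unfolding hpt K_d hlin e by (simp only: add.assoc add.left_commute)
    \<comment> \<open>The two terms containing \<open>d a\<close> cancel: \<open>h\<close> lowers
      the degree of the first factor by one and so reverses their relative sign.\<close>
    also have "\<dots> = pt (n + 1) j (mdiff N (n - j) (h (n - j + 1) x) + h (n - j + 1 + 1) (mdiff N (n - j + 1) x)) a"
      unfolding pt_add1[OF m a] by (simp add: ksign_def)
    also have "\<dots> = pt (n + 1) j x a" using h(4)[OF x'] by simp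
    finally show "mdiff K n (hK n (pt (n + 1) j x a)) + hK (n + 1) (mdiff K (n + 1) (pt (n + 1) j x a)) = pt (n + 1) j x a" .
  next
    fix v w assume "mdiff K n (hK n v) + hK (n + 1) (mdiff K (n + 1) v) = v" "mdiff K n (hK n w) + hK (n + 1) (mdiff K (n + 1) w) = w"
    moreover have "mdiff K n (hK n (v + w)) + hK (n + 1) (mdiff K (n + 1) (v + w)) =
       (mdiff K n (hK n v) + hK (n + 1) (mdiff K (n + 1) v)) + (mdiff K n (hK n w) + hK (n + 1) (mdiff K (n + 1) w))"
      by (simp add: hlin ac_simps)
    ultimately show "mdiff K n (hK n (v + w)) + hK (n + 1) (mdiff K (n + 1) (v + w)) = v + w" by simp
  next
    fix c w assume "mdiff K n (hK n w) + hK (n + 1) (mdiff K (n + 1) w) = w"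
    moreover have "mdiff K n (hK n (fs c w)) + hK (n + 1) (mdiff K (n + 1) (fs c w)) =
       fs c (mdiff K n (hK n w) + hK (n + 1) (mdiff K (n + 1) w))"
      by (simp add: hlin)
    ultimately show "mdiff K n (hK n (fs c w)) + hK (n + 1) (mdiff K (n + 1) (fs c w)) = fs c w" by simp
  qed (simp add: hlin)
  show ?thesis
  proof (rule acyclic_modI)
    fix i w assume w: "w \<in> mgrade K (i + 1)" "mdiff K (i + 1) w = 0"
    then have "w = mdiff K i (hK i w)" using hd[OF w(1)] by (simp add: hlin)
    then show "\<exists>y\<in>mgrade K i. w = mdiff K i y" using hmem[OF w(1)] by blast
  qed
qed

text \<open>The components of \<open>A\<close> have countable spanning sets, so each component of
  \<open>N \<otimes> A\<close> is spanned by a family indexed by \<open>Bu\<close>, a degree and a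
  natural number, which is no larger than \<open>Bu\<close>.\<close>

lemma K_embed:
  assumes "locally_finite A"
  shows "\<exists>f g. (\<forall>i. Vector_Spaces.linear fs u (f i)) \<and> (\<forall>i. \<forall>w\<in>mgrade K i. g i (f i w) = w)"
proof -
  have "\<exists>e :: nat \<Rightarrow> 'a. range e \<subseteq> agrade A j \<and> agrade A j \<subseteq> R.V.span (range e)" for j
  proof -
    obtain B where B: "finite B" "B \<subseteq> agrade A j" "R.V.span B = agrade A j"
      using assms unfolding locally_finite_def by blast
    obtain n f where f: "B = f ` {i::nat. i < n}" using B(1) unfolding finite_conv_nat_seg_image by blast
    define e where "e k = (if k < n then f k else 0)" for k
    have e: "range e = insert 0 B"
      unfolding f by (auto simp: e_def image_iff intro: exI[of _ n])
    have "agrade A j \<subseteq> R.V.span (range e)" unfolding e using B(3) R.V.span_mono[of B "insert 0 B"] by blast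
    moreover have "range e \<subseteq> agrade A j" using e B(2) R.zero_mem by auto
    ultimately show ?thesis by blast
  qed
  then have "\<forall>j. \<exists>e :: nat \<Rightarrow> 'a. range e \<subseteq> agrade A j \<and> agrade A j \<subseteq> R.V.span (range e)" by blast
  from choice[OF this] obtain e :: "int \<Rightarrow> nat \<Rightarrow> 'a" where e: "\<And>j. range (e j) \<subseteq> agrade A j \<and> agrade A j \<subseteq> R.V.span (range (e j))" by blast
  have em: "e j k \<in> agrade A j" for j k using e[of j] by auto
  \<comment> \<open>Projecting \<open>'u\<close> onto each component of \<open>N\<close> lets the
    single set \<open>Bu\<close> parametrize spanning sets of all components.\<close>
  have "\<forall>i. \<exists>q. Vector_Spaces.linear u u q \<and> (\<forall>v\<in>mgrade N i. q v = v) \<and> (\<forall>v. q v \<in> mgrade N i)"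
  proof
    fix i
    have "U.subspace (mgrade N i)" using N.grade by simp
    from projection[OF this] show "\<exists>q. Vector_Spaces.linear u u q \<and> (\<forall>v\<in>mgrade N i. q v = v) \<and> (\<forall>v. q v \<in> mgrade N i)" by metis
  qed
  from choice[OF this] obtain q where q: "\<And>i. Vector_Spaces.linear u u (q i)" "\<And>i v. v \<in> mgrade N i \<Longrightarrow> q i v = v"
    "\<And>i v. q i v \<in> mgrade N i" by blast
  have "\<exists>fg. Vector_Spaces.linear fs u (fst fg) \<and> (\<forall>w\<in>mgrade K n. snd fg (fst fg w) = w)" for n
  proof -
    let ?pt = "\<lambda>(b, j, k). pt n j (q (n - j) b) (e j k)"
    let ?X = "?pt ` (Bu \<times> (UNIV :: (int \<times> nat) set))"
    have XK: "?X \<subseteq> mgrade K n" using q(3) em pt_mem by auto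
    have base: "pt n j (q (n - j) b) (e j k) \<in> F.span ?X" if "b \<in> Bu" for b j k
      using that by (intro F.span_base) (auto intro!: image_eqI[of _ _ "(b, j, k)"])
    have s1: "pt n j x (e j k) \<in> F.span ?X" if x: "x \<in> mgrade N (n - j)" for x j k
    proof -
      have "pt n j (q (n - j) y) (e j k) \<in> F.span ?X" if "y \<in> U.span Bu" for y
      proof -
        have ql: "q (n - j) (v + w) = q (n - j) v + q (n - j) w" "q (n - j) (u c v) = u c (q (n - j) v)" for v w c
          using q(1)[of "n - j"] by (auto simp: Vector_Spaces.linear_iff)
        have q0: "q (n - j) 0 = 0" using ql(1)[of 0 0] by simp
        show ?thesis
          using U.subspace_span_induct[OF that subset_UNIV U.subspace_UNIV, of "\<lambda>y. pt n j (q (n - j) y) (e j k) \<in> F.span ?X"]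
            base F.span_add F.span_scale F.span_zero
          by (simp add: ql q0 pt_add1[OF q(3) q(3) em] pt_scale1[OF q(3) em] em)
      qed
      from this[of x] show ?thesis using Bu q(2)[OF x] by simp
    qed
    have s2: "pt n j x a \<in> F.span ?X" if x: "x \<in> mgrade N (n - j)" and a: "a \<in> agrade A j" for x j a
    proof -
      have "a \<in> R.V.span (range (e j))" using a e by blast
      from R.V.subspace_span_induct[OF this _ R.grade, of j "\<lambda>a. pt n j x a \<in> F.span ?X"]
      show ?thesis
        using e[of j] s1[OF x] F.span_add F.span_scale F.span_zero x
        by (auto simp: pt_add2[OF x] pt_scale2[OF x])
    qed
    have KX: "mgrade K n \<subseteq> F.span ?X"
      unfolding K_grade by (rule F.span_minimal[OF _ F.subspace_span]) (use s2 in blast)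
    have "|UNIV :: (int \<times> nat) set| \<le>o |Bu|"
    proof -
      obtain c :: "nat \<Rightarrow> 'u" where c: "inj c" "range c \<subseteq> Bu" using infinite_Bu infinite_countable_subset by blast
      have "inj (\<lambda>(i, k). c (prod_encode (int_encode i, k)))"
        by (rule injI) (auto simp: inj_eq[OF c(1)] inj_eq[OF inj_int_encode])
      moreover have "(\<lambda>(i, k). c (prod_encode (int_encode i, k))) ` UNIV \<subseteq> Bu" using c(2) by auto
      ultimately show ?thesis using card_of_ordLeq by blast
    qed
    then have "|Bu \<times> (UNIV :: (int \<times> nat) set)| =o |Bu|"
      using card_of_Times_infinite[OF infinite_Bu, of "UNIV :: (int \<times> nat) set"] by simp
    then have card: "|?X| \<le>o |Bu|"
      using card_of_image ordLeq_ordIso_trans by blast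
    show ?thesis
    proof (rule embed[OF fs K_subspace XK KX card])
      fix f g assume "Vector_Spaces.linear fs u f" "\<And>v. v \<in> mgrade K n \<Longrightarrow> g (f v) = v"
      then show ?thesis by (intro exI[of _ "(f, g)"]) simp
    qed
  qed
  then have "\<forall>n. \<exists>fg. Vector_Spaces.linear fs u (fst fg) \<and> (\<forall>w\<in>mgrade K n. snd fg (fst fg w) = w)" by blast
  from choice[OF this] obtain fg where "\<And>n. Vector_Spaces.linear fs u (fst (fg n)) \<and> (\<forall>w\<in>mgrade K n. snd (fg n) (fst (fg n) w) = w)" by blast
  then show ?thesis by (intro exI[of _ "\<lambda>n. fst (fg n)"] exI[of _ "\<lambda>n. snd (fg n)"]) blast
qed

text \<open>The universal property of the free right extension: \<open>\<phi>\<close> extends by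
  \<open>x \<otimes> a \<mapsto> \<phi>(x) a\<close>.\<close>

lemma K_extend:
  assumes I: "dg_bimodule A I" "mscale I = u" and \<phi>: "chain_hom A m N I \<phi>"
  obtains \<Psi> where "chain_hom A m K I \<Psi>" "graded_hom (op_alg A) m (op_left K) (op_left I) \<Psi>"
    "\<And>n j x a. x \<in> mgrade N (n - j) \<Longrightarrow> a \<in> agrade A j \<Longrightarrow> \<Psi> n (pt n j x a) = ract I (n - j + m) j (\<phi> (n - j) x) a"
proof -
  interpret I: bimod A I by (rule bimodI[OF dga_axioms I(1)])
  interpret \<phi>: ghom A N I m \<phi> using \<phi> N.mod I.L.mod by (auto intro!: ghomI simp: chain_hom_def)
  have \<phi>d: "mdiff I (i + m) (\<phi> i x) = ksign m (\<phi> (i + 1) (mdiff N i x))" if "x \<in> mgrade N i" for i x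
    using \<phi> that by (simp add: chain_hom_def)
  have \<phi>s: "\<phi> i (u c x) = u c (\<phi> i x)" if "x \<in> mgrade N i" for i x c using \<phi>.scale[OF that] I(2) by simp
  have rs: "ract I i p (u c x) a = u c (ract I i p x a)" if "a \<in> agrade A p" "x \<in> mgrade I i" for i p c x a
    using I.r_scale[OF that] I(2) by simp
  have rs2: "ract I i p x (ascale A c a) = u c (ract I i p x a)" if "a \<in> agrade A p" "x \<in> mgrade I i" for i p c x a
    using I.r_scale2[OF that] I(2) by simp
  define P where "P n j x a = ract I (n - j + m) j (\<phi> (n - j) x) a" for n j x a
  have Pm: "P n j x a \<in> mgrade I (n + m)" if "x \<in> mgrade N (n - j)" "a \<in> agrade A j" for n j x a
    using that by (simp add: P_def)
  \<comment> \<open>\<open>y\<close> corresponds to \<open>w\<close> if each functional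
    \<open>\<mu>\<close> takes on \<open>y\<close> the value of \<open>w\<close> at the family of
    forms \<open>\<mu> (\<phi>(x) a)\<close>. Since functionals separate points, this determines
    \<open>y\<close> independently of any expansion of \<open>w\<close> into elementary
    tensors.\<close>
  define R where "R n w y \<longleftrightarrow> (\<forall>\<mu>. Vector_Spaces.linear u (*) \<mu> \<longrightarrow> \<mu> y = w (\<lambda>j x a. \<mu> (P n j x a)))" for n w y
  have R_uniq: "y = z" if "R n w y" "R n w z" for n w y z
    using that by (intro U.functionals_separate) (auto simp: R_def)
  have \<mu>l: "\<mu> (x + y) = \<mu> x + \<mu> y" "\<mu> (u c x) = c * \<mu> x" "\<mu> 0 = 0"
    if "Vector_Spaces.linear u (*) \<mu>" for \<mu> :: "'u \<Rightarrow> 'k" and x y c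
  proof -
    show "\<mu> (x + y) = \<mu> x + \<mu> y" "\<mu> (u c x) = c * \<mu> x" for x y c using that by (auto simp: Vector_Spaces.linear_iff)
    from this(2)[of 0 0] show "\<mu> 0 = 0" by simp
  qed
  have R_pt: "R n (pt n j x a) (P n j x a)" if x: "x \<in> mgrade N (n - j)" and a: "a \<in> agrade A j" for n j x a
    unfolding R_def
  proof (intro allI impI)
    fix \<mu> assume \<mu>: "Vector_Spaces.linear u (*) \<mu>"
    have "bil n (\<lambda>j x a. \<mu> (P n j x a))"
      by (rule bilI) (simp_all add: P_def \<mu>l[OF \<mu>] \<phi>s rs I(2))
    then show "\<mu> (P n j x a) = pt n j x a (\<lambda>j x a. \<mu> (P n j x a))" by (simp add: pt_def)
  qed
  have R_0: "R n 0 0" for n by (simp add: R_def \<mu>l zero_fun_apply)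
  have R_add: "R n (v + w) (y + z)" if "R n v y" "R n w z" for n v w y z
    using that by (simp add: R_def \<mu>l plus_fun_apply)
  have R_scale: "R n (fs c w) (u c y)" if "R n w y" for n w y c
    using that by (simp add: R_def \<mu>l fs_def)
  have gs: "u c y \<in> mgrade I i" if "y \<in> mgrade I i" for c y i using I.L.scale_mem[OF that] I(2) by simp
  have ex: "\<exists>y\<in>mgrade I (n + m). R n w y" if "w \<in> mgrade K n" for n w
    using that
  proof (rule K_induct)
    show "\<exists>y\<in>mgrade I (n + m). R n 0 y" using R_0 by (intro bexI[of _ 0]) auto
    show "\<exists>y\<in>mgrade I (n + m). R n (pt n j x a) y" if "x \<in> mgrade N (n - j)" "a \<in> agrade A j" for j x a
      using R_pt[OF that] Pm[OF that] by blast
    show "\<exists>y\<in>mgrade I (n + m). R n (v + w) y" if "\<exists>y\<in>mgrade I (n + m). R n v y" "\<exists>y\<in>mgrade I (n + m). R n w y" for v w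
      using that R_add I.L.add_mem by blast
    show "\<exists>y\<in>mgrade I (n + m). R n (fs c w) y" if "\<exists>y\<in>mgrade I (n + m). R n w y" for c w
      using that R_scale gs by blast
  qed
  define \<Psi> where "\<Psi> n w = (THE y. R n w y)" for n w
  have \<Psi>_eq: "\<Psi> n w = y" if "R n w y" for n w y
    unfolding \<Psi>_def using that R_uniq by (intro the_equality) auto
  have \<Psi>R: "R n w (\<Psi> n w)" "\<Psi> n w \<in> mgrade I (n + m)" if w: "w \<in> mgrade K n" for n w
    using ex[OF w] \<Psi>_eq by auto
  have \<Psi>pt: "\<Psi> n (pt n j x a) = P n j x a" if "x \<in> mgrade N (n - j)" "a \<in> agrade A j" for n j x a
    by (rule \<Psi>_eq[OF R_pt[OF that]])
  have \<Psi>0: "\<Psi> n 0 = 0" for n by (rule \<Psi>_eq[OF R_0])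
  have \<Psi>add: "\<Psi> n (v + w) = \<Psi> n v + \<Psi> n w" if "v \<in> mgrade K n" "w \<in> mgrade K n" for n v w
    by (rule \<Psi>_eq[OF R_add]) (use that \<Psi>R in auto)
  have \<Psi>scale: "\<Psi> n (fs c w) = u c (\<Psi> n w)" if "w \<in> mgrade K n" for n c w
    by (rule \<Psi>_eq[OF R_scale]) (use that \<Psi>R in auto)
  have \<Psi>k: "\<Psi> n (ksign l w) = ksign l (\<Psi> n w)" if "w \<in> mgrade K n" for n l w
    using \<Psi>scale[OF that, of "-1"] by (simp add: ksign_def F.scale_minus_left U.scale_minus_left)
  have ind: "Q w" if w: "w \<in> mgrade K n" and p: "\<And>j x a. x \<in> mgrade N (n - j) \<Longrightarrow> a \<in> agrade A j \<Longrightarrow> Q (pt n j x a)"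
    "Q 0" "\<And>v w. v \<in> mgrade K n \<Longrightarrow> w \<in> mgrade K n \<Longrightarrow> Q v \<Longrightarrow> Q w \<Longrightarrow> Q (v + w)"
    "\<And>c w. w \<in> mgrade K n \<Longrightarrow> Q w \<Longrightarrow> Q (fs c w)" for Q n w
  proof -
    have "w \<in> mgrade K n \<and> Q w"
      by (rule F.subspace_span_induct[OF w[unfolded K_grade] _ K_subspace]) (use p pt_mem in auto)
    then show ?thesis by blast
  qed
  show thesis
  proof (rule that[of \<Psi>])
    show "\<Psi> n (pt n j x a) = ract I (n - j + m) j (\<phi> (n - j) x) a" if "x \<in> mgrade N (n - j)" "a \<in> agrade A j" for n j x a
      using \<Psi>pt[OF that] by (simp add: P_def)
    have left: "graded_hom A m K I \<Psi>"
    proof (rule graded_homI)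
      fix p i b w assume b: "b \<in> agrade A p" and w: "w \<in> mgrade K i"
      show "\<Psi> (p + i) (lact K p i b w) = ksign (m * p) (lact I p (i + m) b (\<Psi> i w))"
        using w
      proof (rule ind)
        fix j x a assume x: "x \<in> mgrade N (i - j)" and a: "a \<in> agrade A j"
        have e: "p + i - j = p + (i - j)" "p + (i - j) + m = p + (i - j + m)" "i - j + m + j = i + m" by simp_all
        have m1: "lact N p (i - j) b x \<in> mgrade N (p + i - j)" using b x by simp
        have m2: "\<phi> (i - j) x \<in> mgrade I (i - j + m)" using x by simp
        show "\<Psi> (p + i) (lact K p i b (pt i j x a)) = ksign (m * p) (lact I p (i + m) b (\<Psi> i (pt i j x a)))"
          unfolding K_l[OF b] \<Psi>pt[OF m1 a] \<Psi>pt[OF x a] P_def e \<phi>.act[OF b x]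
          using I.lr[OF b a m2] I.r_ksign[OF a, of "lact I p (i - j + m) b (\<phi> (i - j) x)" "p + (i - j + m)"] b m2
          by (simp only: e I.L.act_mem[OF b m2 refl])
      next
        fix v w assume "v \<in> mgrade K i" "w \<in> mgrade K i"
         "\<Psi> (p + i) (lact K p i b v) = ksign (m * p) (lact I p (i + m) b (\<Psi> i v))"
         "\<Psi> (p + i) (lact K p i b w) = ksign (m * p) (lact I p (i + m) b (\<Psi> i w))"
        then show "\<Psi> (p + i) (lact K p i b (v + w)) = ksign (m * p) (lact I p (i + m) b (\<Psi> i (v + w)))"
          using b by (simp add: \<Psi>add K_l_mem \<Psi>R ksign_add)
      next
        fix c w assume "w \<in> mgrade K i" "\<Psi> (p + i) (lact K p i b w) = ksign (m * p) (lact I p (i + m) b (\<Psi> i w))"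
        then show "\<Psi> (p + i) (lact K p i b (fs c w)) = ksign (m * p) (lact I p (i + m) b (\<Psi> i (fs c w)))"
          using b I.L.act_scale[OF b \<Psi>R(2), of w i c] I(2) by (simp add: \<Psi>scale K_l_mem \<Psi>R U.scale_ksign)
      qed (use b in \<open>simp add: \<Psi>0\<close>)
    qed (simp_all add: \<Psi>R \<Psi>add \<Psi>scale I(2))
    show "graded_hom (op_alg A) m (op_left K) (op_left I) \<Psi>"
    proof (rule graded_homI, unfold I.op_sel)
      fix p i b w assume b: "b \<in> agrade A p" and w: "w \<in> mgrade (op_left K) i"
      have w: "w \<in> mgrade K i" using w by (simp add: op_left_def)
      have "\<Psi> (i + p) (ract K i p w b) = ract I (i + m) p (\<Psi> i w) b"
        using w
      proof (rule ind)
        fix j x a assume x: "x \<in> mgrade N (i - j)" and a: "a \<in> agrade A j"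
        have e: "i - j + m + j = i + m" "i + p - (j + p) = i - j" by simp_all
        have x': "x \<in> mgrade N (i + p - (j + p))" using x by simp
        have ab: "amult A j p a b \<in> agrade A (j + p)" using a b by simp
        have m2: "\<phi> (i - j) x \<in> mgrade I (i - j + m)" using x by simp
        show "\<Psi> (i + p) (ract K i p (pt i j x a) b) = ract I (i + m) p (\<Psi> i (pt i j x a)) b"
          unfolding K_r[OF b] \<Psi>pt[OF x' ab] \<Psi>pt[OF x a] P_def e
          using I.r_assoc[OF a b m2] by (simp only: e)
      next
        fix v w assume "v \<in> mgrade K i" "w \<in> mgrade K i"
         "\<Psi> (i + p) (ract K i p v b) = ract I (i + m) p (\<Psi> i v) b"
         "\<Psi> (i + p) (ract K i p w b) = ract I (i + m) p (\<Psi> i w) b"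
        then show "\<Psi> (i + p) (ract K i p (v + w) b) = ract I (i + m) p (\<Psi> i (v + w)) b"
          using b by (simp add: \<Psi>add K_r_mem \<Psi>R)
      next
        fix c w assume "w \<in> mgrade K i" "\<Psi> (i + p) (ract K i p w b) = ract I (i + m) p (\<Psi> i w) b"
        then show "\<Psi> (i + p) (ract K i p (fs c w) b) = ract I (i + m) p (\<Psi> i (fs c w)) b"
          using b rs[OF b \<Psi>R(2)] by (simp add: \<Psi>scale K_r_mem \<Psi>R)
      qed (use b in \<open>simp add: \<Psi>0\<close>)
      then show "\<Psi> (p + i) (lact (op_left K) p i b w) = ksign (m * p) (ksign (p * (i + m)) (ract I (i + m) p (\<Psi> i w) b))"
        using \<Psi>k[OF K_r_mem[OF b w]] by (simp add: op_left_def add.commute)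
          (cases "even m"; cases "even p"; cases "even i"; simp add: ksign_if)
    qed (simp_all add: op_left_def \<Psi>R \<Psi>add \<Psi>scale I(2))
    show "chain_hom A m K I \<Psi>"
      unfolding chain_hom_def
    proof (intro conjI left allI ballI)
      fix i w assume w: "w \<in> mgrade K i"
      show "mdiff I (i + m) (\<Psi> i w) = ksign m (\<Psi> (i + 1) (mdiff K i w))"
        using w
      proof (rule ind)
        fix j x a assume x: "x \<in> mgrade N (i - j)" and a: "a \<in> agrade A j"
        have e: "i - j + m + j = i + m" "i + 1 - j = i - j + 1" "i + 1 - (j + 1) = i - j" "i - j + 1 + m = i - j + m + 1" by simp_all
        have m1: "mdiff N (i - j) x \<in> mgrade N (i + 1 - j)" using x by simp
        have m2: "x \<in> mgrade N (i + 1 - (j + 1))" using x by simp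
        have da: "adiff A j a \<in> agrade A (j + 1)" using a by simp
        have m3: "\<phi> (i - j) x \<in> mgrade I (i - j + m)" using x by simp
        have m4: "\<phi> (i - j + 1) (mdiff N (i - j) x) \<in> mgrade I (i - j + m + 1)" using x by simp
        have "\<Psi> (i + 1) (mdiff K i (pt i j x a)) =
           ract I (i - j + m + 1) j (\<phi> (i - j + 1) (mdiff N (i - j) x)) a + ksign (i - j) (ract I (i - j + m) (j + 1) (\<phi> (i - j) x) (adiff A j a))"
          unfolding K_d using pt_mem[OF m1 a] pt_mem[OF m2 da] \<Psi>k[OF pt_mem[OF m2 da]] F.subspace_ksign[OF K_subspace pt_mem[OF m2 da]]
          by (subst \<Psi>add) (simp_all add: \<Psi>pt[OF m1 a] \<Psi>pt[OF m2 da] P_def e)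
        moreover have "mdiff I (i + m) (\<Psi> i (pt i j x a)) =
          ksign m (ract I (i - j + m + 1) j (\<phi> (i - j + 1) (mdiff N (i - j) x)) a) + ksign (i - j + m) (ract I (i - j + m) (j + 1) (\<phi> (i - j) x) (adiff A j a))"
          using I.r_leibniz[OF a m3] \<phi>d[OF x] I.r_ksign[OF a m4] unfolding \<Psi>pt[OF x a] P_def by (simp add: e)
        ultimately show "mdiff I (i + m) (\<Psi> i (pt i j x a)) = ksign m (\<Psi> (i + 1) (mdiff K i (pt i j x a)))"
          by (simp add: ksign_add add.commute)
      next
        fix v w assume "v \<in> mgrade K i" "w \<in> mgrade K i"
         "mdiff I (i + m) (\<Psi> i v) = ksign m (\<Psi> (i + 1) (mdiff K i v))"
         "mdiff I (i + m) (\<Psi> i w) = ksign m (\<Psi> (i + 1) (mdiff K i w))"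
        then show "mdiff I (i + m) (\<Psi> i (v + w)) = ksign m (\<Psi> (i + 1) (mdiff K i (v + w)))"
          by (simp add: \<Psi>add \<Psi>R K_d_mem ksign_add)
      next
        fix c w assume "w \<in> mgrade K i" "mdiff I (i + m) (\<Psi> i w) = ksign m (\<Psi> (i + 1) (mdiff K i w))"
        then show "mdiff I (i + m) (\<Psi> i (fs c w)) = ksign m (\<Psi> (i + 1) (mdiff K i (fs c w)))"
          using I.L.d_scale[OF \<Psi>R(2), of w i c] I(2) by (simp add: \<Psi>scale \<Psi>R K_d_mem U.scale_ksign)
      qed (simp add: \<Psi>0)
    qed
  qed
qed

end

lemma semi_injective_bimodule_kinj:
  fixes A :: "('k::field, 'a::ab_group_add) dg_alg" and u :: "'k \<Rightarrow> 'u::ab_group_add \<Rightarrow> 'u"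
  assumes A: "dgu A u" and lf: "locally_finite A" and I: "semi_injective_bimodule u A I"
  shows "kinj u A I"
  unfolding kinj_def
proof (intro ballI impI allI)
  fix N n \<phi> assume N: "N \<in> dg_modules u A" and ac: "acyclic_mod N" and \<phi>: "chain_hom A (n + 1) N I \<phi>"
  interpret dgu A u by fact
  interpret tens A u N using N by unfold_locales (auto simp: dg_modules_def)
  have Ib: "dg_bimodule A I" "mscale I = u" using I by (auto simp: semi_injective_bimodule_def dg_bimodules_def)
  interpret I: bimod A I by (rule bimodI[OF dga_axioms Ib(1)])
  interpret \<phi>: ghom A N I "n + 1" \<phi> using \<phi> N.mod I.L.mod by (auto intro!: ghomI simp: chain_hom_def)
  obtain f g where fg0: "\<forall>i. Vector_Spaces.linear fs u (f i)" "\<forall>i. \<forall>w\<in>mgrade K i. g i (f i w) = w"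
    using K_embed[OF lf] by blast
  have f: "\<And>i. Vector_Spaces.linear (mscale K) u (f i)" and g: "\<And>i w. w \<in> mgrade K i \<Longrightarrow> g i (f i w) = w"
    using fg0 by simp_all
  define T where "T = transport u f g K"
  note tr = transport_bi[where f = f and g = g, OF K_bi f g dga_axioms]
  have Tb: "dg_bimodule A T" using tr(1) by (simp add: T_def)
  have T: "T \<in> dg_bimodules u A" using Tb by (simp add: dg_bimodules_def T_def transport_def)
  have fT: "dg_hom A K T f" and gT: "dg_hom A T K g" and gTo: "dg_hom (op_alg A) (op_left T) (op_left K) g"
    using tr(2,3) by (auto simp: dg_bihom_def T_def)
  interpret T: bimod A T by (rule bimodI[OF dga_axioms Tb])
  interpret f: dghom A K T f by (rule dghomI[OF K_left T.L.mod fT])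
  interpret g: dghom A T K g by (rule dghomI[OF T.L.mod K_left gT])
  have fg: "f i (g i w) = w" if "w \<in> mgrade T i" for i w
    using that g by (auto simp: T_def transport_def)
  have Tac: "acyclic_mod T"
  proof (rule acyclic_modI)
    fix i w assume w: "w \<in> mgrade T (i + 1)" "mdiff T (i + 1) w = 0"
    have "mdiff K (i + 1) (g (i + 1) w) = 0" using g.comm[OF w(1) refl] w(2) by simp
    then obtain y where y: "y \<in> mgrade K i" "g (i + 1) w = mdiff K i y"
      using acyclic_modD[OF K_acyclic[OF ac] g.mem0[OF w(1)] refl] by metis
    have "w = mdiff T i (f i y)" using fg[OF w(1)] f.comm[OF y(1) refl] y(2) by simp
    then show "\<exists>y\<in>mgrade T i. w = mdiff T i y" using f.mem0[OF y(1)] by blast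
  qed
  obtain \<Psi> where \<Psi>: "chain_hom A (n + 1) K I \<Psi>" "graded_hom (op_alg A) (n + 1) (op_left K) (op_left I) \<Psi>"
    and \<Psi>pt: "\<And>m j x a. x \<in> mgrade N (m - j) \<Longrightarrow> a \<in> agrade A j \<Longrightarrow>
      \<Psi> m (pt m j x a) = ract I (m - j + (n + 1)) j (\<phi> (m - j) x) a"
    using K_extend[OF Ib \<phi>] by metis
  have opl: "left_dg_module (op_alg A) (op_left T)" "left_dg_module (op_alg A) (op_left K)" "left_dg_module (op_alg A) (op_left I)"
    using T.rmod K_right I.rmod by (auto simp: right_dg_module_def)
  have c1: "chain_hom A (n + 1) T I (\<lambda>i w. \<Psi> i (g i w))"
    using graded_hom_comp[OF T.L.mod K_left I.L.mod g.hom] \<Psi>(1) g.comm by (simp add: chain_hom_def)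
  have c2: "graded_hom (op_alg A) (n + 1) (op_left T) (op_left I) (\<lambda>i w. \<Psi> i (g i w))"
    using graded_hom_comp[OF opl dg_homD(1)[OF gTo] \<Psi>(2)] by simp
  obtain h where h: "graded_hom A n T I h"
    and he: "\<And>i w. w \<in> mgrade T i \<Longrightarrow> \<Psi> i (g i w) = mdiff I (i + n) (h i w) - ksign n (h (i + 1) (mdiff T i w))"
    using semi_injective_bimodule_null[OF A I T Tac c1 c2] by (auto simp: null_hom_def)
  \<comment> \<open>The inclusion \<open>x \<mapsto> x \<otimes> 1\<close> of left modules. The
    extension of \<open>\<phi>\<close> restricts to \<open>\<phi>\<close> along it, and so does a
    nullhomotopy of the extension to one of \<open>\<phi>\<close>.\<close>
  have inj: "graded_hom A 0 N K (\<lambda>i x. pt i 0 x (aunit A))"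
    by (rule graded_homI) (simp_all add: pt_mem pt_add1 pt_scale1 K_l)
  have dj: "mdiff K i (pt i 0 x (aunit A)) = pt (i + 1) 0 (mdiff N i x) (aunit A)" if "x \<in> mgrade N i" for i x
    using that by (simp add: K_d)
  show "null_hom A n N I \<phi>"
    unfolding null_hom_def
  proof (intro exI conjI allI ballI)
    show "graded_hom A n N I (\<lambda>i x. h i (f i (pt i 0 x (aunit A))))"
      using graded_hom_comp[OF N.mod T.L.mod I.L.mod graded_hom_comp[OF N.mod K_left T.L.mod inj f.hom] h] by simp
    fix i x assume x: "x \<in> mgrade N i"
    have m: "pt i 0 x (aunit A) \<in> mgrade K i" using x by (intro pt_mem) simp_all
    show "\<phi> i x = mdiff I (i + n) (h i (f i (pt i 0 x (aunit A)))) -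
        ksign n (h (i + 1) (f (i + 1) (pt (i + 1) 0 (mdiff N i x) (aunit A))))"
      using he[OF f.mem0[OF m]] x \<Psi>pt[of x i 0 "aunit A"] g[OF m] f.comm[OF m refl] by (simp add: dj)
  qed
qed

section \<open>Duality\<close>

lemma hom_sel: "mscale (hom_complex A M N) = (\<lambda>c f i m. mscale N c (f i m))"
  "f \<in> mgrade (hom_complex A M N) n \<longleftrightarrow> graded_hom A n M N f \<and> (\<forall>i m. m \<notin> mgrade M i \<longrightarrow> f i m = 0)"
  "mdiff (hom_complex A M N) n f i m = (if m \<in> mgrade M i
                 then mdiff N (i + n) (f i m) - ksign n (f (i + 1) (mdiff M i m)) else 0)"
  "ract (hom_complex A M N) n p f a i m = (if m \<in> mgrade M i
                then ksign (p * i) (ract N (i + n) p (f i m) a) else 0)"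
  by (auto simp: hom_complex_def)

lemma graded_hom_cong:
  assumes "left_dg_module A M" "graded_hom A n M N f" "\<And>i x. x \<in> mgrade M i \<Longrightarrow> g i x = f i x"
  shows "graded_hom A n M N g"
proof -
  interpret lmod A M by unfold_locales fact
  show ?thesis
    using assms(2,3) unfolding graded_hom_def k_linear_def by simp
qed

lemma dg_hom_comp:
  assumes "left_dg_module A L" "left_dg_module A M" "left_dg_module A N" "dg_hom A L M f" "dg_hom A M N g"
  shows "dg_hom A L N (\<lambda>i x. g i (f i x))"
proof -
  interpret f: dghom A L M f using assms by (intro dghomI)
  interpret g: dghom A M N g using assms by (intro dghomI)
  show ?thesis
    using graded_hom_comp[OF assms(1-3) f.hom g.hom] by (auto simp: dg_hom_def f.comm g.comm)
qed

lemma op_left_sel: "mscale (op_left M) = mscale M" "mgrade (op_left M) = mgrade M" "mdiff (op_left M) = mdiff M"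
    "lact (op_left M) p i a m = ksign (p * i) (ract M i p m a)" "agrade (op_alg A) = agrade A"
  by (simp_all add: op_left_def op_alg_def)

text \<open>A map of degree 0 respects the right action if and only if it respects the signed left
  action of the opposite algebra, since the sign depends on degrees alone.\<close>

lemma dg_hom_opI:
  assumes "\<And>i x. x \<in> mgrade M i \<Longrightarrow> f i x \<in> mgrade N i"
    and "\<And>i x y. x \<in> mgrade M i \<Longrightarrow> y \<in> mgrade M i \<Longrightarrow> f i (x + y) = f i x + f i y"
    and "\<And>i c x. x \<in> mgrade M i \<Longrightarrow> f i (mscale M c x) = mscale N c (f i x)"
    and "\<And>p i a x. a \<in> agrade A p \<Longrightarrow> x \<in> mgrade M i \<Longrightarrow> f (i + p) (ract M i p x a) = ract N i p (f i x) a"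
    and "\<And>i x. x \<in> mgrade M i \<Longrightarrow> f (i + 1) (mdiff M i x) = mdiff N i (f i x)"
    and M: "dga A" "right_dg_module A M"
  shows "dg_hom (op_alg A) (op_left M) (op_left N) f"
proof -
  interpret rmod A M using M by (simp add: rmod_def rmod_axioms_def)
  interpret L: lmod "op_alg A" "op_left M" by (rule op_lmod)
  have neg: "f i (- x) = - f i x" if x: "x \<in> mgrade M i" for i x
  proof -
    have x': "- x \<in> mgrade M i" using L.neg_mem x by (simp add: op_left_sel)
    have z: "0 \<in> mgrade M i" using L.zero_mem by (simp add: op_left_sel)
    show ?thesis using assms(2)[OF x x'] assms(2)[OF z z] by (simp add: eq_neg_iff_add_eq_0 add.commute)
  qed
  have k: "f (p + i) (ksign n (ract M i p x a)) = ksign n (f (i + p) (ract M i p x a))"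
    if "a \<in> agrade A p" "x \<in> mgrade M i" for a p x i n
  proof -
    have "ract M i p x a \<in> mgrade M (p + i)" using that by (simp add: add.commute)
    then show ?thesis by (simp add: ksign_def neg add.commute)
  qed
  show ?thesis
    by (rule dg_homI[OF graded_homI]) (use assms in \<open>simp_all add: op_left_sel k\<close>)
qed

context dga
begin

lemma torsion_graded_hom:
  assumes "left_dg_module A M" "left_dg_module A N" "graded_hom A n M N f"
  shows "graded_hom A n (torsion A M) (torsion A N) f"
proof -
  interpret f: ghom A M N n f using assms by (intro ghomI)
  show ?thesis
  proof (rule graded_homI)
    fix i x assume "x \<in> mgrade (torsion A M) i"
    then obtain k where k: "x \<in> mgrade M i" "\<forall>p\<ge>k. \<forall>a\<in>agrade A p. lact M p i a x = 0" by (rule torsionE)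
    show "f i x \<in> mgrade (torsion A N) (i + n)"
    proof (rule torsionI[of _ _ _ k])
      fix p a assume a: "k \<le> p" "a \<in> agrade A p"
      have "f (p + i) (lact M p i a x) = 0" using k a by simp
      then show "lact N p (i + n) a (f i x) = 0" using f.act[OF a(2) k(1)] by simp
    qed (use k in simp)
  qed (simp_all add: torsion_sub f.act)
qed

lemma torsion_dg_hom:
  assumes "left_dg_module A M" "left_dg_module A N" "dg_hom A M N f"
  shows "dg_hom A (torsion A M) (torsion A N) f"
  using torsion_graded_hom[OF assms(1,2), of 0 f] assms(3) by (simp add: dg_hom_def torsion_sub)

text \<open>Torsion need not preserve quasi-isomorphisms, but a homotopy consists of module
  homomorphisms and so restricts to torsion submodules. This is how \<open>T\<close> and
  \<open>J\<close> are compared after taking torsion.\<close>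

lemma torsion_homotopic:
  assumes "left_dg_module A M" "left_dg_module A N" "homotopic_homs A M N f g"
  shows "homotopic_homs A (torsion A M) (torsion A N) f g"
proof -
  obtain h where "graded_hom A (-1) M N h"
   "\<forall>i. \<forall>m\<in>mgrade M i. f i m - g i m = mdiff N (i - 1) (h i m) + h (i + 1) (mdiff M i m)"
    using assms(3) by (auto simp: homotopic_homs_def)
  then show ?thesis
    unfolding homotopic_homs_def using torsion_graded_hom[OF assms(1,2)]
    by (intro exI[of _ h]) (auto simp: torsion_sub)
qed

lemma hom_complex_right:
  assumes P: "left_dg_module A P" and D: "dg_bimodule A D"
  shows "right_dg_module A (hom_complex A P D)"
proof -
  interpret P: lmod A P by unfold_locales fact
  interpret D: bimod A D by (rule bimodI[OF dga_axioms D])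
  let ?H = "hom_complex A P D"
  have vs: "vector_space (\<lambda>c f (i::int) m. mscale D c (f i m))"
    by unfold_locales (auto simp: fun_eq_iff D.L.V.scale_right_distrib D.L.V.scale_left_distrib)
  interpret V: vector_space "\<lambda>c f (i::int) m. mscale D c (f i m)" by (rule vs)
  have gh: "ghom A P D n f" if "f \<in> mgrade ?H n" for n f
    using that by (intro ghomI P D.L.mod) (simp add: hom_sel)
  have kf: "ksign n g i m = ksign n (g i m)" for n i m and g :: "int \<Rightarrow> _ \<Rightarrow> _" by (simp add: ksign_def)
  show ?thesis
  proof (rule right_dg_moduleI, unfold hom_sel(1))
    show "V.subspace (mgrade ?H i)" for i
    proof (rule V.subspaceI)
      show "0 \<in> mgrade ?H i" unfolding hom_sel by (intro conjI graded_homI) auto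
      show "f + g \<in> mgrade ?H i" if fg: "f \<in> mgrade ?H i" "g \<in> mgrade ?H i" for f g
        using graded_hom_add[OF D.L.mod, of i P f g] fg unfolding hom_sel by (auto simp: plus_fun_def)
      show "(\<lambda>j m. mscale D c (f j m)) \<in> mgrade ?H i" if f: "f \<in> mgrade ?H i" for c f
      proof -
        interpret f: ghom A P D i f by (rule gh[OF f])
        show ?thesis using f unfolding hom_sel
          by (auto intro!: graded_homI simp: f.act D.L.V.scale_right_distrib D.L.V.scale_ksign D.L.V.scale_left_commute)
      qed
    qed
    fix n f assume f0: "f \<in> mgrade ?H n"
    interpret f: ghom A P D n f by (rule gh[OF f0])
    have hd: "mdiff ?H n f i m = hom_d P D n f i m" if "m \<in> mgrade P i" for i m using that by (simp add: hom_sel hom_d_def)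
    show df: "mdiff ?H n f \<in> mgrade ?H (n + 1)"
      unfolding hom_sel(2)
    proof (intro conjI allI impI)
      show "graded_hom A (n + 1) P D (mdiff ?H n f)" by (rule graded_hom_cong[OF P f.graded_hom_d[OF dga_axioms] hd])
    qed (simp add: hom_sel(3))
    show "mdiff ?H (n + 1) (mdiff ?H n f) = 0"
    proof (intro ext)
      fix i m
      show "mdiff ?H (n + 1) (mdiff ?H n f) i m = 0 i m"
        using f.hom_d_hom_d[of m i] hd[of m i] hd[of "mdiff P i m" "i + 1"]
        by (cases "m \<in> mgrade P i") (simp_all add: hom_sel(3)[of A P D "n + 1"] hom_d_def[of _ _ "n + 1"])
    qed
    show "mdiff ?H n (f + g) = mdiff ?H n f + mdiff ?H n g" if "g \<in> mgrade ?H n" for g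
    proof -
      interpret g: ghom A P D n g by (rule gh[OF that])
      show ?thesis by (simp add: fun_eq_iff hom_sel ksign_add)
    qed
    show "mdiff ?H n (\<lambda>i m. mscale D c (f i m)) = (\<lambda>i m. mscale D c (mdiff ?H n f i m))" for c
      by (simp add: fun_eq_iff hom_sel D.L.V.scale_right_diff_distrib D.L.V.scale_ksign)
    fix p a assume a: "a \<in> agrade A p"
    \<comment> \<open>The sign \<open>(-1)^(|a||m|)\<close> in the action is what makes
      \<open>f a\<close> left linear of degree \<open>|f| + |a|\<close>.\<close>
    show "ract ?H n p f a \<in> mgrade ?H (n + p)"
    proof -
      have "graded_hom A (n + p) P D (\<lambda>i m. ksign (p * i) (ract D (i + n) p (f i m) a))"
      proof (rule graded_homI)
        fix q i b m assume b: "b \<in> agrade A q" and m: "m \<in> mgrade P i"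
        have e: "q + i + n = q + (i + n)" "i + (n + p) = i + n + p" by simp_all
        have x: "f i m \<in> mgrade D (i + n)" using m by simp
        have y: "lact D q (i + n) b (f i m) \<in> mgrade D (q + (i + n))" by (rule D.L.act_mem[OF b x refl])
        have z: "ract D (i + n) p (f i m) a \<in> mgrade D (i + n + p)" by (rule D.r_mem[OF a x refl])
        have w: "lact D q (i + n + p) b (ksign (p * i) (ract D (i + n) p (f i m) a)) =
            ksign (p * i) (lact D q (i + n + p) b (ract D (i + n) p (f i m) a))"
          by (rule D.L.act_ksign[OF b z])
        show "ksign (p * (q + i)) (ract D (q + i + n) p (f (q + i) (lact P q i b m)) a) =
          ksign ((n + p) * q) (lact D q (i + (n + p)) b (ksign (p * i) (ract D (i + n) p (f i m) a)))"
          unfolding f.act[OF b m] e D.r_ksign[OF a y] D.lr[OF b a x] w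
          by (cases "even n"; cases "even p"; cases "even q"; simp add: ksign_if)
      next
        fix i m m' assume "m \<in> mgrade P i" "m' \<in> mgrade P i"
        then show "ksign (p * i) (ract D (i + n) p (f i (m + m')) a) =
           ksign (p * i) (ract D (i + n) p (f i m) a) + ksign (p * i) (ract D (i + n) p (f i m') a)"
          using a by (simp add: ksign_add)
      next
        fix i c m assume "m \<in> mgrade P i"
        then show "ksign (p * i) (ract D (i + n) p (f i (mscale P c m)) a) =
           mscale D c (ksign (p * i) (ract D (i + n) p (f i m) a))"
          using a by (simp add: D.L.V.scale_ksign)
      qed (use a in simp_all)
      then have "graded_hom A (n + p) P D (ract ?H n p f a)"
        by (rule graded_hom_cong[OF P]) (simp add: hom_sel(4))
      then show ?thesis unfolding hom_sel(2) by (simp add: hom_sel(4))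
    qed
    show "ract ?H n p (f + g) a = ract ?H n p f a + ract ?H n p g a" if "g \<in> mgrade ?H n" for g
    proof -
      interpret g: ghom A P D n g by (rule gh[OF that])
      show ?thesis using a by (simp add: fun_eq_iff hom_sel ksign_add)
    qed
    show "ract ?H n p (\<lambda>i m. mscale D c (f i m)) a = (\<lambda>i m. mscale D c (ract ?H n p f a i m))" for c
      using a by (simp add: fun_eq_iff hom_sel D.L.V.scale_ksign)
    show "ract ?H n p f (a + b) = ract ?H n p f a + ract ?H n p f b" if "b \<in> agrade A p" for b
      using a that by (simp add: fun_eq_iff hom_sel ksign_add)
    show "ract ?H n p f (ascale A c a) = (\<lambda>i m. mscale D c (ract ?H n p f a i m))" for c
      using a by (simp add: fun_eq_iff hom_sel D.L.V.scale_ksign)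
    show "ract ?H n (p + q) f (amult A p q a b) = ract ?H (n + p) q (ract ?H n p f a) b" if b: "b \<in> agrade A q" for q b
    proof (intro ext)
      fix i m
      show "ract ?H n (p + q) f (amult A p q a b) i m = ract ?H (n + p) q (ract ?H n p f a) b i m"
      proof (cases "m \<in> mgrade P i")
        case True
        have x: "f i m \<in> mgrade D (i + n)" using True by simp
        have z: "ract D (i + n) p (f i m) a \<in> mgrade D (i + n + p)" by (rule D.r_mem[OF a x refl])
        have e: "i + (n + p) = i + n + p" "(p + q) * i = q * i + p * i" by (simp_all add: algebra_simps)
        show ?thesis
          unfolding hom_sel(4) if_P[OF True] e D.r_ksign[OF b z] D.r_assoc[OF a b x] by simp
      qed (simp add: hom_sel)
    qed
    show "mdiff ?H (n + p) (ract ?H n p f a) = ract ?H (n + 1) p (mdiff ?H n f) a + ksign n (ract ?H n (p + 1) f (adiff A p a))"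
    proof (intro ext)
      fix i m
      show "mdiff ?H (n + p) (ract ?H n p f a) i m = (ract ?H (n + 1) p (mdiff ?H n f) a + ksign n (ract ?H n (p + 1) f (adiff A p a))) i m"
      proof (cases "m \<in> mgrade P i")
        case True
        have fm: "f i m \<in> mgrade D (i + n)" and fdm: "f (i + 1) (mdiff P i m) \<in> mgrade D (i + n + 1)" using True by simp_all
        have da: "adiff A p a \<in> agrade A (p + 1)" using a by simp
        have rl: "mdiff D (i + n + p) (ract D (i + n) p (f i m) a) =
          ract D (i + n + 1) p (mdiff D (i + n) (f i m)) a + ksign (i + n) (ract D (i + n) (p + 1) (f i m) (adiff A p a))"
          by (rule D.r_leibniz[OF a fm])
        have rm: "ract D (i + n) p (f i m) a \<in> mgrade D (i + n + p)" using a fm by simp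
        have dfm: "mdiff D (i + n) (f i m) \<in> mgrade D (i + n + 1)" using fm by simp
        have rd: "ract D (i + n + 1) p (mdiff D (i + n) (f i m) - ksign n (f (i + 1) (mdiff P i m))) a =
          ract D (i + n + 1) p (mdiff D (i + n) (f i m)) a - ksign n (ract D (i + n + 1) p (f (i + 1) (mdiff P i m)) a)"
        proof -
          have "ract D (i + n + 1) p (mdiff D (i + n) (f i m) + (- ksign n (f (i + 1) (mdiff P i m)))) a =
            ract D (i + n + 1) p (mdiff D (i + n) (f i m)) a + ract D (i + n + 1) p (- ksign n (f (i + 1) (mdiff P i m))) a"
            by (rule D.r_add[OF a dfm]) (use fdm in simp)
          moreover have "ract D (i + n + 1) p (- ksign n (f (i + 1) (mdiff P i m))) a = - ksign n (ract D (i + n + 1) p (f (i + 1) (mdiff P i m)) a)"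
            using D.r_ksign[OF a fdm, of "n + 1"] by (simp add: ksign_def split: if_splits)
          ultimately show ?thesis by simp
        qed
        have e: "i + (n + p) = i + n + p" "i + (n + 1) = i + n + 1" "i + 1 + n = i + n + 1" by simp_all
        have "mdiff ?H (n + p) (ract ?H n p f a) i m = ksign (p * i) (ract D (i + n + 1) p (mdiff D (i + n) (f i m)) a +
            ksign (i + n) (ract D (i + n) (p + 1) (f i m) (adiff A p a))) - ksign (n + p + p * (i + 1)) (ract D (i + n + 1) p (f (i + 1) (mdiff P i m)) a)"
          using True rm by (simp add: hom_sel e rl)
        also have "\<dots> = ksign (p * i) (ract D (i + n + 1) p (mdiff D (i + n) (f i m)) a - ksign n (ract D (i + n + 1) p (f (i + 1) (mdiff P i m)) a)) +
            ksign n (ksign ((p + 1) * i) (ract D (i + n) (p + 1) (f i m) (adiff A p a)))"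
          by (cases "even n"; cases "even p"; cases "even i"; simp add: ksign_if)
        also have "\<dots> = (ract ?H (n + 1) p (mdiff ?H n f) a + ksign n (ract ?H n (p + 1) f (adiff A p a))) i m"
          using True by (simp add: hom_sel e rd kf)
        finally show ?thesis .
      qed (simp add: hom_sel kf)
    qed
  next
    fix n f assume "f \<in> mgrade ?H n"
    then interpret f: ghom A P D n f by (rule gh)
    show "ract ?H n 0 f (aunit A) = f"
      using \<open>f \<in> mgrade ?H n\<close> by (auto simp: fun_eq_iff hom_sel)
  qed (use vs dga_axioms in auto)
qed

end

section \<open>Matlis duals and Hom complexes under homotopy equivalences; isomorphisms given by one
  roof\<close>

lemma op_left_matlis:
  assumes "dga A" "left_dg_module A (M :: ('k::field, 'a::ab_group_add, 'm::ab_group_add) dg_mod)"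
  shows "right_dg_module A (matlis_dual M)" "left_dg_module (op_alg A) (op_left (matlis_dual M))"
proof -
  show "right_dg_module A (matlis_dual M)" by (rule dga.matlis_right[OF assms])
  then show "left_dg_module (op_alg A) (op_left (matlis_dual M))" by (simp add: right_dg_module_def)
qed

definition dstar :: "('k, 'a, 'm) dg_mod \<Rightarrow> (int \<Rightarrow> 'm \<Rightarrow> 'n) \<Rightarrow> int \<Rightarrow> ('n \<Rightarrow> 'k::zero) \<Rightarrow> 'm \<Rightarrow> 'k" where
  "dstar X f n g x = (if x \<in> mgrade X (- n) then g (f (- n) x) else 0)"

lemma dstar_hom:
  fixes X :: "('k::field, 'a::ab_group_add, 'm::ab_group_add) dg_mod"
    and Y :: "('k, 'a, 'n::ab_group_add) dg_mod"
  assumes A: "dga A" and X: "left_dg_module A X" and Y: "left_dg_module A Y" and f: "dg_hom A X Y f"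
  shows "dg_hom (op_alg A) (op_left (matlis_dual Y)) (op_left (matlis_dual X)) (dstar X f)"
proof (rule dg_hom_opI)
  interpret f: dghom A X Y f using X Y f by (rule dghomI)
  show "dstar X f i g \<in> mgrade (matlis_dual X) i" if "g \<in> mgrade (matlis_dual Y) i" for i g
    using that by (auto simp: k_linear_def dstar_def)
  show "dstar X f (i + p) (ract (matlis_dual Y) i p g a) = ract (matlis_dual X) i p (dstar X f i g) a"
    if a: "a \<in> agrade A p" and g: "g \<in> mgrade (matlis_dual Y) i" for p i a g
  proof
    fix x
    show "dstar X f (i + p) (ract (matlis_dual Y) i p g a) x = ract (matlis_dual X) i p (dstar X f i g) a x"
    proof (cases "x \<in> mgrade X (- i - p)")
      case True
      have "f (- i) (lact X p (- i - p) a x) = lact Y p (- i - p) a (f (- i - p) x)"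
        using f.act0[OF a True] by simp
      moreover have "lact X p (- i - p) a x \<in> mgrade X (- i)" using a True by simp
      ultimately show ?thesis using True by (simp add: dstar_def)
    qed (simp add: dstar_def)
  qed
  show "dstar X f (i + 1) (mdiff (matlis_dual Y) i g) = mdiff (matlis_dual X) i (dstar X f i g)"
    if g: "g \<in> mgrade (matlis_dual Y) i" for i g
  proof
    fix x
    show "dstar X f (i + 1) (mdiff (matlis_dual Y) i g) x = mdiff (matlis_dual X) i (dstar X f i g) x"
    proof (cases "x \<in> mgrade X (- i - 1)")
      case True
      have "f (- i) (mdiff X (- i - 1) x) = mdiff Y (- i - 1) (f (- i - 1) x)"
        using f.comm[OF True, of "- i"] by simp
      moreover have "mdiff X (- i - 1) x \<in> mgrade X (- i)" using True by simp
      ultimately show ?thesis using True by (simp add: dstar_def)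
    qed (simp add: dstar_def)
  qed
qed (use A op_left_matlis(1)[OF A Y] in \<open>auto simp: dstar_def\<close>)

text \<open>A cocycle \<open>g\<close> vanishes on boundaries, so applied to the homotopy formula it
  leaves \<open>g h d\<close>, which up to sign is the coboundary of \<open>g h\<close>.\<close>

lemma dstar_homotopic:
  fixes X :: "('k::field, 'a::ab_group_add, 'm::ab_group_add) dg_mod"
  assumes X: "left_dg_module A X" and h: "homotopic_homs A X X \<phi> (\<lambda>i x. x)"
    and \<phi>: "\<And>i x. x \<in> mgrade X i \<Longrightarrow> \<phi> i x \<in> mgrade X i"
    and g: "g \<in> mgrade (matlis_dual X) (n + 1)" "mdiff (matlis_dual X) (n + 1) g = 0"
  shows "\<exists>w\<in>mgrade (matlis_dual X) n. dstar X \<phi> (n + 1) g - g = mdiff (matlis_dual X) n w"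
proof -
  obtain h where h: "graded_hom A (-1) X X h"
    and e: "\<And>i x. x \<in> mgrade X i \<Longrightarrow> \<phi> i x - x = mdiff X (i - 1) (h i x) + h (i + 1) (mdiff X i x)"
    using h by (auto simp: homotopic_homs_def)
  interpret h: ghom A X X "-1" h using X h by (intro ghomI)
  define w where "w x = (if x \<in> mgrade X (- n) then - ksign n (g (h (- n) x)) else 0)" for x
  have g0: "k_linear (mscale X) (mgrade X (- n - 1)) (*) UNIV g" "\<And>x. x \<notin> mgrade X (- n - 1) \<Longrightarrow> g x = 0"
    using g by auto
  have gadd: "g (x + y) = g x + g y" if "x \<in> mgrade X (- n - 1)" "y \<in> mgrade X (- n - 1)" for x y
    using g0 that by (simp add: k_linear_def)
  have m2: "- 2 - n = - n - (2::int)" by simp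
  have gd: "g (mdiff X (- n - 2) y) = 0" if y: "y \<in> mgrade X (- n - 2)" for y
    using fun_cong[OF g(2), of y] y by (simp add: ksign_def m2 split: if_splits)
  show ?thesis
  proof
    show "w \<in> mgrade (matlis_dual X) n"
      using g0 by (simp add: w_def k_linear_def ksign_add k_ksign_mult)
    show "dstar X \<phi> (n + 1) g - g = mdiff (matlis_dual X) n w"
    proof
      fix x
      show "(dstar X \<phi> (n + 1) g - g) x = mdiff (matlis_dual X) n w x"
      proof (cases "x \<in> mgrade X (- n - 1)")
        case True
        have m: "h (- n - 1) x \<in> mgrade X (- n - 2)" "mdiff X (- n - 1) x \<in> mgrade X (- n)"
          using True by simp_all
        then have m': "mdiff X (- n - 2) (h (- n - 1) x) \<in> mgrade X (- n - 1)" "h (- n) (mdiff X (- n - 1) x) \<in> mgrade X (- n - 1)"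
          by simp_all
        have "\<phi> (- n - 1) x = x + (mdiff X (- n - 2) (h (- n - 1) x) + h (- n) (mdiff X (- n - 1) x))"
          using e[OF True] by (simp add: algebra_simps)
        then have "g (\<phi> (- n - 1) x) = g x + g (h (- n) (mdiff X (- n - 1) x))"
          using gadd True m m' gd[OF m(1)] by simp
        then show ?thesis using True m by (simp add: dstar_def w_def)
      qed (simp add: dstar_def g0)
    qed
  qed
qed

lemma dstar_ciso:
  fixes X :: "('k::field, 'a::ab_group_add, 'm::ab_group_add) dg_mod"
    and Y :: "('k, 'a, 'n::ab_group_add) dg_mod"
  assumes A: "dga A" and X: "left_dg_module A X" and Y: "left_dg_module A Y"
    and f: "dg_hom A X Y f" and r: "dg_hom A Y X r"
    and rf: "homotopic_homs A X X (\<lambda>i x. r i (f i x)) (\<lambda>i x. x)"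
    and fr: "homotopic_homs A Y Y (\<lambda>i x. f i (r i x)) (\<lambda>i x. x)"
  shows "cohomology_iso (op_left (matlis_dual Y)) (op_left (matlis_dual X)) (dstar X f)"
proof -
  interpret f: dghom A X Y f using X Y f by (rule dghomI)
  interpret r: dghom A Y X r using Y X r by (rule dghomI)
  interpret F: dghom "op_alg A" "op_left (matlis_dual Y)" "op_left (matlis_dual X)" "dstar X f"
    by (intro dghomI op_left_matlis dstar_hom A X Y f)
  interpret R: dghom "op_alg A" "op_left (matlis_dual X)" "op_left (matlis_dual Y)" "dstar Y r"
    by (intro dghomI op_left_matlis dstar_hom A X Y r)
  have "dstar Y r n (dstar X f n g) = dstar Y (\<lambda>i x. f i (r i x)) n g" for n and g :: "'n \<Rightarrow> 'k"
    by (auto simp: dstar_def)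
  moreover have "dstar X f n (dstar Y r n g) = dstar X (\<lambda>i x. r i (f i x)) n g" for n and g :: "'m \<Rightarrow> 'k"
    by (auto simp: dstar_def)
  ultimately show ?thesis
    using dstar_homotopic[OF X rf] dstar_homotopic[OF Y fr] F.comm R.comm
    by (intro ciso_inverse[OF op_left_matlis(2)[OF A Y] op_left_matlis(2)[OF A X], of _ "dstar Y r"])
      (use F.mem0 R.mem0 in \<open>simp_all only: op_left_sel f.mem0 r.mem0\<close>)
qed

lemma bijective_ciso:
  assumes M: "left_dg_module A M" and N: "left_dg_module A N" and f: "dg_hom A M N f"
    and surj: "\<And>i y. y \<in> mgrade N i \<Longrightarrow> \<exists>x\<in>mgrade M i. f i x = y"
    and inj: "\<And>i x. x \<in> mgrade M i \<Longrightarrow> f i x = 0 \<Longrightarrow> x = 0"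
  shows "cohomology_iso M N f"
proof -
  interpret f: dghom A M N f using M N f by (rule dghomI)
  show ?thesis
  proof (rule cisoI)
    fix i y assume y: "y \<in> mgrade N (i + 1)" "mdiff N (i + 1) y = 0"
    obtain x where x: "x \<in> mgrade M (i + 1)" "f (i + 1) x = y" using surj[OF y(1)] by blast
    have "mdiff M (i + 1) x = 0"
      using inj[of "mdiff M (i + 1) x" "i + 1 + 1"] f.comm[OF x(1) refl] x y by simp
    then show "\<exists>x\<in>mgrade M (i + 1). mdiff M (i + 1) x = 0 \<and> (\<exists>w\<in>mgrade N i. y - f (i + 1) x = mdiff N i w)"
      using x by (intro bexI[of _ x] conjI bexI[of _ 0]) simp_all
  next
    fix i x w assume x: "x \<in> mgrade M (i + 1)" "w \<in> mgrade N i" "f (i + 1) x = mdiff N i w"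
    obtain v where v: "v \<in> mgrade M i" "f i v = w" using surj[OF x(2)] by blast
    have "f (i + 1) (x - mdiff M i v) = 0" using f.comm[OF v(1) refl] v x by simp
    then have "x - mdiff M i v = 0" using inj[of "x - mdiff M i v" "i + 1"] x v by simp
    then show "\<exists>v\<in>mgrade M i. x = mdiff M i v" using v by auto
  qed
qed

lemma ciso_transport:
  assumes "left_dg_module A M" "\<And>i. Vector_Spaces.linear (mscale M) u (f i)" "\<And>i x. x \<in> mgrade M i \<Longrightarrow> g i (f i x) = x"
  shows "cohomology_iso (transport u f g M) M g"
proof (rule bijective_ciso[OF transport_left(1)[OF assms] assms(1) transport_left(3)[OF assms]])
  have f0: "f i 0 = 0" for i using assms(2)[of i] by (metis Vector_Spaces.linear_iff add_cancel_right_right)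
  show "\<exists>x\<in>mgrade (transport u f g M) i. g i x = y" if "y \<in> mgrade M i" for i y
    using that assms(3) by (auto simp: transport_def)
  show "x = 0" if "x \<in> mgrade (transport u f g M) i" "g i x = 0" for i x
    using that assms(3) f0 by (auto simp: transport_def)
qed

text \<open>The inverse of the roof \<open>(Z, s, f)\<close> is \<open>(Z, f, s)\<close>; both
  composites can be formed with apex \<open>Z\<close> and have equal legs.\<close>

lemma derived_iso_roof:
  assumes Z: "Z \<in> dg_modules u A" and s: "quasi_iso A Z M s" and f: "quasi_iso A Z N f"
    and M: "left_dg_module A M" and N: "left_dg_module A N"
  shows "derived_iso u A M N"
proof -
  have Zm: "left_dg_module A Z" using Z by (simp add: dg_modules_def)
  have sf: "dg_hom A Z M s" "dg_hom A Z N f" using s f by (simp_all add: quasi_iso_def)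
  interpret lmod A Z by unfold_locales fact
  have idZ: "dg_hom A Z Z (\<lambda>i x. x)"
    by (rule dg_homI[OF graded_homI]) auto
  have qid: "quasi_iso A Z Z (\<lambda>i x. x)"
    unfolding quasi_iso_def by (intro conjI idZ bijective_ciso[OF Zm Zm]) auto
  show ?thesis
    unfolding derived_iso_def is_roof_def roof_composite_def roof_equiv_def id_roof_def
    apply (intro conjI M N exI[of _ "(Z, s, f)"] exI[of _ "(Z, f, s)"] exI[of _ "(Z, s, s)"] exI[of _ "(Z, f, f)"])
         apply (simp_all only: prod.case)
         apply (intro conjI Z s f sf)
        apply (intro conjI Z s f sf)
       apply (intro bexI[OF _ Z] exI[of _ "\<lambda>i x. x"] conjI qid idZ homotopic_refl Zm N refl)
      apply (intro bexI[OF _ Z] exI[of _ "\<lambda>i x. x"] exI[of _ s] conjI s sf idZ homotopic_refl Zm M)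
     apply (intro bexI[OF _ Z] exI[of _ "\<lambda>i x. x"] conjI qid idZ homotopic_refl Zm M refl)
    apply (intro bexI[OF _ Z] exI[of _ "\<lambda>i x. x"] exI[of _ f] conjI f sf idZ homotopic_refl Zm N)
    done
qed

lemma precompose_hom:
  assumes A: "dga A" and P: "left_dg_module A P" and F: "left_dg_module A F" and D: "dg_bimodule A D"
    and f: "dg_hom A P F f"
  shows "dg_hom (op_alg A) (op_left (hom_complex A F D)) (op_left (hom_complex A P D)) (precompose P f)"
proof (rule dg_hom_opI)
  interpret f: dghom A P F f using P F f by (rule dghomI)
  interpret D: bimod A D by (rule bimodI[OF A D])
  show "precompose P f n g \<in> mgrade (hom_complex A P D) n" if g: "g \<in> mgrade (hom_complex A F D) n" for n g
  proof -
    have "graded_hom A (0 + n) P D (\<lambda>i x. g (i + 0) (f i x))"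
      using g by (intro graded_hom_comp[OF P F D.L.mod f.hom]) (simp add: hom_sel)
    then have "graded_hom A (0 + n) P D (precompose P f n g)"
      by (rule graded_hom_cong[OF P]) (simp add: precompose_def)
    then show ?thesis by (simp add: hom_sel(2) precompose_def)
  qed
  show "precompose P f (n + 1) (mdiff (hom_complex A F D) n g) = mdiff (hom_complex A P D) n (precompose P f n g)" for n g
  proof (intro ext)
    fix i x
    show "precompose P f (n + 1) (mdiff (hom_complex A F D) n g) i x = mdiff (hom_complex A P D) n (precompose P f n g) i x"
      using f.comm[of x i "i + 1"] by (cases "x \<in> mgrade P i") (simp_all add: hom_sel(3) precompose_def)
  qed
  show "precompose P f n (mscale (hom_complex A F D) c g) = mscale (hom_complex A P D) c (precompose P f n g)" for n c g
    by (simp add: fun_eq_iff precompose_def hom_sel(1))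
  show "precompose P f (n + p) (ract (hom_complex A F D) n p g a) = ract (hom_complex A P D) n p (precompose P f n g) a" for n p g a
    by (simp add: fun_eq_iff precompose_def hom_sel(4))
qed (use A in \<open>auto simp: dga.hom_complex_right[OF A F D] precompose_def fun_eq_iff\<close>)

text \<open>The cochain is \<open>G h\<close> up to sign: since \<open>G\<close> is a cocycle,
  \<open>G d h\<close> equals \<open>d G h\<close> up to sign, and this together with
  \<open>G h d\<close> is the coboundary of \<open>G h\<close>.\<close>

lemma precompose_homotopic:
  assumes A: "dga A" and F: "left_dg_module A F" and D: "left_dg_module A D"
    and h: "homotopic_homs A F F \<phi> (\<lambda>i x. x)"
    and G: "G \<in> mgrade (hom_complex A F D) (n + 1)" "mdiff (hom_complex A F D) (n + 1) G = 0"
  shows "\<exists>w\<in>mgrade (hom_complex A F D) n. precompose F \<phi> (n + 1) G - G = mdiff (hom_complex A F D) n w"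
proof -
  obtain h where h: "graded_hom A (-1) F F h"
    and e: "\<And>i x. x \<in> mgrade F i \<Longrightarrow> \<phi> i x - x = mdiff F (i - 1) (h i x) + h (i + 1) (mdiff F i x)"
    using h by (auto simp: homotopic_homs_def)
  interpret h: ghom A F F "-1" h using F h by (intro ghomI)
  have gG: "graded_hom A (n + 1) F D G" and G0: "\<And>i x. x \<notin> mgrade F i \<Longrightarrow> G i x = 0" using G by (simp_all add: hom_sel)
  interpret G: ghom A F D "n + 1" G using F D gG by (intro ghomI)
  have dG: "mdiff D (i + (n + 1)) (G i x) = ksign (n + 1) (G (i + 1) (mdiff F i x))" if "x \<in> mgrade F i" for i x
    using fun_cong[OF fun_cong[OF G(2), of i], of x] that by (simp add: hom_sel(3))
  have q: "graded_hom A (- 1 + (n + 1)) F D (\<lambda>i x. G (i + - 1) (h i x))"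
    by (rule graded_hom_comp[OF F F D h gG])
  then interpret q: ghom A F D n "\<lambda>i x. G (i - 1) (h i x)" using F D by (intro ghomI) simp_all
  define w where "w i x = (if x \<in> mgrade F i then ksign (n + 1) (G (i - 1) (h i x)) else 0)" for i x
  have "graded_hom A n F D (\<lambda>i x. ksign (n + 1) (G (i - 1) (h i x)))"
  proof (rule graded_homI)
    fix p i a x assume a: "a \<in> agrade A p" and x: "x \<in> mgrade F i"
    have "G (i - 1) (h i x) \<in> mgrade D (i + n)" using x by simp
    then show "ksign (n + 1) (G (p + i - 1) (h (p + i) (lact F p i a x))) =
       ksign (n * p) (lact D p (i + n) a (ksign (n + 1) (G (i - 1) (h i x))))"
      using q.act[OF a x] a by (simp add: ac_simps)
  qed (simp_all add: ksign_add G.T.V.scale_ksign)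
  then have "graded_hom A n F D w"
    by (rule graded_hom_cong[OF F]) (simp add: w_def)
  then have wm: "w \<in> mgrade (hom_complex A F D) n" by (simp add: hom_sel(2) w_def)
  show ?thesis
  proof (rule bexI[OF _ wm], intro ext)
    fix i x
    show "(precompose F \<phi> (n + 1) G - G) i x = mdiff (hom_complex A F D) n w i x"
    proof (cases "x \<in> mgrade F i")
      case True
      have m: "h i x \<in> mgrade F (i - 1)" "mdiff F i x \<in> mgrade F (i + 1)" using True by simp_all
      have m': "mdiff F (i - 1) (h i x) \<in> mgrade F i" "h (i + 1) (mdiff F i x) \<in> mgrade F i" using m by simp_all
      have "\<phi> i x = x + (mdiff F (i - 1) (h i x) + h (i + 1) (mdiff F i x))"
        using e[OF True] by (simp add: algebra_simps)
      then have "G i (\<phi> i x) = G i x + (G i (mdiff F (i - 1) (h i x)) + G i (h (i + 1) (mdiff F i x)))"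
        using True m' by simp
      moreover have "G i (mdiff F (i - 1) (h i x)) = ksign (n + 1) (mdiff D (i + n) (G (i - 1) (h i x)))"
        using dG[OF m(1)] by (simp add: add.commute) (simp add: ksign_def)
      moreover have "mdiff D (i + n) (ksign (n + 1) (G (i - 1) (h i x))) = ksign (n + 1) (mdiff D (i + n) (G (i - 1) (h i x)))"
        by (rule G.T.d_ksign) (use m in simp)
      ultimately show ?thesis using True m by (simp add: precompose_def hom_sel(3) w_def) (simp add: ksign_def)
    qed (simp add: precompose_def hom_sel(3) G0)
  qed
qed

lemma precompose_ciso:
  assumes A: "dga A" and P: "left_dg_module A P" and F: "left_dg_module A F" and D: "dg_bimodule A D"
    and f: "dg_hom A P F f" and r: "dg_hom A F P r"
    and rf: "homotopic_homs A P P (\<lambda>i x. r i (f i x)) (\<lambda>i x. x)"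
    and fr: "homotopic_homs A F F (\<lambda>i x. f i (r i x)) (\<lambda>i x. x)"
  shows "cohomology_iso (op_left (hom_complex A F D)) (op_left (hom_complex A P D)) (precompose P f)"
proof -
  interpret f: dghom A P F f using P F f by (rule dghomI)
  interpret r: dghom A F P r using F P r by (rule dghomI)
  have l: "left_dg_module (op_alg A) (op_left (hom_complex A X D))" if "left_dg_module A X" for X
    using dga.hom_complex_right[OF A that D] by (simp add: right_dg_module_def)
  have Dl: "left_dg_module A D" using D by (simp add: dg_bimodule_def)
  interpret f': dghom "op_alg A" "op_left (hom_complex A F D)" "op_left (hom_complex A P D)" "precompose P f"
    by (intro dghomI l P F precompose_hom A D f)
  interpret r': dghom "op_alg A" "op_left (hom_complex A P D)" "op_left (hom_complex A F D)" "precompose F r"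
    by (intro dghomI l P F precompose_hom A D r)
  have "precompose F r n (precompose P f n g) = precompose F (\<lambda>i x. f i (r i x)) n g" if "g \<in> mgrade (hom_complex A F D) n" for n g
    by (auto simp: precompose_def fun_eq_iff)
  moreover have "precompose P f n (precompose F r n g) = precompose P (\<lambda>i x. r i (f i x)) n g" if "g \<in> mgrade (hom_complex A P D) n" for n g
    by (auto simp: precompose_def fun_eq_iff)
  ultimately show ?thesis
    using precompose_homotopic[OF A P Dl rf] precompose_homotopic[OF A F Dl fr] f'.comm r'.comm
    by (intro ciso_inverse[OF l[OF F] l[OF P], of _ "precompose F r"])
      (use f'.mem0 r'.mem0 in \<open>simp_all only: op_left_sel\<close>)
qed

context pairing
begin

text \<open>The sign makes this map compatible with the differentials and with both actions.\<close>

definition theta :: "int \<Rightarrow> ('t \<Rightarrow> 'k) \<Rightarrow> int \<Rightarrow> 'f \<Rightarrow> 'i \<Rightarrow> 'k" where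
  "theta n g i f x = (if f \<in> mgrade F i \<and> x \<in> mgrade (torsion A I) (- (i + n))
     then ksign ((n + 1) * i) (g (t (- (i + n)) i x f)) else 0)"

lemma theta_zero:
  assumes g: "g \<in> mgrade (matlis_dual (torsion A T)) n" and inj: "dual_inj A I F T t" and z: "theta n g = 0"
  shows "g = 0"
proof
  fix w
  have e: "- j - n = - n - j" for j by simp
  have "g (t (- n - j) j x f) = 0" if "x \<in> mgrade (torsion A I) (- n - j)" "f \<in> mgrade F j" for j x f
    using fun_cong[OF fun_cong[OF fun_cong[OF z, of j], of f], of x] that
    by (simp add: theta_def e ksign_def split: if_splits)
  then have "\<forall>w\<in>mgrade (torsion A T) (- n). g w = 0"
    using inj[unfolded dual_inj_def, rule_format, of "- n" g] g by auto
  then show "g w = 0 w" using g by (cases "w \<in> mgrade (torsion A T) (- n)") auto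
qed

text \<open>Each axiom of the pairing accounts for one compatibility: balance makes
  \<open>theta n g\<close> left linear, left linearity of \<open>t\<close> gives the right action,
  and the Leibniz rule \<open>t_d\<close> gives the differential.\<close>

lemma theta_hom:
  "dg_hom (op_alg A) (op_left (matlis_dual (torsion A T))) (op_left (hom_complex A F (matlis_dual (torsion A I)))) theta"
proof (rule dg_hom_opI)
  have A: "dga A" by unfold_locales
  let ?D = "matlis_dual (torsion A I)"
  let ?H = "hom_complex A F ?D"
  interpret TI: bimod A "torsion A I"
    by (rule bimodI[OF A]) (rule dga.torsion_bi[OF A I.bimod])
  interpret TT: lmod A "torsion A T" by unfold_locales (rule dga.torsion_left[OF A T.mod])
  show "right_dg_module A (matlis_dual (torsion A T))" by (rule op_left_matlis(1)[OF A TT.mod])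
  fix n g assume g: "g \<in> mgrade (matlis_dual (torsion A T)) n"
  have gl: "k_linear (mscale T) (mgrade (torsion A T) (- n)) (*) UNIV g" using g by simp
  have gadd: "g (v + w) = g v + g w" and gscale: "g (mscale T c v) = c * g v"
    if "v \<in> mgrade (torsion A T) (- n)" "w \<in> mgrade (torsion A T) (- n)" for v w c
    using gl that by (simp_all add: k_linear_def)
  have gks: "g (ksign m v) = ksign m (g v)" if "v \<in> mgrade (torsion A T) (- n)" for m v
  proof -
    have "g (v + - v) = g v + g (- v)" by (rule gadd) (use that in simp_all)
    moreover have "g 0 = 0" using gscale[of 0 0 0] by simp
    ultimately show ?thesis by (simp add: ksign_def eq_neg_iff_add_eq_0 add.commute)
  qed
  have tm: "t l i x f \<in> mgrade (torsion A T) (- n)" if "x \<in> mgrade (torsion A I) l" "f \<in> mgrade F i" "l = - i - n" for l i x f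
    by (rule t_torsion[OF that(1,2)]) (simp add: that(3))
  have th: "theta n g i f x = ksign ((n + 1) * i) (g (t l i x f))"
    if "x \<in> mgrade (torsion A I) l" "f \<in> mgrade F i" "l = - i - n" for l i x f
    using that by (simp add: theta_def)
  have th0: "theta n g i f x = 0" if "x \<notin> mgrade (torsion A I) (- i - n)" for i x f
    using that by (simp add: theta_def)
  have kf: "ksign m h x = ksign m (h x)" for m x and h :: "'i \<Rightarrow> 'k" by (simp add: ksign_def)
  have "graded_hom A n F ?D (theta n g)"
  proof (rule graded_homI)
    fix i f assume f: "f \<in> mgrade F i"
    have "k_linear (mscale (torsion A I)) (mgrade (torsion A I) (- i - n)) (*) UNIV (theta n g i f)"
      unfolding k_linear_def
    proof (intro conjI ballI allI UNIV_I)
      fix x assume x: "x \<in> mgrade (torsion A I) (- i - n)"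
      show "theta n g i f (mscale (torsion A I) c x) = c * theta n g i f x" for c
        using th[OF TI.L.scale_mem[OF x] f refl] th[OF x f refl] gscale[OF tm[OF x f refl] tm[OF x f refl]] torsion_sub[OF x] f
        by (simp add: k_ksign_mult)
      fix y assume y: "y \<in> mgrade (torsion A I) (- i - n)"
      show "theta n g i f (x + y) = theta n g i f x + theta n g i f y"
        using th[OF TI.L.add_mem[OF x y] f refl] th[OF x f refl] th[OF y f refl]
          gadd[OF tm[OF x f refl] tm[OF y f refl]] torsion_sub[OF x] torsion_sub[OF y] f
        by (simp add: ksign_add)
    qed
    then show "theta n g i f \<in> mgrade ?D (i + n)" by (simp add: th0)
    show "theta n g i (mscale F c f) = mscale ?D c (theta n g i f)" for c
    proof
      fix x
      show "theta n g i (mscale F c f) x = mscale ?D c (theta n g i f) x"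
      proof (cases "x \<in> mgrade (torsion A I) (- i - n)")
        case True
        then show ?thesis
          using th[OF True F.scale_mem[OF f] refl] th[OF True f refl] gscale[OF tm[OF True f refl] tm[OF True f refl]]
            torsion_sub[OF True] f by (simp add: k_ksign_mult)
      qed (simp add: th0)
    qed
    show "theta n g i (f + f') = theta n g i f + theta n g i f'" if f': "f' \<in> mgrade F i" for f'
    proof
      fix x
      show "theta n g i (f + f') x = (theta n g i f + theta n g i f') x"
      proof (cases "x \<in> mgrade (torsion A I) (- i - n)")
        case True
        then show ?thesis
          using th[OF True F.add_mem[OF f f'] refl] th[OF True f refl] th[OF True f' refl]
            gadd[OF tm[OF True f refl] tm[OF True f' refl]] torsion_sub[OF True] f f' by (simp add: ksign_add)
      qed (simp add: th0)
    qed
    fix p a assume a: "a \<in> agrade A p"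
    show "theta n g (p + i) (lact F p i a f) = ksign (n * p) (lact ?D p (i + n) a (theta n g i f))"
    proof
      fix x
      show "theta n g (p + i) (lact F p i a f) x = ksign (n * p) (lact ?D p (i + n) a (theta n g i f)) x"
      proof (cases "x \<in> mgrade (torsion A I) (- (i + n) - p)")
        case True
        have l: "- (i + n) - p = - (p + i) - n" "- (i + n) - p + p = - i - n" by simp_all
        have xa: "ract (torsion A I) (- (i + n) - p) p x a \<in> mgrade (torsion A I) (- (i + n) - p + p)"
          by (rule TI.r_mem[OF a True refl])
        have "theta n g (p + i) (lact F p i a f) x = ksign ((n + 1) * (p + i)) (g (t (- (i + n) - p) (p + i) x (lact F p i a f)))"
          by (rule th[OF True F.act_mem[OF a f refl] l(1)])
        also have "t (- (i + n) - p) (p + i) x (lact F p i a f) = t (- (i + n) - p + p) i (ract I (- (i + n) - p) p x a) f"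
          using t_bal[OF a torsion_sub[OF True] f] by simp
        finally show ?thesis
          using th[OF xa f l(2)] True
          by (simp only: kf matlis_sel(4) if_True torsion_sel)
             (cases "even n"; cases "even p"; cases "even i"; simp add: ksign_if)
      next
        case False
        moreover have "- (p + i) - n = - (i + n) - p" by simp
        ultimately show ?thesis using th0[of x "p + i"] by (simp only: kf matlis_sel(4) if_False) simp
      qed
    qed
  qed
  then show "theta n g \<in> mgrade ?H n"
    unfolding hom_sel(2) by (simp add: theta_def fun_eq_iff)
  show "theta (n + p) (ract (matlis_dual (torsion A T)) n p g a) = ract ?H n p (theta n g) a"
    if a: "a \<in> agrade A p" for p a
  proof (intro ext)
    fix i f x
    show "theta (n + p) (ract (matlis_dual (torsion A T)) n p g a) i f x = ract ?H n p (theta n g) a i f x"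
    proof (cases "f \<in> mgrade F i \<and> x \<in> mgrade (torsion A I) (- (i + n) - p)")
      case True
      define l where "l = - (i + n) - p"
      have l: "- (i + (n + p)) = l" "- n - p = l + i" "- (i + n) - p = l" "p + l = - i - n" by (simp_all add: l_def)
      have f: "f \<in> mgrade F i" and x: "x \<in> mgrade (torsion A I) l" using True by (simp_all add: l_def)
      have tl: "t l i x f \<in> mgrade (torsion A T) (l + i)" by (rule t_torsion[OF x f refl])
      have ax: "lact (torsion A I) p l a x \<in> mgrade (torsion A I) (p + l)" by (rule TI.L.act_mem[OF a x refl])
      have "theta (n + p) (ract (matlis_dual (torsion A T)) n p g a) i f x =
         ksign ((n + p + 1) * i) (g (lact T p (l + i) a (t l i x f)))"
        using f x tl by (simp add: theta_def l(1) del: minus_add_distrib matlis_sel) (simp only: matlis_sel l(2) if_True torsion_sel)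
      also have "lact T p (l + i) a (t l i x f) = t (p + l) i (lact I p l a x) f"
        using t_left[OF a torsion_sub[OF x] f] by simp
      finally have e: "theta (n + p) (ract (matlis_dual (torsion A T)) n p g a) i f x =
         ksign ((n + p + 1) * i) (g (t (p + l) i (lact I p l a x) f))" .
      have "ract ?H n p (theta n g) a i f x = ksign (p * i) (ksign ((n + 1) * i) (g (t (p + l) i (lact I p l a x) f)))"
        using th[OF ax f l(4)] f x
        by (simp only: hom_sel(4) if_True kf matlis_sel(5) l torsion_sel)
      then show ?thesis unfolding e
        by (cases "even n"; cases "even p"; cases "even i"; simp add: ksign_if)
    next
      case False
      moreover have "- (i + (n + p)) = - (i + n) - p" by simp
      ultimately show ?thesis
        by (cases "f \<in> mgrade F i") (simp_all only: hom_sel(4) theta_def kf matlis_sel(5) if_False if_True simp_thms ksign_zero zero_fun_apply)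
    qed
  qed
  show "theta (n + 1) (mdiff (matlis_dual (torsion A T)) n g) = mdiff ?H n (theta n g)"
  proof (intro ext)
    fix i f x
    show "theta (n + 1) (mdiff (matlis_dual (torsion A T)) n g) i f x = mdiff ?H n (theta n g) i f x"
    proof (cases "f \<in> mgrade F i \<and> x \<in> mgrade (torsion A I) (- (i + n) - 1)")
      case True
      define l where "l = - (i + n) - 1"
      have l: "- (i + (n + 1)) = l" "- n - 1 = l + i" "- (i + n) - 1 = l" "l + 1 = - i - n" "l = - (i + 1) - n" by (simp_all add: l_def)
      have f: "f \<in> mgrade F i" and x: "x \<in> mgrade (torsion A I) l" using True by (simp_all add: l_def)
      have df: "mdiff F i f \<in> mgrade F (i + 1)" using f by simp
      have tl: "t l i x f \<in> mgrade (torsion A T) (l + i)" by (rule t_torsion[OF x f refl])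
      have dx: "mdiff (torsion A I) l x \<in> mgrade (torsion A I) (l + 1)" by (rule TI.L.d_mem[OF x refl])
      have "theta (n + 1) (mdiff (matlis_dual (torsion A T)) n g) i f x =
         ksign ((n + 1 + 1) * i) (- ksign n (g (mdiff T (l + i) (t l i x f))))"
        using f x tl by (simp add: theta_def l(1) del: minus_add_distrib matlis_sel) (simp only: matlis_sel l(2) if_True torsion_sel ksign_minus ksign_ksign)
      also have "mdiff T (l + i) (t l i x f) = t (l + 1) i (mdiff I l x) f + ksign l (t l (i + 1) x (mdiff F i f))"
        using t_d[OF torsion_sub[OF x] f] by simp
      also have "g \<dots> = g (t (l + 1) i (mdiff I l x) f) + ksign l (g (t l (i + 1) x (mdiff F i f)))"
        using gadd[of "t (l + 1) i (mdiff I l x) f" "ksign l (t l (i + 1) x (mdiff F i f))"]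
          tm[OF dx f l(4)] tm[OF x df l(5)] gks[OF tm[OF x df l(5)]] by simp
      finally have e: "theta (n + 1) (mdiff (matlis_dual (torsion A T)) n g) i f x =
         ksign ((n + 1 + 1) * i) (- ksign n (g (t (l + 1) i (mdiff I l x) f) + ksign l (g (t l (i + 1) x (mdiff F i f)))))" .
      have "mdiff ?H n (theta n g) i f x = - ksign (i + n) (ksign ((n + 1) * i) (g (t (l + 1) i (mdiff I l x) f))) -
          ksign n (ksign ((n + 1) * (i + 1)) (g (t l (i + 1) x (mdiff F i f))))"
        using th[OF dx f l(4)] th[OF x df l(5)] f x
        by (simp only: hom_sel(3) if_True kf matlis_sel(3) l(3) torsion_sel fun_diff_def)
      moreover have "ksign l z = - ksign (i + n) z" for z :: 'k by (simp add: l_def ksign_def)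
      ultimately show ?thesis unfolding e
        by (cases "even n"; cases "even i"; simp add: ksign_if)
    next
      case False
      moreover have "- (i + (n + 1)) = - (i + n) - 1" "- (i + n) - 1 = - (i + 1) - n" by simp_all
      ultimately show ?thesis using th0[of x "i + 1"]
        by (cases "f \<in> mgrade F i")
          (simp_all only: hom_sel(3) theta_def[of "n + 1"] kf matlis_sel(3) if_False if_True simp_thms ksign_zero zero_fun_apply fun_diff_def diff_self)
    qed
  qed
next
  let ?H = "hom_complex A F (matlis_dual (torsion A I))"
  show "theta n (g + g') = theta n g + theta n g'" for n g g'
    by (auto simp: theta_def fun_eq_iff ksign_add)
  show "theta n (mscale (matlis_dual (torsion A T)) c g) = mscale ?H c (theta n g)" for n c g
    by (auto simp: theta_def fun_eq_iff hom_sel(1) k_ksign_mult)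
qed (rule I.dga_axioms)

text \<open>The map is bijective already on cochains: injective by \<open>dual_inj\<close>,
  surjective by \<open>dual_surj\<close>.\<close>

lemma theta_ciso:
  assumes "dual_inj A I F T t" "dual_surj A I F T t"
  shows "cohomology_iso (op_left (matlis_dual (torsion A T))) (op_left (hom_complex A F (matlis_dual (torsion A I)))) theta"
proof (rule bijective_ciso[OF _ _ theta_hom])
  have A: "dga A" by unfold_locales
  show "left_dg_module (op_alg A) (op_left (matlis_dual (torsion A T)))"
    by (rule op_left_matlis(2)[OF A dga.torsion_left[OF A T.mod]])
  have D: "dg_bimodule A (matlis_dual (torsion A I))"
    by (rule dga.matlis_bi[OF A dga.torsion_bi[OF A I.bimod]])
  show "left_dg_module (op_alg A) (op_left (hom_complex A F (matlis_dual (torsion A I))))"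
    using dga.hom_complex_right[OF A F.mod D] by (simp add: right_dg_module_def)
  show "g = 0" if "g \<in> mgrade (op_left (matlis_dual (torsion A T))) n" "theta n g = 0" for n g
    using that theta_zero[OF _ assms(1), of g n] by (simp only: op_left_sel)
  show "\<exists>g\<in>mgrade (op_left (matlis_dual (torsion A T))) n. theta n g = G"
    if "G \<in> mgrade (op_left (hom_complex A F (matlis_dual (torsion A I)))) n" for n G
  proof -
    have G: "graded_hom A n F (matlis_dual (torsion A I)) G" "\<And>i f. f \<notin> mgrade F i \<Longrightarrow> G i f = 0"
      using that by (simp_all add: op_left_sel(2) hom_sel(2))
    obtain g where g: "k_linear (mscale T) (mgrade (torsion A T) (- n)) (*) UNIV g"
      and Gg: "\<And>j f x. f \<in> mgrade F j \<Longrightarrow> x \<in> mgrade (torsion A I) (- (j + n)) \<Longrightarrow>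
            G j f x = ksign ((n + 1) * j) (g (t (- (j + n)) j x f))"
      using assms(2) G(1) unfolding dual_surj_def by metis
    have G3: "G i f x = 0" if "f \<in> mgrade F i" "x \<notin> mgrade (torsion A I) (- (i + n))" for i f x
    proof -
      have "G i f \<in> mgrade (matlis_dual (torsion A I)) (i + n)"
        using G(1) that(1) unfolding graded_hom_def k_linear_def by blast
      then show ?thesis using that(2) by simp
    qed
    interpret TT: lmod A "torsion A T" by unfold_locales (rule dga.torsion_left[OF A T.mod])
    \<comment> \<open>Elements of the Matlis dual vanish outside the component, so the functional is
      cut off there; the values of \<open>t\<close> on torsion elements lie inside.\<close>
    define g' where "g' w = (if w \<in> mgrade (torsion A T) (- n) then g w else 0)" for w
    have "g' \<in> mgrade (matlis_dual (torsion A T)) n"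
      using g TT.scale_mem by (simp add: g'_def k_linear_def)
    moreover have "theta n g' = G"
    proof (intro ext)
      fix i f x
      have "t (- (i + n)) i x f \<in> mgrade (torsion A T) (- n)" if "f \<in> mgrade F i" "x \<in> mgrade (torsion A I) (- (i + n))"
        by (rule t_torsion[OF that(2,1)]) simp
      then show "theta n g' i f x = G i f x" using Gg G(2) G3 
        by (cases "f \<in> mgrade F i"; cases "x \<in> mgrade (torsion A I) (- (i + n))")
          (simp_all add: theta_def g'_def del: minus_add_distrib)
    qed
    ultimately show ?thesis by (auto simp: op_left_sel(2) simp del: matlis_sel)
  qed
qed

end

section \<open>Homotopy equivalences and the final comparison\<close>

context dgu
begin

text \<open>The cone is both acyclic and K-projective, so its own identity is nullhomotopic;
  \<open>contraction\<close> turns this into an inverse of \<open>f\<close>.\<close>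

lemma kproj_equivalence:
  assumes kX: "kproj u A X" and kY: "kproj u A Y" and X: "X \<in> dg_modules u A" and Y: "Y \<in> dg_modules u A"
    and f: "dg_hom A Y X f" and ac: "acyclic_mod (mcone X Y f)"
  obtains r where "dg_hom A X Y r" "homotopic_homs A Y Y (\<lambda>i x. r i (f i x)) (\<lambda>i x. x)"
    "homotopic_homs A X X (\<lambda>i x. f i (r i x)) (\<lambda>i x. x)"
proof -
  interpret cone A u X Y 1 "\<lambda>i. f (i + 1)" by (rule mcone[OF X Y f])
  have "chain_hom A (- 1 + 1) G G (\<lambda>i x. x)"
    by (simp add: chain_hom_0) (rule dg_homI[OF graded_homI]; simp)
  then have "null_hom A (-1) G G (\<lambda>i x. x)"
    using kproj_cone[OF kX kY] G_in ac unfolding kproj_def by blast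
  then show ?thesis by (rule contraction[OF X Y f]) (rule that)
qed

lemma kinj_equivalence:
  assumes kX: "kinj u A X" and kY: "kinj u A Y" and X: "X \<in> dg_modules u A" and Y: "Y \<in> dg_modules u A"
    and q: "quasi_iso A Y X f"
  obtains r where "dg_hom A X Y r" "homotopic_homs A Y Y (\<lambda>i x. r i (f i x)) (\<lambda>i x. x)"
    "homotopic_homs A X X (\<lambda>i x. f i (r i x)) (\<lambda>i x. x)"
proof -
  have f: "dg_hom A Y X f" using q by (simp add: quasi_iso_def)
  interpret cone A u X Y 1 "\<lambda>i. f (i + 1)" by (rule mcone[OF X Y f])
  have "chain_hom A (- 1 + 1) G G (\<lambda>i x. x)"
    by (simp add: chain_hom_0) (rule dg_homI[OF graded_homI]; simp)
  then have "null_hom A (-1) G G (\<lambda>i x. x)"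
    using kinj_cone[OF kX kY] G_in mcone_acyclic[OF X Y q] unfolding kinj_def by blast
  then show ?thesis by (rule contraction[OF X Y f]) (rule that)
qed

end

theorem theoremA:
  fixes u :: "'k::field \<Rightarrow> 'u::ab_group_add \<Rightarrow> 'u"
    and A :: "('k, 'a::ab_group_add) dg_alg"
    and M J P I :: "('k, 'a, 'u) dg_mod"
    and \<eta> \<pi> :: "int \<Rightarrow> 'u \<Rightarrow> 'u"
    and \<iota> :: "int \<Rightarrow> 'a \<Rightarrow> 'u"
  assumes "universe u"
    and "dg_algebra A" and "connected_cochain A" and "locally_finite A"
    and "compact_dg_module u A M"
    and "semi_injective_resolution u A M J \<eta>"
    and "semi_injective_bimodule_resolution u A (reg_bimodule A) I \<iota>"
    and "semi_projective_resolution u A M P \<pi>"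
  shows "derived_iso (\<lambda>c f (i::int) (x::'u) (y::'u). c * f i x y :: 'k) (op_alg A)
           (op_left (matlis_dual (torsion A J)))
           (op_left (hom_complex A P (matlis_dual (torsion A I))))"
proof -
  have dgu: "dgu A u" by unfold_locales fact+
  then interpret dgu A u .
  have A: "dga A" by unfold_locales
  have kP: "kproj u A P" and P: "P \<in> dg_modules u A" and q\<pi>: "quasi_iso A P M \<pi>"
    using assms(8) semi_projective_kproj by (auto simp: semi_projective_resolution_def semi_projective_def)
  have kJ: "kinj u A J" and J: "J \<in> dg_modules u A" and q\<eta>: "quasi_iso A M J \<eta>"
    using assms(6) semi_injective_kinj by (auto simp: semi_injective_resolution_def semi_injective_def)
  have sI: "semi_injective_bimodule u A I" and \<iota>: "dg_bihom A (reg_bimodule A) I \<iota>"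
    and \<iota>c: "cohomology_iso (reg_bimodule A) I \<iota>"
    using assms(7) by (simp_all add: semi_injective_bimodule_resolution_def)
  have I: "dg_bimodule A I" "mscale I = u"
    using sI by (simp_all add: semi_injective_bimodule_def dg_bimodules_def)
  obtain Au \<kappa> ki where fc: "free_ctx A u Au \<kappa> ki" using ex_free[OF dgu assms(4)] by blast
  then interpret free_ctx A u Au \<kappa> ki .
  interpret I: bimod A I by (rule bimodI[OF A I(1)])
  interpret adm_ctx A u Au \<kappa> ki I \<iota>
    by unfold_locales (use I(2) \<iota> \<iota>c semi_injective_bimodule_kinj[OF dgu assms(4) sI] in auto)
  have M: "M \<in> dg_modules u A" using assms(5) by (simp add: compact_dg_module_def)
  have mod: "left_dg_module A X" "mscale X = u" if "X \<in> dg_modules u A" for X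
    using that by (simp_all add: dg_modules_def)
  obtain S where S: "finite S" "generates A P S" using compact_finite_generates[OF assms(5) kP P q\<pi>] by blast
  obtain b where b: "acyclic_below b P" using compact_bounded_below[OF assms(5) kP P q\<pi>] by blast
  note ic = initial_cone[OF P S(2,1) b]
  obtain S' where S': "finite S'" "generates A (mcone P (zero_mod u) (\<lambda>i x. 0)) S'" using ic(2) by blast
  obtain F T t \<delta> where adm: "admissible u A I e0 F T t" and \<delta>: "dg_hom A F P \<delta>" and ac: "acyclic_mod (mcone P F \<delta>)"
    using acyclic_cone_exists[OF kP P zero_admissible ic(1) S' ic(3)] by blast
  have F: "F \<in> dg_modules u A" and T: "T \<in> dg_modules u A" and kF: "kproj u A F" and kT: "kinj u A T"
    and pt: "pairing A I F T t" and sc: "cohomology_iso F T (\<lambda>j f. t 0 j e0 f)"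
    and di: "dual_inj A I F T t" and ds: "dual_surj A I F T t"
    using adm by (simp_all add: admissible_def)
  interpret pairing A I F T t by (rule pt)
  obtain \<alpha> where \<alpha>: "dg_hom A P F \<alpha>" and \<alpha>\<delta>: "homotopic_homs A F F (\<lambda>i x. \<alpha> i (\<delta> i x)) (\<lambda>i x. x)"
    and \<delta>\<alpha>: "homotopic_homs A P P (\<lambda>i x. \<delta> i (\<alpha> i x)) (\<lambda>i x. x)"
    by (rule kproj_equivalence[OF kP kF P F \<delta> ac])
  note PM = mod(1)[OF P] and FM = mod(1)[OF F] and TM = mod(1)[OF T] and JM = mod(1)[OF J] and MM = mod(1)[OF M]
  have \<delta>c: "cohomology_iso F P \<delta>" by (rule homotopy_equiv_ciso[OF FM PM \<delta> \<alpha> \<alpha>\<delta> \<delta>\<alpha>])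
  have d\<pi>: "dg_hom A P M \<pi>" "cohomology_iso P M \<pi>" using q\<pi> by (simp_all add: quasi_iso_def)
  have d\<eta>: "dg_hom A M J \<eta>" "cohomology_iso M J \<eta>" using q\<eta> by (simp_all add: quasi_iso_def)
  let ?g = "\<lambda>i x. \<eta> i (\<pi> i (\<delta> i x))"
  have g1: "dg_hom A F M (\<lambda>i x. \<pi> i (\<delta> i x))" by (rule dg_hom_comp[OF FM PM MM \<delta> d\<pi>(1)])
  have g: "dg_hom A F J ?g" by (rule dg_hom_comp[OF FM MM JM g1 d\<eta>(1)])
  have gc: "cohomology_iso F J ?g"
    by (rule ciso_comp[OF FM MM JM g1 d\<eta>(1) ciso_comp[OF FM PM MM \<delta> d\<pi>(1) \<delta>c d\<pi>(2)] d\<eta>(2)])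
  let ?s = "\<lambda>j f. t 0 j e0 f"
  have s: "dg_hom A F T ?s" by (rule e0_act_dg_hom[OF pt mod(2)[OF F] mod(2)[OF T]])
  \<comment> \<open>\<open>F \<rightarrow> T\<close> is a quasi-isomorphism into a K-injective
    module. The comparison of \<open>F\<close> with \<open>J\<close> through \<open>P\<close> and
    \<open>M\<close> therefore extends over \<open>T\<close>, up to homotopy.\<close>
  obtain \<beta> where \<beta>: "dg_hom A T J \<beta>" and \<beta>s: "homotopic_homs A F J (\<lambda>i x. \<beta> i (?s i x)) ?g"
    using kinj_extend[OF kJ J F T _ g, of ?s] s sc unfolding quasi_iso_def by blast
  have "cohomology_iso T J \<beta>" by (rule ciso_cancel_right[OF FM TM JM s \<beta> g \<beta>s gc sc])
  then have q\<beta>: "quasi_iso A T J \<beta>" using \<beta> by (simp add: quasi_iso_def)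
  obtain \<rho> where \<rho>: "dg_hom A J T \<rho>" and \<rho>\<beta>: "homotopic_homs A T T (\<lambda>i x. \<rho> i (\<beta> i x)) (\<lambda>i x. x)"
    and \<beta>\<rho>: "homotopic_homs A J J (\<lambda>i x. \<beta> i (\<rho> i x)) (\<lambda>i x. x)"
    by (rule kinj_equivalence[OF kJ kT J T q\<beta>])
  let ?D = "matlis_dual (torsion A I)"
  let ?N1 = "op_left (matlis_dual (torsion A J))" and ?N2 = "op_left (matlis_dual (torsion A T))"
    and ?N3 = "op_left (hom_complex A F ?D)" and ?N4 = "op_left (hom_complex A P ?D)"
  have D: "dg_bimodule A ?D" by (rule dga.matlis_bi[OF A dga.torsion_bi[OF A I(1)]])
  note tT = torsion_left[OF TM] and tJ = torsion_left[OF JM]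
  note tb = torsion_dg_hom[OF TM JM \<beta>] and tr = torsion_dg_hom[OF JM TM \<rho>]
  have N1: "left_dg_module (op_alg A) ?N1" and N2: "left_dg_module (op_alg A) ?N2"
    by (rule op_left_matlis(2)[OF A] tT tJ)+
  have N3: "left_dg_module (op_alg A) ?N3" and N4: "left_dg_module (op_alg A) ?N4"
    using dga.hom_complex_right[OF A FM D] dga.hom_complex_right[OF A PM D] by (simp_all add: right_dg_module_def)
  \<comment> \<open>Three quasi-isomorphisms in the same direction, with \<Gamma> for torsion:
    \<open>(\<Gamma> J)' \<rightarrow> (\<Gamma> T)'\<close> dual to \<open>\<beta>\<close>, then
    \<open>theta\<close> to \<open>Hom(F, (\<Gamma> I)')\<close>, then composition with
    \<open>\<alpha>\<close> to \<open>Hom(P, (\<Gamma> I)')\<close>.\<close>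
  note h1 = dstar_hom[OF A tT tJ tb] and c1 = dstar_ciso[OF A tT tJ tb tr torsion_homotopic[OF TM TM \<rho>\<beta>] torsion_homotopic[OF JM JM \<beta>\<rho>]]
  note h2 = theta_hom and c2 = theta_ciso[OF di ds]
  note h3 = precompose_hom[OF A PM FM D \<alpha>] and c3 = precompose_ciso[OF A PM FM D \<alpha> \<delta> \<delta>\<alpha> \<alpha>\<delta>]
  note h12 = dg_hom_comp[OF N1 N2 N3 h1 h2] and c12 = ciso_comp[OF N1 N2 N3 h1 h2 c1 c2]
  note h13 = dg_hom_comp[OF N1 N3 N4 h12 h3] and c13 = ciso_comp[OF N1 N3 N4 h12 h3 c12 c3]
  let ?us = "\<lambda>c f (i::int) (x::'u) (y::'u). c * f i x y :: 'k"
  \<comment> \<open>The apex of the roof has to lie in the function type of the Hom complex. A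
    functional on \<open>'u\<close> is copied there as a function that is constant in its first two
    arguments.\<close>
  let ?in = "\<lambda>(_::int) (g :: 'u \<Rightarrow> 'k) (i::int) (x::'u) (y::'u). g y" and ?out = "\<lambda>(_::int) w. w (0::int) (0::'u) :: 'u \<Rightarrow> 'k"
  let ?Z = "transport ?us ?in ?out ?N1"
  have vs: "vector_space ?us" by unfold_locales (auto simp: fun_eq_iff algebra_simps)
  have lin: "Vector_Spaces.linear (mscale ?N1) ?us (?in i)" for i
    using vs N1 unfolding Vector_Spaces.linear_iff left_dg_module_def
    by (auto simp: op_left_sel fun_eq_iff)
  have Z: "left_dg_module (op_alg A) ?Z" "dg_hom (op_alg A) ?Z ?N1 ?out" and Zc: "cohomology_iso ?Z ?N1 ?out"
    by (rule transport_left[where f = ?in and g = ?out and u = ?us, OF N1 lin]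
      ciso_transport[where f = ?in and g = ?out and u = ?us, OF N1 lin]; simp)+
  have ZZ: "?Z \<in> dg_modules ?us (op_alg A)" using Z(1) by (simp add: dg_modules_def transport_def)
  have "quasi_iso (op_alg A) ?Z ?N1 ?out" using Z(2) Zc by (simp only: quasi_iso_def)
  moreover note dg_hom_comp[OF Z(1) N1 N4 Z(2) h13] ciso_comp[OF Z(1) N1 N4 Z(2) h13 Zc c13]
  ultimately show ?thesis
    using derived_iso_roof[OF ZZ _ _ N1 N4] unfolding quasi_iso_def by blast
qed

end
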